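(* Let $H$ be a finite-dimensional Hopf algebra over a field $\Bbbk$, $(M,\psi)$ an involutive Hopf bimodule over $H$, and $\Gamma$ a Kitaev graph. There exist a unique action $\triangleright:\mathbb H_\Gamma\otimes\mathbb M_\Gamma\to\mathbb M_\Gamma$ and a unique coaction $\delta:\mathbb M_\Gamma\to\mathbb H_\Gamma\otimes\mathbb M_\Gamma$ of $\mathbb H_\Gamma$ on the extended Hilbert space $\mathbb M_\Gamma$ such that for all cilia $c\in C_\Gamma$ $$\triangleright\circ(\mathrm i_c\otimes\mathrm{id})=\bullet_c:H_c\otimes\mathbb M_\Gamma\to\mathbb M_\Gamma,\qquad(\mathrm{pr}_c\otimes\mathrm{id})\circ\delta=\delta_c:\mathbb M_\Gamma\to H_c\otimes\mathbb M_\Gamma,$$ where $\bullet_c$ and $\delta_c$ are the vertex action and face coaction associated to $c$. This turns $\mathbb M_\Gamma$ into a left-left Yetter--Drinfeld module over $\mathbb H_\Gamma$.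
   Context: **Hopf algebra notation.** $\otimes=\otimes_\Bbbk$; $S$ antipode, $\varepsilon$ counit, $\eta$ unit of $H$; Sweedler notation $h_{(1)}\otimes h_{(2)}$. A left-left Yetter--Drinfeld module over a Hopf algebra is a left module and left comodule $N$ with $(h\bullet n)_{|-1|}\otimes(h\bullet n)_{|0|}=h_{(1)}n_{|-1|}S(h_{(3)})\otimes h_{(2)}\bullet n_{|0|}$. **Involutive Hopf bimodules.** An $H$-bimodule and $H$-bicomodule $M$ (coactions $m_{[-1]}\otimes m_{[0]}$, $m_{[0]}\otimes m_{[1]}$) with $$(h\triangleright m\triangleleft g)_{[-1]}\otimes(h\triangleright m\triangleleft g)_{[0]}\otimes(h\triangleright m\triangleleft g)_{[1]}=h_{(1)}m_{[-1]}g_{(1)}\otimes h_{(2)}\triangleright m_{[0]}\triangleleft g_{(2)}\otimes h_{(3)}m_{[1]}S^{-2}(g_{(3)}),$$ together with a linear involution $\psi:M\to M$ with $\psi(h\triangleright m)=\psi(m)\triangleleft S(h)$ and $\psi(m)_{[-1]}\otimes\psi(m)_{[0]}=S(m_{[1]})\otimes\psi(m_{[0]})$. **Kitaev graphs.** A ribbon graph $(\Gamma,\iota,\rho)$ is a finite set $\Gamma$ of half-edges with a fixed-point free involution $\iota$ and a permutation $\rho$. Vertices $V_\Gamma$, edges $E_\Gamma$, faces $F_\Gamma$ are the cycles (including those of length one) of $\rho$, $\iota$, $\rho^{-1}\iota$; $v_h,e_h,f_h$ are the ones containing $h\in\Gamma$. It is connected if $\langle\iota,\rho\rangle$ acts transitively.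 A Kitaev graph is a connected ribbon graph with a subset $C_\Gamma\subset\Gamma$ of cilia such that $C_\Gamma\to V_\Gamma$, $c\mapsto v_c$, and $C_\Gamma\to F_\Gamma$, $c\mapsto f_{\rho^{-1}(c)}$, are bijective, a distinguished cilium $\mathrm{pt}\in C_\Gamma$, and a total order on $\Gamma$ such that for $e_h\ne e_k$: $h<k$ iff $\iota(h)<\iota(k)$. The source of an edge $\{h,\iota(h)\}$ is $s=\min\{h,\iota(h)\}$, its target is $\iota(s)$. Edges are ordered by their sources, cilia by the order of $\Gamma$. **Extended Hilbert space.** $\mathbb M_\Gamma=\bigotimes_{e\in E_\Gamma}M_e$, $M_e=M$. For a half-edge $h$, $a\in H$, $\alpha\in H^*$, the operators $L_h(a),T_h(\alpha)$ on $\mathbb M_\Gamma$ are the identity on all factors except $M_{e_h}$, where $L_h(a)m=a\triangleright m$ if $h$ is a target, $L_h(a)m=m\triangleleft S(a)$ if $h$ is a source; $T_h(\alpha)m=\alpha(m_{[-1]})m_{[0]}$ if $h$ is a source, $T_h(\alpha)m=\alpha(S(m_{[1]}))m_{[0]}$ if $h$ is a target. For a cilium $c$ let $v_c=[h_1,\dots,h_i]$ with $h_1=c$, $h_{r+1}=\rho(h_r)$, and $f_{\rho^{-1}(c)}=[k_1,\dots,k_j]$ with $k_1=\rho^{-1}(c)$, $k_{r+1}=\rho^{-1}\iota(k_r)$. Put $H_c=H$. The vertex action is $a\bullet_cm=L_{h_i}(a_{(i)})\cdots L_{h_1}(a_{(1)})m$; the face coaction $\delta_c$ is determined by $(\alpha\otimes\mathrm{id})\delta_c(m)=T_{k_j}(\alpha_{(1)})\cdots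 T_{k_1}(\alpha_{(j)})m$ for $\alpha\in H^*$, where $\alpha_{(1)}\otimes\cdots\otimes\alpha_{(j)}$ is the iterated coproduct in $H^*$. **The Hopf algebra.** $\mathbb H_\Gamma=\bigotimes_{c\in C_\Gamma}H_c$; $\mathrm{pr}_c=\varepsilon\otimes\cdots\otimes\mathrm{id}\otimes\cdots\otimes\varepsilon:\mathbb H_\Gamma\to H_c$ and $\mathrm i_c=\eta\otimes\cdots\otimes\mathrm{id}\otimes\cdots\otimes\eta:H_c\to\mathbb H_\Gamma$, with $\mathrm{id}$ in the $c$-th factor. *)

theory Defs
  imports
    Complex_Main
    "HOL-Library.FuncSet"
    "HOL-Library.Function_Algebras"
    "HOL-Combinatorics.Orbits"
begin

section \<open>Vector spaces and linear maps\<close>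

text \<open>
  Tensor products are needed for spaces that depend on the data of the theorem, so vector spaces
  are presented by carriers: a record consists of a scalar multiplication that makes the whole
  type a vector space and of a linear subspace of it. All maps only matter on carriers.
\<close>

record ('k, 'v) vspace =
  vcar :: "'v set"
  vscale :: "'k \<Rightarrow> 'v \<Rightarrow> 'v"

definition is_vspace :: "('k::field, 'v::ab_group_add, 'z) vspace_scheme \<Rightarrow> bool" where
  "is_vspace V \<longleftrightarrow> vector_space (vscale V) \<and> module.subspace (vscale V) (vcar V)"

definition fin_dim :: "('k::field, 'v::ab_group_add, 'z) vspace_scheme \<Rightarrow> bool" where
  "fin_dim V \<longleftrightarrow> (\<exists>B. finite B \<and> B \<subseteq> vcar V \<and> vcar V \<subseteq> module.span (vscale V) B)"

definition scalars :: "('k::field, 'k) vspace" where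
  "scalars = \<lparr>vcar = UNIV, vscale = (*)\<rparr>"

definition fscale :: "'k::field \<Rightarrow> ('x \<Rightarrow> 'k) \<Rightarrow> 'x \<Rightarrow> 'k" where
  "fscale c f = (\<lambda>x. c * f x)"

definition linmap :: "('k::field, 'v::ab_group_add, 'y) vspace_scheme \<Rightarrow>
    ('k, 'w::ab_group_add, 'z) vspace_scheme \<Rightarrow> ('v \<Rightarrow> 'w) \<Rightarrow> bool" where
  "linmap V W f \<longleftrightarrow>
     (\<forall>x\<in>vcar V. f x \<in> vcar W) \<and>
     (\<forall>x\<in>vcar V. \<forall>y\<in>vcar V. f (x + y) = f x + f y) \<and>
     (\<forall>c. \<forall>x\<in>vcar V. f (vscale V c x) = vscale W c (f x))"

definition bilin :: "('k::field, 'v::ab_group_add, 'x) vspace_scheme \<Rightarrow>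
    ('k, 'w::ab_group_add, 'y) vspace_scheme \<Rightarrow> ('k, 'u::ab_group_add, 'z) vspace_scheme \<Rightarrow>
    ('v \<Rightarrow> 'w \<Rightarrow> 'u) \<Rightarrow> bool" where
  "bilin V W X \<beta> \<longleftrightarrow>
     (\<forall>x\<in>vcar V. linmap W X (\<beta> x)) \<and> (\<forall>y\<in>vcar W. linmap V X (\<lambda>x. \<beta> x y))"

definition multilin :: "'i set \<Rightarrow> ('k::field, 'v::ab_group_add, 'y) vspace_scheme \<Rightarrow>
    ('k, 'u::ab_group_add, 'z) vspace_scheme \<Rightarrow> (('i \<Rightarrow> 'v) \<Rightarrow> 'u) \<Rightarrow> bool" where
  "multilin I V X \<beta> \<longleftrightarrow>
     (\<forall>x\<in>I \<rightarrow>\<^sub>E vcar V. \<beta> x \<in> vcar X \<and> (\<forall>i\<in>I. linmap V X (\<lambda>v. \<beta> (x(i := v)))))"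

text \<open>The functionals are 0 off the carrier, so that equality of functionals is equality on \<open>V\<close>.\<close>

definition dual :: "('k::field, 'v::ab_group_add, 'z) vspace_scheme \<Rightarrow> ('k, 'v \<Rightarrow> 'k) vspace" where
  "dual V = \<lparr>vcar = {\<alpha>. linmap V scalars \<alpha> \<and> (\<forall>x. x \<notin> vcar V \<longrightarrow> \<alpha> x = 0)}, vscale = fscale\<rparr>"

section \<open>Tensor products\<close>

text \<open>
  The tensor product of vector spaces over a field, realised inside the dual of the space of
  bilinear (multilinear) forms: \<open>x \<otimes> y\<close> is the evaluation of bilinear forms at \<open>(x, y)\<close>,
  and the tensor product is the linear span of these evaluations. The theorems
  \<open>tensor_universal\<close> and \<open>ptensor_universal\<close> below are the universal properties; they justify
  the choice in \<open>tlift\<close> and \<open>plift\<close>, the linear maps induced by bilinear and multilinear maps.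
  In particular \<open>tlift V W X (\<lambda>x y. \<beta> x y) t\<close> is what is written \<open>\<beta> t\<^sub>1 t\<^sub>2\<close> in Sweedler notation,
  with values in \<open>X\<close>.
\<close>

definition tensor :: "('k::field, 'v::ab_group_add, 'y) vspace_scheme \<Rightarrow>
    ('k, 'w::ab_group_add, 'z) vspace_scheme \<Rightarrow> 'v \<Rightarrow> 'w \<Rightarrow> (('v \<Rightarrow> 'w \<Rightarrow> 'k) \<Rightarrow> 'k)" where
  "tensor V W x y = (\<lambda>B. if bilin V W scalars B then B x y else 0)"

definition tprod :: "('k::field, 'v::ab_group_add, 'y) vspace_scheme \<Rightarrow>
    ('k, 'w::ab_group_add, 'z) vspace_scheme \<Rightarrow> ('k, ('v \<Rightarrow> 'w \<Rightarrow> 'k) \<Rightarrow> 'k) vspace"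
    (infixr "\<otimes>\<^sub>s" 70) where
  "V \<otimes>\<^sub>s W = \<lparr>vcar = module.span fscale {tensor V W x y | x y. x \<in> vcar V \<and> y \<in> vcar W},
             vscale = fscale\<rparr>"

definition tlift :: "('k::field, 'v::ab_group_add, 'x) vspace_scheme \<Rightarrow>
    ('k, 'w::ab_group_add, 'y) vspace_scheme \<Rightarrow> ('k, 'u::ab_group_add, 'z) vspace_scheme \<Rightarrow>
    ('v \<Rightarrow> 'w \<Rightarrow> 'u) \<Rightarrow> (('v \<Rightarrow> 'w \<Rightarrow> 'k) \<Rightarrow> 'k) \<Rightarrow> 'u" where
  "tlift V W X \<beta> =
     (SOME f. linmap (V \<otimes>\<^sub>s W) X f \<and> (\<forall>x\<in>vcar V. \<forall>y\<in>vcar W. f (tensor V W x y) = \<beta> x y))"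

text \<open>The tensor power \<open>\<Otimes>\<^bsub>i\<in>I\<^esub> V\<close>; pure tensors are indexed by families \<open>x \<in> I \<rightarrow>\<^sub>E vcar V\<close>.\<close>

definition ptensor :: "'i set \<Rightarrow> ('k::field, 'v::ab_group_add, 'z) vspace_scheme \<Rightarrow>
    ('i \<Rightarrow> 'v) \<Rightarrow> ((('i \<Rightarrow> 'v) \<Rightarrow> 'k) \<Rightarrow> 'k)" where
  "ptensor I V x = (\<lambda>B. if multilin I V scalars B then B x else 0)"

definition tpower :: "'i set \<Rightarrow> ('k::field, 'v::ab_group_add, 'z) vspace_scheme \<Rightarrow>
    ('k, (('i \<Rightarrow> 'v) \<Rightarrow> 'k) \<Rightarrow> 'k) vspace" where
  "tpower I V = \<lparr>vcar = module.span fscale (ptensor I V ` (I \<rightarrow>\<^sub>E vcar V)), vscale = fscale\<rparr>"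

definition plift :: "'i set \<Rightarrow> ('k::field, 'v::ab_group_add, 'y) vspace_scheme \<Rightarrow>
    ('k, 'u::ab_group_add, 'z) vspace_scheme \<Rightarrow>
    (('i \<Rightarrow> 'v) \<Rightarrow> 'u) \<Rightarrow> ((('i \<Rightarrow> 'v) \<Rightarrow> 'k) \<Rightarrow> 'k) \<Rightarrow> 'u" where
  "plift I V X \<beta> =
     (SOME f. linmap (tpower I V) X f \<and> (\<forall>x\<in>I \<rightarrow>\<^sub>E vcar V. f (ptensor I V x) = \<beta> x))"

lemma vector_space_fscale: "vector_space (fscale :: 'k::field \<Rightarrow> ('x \<Rightarrow> 'k) \<Rightarrow> 'x \<Rightarrow> 'k)"
  by unfold_locales (auto simp: fscale_def fun_eq_iff algebra_simps)

lemma is_vspace_scalars: "is_vspace (scalars :: ('k::field, 'k) vspace)"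
proof -
  interpret vector_space "(*) :: 'k \<Rightarrow> 'k \<Rightarrow> 'k"
    by unfold_locales (auto simp: algebra_simps)
  show ?thesis
    unfolding is_vspace_def scalars_def by (simp add: vector_space_axioms)
qed

lemma linear_map_on_span_exists:
  fixes u :: "'p \<Rightarrow> 'b \<Rightarrow> 'k::field"
    and X :: "('k, 'u::ab_group_add, 'z) vspace_scheme"
  assumes X: "is_vspace X"
    and closed: "\<And>p. p \<in> P \<Longrightarrow> \<beta> p \<in> vcar X"
    and forms: "\<And>\<phi>. linmap \<lparr>vcar = UNIV, vscale = vscale X\<rparr> scalars \<phi> \<Longrightarrow>
                  \<exists>B. \<forall>p\<in>P. u p B = \<phi> (\<beta> p)"
  shows "\<exists>f. linmap \<lparr>vcar = module.span fscale (u ` P), vscale = fscale\<rparr> X f \<and>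
             (\<forall>p\<in>P. f (u p) = \<beta> p)"
proof -
  interpret F: vector_space "fscale :: 'k \<Rightarrow> ('b \<Rightarrow> 'k) \<Rightarrow> 'b \<Rightarrow> 'k"
    by (rule vector_space_fscale)
  interpret X: vector_space "vscale X"
    using X by (simp add: is_vspace_def)
  interpret K: vector_space "(*) :: 'k \<Rightarrow> 'k \<Rightarrow> 'k"
    by unfold_locales (auto simp: algebra_simps)
  interpret FX: vector_space_pair "fscale :: 'k \<Rightarrow> ('b \<Rightarrow> 'k) \<Rightarrow> 'b \<Rightarrow> 'k" "vscale X" ..
  interpret XK: vector_space_pair "vscale X" "(*) :: 'k \<Rightarrow> 'k \<Rightarrow> 'k" ..
  interpret FK: vector_space_pair "fscale :: 'k \<Rightarrow> ('b \<Rightarrow> 'k) \<Rightarrow> 'b \<Rightarrow> 'k" "(*) :: 'k \<Rightarrow> 'k \<Rightarrow> 'k" ..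
  have sub: "X.subspace (vcar X)"
    using X by (simp add: is_vspace_def)
  obtain D where D: "D \<subseteq> u ` P" "F.independent D" "u ` P \<subseteq> F.span D"
    by (rule F.maximal_independent_subset)
  define q where "q d = (SOME p. p \<in> P \<and> u p = d)" for d
  have q: "q d \<in> P \<and> u (q d) = d" if "d \<in> D" for d
    unfolding q_def by (rule someI_ex) (use D(1) that in auto)
  define f where "f = FX.construct D (\<lambda>d. \<beta> (q d))"
  have f_lin: "Vector_Spaces.linear fscale (vscale X) f"
    unfolding f_def by (rule FX.linear_construct[OF D(2)])
  have f_D: "f d = \<beta> (q d)" if "d \<in> D" for d
    unfolding f_def by (rule FX.construct_basis[OF D(2) that])
  have f_u: "f (u p) = \<beta> p" if p: "p \<in> P" for p
  proof (rule ccontr)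
    define w where "w = f (u p) - \<beta> p"
    assume "f (u p) \<noteq> \<beta> p"
    then have "w \<noteq> 0" by (simp add: w_def)
    then have "X.independent {w}" by simp
    then obtain \<phi> where \<phi>: "Vector_Spaces.linear (vscale X) (*) \<phi>" "\<phi> w = 1"
      using XK.linear_independent_extend[of "{w}" "\<lambda>_. 1"] by auto
    interpret \<phi>: Vector_Spaces.linear "vscale X" "(*) :: 'k \<Rightarrow> 'k \<Rightarrow> 'k" \<phi> by (rule \<phi>(1))
    have "linmap \<lparr>vcar = UNIV, vscale = vscale X\<rparr> scalars \<phi>"
      by (simp add: linmap_def scalars_def \<phi>.add \<phi>.scale)
    from forms[OF this] obtain B where B: "\<And>p. p \<in> P \<Longrightarrow> u p B = \<phi> (\<beta> p)"
      by blast
    have lin1: "Vector_Spaces.linear fscale (*) (\<lambda>t. \<phi> (f t))"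
      using Vector_Spaces.linear_compose[OF f_lin \<phi>(1)] by (simp add: o_def)
    have lin2: "Vector_Spaces.linear fscale (*) (\<lambda>t :: 'b \<Rightarrow> 'k. t B)"
      by unfold_locales (auto simp: fscale_def algebra_simps)
    have "u p \<in> F.span D" using D(3) p by blast
    moreover have "\<phi> (f d) = d B" if d: "d \<in> D" for d
      using B[OF conjunct1[OF q[OF d]]] unfolding conjunct2[OF q[OF d]] f_D[OF d] by (rule sym)
    ultimately have "\<phi> (f (u p)) = u p B"
      using FK.linear_eq_on_span[OF lin1 lin2, where B = D and x = "u p"] by blast
    then have "\<phi> w = 0" using B[OF p] by (simp add: w_def \<phi>.diff)
    with \<phi>(2) show False by simp
  qed
  interpret f: Vector_Spaces.linear fscale "vscale X" f by (rule f_lin)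
  have "f t \<in> vcar X" if "t \<in> F.span (u ` P)" for t
  proof -
    have "f ` F.span (u ` P) = X.span (f ` u ` P)" by (simp add: f.span_image)
    also have "\<dots> \<subseteq> vcar X"
      by (rule X.span_minimal[OF _ sub]) (use f_u closed in auto)
    finally show ?thesis using that by blast
  qed
  then have "linmap \<lparr>vcar = F.span (u ` P), vscale = fscale\<rparr> X f"
    by (simp add: linmap_def f.add f.scale)
  with f_u show ?thesis by (intro exI[of _ f] conjI ballI)
qed

lemma linear_map_on_span_unique:
  fixes S :: "('b \<Rightarrow> 'k::field) set"
    and X :: "('k, 'u::ab_group_add, 'z) vspace_scheme"
  assumes X: "is_vspace X"
    and f: "linmap \<lparr>vcar = module.span fscale S, vscale = fscale\<rparr> X f"
    and g: "linmap \<lparr>vcar = module.span fscale S, vscale = fscale\<rparr> X g"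
    and eq: "\<And>s. s \<in> S \<Longrightarrow> f s = g s"
    and t: "t \<in> module.span fscale S"
  shows "f t = g t"
proof -
  interpret F: vector_space "fscale :: 'k \<Rightarrow> ('b \<Rightarrow> 'k) \<Rightarrow> 'b \<Rightarrow> 'k"
    by (rule vector_space_fscale)
  interpret X: vector_space "vscale X"
    using X by (simp add: is_vspace_def)
  have zero: "h 0 = 0" if h: "linmap \<lparr>vcar = F.span S, vscale = fscale\<rparr> X h" for h
  proof -
    have "h (fscale 0 0) = vscale X 0 (h 0)"
      using h F.span_zero[of S] unfolding linmap_def vspace.select_convs by blast
    then show ?thesis by simp
  qed
  have "t \<in> F.span S \<and> f t = g t"
    using t
  proof (induction rule: F.span_induct_alt)
    case base
    show ?case by (simp only: F.span_zero zero[OF f] zero[OF g])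
  next
    case (step c x y)
    have x: "x \<in> F.span S" using step by (simp add: F.span_base)
    then have cx: "fscale c x \<in> F.span S" by (rule F.span_scale)
    have y: "y \<in> F.span S" "f y = g y" using step by auto
    have "f (fscale c x + y) = g (fscale c x + y)"
      using f g cx x y eq[of x] step.hyps unfolding linmap_def by simp
    with F.span_add[OF cx y(1)] show ?case by blast
  qed
  then show ?thesis ..
qed

lemma linmap_comp_functional:
  assumes "linmap V X g" and "linmap \<lparr>vcar = UNIV, vscale = vscale X\<rparr> scalars \<phi>"
  shows "linmap V scalars (\<lambda>x. \<phi> (g x))"
  using assms by (auto simp: linmap_def scalars_def)

lemma bilin_tensor:
  fixes V :: "('k::field, 'v::ab_group_add, 'y) vspace_scheme"
    and W :: "('k, 'w::ab_group_add, 'z) vspace_scheme"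
  shows "bilin V W (V \<otimes>\<^sub>s W) (tensor V W)"
proof -
  interpret F: vector_space "fscale :: 'k \<Rightarrow> (('v \<Rightarrow> 'w \<Rightarrow> 'k) \<Rightarrow> 'k) \<Rightarrow> ('v \<Rightarrow> 'w \<Rightarrow> 'k) \<Rightarrow> 'k"
    by (rule vector_space_fscale)
  have "tensor V W x y \<in> vcar (V \<otimes>\<^sub>s W)" if "x \<in> vcar V" "y \<in> vcar W" for x y
    using that by (auto simp: tprod_def intro!: F.span_base)
  then show ?thesis
    by (auto simp: bilin_def linmap_def)
      (auto simp: tprod_def tensor_def bilin_def linmap_def scalars_def fscale_def fun_eq_iff)
qed

theorem tensor_universal:
  assumes X: "is_vspace X" and \<beta>: "bilin V W X \<beta>"
  shows "linmap (V \<otimes>\<^sub>s W) X (tlift V W X \<beta>)"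
    and "\<lbrakk>x \<in> vcar V; y \<in> vcar W\<rbrakk> \<Longrightarrow> tlift V W X \<beta> (tensor V W x y) = \<beta> x y"
    and "\<lbrakk>linmap (V \<otimes>\<^sub>s W) X f; \<And>x y. \<lbrakk>x \<in> vcar V; y \<in> vcar W\<rbrakk> \<Longrightarrow> f (tensor V W x y) = \<beta> x y;
          t \<in> vcar (V \<otimes>\<^sub>s W)\<rbrakk> \<Longrightarrow> f t = tlift V W X \<beta> t"
proof -
  let ?P = "vcar V \<times> vcar W" and ?u = "\<lambda>(x, y). tensor V W x y"
  have set: "{tensor V W x y |x y. x \<in> vcar V \<and> y \<in> vcar W} = ?u ` ?P" by auto
  have "\<exists>f. linmap \<lparr>vcar = module.span fscale (?u ` ?P), vscale = fscale\<rparr> X f \<and>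
             (\<forall>p\<in>?P. f (?u p) = (case p of (x, y) \<Rightarrow> \<beta> x y))"
  proof (rule linear_map_on_span_exists[OF X])
    fix p assume "p \<in> ?P"
    then show "(case p of (x, y) \<Rightarrow> \<beta> x y) \<in> vcar X"
      using \<beta> by (auto simp: bilin_def linmap_def)
  next
    fix \<phi> assume \<phi>: "linmap \<lparr>vcar = UNIV, vscale = vscale X\<rparr> scalars \<phi>"
    have "bilin V W scalars (\<lambda>x y. \<phi> (\<beta> x y))"
    proof -
      have "linmap W scalars (\<lambda>y. \<phi> (\<beta> x y))" if "x \<in> vcar V" for x
        by (rule linmap_comp_functional[OF _ \<phi>]) (use \<beta> that in \<open>simp add: bilin_def\<close>)
      moreover have "linmap V scalars (\<lambda>x. \<phi> (\<beta> x y))" if "y \<in> vcar W" for y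
        by (rule linmap_comp_functional[OF _ \<phi>]) (use \<beta> that in \<open>simp add: bilin_def\<close>)
      ultimately show ?thesis by (simp add: bilin_def)
    qed
    then show "\<exists>B. \<forall>p\<in>?P. ?u p B = \<phi> (case p of (x, y) \<Rightarrow> \<beta> x y)"
      by (intro exI[of _ "\<lambda>x y. \<phi> (\<beta> x y)"]) (auto simp: tensor_def)
  qed
  then have "\<exists>f. linmap (V \<otimes>\<^sub>s W) X f \<and> (\<forall>x\<in>vcar V. \<forall>y\<in>vcar W. f (tensor V W x y) = \<beta> x y)"
    unfolding tprod_def set by auto
  then have *: "linmap (V \<otimes>\<^sub>s W) X (tlift V W X \<beta>) \<and>
      (\<forall>x\<in>vcar V. \<forall>y\<in>vcar W. tlift V W X \<beta> (tensor V W x y) = \<beta> x y)"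
    unfolding tlift_def by (rule someI_ex)
  show "linmap (V \<otimes>\<^sub>s W) X (tlift V W X \<beta>)" using * by blast
  show "\<lbrakk>x \<in> vcar V; y \<in> vcar W\<rbrakk> \<Longrightarrow> tlift V W X \<beta> (tensor V W x y) = \<beta> x y" using * by blast
  show "f t = tlift V W X \<beta> t"
    if "linmap (V \<otimes>\<^sub>s W) X f" "t \<in> vcar (V \<otimes>\<^sub>s W)"
      and "\<And>x y. \<lbrakk>x \<in> vcar V; y \<in> vcar W\<rbrakk> \<Longrightarrow> f (tensor V W x y) = \<beta> x y"
  proof (rule linear_map_on_span_unique[OF X that(1)[unfolded tprod_def]
        conjunct1[OF *, unfolded tprod_def]])
    show "t \<in> module.span fscale ({tensor V W x y | x y. x \<in> vcar V \<and> y \<in> vcar W})"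
      using that(2) by (simp add: tprod_def)
    fix s assume "s \<in> {tensor V W x y | x y. x \<in> vcar V \<and> y \<in> vcar W}"
    then obtain x y where "s = tensor V W x y" "x \<in> vcar V" "y \<in> vcar W" by blast
    with that(3)[of x y] * show "f s = tlift V W X \<beta> s" by simp
  qed
qed

lemma multilin_ptensor:
  fixes V :: "('k::field, 'v::ab_group_add, 'z) vspace_scheme"
  shows "multilin I V (tpower I V) (ptensor I V)"
proof -
  interpret F: vector_space "fscale :: 'k \<Rightarrow> ((('i \<Rightarrow> 'v) \<Rightarrow> 'k) \<Rightarrow> 'k) \<Rightarrow> (('i \<Rightarrow> 'v) \<Rightarrow> 'k) \<Rightarrow> 'k"
    by (rule vector_space_fscale)
  have upd: "x(i := v) \<in> I \<rightarrow>\<^sub>E vcar V"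
    if "x \<in> I \<rightarrow>\<^sub>E vcar V" "i \<in> I" "v \<in> vcar V" for x i v
    using that by (auto simp: PiE_iff extensional_def)
  have mem: "ptensor I V x \<in> vcar (tpower I V)" if "x \<in> I \<rightarrow>\<^sub>E vcar V" for x
    using that by (simp add: tpower_def F.span_base)
  have lin: "linmap V (tpower I V) (\<lambda>v. ptensor I V (x(i := v)))"
    if x: "x \<in> I \<rightarrow>\<^sub>E vcar V" and i: "i \<in> I" for x i
  proof -
    have form: "linmap V scalars (\<lambda>v. B (x(i := v)))" if "multilin I V scalars B" for B
      using that x i by (simp add: multilin_def)
    have "ptensor I V (x(i := v + w)) = ptensor I V (x(i := v)) + ptensor I V (x(i := w))"
      if "v \<in> vcar V" "w \<in> vcar V" for v w
      using form that by (intro ext) (simp add: ptensor_def linmap_def)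
    moreover have "ptensor I V (x(i := vscale V c v)) = fscale c (ptensor I V (x(i := v)))"
      if "v \<in> vcar V" for c v
      using form that by (intro ext) (simp add: ptensor_def linmap_def fscale_def scalars_def)
    ultimately show ?thesis
      using mem upd[OF x i] unfolding linmap_def by (simp add: tpower_def)
  qed
  show ?thesis
    unfolding multilin_def using mem lin by blast
qed

theorem ptensor_universal:
  assumes X: "is_vspace X" and \<beta>: "multilin I V X \<beta>"
  shows "linmap (tpower I V) X (plift I V X \<beta>)"
    and "x \<in> I \<rightarrow>\<^sub>E vcar V \<Longrightarrow> plift I V X \<beta> (ptensor I V x) = \<beta> x"
    and "\<lbrakk>linmap (tpower I V) X f; \<And>x. x \<in> I \<rightarrow>\<^sub>E vcar V \<Longrightarrow> f (ptensor I V x) = \<beta> x;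
          t \<in> vcar (tpower I V)\<rbrakk> \<Longrightarrow> f t = plift I V X \<beta> t"
proof -
  have "\<exists>f. linmap \<lparr>vcar = module.span fscale (ptensor I V ` (I \<rightarrow>\<^sub>E vcar V)), vscale = fscale\<rparr> X f \<and>
             (\<forall>p\<in>I \<rightarrow>\<^sub>E vcar V. f (ptensor I V p) = \<beta> p)"
  proof (rule linear_map_on_span_exists[OF X])
    fix p assume "p \<in> I \<rightarrow>\<^sub>E vcar V"
    then show "\<beta> p \<in> vcar X" using \<beta> by (simp add: multilin_def)
  next
    fix \<phi> assume \<phi>: "linmap \<lparr>vcar = UNIV, vscale = vscale X\<rparr> scalars \<phi>"
    have "multilin I V scalars (\<lambda>x. \<phi> (\<beta> x))"
    proof -
      have "linmap V scalars (\<lambda>v. \<phi> (\<beta> (x(i := v))))" if "x \<in> I \<rightarrow>\<^sub>E vcar V" "i \<in> I" for x i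
        by (rule linmap_comp_functional[OF _ \<phi>]) (use \<beta> that in \<open>simp add: multilin_def\<close>)
      then show ?thesis by (simp add: multilin_def scalars_def)
    qed
    then show "\<exists>B. \<forall>p\<in>I \<rightarrow>\<^sub>E vcar V. ptensor I V p B = \<phi> (\<beta> p)"
      by (intro exI[of _ "\<lambda>x. \<phi> (\<beta> x)"]) (auto simp: ptensor_def)
  qed
  then have *: "linmap (tpower I V) X (plift I V X \<beta>) \<and>
      (\<forall>x\<in>I \<rightarrow>\<^sub>E vcar V. plift I V X \<beta> (ptensor I V x) = \<beta> x)"
    unfolding plift_def tpower_def by (rule someI_ex)
  show "linmap (tpower I V) X (plift I V X \<beta>)" using * by blast
  show "x \<in> I \<rightarrow>\<^sub>E vcar V \<Longrightarrow> plift I V X \<beta> (ptensor I V x) = \<beta> x" using * by blast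
  show "f t = plift I V X \<beta> t"
    if "linmap (tpower I V) X f" "t \<in> vcar (tpower I V)"
      and "\<And>x. x \<in> I \<rightarrow>\<^sub>E vcar V \<Longrightarrow> f (ptensor I V x) = \<beta> x"
  proof (rule linear_map_on_span_unique[OF X that(1)[unfolded tpower_def]
        conjunct1[OF *, unfolded tpower_def]])
    show "t \<in> module.span fscale (ptensor I V ` (I \<rightarrow>\<^sub>E vcar V))"
      using that(2) by (simp add: tpower_def)
    fix s assume "s \<in> ptensor I V ` (I \<rightarrow>\<^sub>E vcar V)"
    then obtain x where "s = ptensor I V x" "x \<in> I \<rightarrow>\<^sub>E vcar V" by blast
    with that(3)[of x] * show "f s = plift I V X \<beta> s" by simp
  qed
qed

section \<open>Hopf algebras, modules and comodules\<close>

record ('k, 'h) hopf = "('k, 'h) vspace" +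
  hmult :: "'h \<Rightarrow> 'h \<Rightarrow> 'h"
  hone :: "'h"
  comult :: "'h \<Rightarrow> (('h \<Rightarrow> 'h \<Rightarrow> 'k) \<Rightarrow> 'k)"
  counit :: "'h \<Rightarrow> 'k"
  antipode :: "'h \<Rightarrow> 'h"

text \<open>Sweedler sums: \<open>\<phi> h\<^sub>1 h\<^sub>2\<close> and \<open>\<phi> h\<^sub>1 h\<^sub>2 h\<^sub>3\<close> with values in \<open>X\<close>.\<close>

definition sw2 :: "('k::field, 'h::ab_group_add) hopf \<Rightarrow>
    ('k, 'u::ab_group_add, 'z) vspace_scheme \<Rightarrow> ('h \<Rightarrow> 'h \<Rightarrow> 'u) \<Rightarrow> 'h \<Rightarrow> 'u" where
  "sw2 H X \<phi> h = tlift H H X \<phi> (comult H h)"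

definition sw3 :: "('k::field, 'h::ab_group_add) hopf \<Rightarrow>
    ('k, 'u::ab_group_add, 'z) vspace_scheme \<Rightarrow> ('h \<Rightarrow> 'h \<Rightarrow> 'h \<Rightarrow> 'u) \<Rightarrow> 'h \<Rightarrow> 'u" where
  "sw3 H X \<phi> h = sw2 H X (\<lambda>a b. sw2 H X (\<phi> a) b) h"

locale hopf_algebra =
  fixes H :: "('k::field, 'h::ab_group_add) hopf"
  assumes vspace: "is_vspace H"
    and mult_bilin: "bilin H H H (hmult H)"
    and one_closed: "hone H \<in> vcar H"
    and mult_assoc: "\<lbrakk>x \<in> vcar H; y \<in> vcar H; z \<in> vcar H\<rbrakk> \<Longrightarrow>
          hmult H (hmult H x y) z = hmult H x (hmult H y z)"
    and one_left: "x \<in> vcar H \<Longrightarrow> hmult H (hone H) x = x"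
    and one_right: "x \<in> vcar H \<Longrightarrow> hmult H x (hone H) = x"
    and comult_lin: "linmap H (H \<otimes>\<^sub>s H) (comult H)"
    and counit_lin: "linmap H scalars (counit H)"
    and coassoc: "x \<in> vcar H \<Longrightarrow>
          sw2 H (H \<otimes>\<^sub>s H \<otimes>\<^sub>s H)
            (\<lambda>a b. sw2 H (H \<otimes>\<^sub>s H \<otimes>\<^sub>s H) (\<lambda>c d. tensor H (H \<otimes>\<^sub>s H) c (tensor H H d b)) a) x =
          sw2 H (H \<otimes>\<^sub>s H \<otimes>\<^sub>s H)
            (\<lambda>a b. sw2 H (H \<otimes>\<^sub>s H \<otimes>\<^sub>s H) (\<lambda>c d. tensor H (H \<otimes>\<^sub>s H) a (tensor H H c d)) b) x"
    and counit_left: "x \<in> vcar H \<Longrightarrow> sw2 H H (\<lambda>a b. vscale H (counit H a) b) x = x"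
    and counit_right: "x \<in> vcar H \<Longrightarrow> sw2 H H (\<lambda>a b. vscale H (counit H b) a) x = x"
    and comult_mult: "\<lbrakk>x \<in> vcar H; y \<in> vcar H\<rbrakk> \<Longrightarrow>
          comult H (hmult H x y) =
          sw2 H (H \<otimes>\<^sub>s H)
            (\<lambda>a b. sw2 H (H \<otimes>\<^sub>s H) (\<lambda>c d. tensor H H (hmult H a c) (hmult H b d)) y) x"
    and comult_one: "comult H (hone H) = tensor H H (hone H) (hone H)"
    and counit_mult: "\<lbrakk>x \<in> vcar H; y \<in> vcar H\<rbrakk> \<Longrightarrow>
          counit H (hmult H x y) = counit H x * counit H y"
    and counit_one: "counit H (hone H) = 1"
    and antipode_lin: "linmap H H (antipode H)"
    and antipode_left: "x \<in> vcar H \<Longrightarrow>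
          sw2 H H (\<lambda>a b. hmult H (antipode H a) b) x = vscale H (counit H x) (hone H)"
    and antipode_right: "x \<in> vcar H \<Longrightarrow>
          sw2 H H (\<lambda>a b. hmult H a (antipode H b)) x = vscale H (counit H x) (hone H)"

text \<open>The antipode of a finite-dimensional Hopf algebra is bijective on the carrier.\<close>

definition antipode_inv :: "('k::field, 'h::ab_group_add) hopf \<Rightarrow> 'h \<Rightarrow> 'h" where
  "antipode_inv H = inv_into (vcar H) (antipode H)"

text \<open>Actions \<open>H \<otimes> N \<rightarrow> N\<close> are given by the corresponding bilinear maps.\<close>

definition left_module :: "('k::field, 'h::ab_group_add) hopf \<Rightarrow>
    ('k, 'n::ab_group_add, 'z) vspace_scheme \<Rightarrow> ('h \<Rightarrow> 'n \<Rightarrow> 'n) \<Rightarrow> bool" where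
  "left_module H N act \<longleftrightarrow>
     bilin H N N act \<and>
     (\<forall>n\<in>vcar N. act (hone H) n = n) \<and>
     (\<forall>x\<in>vcar H. \<forall>y\<in>vcar H. \<forall>n\<in>vcar N. act (hmult H x y) n = act x (act y n))"

definition right_module :: "('k::field, 'h::ab_group_add) hopf \<Rightarrow>
    ('k, 'n::ab_group_add, 'z) vspace_scheme \<Rightarrow> ('n \<Rightarrow> 'h \<Rightarrow> 'n) \<Rightarrow> bool" where
  "right_module H N act \<longleftrightarrow>
     bilin N H N act \<and>
     (\<forall>n\<in>vcar N. act n (hone H) = n) \<and>
     (\<forall>x\<in>vcar H. \<forall>y\<in>vcar H. \<forall>n\<in>vcar N. act n (hmult H x y) = act (act n x) y)"

definition left_comodule :: "('k::field, 'h::ab_group_add) hopf \<Rightarrow>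
    ('k, 'n::ab_group_add, 'z) vspace_scheme \<Rightarrow> ('n \<Rightarrow> (('h \<Rightarrow> 'n \<Rightarrow> 'k) \<Rightarrow> 'k)) \<Rightarrow> bool" where
  "left_comodule H N co \<longleftrightarrow>
     linmap N (H \<otimes>\<^sub>s N) co \<and>
     (\<forall>n\<in>vcar N.
        tlift H N (H \<otimes>\<^sub>s H \<otimes>\<^sub>s N)
          (\<lambda>x n'. sw2 H (H \<otimes>\<^sub>s H \<otimes>\<^sub>s N) (\<lambda>a b. tensor H (H \<otimes>\<^sub>s N) a (tensor H N b n')) x) (co n) =
        tlift H N (H \<otimes>\<^sub>s H \<otimes>\<^sub>s N)
          (\<lambda>x n'. tensor H (H \<otimes>\<^sub>s N) x (co n')) (co n)) \<and>
     (\<forall>n\<in>vcar N. tlift H N N (\<lambda>x n'. vscale N (counit H x) n') (co n) = n)"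

definition right_comodule :: "('k::field, 'h::ab_group_add) hopf \<Rightarrow>
    ('k, 'n::ab_group_add, 'z) vspace_scheme \<Rightarrow> ('n \<Rightarrow> (('n \<Rightarrow> 'h \<Rightarrow> 'k) \<Rightarrow> 'k)) \<Rightarrow> bool" where
  "right_comodule H N co \<longleftrightarrow>
     linmap N (N \<otimes>\<^sub>s H) co \<and>
     (\<forall>n\<in>vcar N.
        tlift N H (N \<otimes>\<^sub>s H \<otimes>\<^sub>s H)
          (\<lambda>n' x. tlift N H (N \<otimes>\<^sub>s H \<otimes>\<^sub>s H)
             (\<lambda>n'' y. tensor N (H \<otimes>\<^sub>s H) n'' (tensor H H y x)) (co n')) (co n) =
        tlift N H (N \<otimes>\<^sub>s H \<otimes>\<^sub>s H)
          (\<lambda>n' x. tensor N (H \<otimes>\<^sub>s H) n' (comult H x)) (co n)) \<and>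
     (\<forall>n\<in>vcar N. tlift N H N (\<lambda>n' x. vscale N (counit H x) n') (co n) = n)"

definition yetter_drinfeld :: "('k::field, 'h::ab_group_add) hopf \<Rightarrow>
    ('k, 'n::ab_group_add, 'z) vspace_scheme \<Rightarrow> ('h \<Rightarrow> 'n \<Rightarrow> 'n) \<Rightarrow>
    ('n \<Rightarrow> (('h \<Rightarrow> 'n \<Rightarrow> 'k) \<Rightarrow> 'k)) \<Rightarrow> bool" where
  "yetter_drinfeld H N act co \<longleftrightarrow>
     left_module H N act \<and> left_comodule H N co \<and>
     (\<forall>h\<in>vcar H. \<forall>n\<in>vcar N.
        co (act h n) =
        sw3 H (H \<otimes>\<^sub>s N)
          (\<lambda>h1 h2 h3. tlift H N (H \<otimes>\<^sub>s N)
             (\<lambda>x n'. tensor H N (hmult H (hmult H h1 x) (antipode H h3)) (act h2 n')) (co n)) h)"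

section \<open>Involutive Hopf bimodules\<close>

record ('k, 'h, 'm) hbimod = "('k, 'm) vspace" +
  lact :: "'h \<Rightarrow> 'm \<Rightarrow> 'm"
  ract :: "'m \<Rightarrow> 'h \<Rightarrow> 'm"
  lco :: "'m \<Rightarrow> (('h \<Rightarrow> 'm \<Rightarrow> 'k) \<Rightarrow> 'k)"
  rco :: "'m \<Rightarrow> (('m \<Rightarrow> 'h \<Rightarrow> 'k) \<Rightarrow> 'k)"
  psi :: "'m \<Rightarrow> 'm"

text \<open>The Sweedler sum \<open>\<phi> m\<^bsub>[-1]\<^esub> m\<^bsub>[0]\<^esub> m\<^bsub>[1]\<^esub>\<close> with values in \<open>X\<close>.\<close>

definition bico_sw :: "('k::field, 'h::ab_group_add) hopf \<Rightarrow> ('k, 'h, 'm::ab_group_add) hbimod \<Rightarrow>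
    ('k, 'u::ab_group_add, 'z) vspace_scheme \<Rightarrow> ('h \<Rightarrow> 'm \<Rightarrow> 'h \<Rightarrow> 'u) \<Rightarrow> 'm \<Rightarrow> 'u" where
  "bico_sw H M X \<phi> m = tlift H M X (\<lambda>x n. tlift M H X (\<lambda>n' y. \<phi> x n' y) (rco M n)) (lco M m)"

locale involutive_hopf_bimodule =
  fixes H :: "('k::field, 'h::ab_group_add) hopf"
    and M :: "('k, 'h, 'm::ab_group_add) hbimod"
  assumes vspace: "is_vspace M"
    and left_module: "left_module H M (lact M)"
    and right_module: "right_module H M (ract M)"
    and bimodule: "\<lbrakk>h \<in> vcar H; m \<in> vcar M; g \<in> vcar H\<rbrakk> \<Longrightarrow>
          ract M (lact M h m) g = lact M h (ract M m g)"
    and left_comodule: "left_comodule H M (lco M)"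
    and right_comodule: "right_comodule H M (rco M)"
    and bicomodule: "m \<in> vcar M \<Longrightarrow>
          tlift M H (H \<otimes>\<^sub>s M \<otimes>\<^sub>s H)
            (\<lambda>n y. tlift H M (H \<otimes>\<^sub>s M \<otimes>\<^sub>s H)
               (\<lambda>x n'. tensor H (M \<otimes>\<^sub>s H) x (tensor M H n' y)) (lco M n)) (rco M m) =
          bico_sw H M (H \<otimes>\<^sub>s M \<otimes>\<^sub>s H) (\<lambda>x n y. tensor H (M \<otimes>\<^sub>s H) x (tensor M H n y)) m"
    and hopf_bimodule: "\<lbrakk>h \<in> vcar H; m \<in> vcar M; g \<in> vcar H\<rbrakk> \<Longrightarrow>
          bico_sw H M (H \<otimes>\<^sub>s M \<otimes>\<^sub>s H) (\<lambda>x n y. tensor H (M \<otimes>\<^sub>s H) x (tensor M H n y))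
            (ract M (lact M h m) g) =
          sw3 H (H \<otimes>\<^sub>s M \<otimes>\<^sub>s H) (\<lambda>h1 h2 h3.
            sw3 H (H \<otimes>\<^sub>s M \<otimes>\<^sub>s H) (\<lambda>g1 g2 g3.
              bico_sw H M (H \<otimes>\<^sub>s M \<otimes>\<^sub>s H) (\<lambda>x n y.
                tensor H (M \<otimes>\<^sub>s H)
                  (hmult H (hmult H h1 x) g1)
                  (tensor M H
                    (ract M (lact M h2 n) g2)
                    (hmult H (hmult H h3 y) (antipode_inv H (antipode_inv H g3))))) m) g) h"
    and psi_lin: "linmap M M (psi M)"
    and psi_invol: "m \<in> vcar M \<Longrightarrow> psi M (psi M m) = m"
    and psi_act: "\<lbrakk>h \<in> vcar H; m \<in> vcar M\<rbrakk> \<Longrightarrow>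
          psi M (lact M h m) = ract M (psi M m) (antipode H h)"
    and psi_coact: "m \<in> vcar M \<Longrightarrow>
          lco M (psi M m) =
          tlift M H (H \<otimes>\<^sub>s M) (\<lambda>n y. tensor H M (antipode H y) (psi M n)) (rco M m)"

section \<open>Kitaev graphs\<close>

record 'd kitaev =
  hedges :: "'d set"
  hinv :: "'d \<Rightarrow> 'd"
  rho :: "'d \<Rightarrow> 'd"
  cilia :: "'d set"
  pt :: "'d"
  ord :: "('d \<times> 'd) set"

text \<open>The cycles of a permutation are rendered as its orbits.\<close>

definition vertex_of :: "'d kitaev \<Rightarrow> 'd \<Rightarrow> 'd set" where
  "vertex_of G h = orbit (rho G) h"

definition edge_of :: "'d kitaev \<Rightarrow> 'd \<Rightarrow> 'd set" where
  "edge_of G h = orbit (hinv G) h"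

definition face_perm :: "'d kitaev \<Rightarrow> 'd \<Rightarrow> 'd" where
  "face_perm G = inv (rho G) \<circ> hinv G"

definition face_of :: "'d kitaev \<Rightarrow> 'd \<Rightarrow> 'd set" where
  "face_of G h = orbit (face_perm G) h"

definition vertices :: "'d kitaev \<Rightarrow> 'd set set" where
  "vertices G = vertex_of G ` hedges G"

definition edges :: "'d kitaev \<Rightarrow> 'd set set" where
  "edges G = edge_of G ` hedges G"

definition faces :: "'d kitaev \<Rightarrow> 'd set set" where
  "faces G = face_of G ` hedges G"

definition lt :: "'d kitaev \<Rightarrow> 'd \<Rightarrow> 'd \<Rightarrow> bool" where
  "lt G h k \<longleftrightarrow> (h, k) \<in> ord G \<and> h \<noteq> k"

definition is_source :: "'d kitaev \<Rightarrow> 'd \<Rightarrow> bool" where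
  "is_source G h \<longleftrightarrow> lt G h (hinv G h)"

inductive_set perm_group :: "('a \<Rightarrow> 'a) set \<Rightarrow> ('a \<Rightarrow> 'a) set" for S where
  perm_id: "id \<in> perm_group S"
| perm_gen: "\<lbrakk>s \<in> S; g \<in> perm_group S\<rbrakk> \<Longrightarrow> s \<circ> g \<in> perm_group S"
| perm_inv: "\<lbrakk>s \<in> S; g \<in> perm_group S\<rbrakk> \<Longrightarrow> inv s \<circ> g \<in> perm_group S"

locale kitaev_graph =
  fixes G :: "'d kitaev"
  assumes fin: "finite (hedges G)"
    and hinv_permutes: "hinv G permutes hedges G"
    and hinv_invol: "h \<in> hedges G \<Longrightarrow> hinv G (hinv G h) = h"
    and hinv_no_fix: "h \<in> hedges G \<Longrightarrow> hinv G h \<noteq> h"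
    and rho_permutes: "rho G permutes hedges G"
    and connected: "\<lbrakk>h \<in> hedges G; k \<in> hedges G\<rbrakk> \<Longrightarrow>
          \<exists>g\<in>perm_group {hinv G, rho G}. g h = k"
    and cilia_sub: "cilia G \<subseteq> hedges G"
    and cilia_vertices: "bij_betw (vertex_of G) (cilia G) (vertices G)"
    and cilia_faces: "bij_betw (\<lambda>c. face_of G (inv (rho G) c)) (cilia G) (faces G)"
    and pt_cilium: "pt G \<in> cilia G"
    and ord_linear: "linear_order_on (hedges G) (ord G)"
    and ord_hinv: "\<lbrakk>h \<in> hedges G; k \<in> hedges G; edge_of G h \<noteq> edge_of G k\<rbrakk> \<Longrightarrow>
          lt G h k \<longleftrightarrow> lt G (hinv G h) (hinv G k)"

text \<open>The half-edges of the cycle of \<open>p\<close> through \<open>h\<close>, in cyclic order starting with \<open>h\<close>.\<close>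

definition cycle_from :: "('d \<Rightarrow> 'd) \<Rightarrow> 'd \<Rightarrow> 'd list" where
  "cycle_from p h = map (\<lambda>r. (p ^^ r) h) [0..<card (orbit p h)]"

section \<open>The extended Hilbert space\<close>

definition ext_space :: "'d kitaev \<Rightarrow> ('k::field, 'h, 'm::ab_group_add) hbimod \<Rightarrow>
    ('k, (('d set \<Rightarrow> 'm) \<Rightarrow> 'k) \<Rightarrow> 'k) vspace" where
  "ext_space G M = tpower (edges G) M"

definition on_edge :: "'d kitaev \<Rightarrow> ('k::field, 'h, 'm::ab_group_add) hbimod \<Rightarrow>
    'd set \<Rightarrow> ('m \<Rightarrow> 'm) \<Rightarrow>
    ((('d set \<Rightarrow> 'm) \<Rightarrow> 'k) \<Rightarrow> 'k) \<Rightarrow> ((('d set \<Rightarrow> 'm) \<Rightarrow> 'k) \<Rightarrow> 'k)" where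
  "on_edge G M e f =
     plift (edges G) M (ext_space G M) (\<lambda>x. ptensor (edges G) M (x(e := f (x e))))"

definition L_op :: "'d kitaev \<Rightarrow> ('k::field, 'h::ab_group_add) hopf \<Rightarrow>
    ('k, 'h, 'm::ab_group_add) hbimod \<Rightarrow> 'd \<Rightarrow> 'h \<Rightarrow>
    ((('d set \<Rightarrow> 'm) \<Rightarrow> 'k) \<Rightarrow> 'k) \<Rightarrow> ((('d set \<Rightarrow> 'm) \<Rightarrow> 'k) \<Rightarrow> 'k)" where
  "L_op G H M h a =
     on_edge G M (edge_of G h)
       (\<lambda>m. if is_source G h then ract M m (antipode H a) else lact M a m)"

definition T_op :: "'d kitaev \<Rightarrow> ('k::field, 'h::ab_group_add) hopf \<Rightarrow>
    ('k, 'h, 'm::ab_group_add) hbimod \<Rightarrow> 'd \<Rightarrow> ('h \<Rightarrow> 'k) \<Rightarrow>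
    ((('d set \<Rightarrow> 'm) \<Rightarrow> 'k) \<Rightarrow> 'k) \<Rightarrow> ((('d set \<Rightarrow> 'm) \<Rightarrow> 'k) \<Rightarrow> 'k)" where
  "T_op G H M h \<alpha> =
     on_edge G M (edge_of G h)
       (\<lambda>m. if is_source G h
            then tlift H M M (\<lambda>x n. vscale M (\<alpha> x) n) (lco M m)
            else tlift M H M (\<lambda>n y. vscale M (\<alpha> (antipode H y)) n) (rco M m))"

text \<open>
  \<open>L_list G H M [h\<^sub>1, \<dots>, h\<^sub>i] a = L\<^bsub>h\<^sub>i\<^esub>(a\<^sub>i) \<dots> L\<^bsub>h\<^sub>1\<^esub>(a\<^sub>1)\<close>, where
  \<open>a\<^sub>1 \<otimes> \<dots> \<otimes> a\<^sub>i\<close> is the iterated coproduct of \<open>a\<close>; for \<open>i = 0\<close> that is the counit.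
\<close>

primrec L_list :: "'d kitaev \<Rightarrow> ('k::field, 'h::ab_group_add) hopf \<Rightarrow>
    ('k, 'h, 'm::ab_group_add) hbimod \<Rightarrow> 'd list \<Rightarrow> 'h \<Rightarrow>
    ((('d set \<Rightarrow> 'm) \<Rightarrow> 'k) \<Rightarrow> 'k) \<Rightarrow> ((('d set \<Rightarrow> 'm) \<Rightarrow> 'k) \<Rightarrow> 'k)" where
  "L_list G H M [] = (\<lambda>a m. vscale (ext_space G M) (counit H a) m)"
| "L_list G H M (h # hs) = (\<lambda>a m.
     sw2 H (ext_space G M) (\<lambda>a1 a2. L_list G H M hs a2 (L_op G H M h a1 m)) a)"

definition vertex_action :: "'d kitaev \<Rightarrow> ('k::field, 'h::ab_group_add) hopf \<Rightarrow>
    ('k, 'h, 'm::ab_group_add) hbimod \<Rightarrow> 'd \<Rightarrow> 'h \<Rightarrow>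
    ((('d set \<Rightarrow> 'm) \<Rightarrow> 'k) \<Rightarrow> 'k) \<Rightarrow> ((('d set \<Rightarrow> 'm) \<Rightarrow> 'k) \<Rightarrow> 'k)" where
  "vertex_action G H M c = L_list G H M (cycle_from (rho G) c)"

text \<open>
  The coproduct of the dual Hopf algebra of a finite-dimensional Hopf algebra:
  \<open>\<alpha>\<^sub>1(x) \<alpha>\<^sub>2(y) = \<alpha>(x y)\<close>.
\<close>

definition dual_comult :: "('k::field, 'h::ab_group_add) hopf \<Rightarrow> ('h \<Rightarrow> 'k) \<Rightarrow>
    ((('h \<Rightarrow> 'k) \<Rightarrow> ('h \<Rightarrow> 'k) \<Rightarrow> 'k) \<Rightarrow> 'k)" where
  "dual_comult H \<alpha> =
     (THE t. t \<in> vcar (dual H \<otimes>\<^sub>s dual H) \<and>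
        (\<forall>x\<in>vcar H. \<forall>y\<in>vcar H.
           tlift (dual H) (dual H) scalars (\<lambda>\<phi> \<chi>. \<phi> x * \<chi> y) t = \<alpha> (hmult H x y)))"

text \<open>
  \<open>T_list G H M [k\<^sub>1, \<dots>, k\<^sub>j] \<alpha> = T\<^bsub>k\<^sub>j\<^esub>(\<alpha>\<^sub>1) \<dots> T\<^bsub>k\<^sub>1\<^esub>(\<alpha>\<^sub>j)\<close>: the head of the list receives the
  last tensor factor of the iterated coproduct of \<open>\<alpha>\<close>. The counit of the dual is evaluation at 1.
\<close>

primrec T_list :: "'d kitaev \<Rightarrow> ('k::field, 'h::ab_group_add) hopf \<Rightarrow>
    ('k, 'h, 'm::ab_group_add) hbimod \<Rightarrow> 'd list \<Rightarrow> ('h \<Rightarrow> 'k) \<Rightarrow>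
    ((('d set \<Rightarrow> 'm) \<Rightarrow> 'k) \<Rightarrow> 'k) \<Rightarrow> ((('d set \<Rightarrow> 'm) \<Rightarrow> 'k) \<Rightarrow> 'k)" where
  "T_list G H M [] = (\<lambda>\<alpha> m. vscale (ext_space G M) (\<alpha> (hone H)) m)"
| "T_list G H M (k # ks) = (\<lambda>\<alpha> m.
     tlift (dual H) (dual H) (ext_space G M)
       (\<lambda>\<alpha>1 \<alpha>2. T_list G H M ks \<alpha>1 (T_op G H M k \<alpha>2 m)) (dual_comult H \<alpha>))"

definition face_coaction :: "'d kitaev \<Rightarrow> ('k::field, 'h::ab_group_add) hopf \<Rightarrow>
    ('k, 'h, 'm::ab_group_add) hbimod \<Rightarrow> 'd \<Rightarrow>
    ((('d set \<Rightarrow> 'm) \<Rightarrow> 'k) \<Rightarrow> 'k) \<Rightarrow> (('h \<Rightarrow> ((('d set \<Rightarrow> 'm) \<Rightarrow> 'k) \<Rightarrow> 'k) \<Rightarrow> 'k) \<Rightarrow> 'k)" where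
  "face_coaction G H M c m =
     (THE t. t \<in> vcar (H \<otimes>\<^sub>s ext_space G M) \<and>
        (\<forall>\<alpha>\<in>vcar (dual H).
           tlift H (ext_space G M) (ext_space G M) (\<lambda>x n. vscale (ext_space G M) (\<alpha> x) n) t =
           T_list G H M (cycle_from (face_perm G) (inv (rho G) c)) \<alpha> m))"

section \<open>The tensor power of a Hopf algebra\<close>

text \<open>The linear map \<open>(H \<otimes> H)\<^bsup>\<otimes>C\<^esup> \<rightarrow> H\<^bsup>\<otimes>C\<^esup> \<otimes> H\<^bsup>\<otimes>C\<^esup>\<close> that permutes the tensor factors.\<close>

definition unzip_tensor :: "'c set \<Rightarrow> ('k::field, 'h::ab_group_add) hopf \<Rightarrow>
    ((('c \<Rightarrow> (('h \<Rightarrow> 'h \<Rightarrow> 'k) \<Rightarrow> 'k)) \<Rightarrow> 'k) \<Rightarrow> 'k) \<Rightarrow>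
    (((('c \<Rightarrow> 'h) \<Rightarrow> 'k) \<Rightarrow> 'k) \<Rightarrow> ((('c \<Rightarrow> 'h) \<Rightarrow> 'k) \<Rightarrow> 'k) \<Rightarrow> 'k) \<Rightarrow> 'k" where
  "unzip_tensor C H =
     (SOME f. linmap (tpower C (H \<otimes>\<^sub>s H)) (tpower C H \<otimes>\<^sub>s tpower C H) f \<and>
        (\<forall>a\<in>C \<rightarrow>\<^sub>E vcar H. \<forall>b\<in>C \<rightarrow>\<^sub>E vcar H.
           f (ptensor C (H \<otimes>\<^sub>s H) (\<lambda>c\<in>C. tensor H H (a c) (b c))) =
           tensor (tpower C H) (tpower C H) (ptensor C H a) (ptensor C H b)))"

definition hopf_power :: "'c set \<Rightarrow> ('k::field, 'h::ab_group_add) hopf \<Rightarrow>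
    ('k, (('c \<Rightarrow> 'h) \<Rightarrow> 'k) \<Rightarrow> 'k) hopf" where
  "hopf_power C H =
     \<lparr>vcar = vcar (tpower C H),
      vscale = vscale (tpower C H),
      hmult = (\<lambda>s t.
        plift C H (tpower C H) (\<lambda>x.
          plift C H (tpower C H) (\<lambda>y. ptensor C H (\<lambda>c\<in>C. hmult H (x c) (y c))) t) s),
      hone = ptensor C H (\<lambda>c\<in>C. hone H),
      comult = plift C H (tpower C H \<otimes>\<^sub>s tpower C H)
        (\<lambda>x. unzip_tensor C H (ptensor C (H \<otimes>\<^sub>s H) (\<lambda>c\<in>C. comult H (x c)))),
      counit = plift C H scalars (\<lambda>x. \<Prod>c\<in>C. counit H (x c)),
      antipode = plift C H (tpower C H) (\<lambda>x. ptensor C H (\<lambda>c\<in>C. antipode H (x c)))\<rparr>"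

definition pr_map :: "'c set \<Rightarrow> ('k::field, 'h::ab_group_add) hopf \<Rightarrow> 'c \<Rightarrow>
    ((('c \<Rightarrow> 'h) \<Rightarrow> 'k) \<Rightarrow> 'k) \<Rightarrow> 'h" where
  "pr_map C H c = plift C H H (\<lambda>x. vscale H (\<Prod>d\<in>C - {c}. counit H (x d)) (x c))"

definition in_map :: "'c set \<Rightarrow> ('k::field, 'h::ab_group_add) hopf \<Rightarrow> 'c \<Rightarrow>
    'h \<Rightarrow> ((('c \<Rightarrow> 'h) \<Rightarrow> 'k) \<Rightarrow> 'k)" where
  "in_map C H c a = ptensor C H (\<lambda>d\<in>C. if d = c then a else hone H)"

definition kitaev_hopf :: "'d kitaev \<Rightarrow> ('k::field, 'h::ab_group_add) hopf \<Rightarrow>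
    ('k, (('d \<Rightarrow> 'h) \<Rightarrow> 'k) \<Rightarrow> 'k) hopf" where
  "kitaev_hopf G H = hopf_power (cilia G) H"

definition is_graph_action :: "'d kitaev \<Rightarrow> ('k::field, 'h::ab_group_add) hopf \<Rightarrow>
    ('k, 'h, 'm::ab_group_add) hbimod \<Rightarrow>
    (((('d \<Rightarrow> 'h) \<Rightarrow> 'k) \<Rightarrow> 'k) \<Rightarrow> ((('d set \<Rightarrow> 'm) \<Rightarrow> 'k) \<Rightarrow> 'k) \<Rightarrow>
      ((('d set \<Rightarrow> 'm) \<Rightarrow> 'k) \<Rightarrow> 'k)) \<Rightarrow> bool" where
  "is_graph_action G H M act \<longleftrightarrow>
     left_module (kitaev_hopf G H) (ext_space G M) act \<and>
     (\<forall>c\<in>cilia G. \<forall>a\<in>vcar H. \<forall>m\<in>vcar (ext_space G M).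
        act (in_map (cilia G) H c a) m = vertex_action G H M c a m)"

definition is_graph_coaction :: "'d kitaev \<Rightarrow> ('k::field, 'h::ab_group_add) hopf \<Rightarrow>
    ('k, 'h, 'm::ab_group_add) hbimod \<Rightarrow>
    (((('d set \<Rightarrow> 'm) \<Rightarrow> 'k) \<Rightarrow> 'k) \<Rightarrow>
      ((((('d \<Rightarrow> 'h) \<Rightarrow> 'k) \<Rightarrow> 'k) \<Rightarrow> ((('d set \<Rightarrow> 'm) \<Rightarrow> 'k) \<Rightarrow> 'k) \<Rightarrow> 'k) \<Rightarrow> 'k)) \<Rightarrow> bool" where
  "is_graph_coaction G H M co \<longleftrightarrow>
     left_comodule (kitaev_hopf G H) (ext_space G M) co \<and>
     (\<forall>c\<in>cilia G. \<forall>m\<in>vcar (ext_space G M).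
        tlift (kitaev_hopf G H) (ext_space G M) (H \<otimes>\<^sub>s ext_space G M)
          (\<lambda>x n. tensor H (ext_space G M) (pr_map (cilia G) H c x) n) (co m) =
        face_coaction G H M c m)"

end

theory Submission
  imports Defs
begin

text \<open>
  Let \<open>A\<^sub>c(a)\<close> be the vertex action at a cilium \<open>c\<close> and \<open>T\<^sub>c(\<alpha>)\<close> the operator by which
  \<open>\<alpha> \<in> H\<^sup>*\<close> acts through the face coaction at \<open>c\<close>. Different cilia have disjoint vertex cycles and
  disjoint face cycles, so the \<open>A\<^sub>c\<close> commute with each other and so do the \<open>T\<^sub>c\<close>; their products
  over all cilia give the action and the coaction. Since the images of the \<open>i\<^sub>c\<close> generate the
  tensor power of \<open>H\<close>, and dually the forms \<open>\<alpha> \<circ> pr\<^sub>c\<close> generate its dual, both are unique.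

  A half-edge operator \<open>L\<^sub>h(a)\<close> fails to commute only with \<open>T\<^sub>h\<close>, where it produces \<open>S(a\<^sub>2)\<close>, and
  with \<open>T\<^bsub>\<iota>h\<^esub>\<close>, where it produces \<open>a\<^sub>1\<close>. At a corner of the vertex that carries no cilium the face
  cycle passes directly between the two contributions, which cancel by the antipode axiom. Only the corner at the
  cilium survives: for the face of another cilium nothing is left, so \<open>A\<^sub>c\<close> and \<open>T\<^bsub>c'\<^esub>\<close> commute,
  and for \<open>c' = c\<close> the two ends \<open>a\<^sub>1\<close> and \<open>S(a\<^sub>3)\<close> remain, which is the Yetter--Drinfeld condition.
  All computations are done in coordinates with respect to a basis of \<open>H\<close>.
\<close>

section \<open>Linear and multilinear maps on carriers\<close>

text \<open>Incidences are not kept apart by the graph: an edge may be a loop, both of its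
  half-edges may lie on one face, and a face may pass through a vertex several times. Commuting
  \<open>L\<^sub>h\<close> with the operators of a face one by one would need a case distinction for
  every such coincidence. Therefore the coactions of all half-edges are taken jointly and contracted
  with a multilinear form. Moving \<open>L\<^sub>h\<close> past them is then a uniform change of
  variables in the form, and a face is recovered from the form that multiplies its components in
  order and applies the counit to all others.

  Finite dimension provides the bases, hence the coproduct of the dual, and it makes the antipode
  bijective, so that \<open>S\<^sup>-\<^sup>2\<close> in the Hopf bimodule law is an honest inverse.
  This twist is what lets sources and targets obey the same relations: a source acts through
  \<open>S\<close>, the opposite target reads the right coaction through \<open>S\<close>, and
  \<open>S \<circ> S\<^sup>-\<^sup>2 \<circ> S = S \<circ> S\<^sup>-\<^sup>1\<close> leaves the bare
  element.\<close>

lemma vs_vector_space: "is_vspace V \<Longrightarrow> vector_space (vscale V)"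
  by (simp add: is_vspace_def)

lemma vs_subspace: "is_vspace V \<Longrightarrow> module.subspace (vscale V) (vcar V)"
  by (simp add: is_vspace_def)

context
  fixes V :: "('k::field, 'v::ab_group_add, 'z) vspace_scheme"
  assumes V: "is_vspace V"
begin

interpretation V: vector_space "vscale V" by (rule vs_vector_space[OF V])

lemma vs_zero: "0 \<in> vcar V"
  using vs_subspace[OF V] V.subspace_0 by blast

lemma vs_add: "x \<in> vcar V \<Longrightarrow> y \<in> vcar V \<Longrightarrow> x + y \<in> vcar V"
  using vs_subspace[OF V] V.subspace_add by blast

lemma vs_scale: "x \<in> vcar V \<Longrightarrow> vscale V c x \<in> vcar V"
  using vs_subspace[OF V] V.subspace_scale by blast

lemma vs_sum: "(\<And>i. i \<in> I \<Longrightarrow> f i \<in> vcar V) \<Longrightarrow> sum f I \<in> vcar V"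
  using vs_subspace[OF V] V.subspace_sum by blast

end

lemma linmap_closed: "linmap V W f \<Longrightarrow> x \<in> vcar V \<Longrightarrow> f x \<in> vcar W"
  and linmap_add: "linmap V W f \<Longrightarrow> x \<in> vcar V \<Longrightarrow> y \<in> vcar V \<Longrightarrow> f (x + y) = f x + f y"
  and linmap_scale: "linmap V W f \<Longrightarrow> x \<in> vcar V \<Longrightarrow> f (vscale V c x) = vscale W c (f x)"
  by (simp_all add: linmap_def)

lemma linmap_zero:
  assumes "is_vspace V" "is_vspace W" "linmap V W f"
  shows "f 0 = 0"
proof -
  interpret V: vector_space "vscale V" by (rule vs_vector_space[OF assms(1)])
  interpret W: vector_space "vscale W" by (rule vs_vector_space[OF assms(2)])
  have "f (vscale V 0 0) = vscale W 0 (f 0)"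
    using linmap_scale[OF assms(3) vs_zero[OF assms(1)]] .
  then show ?thesis by simp
qed

lemma linmap_sum:
  assumes V: "is_vspace V" and W: "is_vspace W" and f: "linmap V W f"
    and g: "\<And>i. i \<in> I \<Longrightarrow> g i \<in> vcar V"
  shows "f (sum g I) = (\<Sum>i\<in>I. f (g i))"
  using g
proof (induction I rule: infinite_finite_induct)
  case (insert i I)
  then show ?case
    using linmap_add[OF f, of "g i" "sum g I"] vs_sum[OF V, of I g] by simp
qed (simp_all add: linmap_zero[OF V W f])

lemma linmap_sum_scale:
  assumes V: "is_vspace V" and W: "is_vspace W" and f: "linmap V W f"
    and g: "\<And>i. i \<in> I \<Longrightarrow> g i \<in> vcar V"
  shows "f (\<Sum>i\<in>I. vscale V (c i) (g i)) = (\<Sum>i\<in>I. vscale W (c i) (f (g i)))"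
  using linmap_sum[OF V W f, of I "\<lambda>i. vscale V (c i) (g i)"] linmap_scale[OF f] g vs_scale[OF V]
  by simp

lemma linmap_id: "linmap V V (\<lambda>x. x)"
  by (simp add: linmap_def)

lemma linmap_comp: "linmap V W f \<Longrightarrow> linmap W X g \<Longrightarrow> linmap V X (\<lambda>x. g (f x))"
  by (simp add: linmap_def)

lemma linmap_cong:
  assumes "linmap V W f" "is_vspace V" "\<And>x. x \<in> vcar V \<Longrightarrow> f x = g x"
  shows "linmap V W g"
  using assms vs_add[OF assms(2)] vs_scale[OF assms(2)] by (simp add: linmap_def)

lemma linmap_sum_fun:
  assumes W: "is_vspace W" and f: "\<And>i. i \<in> I \<Longrightarrow> linmap V W (f i)"
  shows "linmap V W (\<lambda>x. \<Sum>i\<in>I. f i x)"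
proof -
  interpret W: vector_space "vscale W" by (rule vs_vector_space[OF W])
  show ?thesis
    using f vs_sum[OF W, of I] unfolding linmap_def
    by (simp add: sum.distrib W.scale_sum_right)
qed

lemma linmap_scale_fun:
  assumes W: "is_vspace W" and f: "linmap V W f"
  shows "linmap V W (\<lambda>x. vscale W c (f x))"
proof -
  interpret W: vector_space "vscale W" by (rule vs_vector_space[OF W])
  show ?thesis
    using f vs_scale[OF W] unfolding linmap_def by (simp add: W.scale_right_distrib mult.commute)
qed

lemma linmap_scalar_fun:
  assumes W: "is_vspace W" and f: "linmap V scalars f" and w: "w \<in> vcar W"
  shows "linmap V W (\<lambda>x. vscale W (f x) w)"
proof -
  interpret W: vector_space "vscale W" by (rule vs_vector_space[OF W])
  show ?thesis
    using f vs_scale[OF W w] unfolding linmap_def scalars_def by (simp add: W.scale_left_distrib)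
qed

lemma bilinI:
  "(\<And>x. x \<in> vcar V \<Longrightarrow> linmap W X (\<beta> x)) \<Longrightarrow> (\<And>y. y \<in> vcar W \<Longrightarrow> linmap V X (\<lambda>x. \<beta> x y)) \<Longrightarrow>
   bilin V W X \<beta>"
  by (simp add: bilin_def)

lemma bilin_left: "bilin V W X \<beta> \<Longrightarrow> y \<in> vcar W \<Longrightarrow> linmap V X (\<lambda>x. \<beta> x y)"
  and bilin_right: "bilin V W X \<beta> \<Longrightarrow> x \<in> vcar V \<Longrightarrow> linmap W X (\<beta> x)"
  and bilin_closed: "bilin V W X \<beta> \<Longrightarrow> x \<in> vcar V \<Longrightarrow> y \<in> vcar W \<Longrightarrow> \<beta> x y \<in> vcar X"
  by (simp_all add: bilin_def linmap_def)

lemma bilin_scalar_fun: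
  assumes W: "is_vspace W" and f: "linmap V scalars f"
  shows "bilin V W W (\<lambda>x n. vscale W (f x) n)"
    and "bilin W V W (\<lambda>n x. vscale W (f x) n)"
proof -
  interpret W: vector_space "vscale W" by (rule vs_vector_space[OF W])
  have "linmap W W (vscale W c)" for c
    using linmap_scale_fun[OF W linmap_id] .
  then show "bilin V W W (\<lambda>x n. vscale W (f x) n)" "bilin W V W (\<lambda>n x. vscale W (f x) n)"
    using linmap_scalar_fun[OF W f] by (auto intro!: bilinI)
qed

lemma vspace_fscale: "is_vspace \<lparr>vcar = module.span fscale S, vscale = fscale :: 'k::field \<Rightarrow> ('x \<Rightarrow> 'k) \<Rightarrow> _\<rparr>"
proof -
  interpret F: vector_space "fscale :: 'k \<Rightarrow> ('x \<Rightarrow> 'k) \<Rightarrow> 'x \<Rightarrow> 'k"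
    by (rule vector_space_fscale)
  show ?thesis by (simp add: is_vspace_def F.vector_space_axioms)
qed

lemma is_vspace_tprod: "is_vspace (V \<otimes>\<^sub>s W)"
  unfolding tprod_def by (rule vspace_fscale)

lemma is_vspace_tpower: "is_vspace (tpower I V)"
  unfolding tpower_def by (rule vspace_fscale)

lemma vscale_tprod [simp]: "vscale (V \<otimes>\<^sub>s W) = fscale"
  by (simp add: tprod_def)

lemma vscale_tpower [simp]: "vscale (tpower I V) = fscale"
  by (simp add: tpower_def)

lemma vscale_scalars [simp]: "vscale scalars = (*)" and vcar_scalars [simp]: "vcar scalars = UNIV"
  by (simp_all add: scalars_def)

lemma tensor_closed: "x \<in> vcar V \<Longrightarrow> y \<in> vcar W \<Longrightarrow> tensor V W x y \<in> vcar (V \<otimes>\<^sub>s W)"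
  by (rule bilin_closed[OF bilin_tensor])

lemma ptensor_closed: "x \<in> I \<rightarrow>\<^sub>E vcar V \<Longrightarrow> ptensor I V x \<in> vcar (tpower I V)"
  using multilin_ptensor[of I V] by (simp add: multilin_def)

lemma linmap_tprod_eqI:
  assumes "is_vspace X" "linmap (V \<otimes>\<^sub>s W) X f" "linmap (V \<otimes>\<^sub>s W) X g"
    and "\<And>x y. x \<in> vcar V \<Longrightarrow> y \<in> vcar W \<Longrightarrow> f (tensor V W x y) = g (tensor V W x y)"
    and "t \<in> vcar (V \<otimes>\<^sub>s W)"
  shows "f t = g t"
proof (rule linear_map_on_span_unique[OF assms(1) assms(2,3)[unfolded tprod_def]])
  show "t \<in> module.span fscale {tensor V W x y | x y. x \<in> vcar V \<and> y \<in> vcar W}"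
    using assms(5) by (simp add: tprod_def)
qed (use assms(4) in blast)

lemma linmap_tpower_eqI:
  assumes "is_vspace X" "linmap (tpower I V) X f" "linmap (tpower I V) X g"
    and "\<And>x. x \<in> I \<rightarrow>\<^sub>E vcar V \<Longrightarrow> f (ptensor I V x) = g (ptensor I V x)"
    and "t \<in> vcar (tpower I V)"
  shows "f t = g t"
proof (rule linear_map_on_span_unique[OF assms(1) assms(2,3)[unfolded tpower_def]])
  show "t \<in> module.span fscale (ptensor I V ` (I \<rightarrow>\<^sub>E vcar V))"
    using assms(5) by (simp add: tpower_def)
qed (use assms(4) in blast)

lemma tlift_tensor_sum:
  assumes X: "is_vspace X" and \<beta>: "bilin V W X \<beta>"
    and "\<And>i. i \<in> I \<Longrightarrow> x i \<in> vcar V" "\<And>i. i \<in> I \<Longrightarrow> y i \<in> vcar W"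
  shows "tlift V W X \<beta> (\<Sum>i\<in>I. tensor V W (x i) (y i)) = (\<Sum>i\<in>I. \<beta> (x i) (y i))"
proof -
  have "tlift V W X \<beta> (\<Sum>i\<in>I. tensor V W (x i) (y i)) = (\<Sum>i\<in>I. tlift V W X \<beta> (tensor V W (x i) (y i)))"
    by (rule linmap_sum[OF is_vspace_tprod X tensor_universal(1)[OF X \<beta>]]) (simp add: tensor_closed assms(3,4))
  also have "\<dots> = (\<Sum>i\<in>I. \<beta> (x i) (y i))"
    by (intro sum.cong refl tensor_universal(2)[OF X \<beta>] assms(3,4))
  finally show ?thesis .
qed

lemma tlift_cong:
  "(\<And>x y. x \<in> vcar V \<Longrightarrow> y \<in> vcar W \<Longrightarrow> \<beta> x y = \<gamma> x y) \<Longrightarrow> tlift V W X \<beta> = tlift V W X \<gamma>"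
  unfolding tlift_def by (rule arg_cong[of _ _ Eps]) (auto simp: fun_eq_iff)

lemma plift_cong:
  "(\<And>x. x \<in> I \<rightarrow>\<^sub>E vcar V \<Longrightarrow> \<beta> x = \<gamma> x) \<Longrightarrow> plift I V X \<beta> = plift I V X \<gamma>"
  unfolding plift_def by (rule arg_cong[of _ _ Eps]) (auto simp: fun_eq_iff)

lemma linmap_tlift_arg:
  assumes "is_vspace X" "bilin V W X \<beta>" "linmap U (V \<otimes>\<^sub>s W) f"
  shows "linmap U X (\<lambda>u. tlift V W X \<beta> (f u))"
  by (rule linmap_comp[OF assms(3) tensor_universal(1)[OF assms(1,2)]])

lemma sum_PiE_insert:
  assumes "c \<notin> F"
  shows "(\<Sum>g\<in>insert c F \<rightarrow>\<^sub>E J. h g) = (\<Sum>j\<in>J. \<Sum>g\<in>F \<rightarrow>\<^sub>E J. h (g(c := j)))"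
proof -
  have "inj_on (\<lambda>(j, g). g(c := j)) (J \<times> (F \<rightarrow>\<^sub>E J))"
    using inj_combinator[OF assms, of "\<lambda>_. J"] .
  then show ?thesis
    unfolding PiE_insert_eq
    by (subst sum.reindex) (simp_all add: sum.cartesian_product case_prod_unfold)
qed

lemma multilin_upd:
  "multilin I V X \<beta> \<Longrightarrow> x \<in> I \<rightarrow>\<^sub>E vcar V \<Longrightarrow> i \<in> I \<Longrightarrow> linmap V X (\<lambda>v. \<beta> (x(i := v)))"
  and multilin_closed: "multilin I V X \<beta> \<Longrightarrow> x \<in> I \<rightarrow>\<^sub>E vcar V \<Longrightarrow> \<beta> x \<in> vcar X"
  by (simp_all add: multilin_def)

text \<open>Expanding every slot gives one summand for each choice function
  \<open>g \<in> C \<rightarrow>\<^sub>E J\<close>. The auxiliary claim expands the slots in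
  \<open>F\<close> one after the other; the family \<open>x\<close> holds the slots that are still
  to come.\<close>

lemma multilin_sum_expand:
  assumes C: "finite C" and V: "is_vspace V" and X: "is_vspace X" and \<beta>: "multilin C V X \<beta>"
    and u: "\<And>c j. c \<in> C \<Longrightarrow> j \<in> J \<Longrightarrow> u c j \<in> vcar V"
  shows "\<beta> (\<lambda>c\<in>C. \<Sum>j\<in>J. vscale V (s c j) (u c j)) =
    (\<Sum>g\<in>C \<rightarrow>\<^sub>E J. vscale X (\<Prod>c\<in>C. s c (g c)) (\<beta> (\<lambda>c\<in>C. u c (g c))))"
proof -
  interpret X: vector_space "vscale X" by (rule vs_vector_space[OF X])
  define w where "w c = (\<Sum>j\<in>J. vscale V (s c j) (u c j))" for c
  have w: "w c \<in> vcar V" if "c \<in> C" for c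
    unfolding w_def using u[OF that] by (intro vs_sum[OF V] vs_scale[OF V])
  have *: "\<beta> (\<lambda>c\<in>C. if c \<in> F then w c else x c) =
      (\<Sum>g\<in>F \<rightarrow>\<^sub>E J. vscale X (\<Prod>c\<in>F. s c (g c)) (\<beta> (\<lambda>c\<in>C. if c \<in> F then u c (g c) else x c)))"
    if "finite F" "F \<subseteq> C" "x \<in> C \<rightarrow>\<^sub>E vcar V" for F x
    using that
  proof (induction F arbitrary: x rule: finite_induct)
    case empty
    then show ?case by simp
  next
    case (insert c F)
    have c: "c \<in> C" "c \<notin> F" using insert by auto
    have x': "x(c := w c) \<in> C \<rightarrow>\<^sub>E vcar V"
      using insert.prems w c by (auto simp: PiE_iff extensional_def)
    have eq: "(\<lambda>d\<in>C. if d \<in> insert c F then w d else x d) =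
        (\<lambda>d\<in>C. if d \<in> F then w d else (x(c := w c)) d)"
      using c by (auto simp: fun_eq_iff)
    have step: "\<beta> (\<lambda>d\<in>C. if d \<in> F then u d (g d) else (x(c := w c)) d) =
        (\<Sum>j\<in>J. vscale X (s c j)
           (\<beta> (\<lambda>d\<in>C. if d \<in> insert c F then u d ((g(c := j)) d) else x d)))" if g: "g \<in> F \<rightarrow>\<^sub>E J" for g
    proof -
      define y where "y = (\<lambda>d\<in>C. if d \<in> F then u d (g d) else x d)"
      have y: "y \<in> C \<rightarrow>\<^sub>E vcar V"
        using insert.prems g u by (auto simp: y_def PiE_iff)
      have 1: "(\<lambda>d\<in>C. if d \<in> F then u d (g d) else (x(c := w c)) d) = y(c := w c)"
        using c by (auto simp: fun_eq_iff y_def)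
      have 2: "(\<lambda>d\<in>C. if d \<in> insert c F then u d ((g(c := j)) d) else x d) = y(c := u c j)" for j
        using c by (auto simp: fun_eq_iff y_def)
      show ?thesis
        unfolding 1 2 unfolding w_def
        by (rule linmap_sum_scale[OF V X multilin_upd[OF \<beta> y c(1)]]) (rule u[OF c(1)])
    qed
    have p: "(\<Prod>d\<in>insert c F. s d ((g(c := j)) d)) = (\<Prod>d\<in>F. s d (g d)) * s c j" for g j
    proof -
      have "(\<Prod>d\<in>F. s d ((g(c := j)) d)) = (\<Prod>d\<in>F. s d (g d))"
        using c by (intro prod.cong) auto
      then show ?thesis using insert.hyps by (simp add: mult.commute)
    qed
    show ?case
      unfolding eq
      apply (subst insert.IH[OF _ x'])
      using insert.prems apply simp
      apply (subst sum_PiE_insert[OF c(2)])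
      apply (subst sum.swap)
      apply (rule sum.cong[OF refl])
      apply (subst step, assumption)
      apply (simp only: p X.scale_sum_right X.scale_scale)
      done
  qed
  have "\<beta> (\<lambda>c\<in>C. w c) = \<beta> (\<lambda>c\<in>C. if c \<in> C then w c else (\<lambda>c\<in>C. 0) c)"
    by (rule arg_cong[of _ _ \<beta>]) auto
  also have "\<dots> = (\<Sum>g\<in>C \<rightarrow>\<^sub>E J. vscale X (\<Prod>c\<in>C. s c (g c))
      (\<beta> (\<lambda>c\<in>C. if c \<in> C then u c (g c) else (\<lambda>c\<in>C. 0) c)))"
    by (rule *[OF C]) (auto simp: vs_zero[OF V])
  also have "\<dots> = (\<Sum>g\<in>C \<rightarrow>\<^sub>E J. vscale X (\<Prod>c\<in>C. s c (g c)) (\<beta> (\<lambda>c\<in>C. u c (g c))))"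
    by (intro sum.cong refl arg_cong2[of _ _ _ _ "vscale X"] arg_cong[of _ _ \<beta>]) auto
  finally show ?thesis by (simp add: w_def)
qed

lemma multilin_prod:
  assumes C: "finite C" and X: "is_vspace X" and f: "\<And>c. c \<in> C \<Longrightarrow> linmap V scalars (f c)"
    and v: "v \<in> vcar X"
  shows "multilin C V X (\<lambda>x. vscale X (\<Prod>c\<in>C. f c (x c)) v)"
  unfolding multilin_def
proof (intro ballI conjI)
  fix x i assume x: "x \<in> C \<rightarrow>\<^sub>E vcar V" and i: "i \<in> C"
  have eq: "(\<Prod>c\<in>C. f c ((x(i := w)) c)) = f i w * (\<Prod>c\<in>C - {i}. f c (x c))" for w
    by (subst prod.remove[OF C i]) (auto intro!: prod.cong)
  have "linmap V scalars (\<lambda>w. f i w * (\<Prod>c\<in>C - {i}. f c (x c)))"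
    using f[OF i] by (simp add: linmap_def algebra_simps)
  then show "linmap V X (\<lambda>w. vscale X (\<Prod>c\<in>C. f c ((x(i := w)) c)) v)"
    unfolding eq by (rule linmap_scalar_fun[OF X _ v])
qed (rule vs_scale[OF X v])

lemma multilin_sum:
  assumes X: "is_vspace X" and f: "\<And>j. j \<in> J \<Longrightarrow> multilin C V X (f j)"
  shows "multilin C V X (\<lambda>x. \<Sum>j\<in>J. f j x)"
  using f unfolding multilin_def by (auto intro!: vs_sum[OF X] linmap_sum_fun[OF X])

lemma multilin_cong:
  assumes "is_vspace V" "multilin C V X f" "\<And>x. x \<in> C \<rightarrow>\<^sub>E vcar V \<Longrightarrow> f x = g x"
  shows "multilin C V X g"
  unfolding multilin_def
proof (intro ballI conjI)
  fix x assume x: "x \<in> C \<rightarrow>\<^sub>E vcar V"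
  then show "g x \<in> vcar X" using assms(2,3)[unfolded multilin_def] by metis
  fix i assume i: "i \<in> C"
  show "linmap V X (\<lambda>v. g (x(i := v)))"
    by (rule linmap_cong[OF multilin_upd[OF assms(2) x i] assms(1)])
      (rule assms(3), use x i in \<open>auto simp: PiE_iff extensional_def\<close>)
qed

lemma multilin_comp: "multilin C V X f \<Longrightarrow> linmap X Y g \<Longrightarrow> multilin C V Y (\<lambda>x. g (f x))"
  unfolding multilin_def using linmap_closed linmap_comp by fast

lemma multilin_map:
  assumes V: "is_vspace V" and \<beta>: "multilin C W X \<beta>" and f: "\<And>c. c \<in> C \<Longrightarrow> linmap V W (f c)"
  shows "multilin C V X (\<lambda>x. \<beta> (\<lambda>c\<in>C. f c (x c)))"
  unfolding multilin_def
proof (intro ballI conjI)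
  fix x assume x: "x \<in> C \<rightarrow>\<^sub>E vcar V"
  have y: "(\<lambda>c\<in>C. f c (x c)) \<in> C \<rightarrow>\<^sub>E vcar W"
    using x linmap_closed[OF f] by auto
  then show "\<beta> (\<lambda>c\<in>C. f c (x c)) \<in> vcar X" by (rule multilin_closed[OF \<beta>])
  fix i assume i: "i \<in> C"
  have eq: "(\<lambda>c\<in>C. f c ((x(i := v)) c)) = (\<lambda>c\<in>C. f c (x c))(i := f i v)" for v
    using i by (auto simp: fun_eq_iff)
  show "linmap V X (\<lambda>v. \<beta> (\<lambda>c\<in>C. f c ((x(i := v)) c)))"
    unfolding eq by (rule linmap_comp[OF f[OF i] multilin_upd[OF \<beta> y i]])
qed

lemma linmap_fscale_eval:
  "linmap (V \<otimes>\<^sub>s W) scalars (\<lambda>t. t b)" "linmap (tpower I V) scalars (\<lambda>s. s x)"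
  by (simp_all add: linmap_def tprod_def tpower_def fscale_def)

section \<open>Finite-dimensional Hopf algebras in coordinates\<close>

text \<open>
  The basis \<open>B\<close> spans a subspace of the type only. All structure maps are extended to the whole
  type by precomposing with the projection \<open>pr\<close>, so that no carrier conditions are needed; the
  unit laws then produce \<open>pr\<close>. The scalars \<open>dl b c a\<close> are the coefficients of the coproduct of
  \<open>a\<close>. Because both legs of \<open>sw s \<phi> a\<close> run over basis vectors only, coassociativity of
  Sweedler sums holds for arbitrary \<open>\<phi>\<close>, linear or not.
\<close>

lemma sum_rot3: "(\<Sum>p\<in>P. \<Sum>q\<in>Q. \<Sum>r\<in>R. f p q r) = (\<Sum>r\<in>R. \<Sum>p\<in>P. \<Sum>q\<in>Q. f p q r)"
proof -
  have "(\<Sum>p\<in>P. \<Sum>q\<in>Q. \<Sum>r\<in>R. f p q r) = (\<Sum>p\<in>P. \<Sum>r\<in>R. \<Sum>q\<in>Q. f p q r)"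
    by (intro sum.cong refl sum.swap)
  then show ?thesis by (simp add: sum.swap[of _ R P])
qed

text \<open>Among the images of the positive even powers, one with a smallest finite spanning set is
  chosen. Applying \<open>f ^^ k\<close> once more gives the image of another even power, which
  cannot be smaller, so \<open>f ^^ k\<close> is bijective on its image. The exponent is even
  because even powers of an antipode preserve the order of products.\<close>

lemma (in vector_space) fitting_even:
  assumes f: "Vector_Spaces.linear scale scale f" and C0: "finite C0" "range f \<subseteq> span C0"
  shows "\<exists>k\<ge>1. even k \<and> (\<forall>x. (f ^^ k) ((f ^^ k) x) = 0 \<longrightarrow> (f ^^ k) x = 0) \<and>
    (\<forall>x. \<exists>y. (f ^^ k) x = (f ^^ k) ((f ^^ k) y))"
proof -
  have pow: "Vector_Spaces.linear scale scale (f ^^ j)" for j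
  proof (induction j)
    case 0
    show ?case by unfold_locales (simp_all add: scale_right_distrib scale_left_distrib)
  next
    case (Suc j)
    show ?case unfolding funpow.simps by (rule Vector_Spaces.linear_compose[OF Suc f])
  qed
  define Q where "Q n \<longleftrightarrow> (\<exists>k C. k \<ge> 1 \<and> even k \<and> finite C \<and> card C = n \<and> span C = range (f ^^ k))" for n
  have "\<exists>n. Q n"
  proof -
    interpret f2: Vector_Spaces.linear scale scale "f ^^ 2" by (rule pow)
    obtain C where C: "C \<subseteq> range (f ^^ 2)" "independent C" "range (f ^^ 2) \<subseteq> span C"
      by (rule maximal_independent_subset)
    have "range (f ^^ 2) \<subseteq> range f" by (auto simp: numeral_2_eq_2)
    then have "finite C" using independent_span_bound[OF C0(1) C(2)] C(1) C0(2) by blast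
    moreover have "span C = range (f ^^ 2)"
      using C f2.subspace_image[OF subspace_UNIV] span_minimal by blast
    ultimately show ?thesis
      unfolding Q_def by (metis even_numeral one_le_numeral)
  qed
  then have Q: "Q (LEAST n. Q n)" by (rule LeastI_ex)
  have least: "(LEAST n. Q n) \<le> n" if "Q n" for n using that by (rule Least_le)
  obtain k C where k: "k \<ge> 1" "even k" and C: "finite C" "card C = (LEAST n. Q n)" "span C = range (f ^^ k)"
    using Q unfolding Q_def by blast
  define g where "g = f ^^ k"
  interpret g: Vector_Spaces.linear scale scale g unfolding g_def by (rule pow)
  have "f ^^ (k + k) = g \<circ> g" by (simp add: g_def funpow_add)
  then have gg: "range (f ^^ (k + k)) = g ` span C" using C(3) by (simp add: g_def image_comp)
  \<comment> \<open>\<open>k + k\<close> is again an admissible even exponent, so by minimality no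
    spanning set of the next image is smaller than \<open>C\<close>.\<close>
  then have small: "card C \<le> card D" if "finite D" "span D = g ` span C" for D
  proof -
    have "Q (card D)"
      unfolding Q_def
      by (rule exI[of _ "k + k"], rule exI[of _ D]) (use that k gg in simp)
    then show ?thesis using least C(2) by simp
  qed
  have gC: "span (g ` C) = g ` span C" by (rule g.span_image)
  have card_gC: "card (g ` C) = card C"
    using small[OF _ gC] C(1) card_image_le[OF C(1), of g] by simp
  then have inj: "inj_on g C" using C(1) by (simp add: eq_card_imp_inj_on)
  have ind: "independent (g ` C)"
  proof
    assume "dependent (g ` C)"
    then obtain a where a: "a \<in> g ` C" "a \<in> span (g ` C - {a})" by (auto simp: dependent_def)
    then have "span (g ` C - {a}) = g ` span C"
      using span_redundant[OF a(2)] gC by (simp add: insert_absorb)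
    then have "card C \<le> card (g ` C - {a})" by (intro small) (simp_all add: C(1))
    moreover have "card (g ` C - {a}) < card (g ` C)" using a(1) C(1) by (intro psubset_card_mono) auto
    ultimately show False using card_gC by simp
  qed
  have inj': "inj_on g (span C)" by (rule g.inj_on_span_independent_image[OF ind inj])
  have "span C \<subseteq> span (g ` C)"
  proof
    fix y assume y: "y \<in> span C"
    show "y \<in> span (g ` C)"
    proof (rule ccontr)
      assume n: "y \<notin> span (g ` C)"
      then have "independent (insert y (g ` C))" using ind by (simp add: independent_insertI)
      moreover have "insert y (g ` C) \<subseteq> span C"
        using y C(3) by (auto simp: g_def)
      ultimately have "card (insert y (g ` C)) \<le> card C"
        using independent_span_bound[OF C(1)] by blast
      moreover have "y \<notin> g ` C" using n span_base by blast
      ultimately show False using card_gC C(1) by simp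
    qed
  qed
  then have surj: "range g \<subseteq> g ` range g" using gC C(3) by (simp add: g_def)
  have "g x = 0" if "g (g x) = 0" for x
    using inj_onD[OF inj', of "g x" 0] that C(3) g.zero by (auto simp: g_def span_zero)
  moreover have "\<exists>y. g x = g (g y)" for x using surj by blast
  ultimately show ?thesis using k unfolding g_def by blast
qed

locale fd_hopf =
  fixes sH :: "'k::field \<Rightarrow> 'h::ab_group_add \<Rightarrow> 'h" and B :: "'h set" and e :: "'h \<Rightarrow> 'h \<Rightarrow> 'k"
    and mul :: "'h \<Rightarrow> 'h \<Rightarrow> 'h" (infixl "\<odot>" 70) and one :: 'h ("\<one>")
    and dl :: "'h \<Rightarrow> 'h \<Rightarrow> 'h \<Rightarrow> 'k" and ep :: "'h \<Rightarrow> 'k" and S :: "'h \<Rightarrow> 'h"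
  assumes vector_space_H: "vector_space sH"
    and finite_B: "finite B"
    and e_add: "e b (x + y) = e b x + e b y"
    and e_scale: "e b (sH k x) = k * e b x"
    and e_basis: "b \<in> B \<Longrightarrow> c \<in> B \<Longrightarrow> e b c = (if b = c then 1 else 0)"
    and mul_left: "x \<odot> y = (\<Sum>b\<in>B. sH (e b x) (b \<odot> y))"
    and mul_right: "x \<odot> y = (\<Sum>b\<in>B. sH (e b y) (x \<odot> b))"
    and dl_lin: "dl p q x = (\<Sum>b\<in>B. e b x * dl p q b)"
    and ep_lin: "ep x = (\<Sum>b\<in>B. e b x * ep b)"
    and S_lin: "S x = (\<Sum>b\<in>B. sH (e b x) (S b))"
    and pr_mul_raw: "(\<Sum>b\<in>B. sH (e b (x \<odot> y)) b) = x \<odot> y"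
    and pr_S_raw: "(\<Sum>b\<in>B. sH (e b (S x)) b) = S x"
    and pr_one_raw: "(\<Sum>b\<in>B. sH (e b \<one>) b) = \<one>"
    and mul_assoc: "x \<odot> y \<odot> z = x \<odot> (y \<odot> z)"
    and one_mul_raw: "\<one> \<odot> x = (\<Sum>b\<in>B. sH (e b x) b)"
    and mul_one_raw: "x \<odot> \<one> = (\<Sum>b\<in>B. sH (e b x) b)"
    and dl_coassoc: "\<lbrakk>b \<in> B; c \<in> B; d \<in> B\<rbrakk> \<Longrightarrow>
        (\<Sum>f\<in>B. dl f d a * dl b c f) = (\<Sum>f\<in>B. dl b f a * dl c d f)"
    and dl_counit_left: "c \<in> B \<Longrightarrow> (\<Sum>b\<in>B. dl b c a * ep b) = e c a"
    and dl_counit_right: "b \<in> B \<Longrightarrow> (\<Sum>c\<in>B. dl b c a * ep c) = e b a"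
    and dl_mul: "\<lbrakk>b \<in> B; c \<in> B\<rbrakk> \<Longrightarrow> dl b c (x \<odot> y) =
        (\<Sum>p\<in>B. \<Sum>q\<in>B. dl p q x * (\<Sum>r\<in>B. \<Sum>u\<in>B. dl r u y * (e b (p \<odot> r) * e c (q \<odot> u))))"
    and dl_one: "\<lbrakk>b \<in> B; c \<in> B\<rbrakk> \<Longrightarrow> dl b c \<one> = e b \<one> * e c \<one>"
    and ep_mul: "ep (x \<odot> y) = ep x * ep y"
    and ep_one: "ep \<one> = 1"
    and S_left: "c \<in> B \<Longrightarrow> (\<Sum>p\<in>B. \<Sum>q\<in>B. dl p q a * e c (S p \<odot> q)) = ep a * e c \<one>"
    and S_right: "c \<in> B \<Longrightarrow> (\<Sum>p\<in>B. \<Sum>q\<in>B. dl p q a * e c (p \<odot> S q)) = ep a * e c \<one>"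
begin

text \<open>More than additivity and homogeneity: the value depends only on the coordinates of the
  argument, so that \<open>\<phi> (pr x) = \<phi> x\<close> also off the span of \<open>B\<close>.
  In particular the identity is \<open>hlin\<close> only if \<open>B\<close> spans the whole type;
  \<open>pr\<close> takes its place.\<close>

definition hlin :: "('k \<Rightarrow> 'n \<Rightarrow> 'n) \<Rightarrow> ('h \<Rightarrow> 'n::ab_group_add) \<Rightarrow> bool" where
  "hlin s \<phi> \<longleftrightarrow> (\<forall>x. \<phi> x = (\<Sum>b\<in>B. s (e b x) (\<phi> b)))"

definition sw :: "('k \<Rightarrow> 'n \<Rightarrow> 'n) \<Rightarrow> ('h \<Rightarrow> 'h \<Rightarrow> 'n::ab_group_add) \<Rightarrow> 'h \<Rightarrow> 'n" where
  "sw s \<phi> a = (\<Sum>b\<in>B. \<Sum>c\<in>B. s (dl b c a) (\<phi> b c))"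

sublocale H: vector_space sH by (rule vector_space_H)

lemma vector_space_times: "vector_space ((*) :: 'k \<Rightarrow> 'k \<Rightarrow> 'k)"
  by unfold_locales (auto simp: algebra_simps)

definition pr :: "'h \<Rightarrow> 'h" where
  "pr x = (\<Sum>b\<in>B. sH (e b x) b)"

lemmas pr_mul = pr_mul_raw[folded pr_def]
  and pr_S = pr_S_raw[folded pr_def]
  and pr_one = pr_one_raw[folded pr_def]
  and one_mul = one_mul_raw[folded pr_def]
  and mul_one = mul_one_raw[folded pr_def]

lemma hlin_mul_left: "hlin sH (\<lambda>x. x \<odot> y)"
  and hlin_mul_right: "hlin sH (\<lambda>y. x \<odot> y)"
  and hlin_dl: "hlin (*) (dl p q)"
  and hlin_ep: "hlin (*) ep"
  and hlin_S: "hlin sH S"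
  unfolding hlin_def using mul_left mul_right dl_lin ep_lin S_lin by blast+

lemma e_sum: "e b (sum f I) = (\<Sum>i\<in>I. e b (f i))"
proof -
  have "e b 0 = 0" using e_scale[of b 0 0] by simp
  then show ?thesis by (induction I rule: infinite_finite_induct) (auto simp: e_add)
qed

lemma hlin_e: "b \<in> B \<Longrightarrow> hlin (*) (e b)"
  unfolding hlin_def
proof
  fix x assume b: "b \<in> B"
  have "(\<Sum>c\<in>B. e c x * e b c) = (\<Sum>c\<in>B. if c = b then e c x else 0)"
    using b by (intro sum.cong refl) (simp add: e_basis)
  then show "e b x = (\<Sum>c\<in>B. e c x * e b c)" using b finite_B by simp
qed

lemma e_pr: "b \<in> B \<Longrightarrow> e b (pr x) = e b x"
proof -
  assume b: "b \<in> B"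
  have "e b (pr x) = (\<Sum>c\<in>B. e c x * e b c)" by (simp add: pr_def e_sum e_scale)
  also have "\<dots> = e b x" by (rule hlin_e[OF b, unfolded hlin_def, rule_format, symmetric])
  finally show ?thesis .
qed

lemma pr_pr: "pr (pr x) = pr x"
proof -
  have "pr (pr x) = (\<Sum>b\<in>B. sH (e b (pr x)) b)" by (rule pr_def)
  also have "\<dots> = (\<Sum>b\<in>B. sH (e b x) b)" by (intro sum.cong refl) (simp add: e_pr)
  also have "\<dots> = pr x" by (rule pr_def[symmetric])
  finally show ?thesis .
qed

lemma hlin_pr_eq: "hlin s \<phi> \<Longrightarrow> \<phi> (pr x) = \<phi> x"
  unfolding hlin_def by (metis (mono_tags, lifting) e_pr sum.cong)

section \<open>Calculus of Sweedler sums\<close>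

lemma sw_cong: "(\<And>x y. x \<in> B \<Longrightarrow> y \<in> B \<Longrightarrow> \<phi> x y = \<psi> x y) \<Longrightarrow> sw s \<phi> a = sw s \<psi> a"
  by (simp add: sw_def cong: sum.cong)

context
  fixes s :: "'k \<Rightarrow> 'n::ab_group_add \<Rightarrow> 'n"
  assumes s: "vector_space s"
begin

interpretation N: vector_space s by (rule s)

lemma hlin_add: "hlin s \<phi> \<Longrightarrow> \<phi> (x + y) = \<phi> x + \<phi> y"
proof -
  assume "hlin s \<phi>"
  then have *: "\<phi> z = (\<Sum>b\<in>B. s (e b z) (\<phi> b))" for z unfolding hlin_def by blast
  show ?thesis unfolding *[of "x + y"] *[of x] *[of y]
    by (simp add: e_add N.scale_left_distrib sum.distrib)
qed

lemma hlin_scale: "hlin s \<phi> \<Longrightarrow> \<phi> (sH c x) = s c (\<phi> x)"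
proof -
  assume "hlin s \<phi>"
  then have *: "\<phi> z = (\<Sum>b\<in>B. s (e b z) (\<phi> b))" for z unfolding hlin_def by blast
  show ?thesis unfolding *[of "sH c x"] *[of x]
    by (simp add: e_scale N.scale_sum_right)
qed

lemma hlin_zero: "hlin s \<phi> \<Longrightarrow> \<phi> 0 = 0"
  using hlin_scale[of \<phi> 0 0] by simp

lemma hlin_sum: "hlin s \<phi> \<Longrightarrow> \<phi> (sum f I) = (\<Sum>i\<in>I. \<phi> (f i))"
  by (induction I rule: infinite_finite_induct) (auto simp: hlin_zero hlin_add)

lemma hlin_expand: "hlin s \<phi> \<Longrightarrow> (\<Sum>b\<in>B. s (e b x) (\<phi> b)) = \<phi> x"
  unfolding hlin_def by metis

lemma hlin_comp: "hlin s \<phi> \<Longrightarrow> hlin sH f \<Longrightarrow> hlin s (\<lambda>x. \<phi> (f x))"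
proof -
  assume \<phi>: "hlin s \<phi>" and f: "hlin sH f"
  show "hlin s (\<lambda>x. \<phi> (f x))"
    unfolding hlin_def
  proof
    fix x
    have "\<phi> (f x) = \<phi> (\<Sum>b\<in>B. sH (e b x) (f b))"
      by (rule arg_cong[OF f[unfolded hlin_def, rule_format]])
    then show "\<phi> (f x) = (\<Sum>b\<in>B. s (e b x) (\<phi> (f b)))"
      by (simp only: hlin_sum[OF \<phi>] hlin_scale[OF \<phi>])
  qed
qed

lemma hlin_post:
  assumes "hlin s \<phi>" "\<And>x y. g (x + y) = g x + g y" "\<And>c x. g (s c x) = s' c (g x)" "g 0 = 0"
  shows "hlin s' (\<lambda>x. g (\<phi> x))"
proof -
  have g: "g (sum f I) = (\<Sum>i\<in>I. g (f i))" for f :: "'i \<Rightarrow> 'n" and I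
    by (induction I rule: infinite_finite_induct) (auto simp: assms)
  show ?thesis
    unfolding hlin_def
  proof
    fix x
    have "g (\<phi> x) = g (\<Sum>b\<in>B. s (e b x) (\<phi> b))" by (simp add: hlin_expand[OF assms(1)])
    then show "g (\<phi> x) = (\<Sum>b\<in>B. s' (e b x) (g (\<phi> b)))" by (simp add: g assms)
  qed
qed

lemma hlin_sumI: "(\<And>i. i \<in> I \<Longrightarrow> hlin s (\<phi> i)) \<Longrightarrow> hlin s (\<lambda>x. \<Sum>i\<in>I. \<phi> i x)"
proof -
  assume h: "\<And>i. i \<in> I \<Longrightarrow> hlin s (\<phi> i)"
  show ?thesis
    unfolding hlin_def
  proof
    fix x
    have "(\<Sum>i\<in>I. \<phi> i x) = (\<Sum>i\<in>I. \<Sum>b\<in>B. s (e b x) (\<phi> i b))"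
      using h by (simp add: hlin_expand)
    then show "(\<Sum>i\<in>I. \<phi> i x) = (\<Sum>b\<in>B. s (e b x) (\<Sum>i\<in>I. \<phi> i b))"
      by (simp add: sum.swap[of _ B] N.scale_sum_right)
  qed
qed

lemma hlin_scaleI: "hlin s \<phi> \<Longrightarrow> hlin s (\<lambda>x. s c (\<phi> x))"
  by (rule hlin_post) (auto simp: N.scale_right_distrib mult.commute)

lemma hlin_scalarI: "hlin (*) f \<Longrightarrow> hlin s (\<lambda>x. s (f x) v)"
proof -
  assume f: "hlin (*) f"
  show "hlin s (\<lambda>x. s (f x) v)"
    unfolding hlin_def
  proof
    fix x
    have "s (f x) v = s (\<Sum>b\<in>B. e b x * f b) v"
      by (rule arg_cong[OF f[unfolded hlin_def, rule_format]])
    then show "s (f x) v = (\<Sum>b\<in>B. s (e b x) (s (f b) v))"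
      by (simp add: N.scale_sum_left)
  qed
qed

lemma hlin_sw: "hlin s (sw s \<phi>)"
  unfolding sw_def by (intro hlin_sumI hlin_scalarI hlin_dl)

lemma hlin_swI: "(\<And>x y. hlin s (\<lambda>z. \<phi> x y z)) \<Longrightarrow> hlin s (\<lambda>z. sw s (\<lambda>x y. \<phi> x y z) a)"
  unfolding sw_def by (intro hlin_sumI hlin_scaleI)

lemma sw_pr: "sw s \<phi> (pr a) = sw s \<phi> a"
  by (rule hlin_pr_eq[OF hlin_sw])

lemma sw_map:
  assumes "\<And>x y. g (x + y) = g x + g y" "\<And>c x. g (s c x) = s' c (g x)" "g 0 = 0"
  shows "g (sw s \<phi> a) = sw s' (\<lambda>x y. g (\<phi> x y)) a"
proof -
  have g: "g (sum f I) = (\<Sum>i\<in>I. g (f i))" for f :: "'i \<Rightarrow> 'n" and I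
    by (induction I rule: infinite_finite_induct) (auto simp: assms)
  show ?thesis by (simp add: sw_def g assms)
qed

lemma sw_scale: "s c (sw s \<phi> a) = sw s (\<lambda>x y. s c (\<phi> x y)) a"
  by (rule sw_map) (auto simp: N.scale_right_distrib mult.commute)

lemma sw_sum: "sw s (\<lambda>x y. \<Sum>i\<in>I. \<phi> i x y) a = (\<Sum>i\<in>I. sw s (\<phi> i) a)"
  unfolding sw_def
  by (simp only: N.scale_sum_right) (simp only: sum.swap[of _ I])

lemma sw_swap: "sw s (\<lambda>x y. sw s (\<lambda>u v. \<phi> x y u v) b) a = sw s (\<lambda>u v. sw s (\<lambda>x y. \<phi> x y u v) a) b"
proof -
  have "sw s (\<lambda>x y. sw s (\<lambda>u v. \<phi> x y u v) b) a =
      (\<Sum>u\<in>B. \<Sum>v\<in>B. sw s (\<lambda>x y. s (dl u v b) (\<phi> x y u v)) a)"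
    by (simp only: sw_def[where a = b] sw_sum)
  also have "\<dots> = sw s (\<lambda>u v. sw s (\<lambda>x y. \<phi> x y u v) a) b"
    by (simp only: sw_def[where a = b] sw_scale)
  finally show ?thesis .
qed

lemma sw_coassoc:
  "sw s (\<lambda>x y. sw s (\<lambda>u v. \<phi> u v y) x) a = sw s (\<lambda>x y. sw s (\<lambda>u v. \<phi> x u v) y) a"
proof -
  have "sw s (\<lambda>x y. sw s (\<lambda>u v. \<phi> u v y) x) a =
      (\<Sum>f\<in>B. \<Sum>d\<in>B. \<Sum>b\<in>B. \<Sum>c\<in>B. s (dl f d a * dl b c f) (\<phi> b c d))"
    by (simp add: sw_def N.scale_sum_right)
  also have "\<dots> = (\<Sum>b\<in>B. \<Sum>c\<in>B. \<Sum>d\<in>B. s (\<Sum>f\<in>B. dl f d a * dl b c f) (\<phi> b c d))"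
    unfolding N.scale_sum_left sum.cartesian_product
    by (rule sum.reindex_bij_witness[of _ "\<lambda>(b, c, d, f). (f, d, b, c)" "\<lambda>(f, d, b, c). (b, c, d, f)"]) auto
  also have "\<dots> = (\<Sum>b\<in>B. \<Sum>c\<in>B. \<Sum>d\<in>B. s (\<Sum>f\<in>B. dl b f a * dl c d f) (\<phi> b c d))"
    by (intro sum.cong refl) (simp add: dl_coassoc)
  also have "\<dots> = (\<Sum>b\<in>B. \<Sum>f\<in>B. \<Sum>c\<in>B. \<Sum>d\<in>B. s (dl b f a * dl c d f) (\<phi> b c d))"
    unfolding N.scale_sum_left sum.cartesian_product
    by (rule sum.reindex_bij_witness[of _ "\<lambda>(b, f, c, d). (b, c, d, f)" "\<lambda>(b, c, d, f). (b, f, c, d)"]) auto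
  also have "\<dots> = sw s (\<lambda>x y. sw s (\<lambda>u v. \<phi> x u v) y) a"
    by (simp add: sw_def N.scale_sum_right)
  finally show ?thesis .
qed

lemma sw_counit_left: "hlin s \<phi> \<Longrightarrow> sw s (\<lambda>x y. s (ep x) (\<phi> y)) a = \<phi> a"
proof -
  assume h: "hlin s \<phi>"
  have "sw s (\<lambda>x y. s (ep x) (\<phi> y)) a = (\<Sum>c\<in>B. s (\<Sum>b\<in>B. dl b c a * ep b) (\<phi> c))"
    unfolding sw_def by (subst sum.swap) (simp add: N.scale_sum_left)
  also have "\<dots> = \<phi> a" using hlin_expand[OF h] by (simp add: dl_counit_left)
  finally show ?thesis .
qed

lemma sw_counit_right: "hlin s \<phi> \<Longrightarrow> sw s (\<lambda>x y. s (ep y) (\<phi> x)) a = \<phi> a"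
proof -
  assume h: "hlin s \<phi>"
  have "sw s (\<lambda>x y. s (ep y) (\<phi> x)) a = (\<Sum>b\<in>B. s (\<Sum>c\<in>B. dl b c a * ep c) (\<phi> b))"
    unfolding sw_def by (simp add: N.scale_sum_left)
  also have "\<dots> = \<phi> a" using hlin_expand[OF h] by (simp add: dl_counit_right)
  finally show ?thesis .
qed

lemma sw_e:
  assumes "\<And>y. hlin s (\<lambda>x. \<phi> x y)" "\<And>x. hlin s (\<phi> x)"
  shows "(\<Sum>b\<in>B. \<Sum>c\<in>B. s (e b x * e c y) (\<phi> b c)) = \<phi> x y"
proof -
  have "(\<Sum>b\<in>B. \<Sum>c\<in>B. s (e b x * e c y) (\<phi> b c)) = (\<Sum>b\<in>B. s (e b x) (\<phi> b y))"
    by (subst hlin_expand[OF assms(2), symmetric]) (simp add: N.scale_sum_right)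
  then show ?thesis using hlin_expand[OF assms(1)] by simp
qed

text \<open>In contrast to \<open>sw_coassoc\<close>, linearity in both slots enters here: the
  products \<open>p \<odot> r\<close> and \<open>q \<odot> u\<close> are not basis vectors, so
  \<open>\<phi>\<close> has to be re-expanded at them.\<close>

lemma sw_mul:
  assumes "\<And>y. hlin s (\<lambda>x. \<phi> x y)" "\<And>x. hlin s (\<phi> x)"
  shows "sw s \<phi> (x \<odot> y) = sw s (\<lambda>p q. sw s (\<lambda>r u. \<phi> (p \<odot> r) (q \<odot> u)) y) x"
proof -
  have "sw s \<phi> (x \<odot> y) = (\<Sum>b\<in>B. \<Sum>c\<in>B. \<Sum>p\<in>B. \<Sum>q\<in>B. \<Sum>r\<in>B. \<Sum>u\<in>B.
      s (dl p q x * (dl r u y * (e b (p \<odot> r) * e c (q \<odot> u)))) (\<phi> b c))"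
    unfolding sw_def
    by (intro sum.cong refl) (simp add: dl_mul N.scale_sum_left sum_distrib_left)
  also have "\<dots> = (\<Sum>p\<in>B. \<Sum>q\<in>B. \<Sum>r\<in>B. \<Sum>u\<in>B. \<Sum>b\<in>B. \<Sum>c\<in>B.
      s (dl p q x * (dl r u y * (e b (p \<odot> r) * e c (q \<odot> u)))) (\<phi> b c))"
    unfolding sum.cartesian_product
    by (rule sum.reindex_bij_witness[of _ "\<lambda>(p, q, r, u, b, c). (b, c, p, q, r, u)" "\<lambda>(b, c, p, q, r, u). (p, q, r, u, b, c)"]) auto
  also have "\<dots> = sw s (\<lambda>p q. sw s (\<lambda>r u. \<phi> (p \<odot> r) (q \<odot> u)) y) x"
    unfolding sw_def
    by (simp only: N.scale_scale[symmetric] N.scale_sum_right[symmetric])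
      (simp only: hlin_expand[OF assms(1)] hlin_expand[OF assms(2)])
  finally show ?thesis .
qed

lemma sw_one:
  assumes "\<And>y. hlin s (\<lambda>x. \<phi> x y)" "\<And>x. hlin s (\<phi> x)"
  shows "sw s \<phi> \<one> = \<phi> \<one> \<one>"
  unfolding sw_def using sw_e[OF assms, of \<one> \<one>] by (simp add: dl_one)

lemma sw_antipode_left: "hlin s \<phi> \<Longrightarrow> sw s (\<lambda>x y. \<phi> (S x \<odot> y)) a = s (ep a) (\<phi> \<one>)"
proof -
  assume h: "hlin s \<phi>"
  have "sw s (\<lambda>x y. \<phi> (S x \<odot> y)) a =
      (\<Sum>p\<in>B. \<Sum>q\<in>B. \<Sum>c\<in>B. s (dl p q a * e c (S p \<odot> q)) (\<phi> c))"
    unfolding sw_def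
    by (subst hlin_expand[OF h, symmetric]) (simp add: N.scale_sum_right)
  also have "\<dots> = (\<Sum>c\<in>B. s (\<Sum>p\<in>B. \<Sum>q\<in>B. dl p q a * e c (S p \<odot> q)) (\<phi> c))"
    unfolding N.scale_sum_left by (rule sum_rot3)
  also have "\<dots> = s (ep a) (\<phi> \<one>)"
    by (simp add: S_left, simp only: N.scale_scale[symmetric] N.scale_sum_right[symmetric] hlin_expand[OF h])
  finally show ?thesis .
qed

lemma sw_antipode_right: "hlin s \<phi> \<Longrightarrow> sw s (\<lambda>x y. \<phi> (x \<odot> S y)) a = s (ep a) (\<phi> \<one>)"
proof -
  assume h: "hlin s \<phi>"
  have "sw s (\<lambda>x y. \<phi> (x \<odot> S y)) a =
      (\<Sum>p\<in>B. \<Sum>q\<in>B. \<Sum>c\<in>B. s (dl p q a * e c (p \<odot> S q)) (\<phi> c))"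
    unfolding sw_def
    by (subst hlin_expand[OF h, symmetric]) (simp add: N.scale_sum_right)
  also have "\<dots> = (\<Sum>c\<in>B. s (\<Sum>p\<in>B. \<Sum>q\<in>B. dl p q a * e c (p \<odot> S q)) (\<phi> c))"
    unfolding N.scale_sum_left by (rule sum_rot3)
  also have "\<dots> = s (ep a) (\<phi> \<one>)"
    by (simp add: S_right, simp only: N.scale_scale[symmetric] N.scale_sum_right[symmetric] hlin_expand[OF h])
  finally show ?thesis .
qed

end

lemma hlin_pr: "hlin sH pr"
  unfolding hlin_def
proof
  fix x
  have "pr b = b" if b: "b \<in> B" for b
  proof -
    have "pr b = (\<Sum>c\<in>B. if c = b then c else 0)"
      unfolding pr_def using b by (intro sum.cong refl) (simp add: e_basis)
    then show ?thesis using b finite_B by simp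
  qed
  then show "pr x = (\<Sum>b\<in>B. sH (e b x) (pr b))"
    by (simp add: pr_def)
qed

lemma pr_basis: "b \<in> B \<Longrightarrow> pr b = b"
proof -
  assume b: "b \<in> B"
  have "pr b = (\<Sum>c\<in>B. if c = b then c else 0)"
    unfolding pr_def using b by (intro sum.cong refl) (simp add: e_basis)
  then show ?thesis using b finite_B by simp
qed

lemma mul_pr_left: "pr x \<odot> y = x \<odot> y"
  by (rule hlin_pr_eq[OF hlin_mul_left])

lemma mul_pr_right: "x \<odot> pr y = x \<odot> y"
  by (rule hlin_pr_eq[OF hlin_mul_right])

lemma ep_pr: "ep (pr x) = ep x"
  by (rule hlin_pr_eq[OF hlin_ep])

lemma S_of_pr: "S (pr x) = S x"
  by (rule hlin_pr_eq[OF hlin_S])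

lemmas pr_simps = pr_mul pr_S pr_one one_mul mul_one pr_pr pr_basis mul_pr_left mul_pr_right ep_pr S_of_pr

lemma hlin_S_comp: "hlin sH f \<Longrightarrow> hlin sH (\<lambda>x. S (f x))"
  and hlin_mul_left_comp: "hlin sH f \<Longrightarrow> hlin sH (\<lambda>x. f x \<odot> y)"
  and hlin_mul_right_comp: "hlin sH f \<Longrightarrow> hlin sH (\<lambda>x. y \<odot> f x)"
  by (rule hlin_comp[OF vector_space_H hlin_S] hlin_comp[OF vector_space_H hlin_mul_left]
      hlin_comp[OF vector_space_H hlin_mul_right], assumption)+

lemmas hlin_intros = hlin_mul_left hlin_mul_right hlin_S hlin_pr hlin_S_comp hlin_mul_left_comp
  hlin_mul_right_comp

lemma sw_mul_right: "y \<odot> sw sH \<phi> a = sw sH (\<lambda>u v. y \<odot> \<phi> u v) a"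
  by (rule sw_map[OF vector_space_H hlin_add[OF vector_space_H hlin_mul_right]
      hlin_scale[OF vector_space_H hlin_mul_right] hlin_zero[OF vector_space_H hlin_mul_right]])

lemma sw_mul_left: "sw sH \<phi> a \<odot> y = sw sH (\<lambda>u v. \<phi> u v \<odot> y) a"
  by (rule sw_map[OF vector_space_H hlin_add[OF vector_space_H hlin_mul_left]
      hlin_scale[OF vector_space_H hlin_mul_left] hlin_zero[OF vector_space_H hlin_mul_left]])

lemmas mul_scale_left = hlin_scale[OF vector_space_H hlin_mul_left]
  and mul_scale_right = hlin_scale[OF vector_space_H hlin_mul_right]

section \<open>The antipode reverses products and coproducts\<close>

lemma sw_coassoc_pair:
  assumes s: "vector_space s"
  shows "sw s (\<lambda>x1 x'. sw s (\<lambda>y1 y'. sw s (\<lambda>x2 x3. sw s (\<lambda>y2 y3. F x1 x2 x3 y1 y2 y3) y') x') y) x =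
    sw s (\<lambda>x' x3. sw s (\<lambda>y' y3. sw s (\<lambda>x1 x2. sw s (\<lambda>y1 y2. F x1 x2 x3 y1 y2 y3) y') x') y) x"
  (is "?l = ?r")
proof -
  have "?l = sw s (\<lambda>x1 x'. sw s (\<lambda>x2 x3. sw s (\<lambda>y1 y'. sw s (\<lambda>y2 y3. F x1 x2 x3 y1 y2 y3) y') y) x') x"
    by (subst sw_swap[OF s]) (rule refl)
  also have "\<dots> = sw s (\<lambda>x1 x'. sw s (\<lambda>x2 x3. sw s (\<lambda>y' y3. sw s (\<lambda>y1 y2. F x1 x2 x3 y1 y2 y3) y') y) x') x"
    by (simp only: sw_coassoc[OF s, symmetric])
  also have "\<dots> = sw s (\<lambda>x' x3. sw s (\<lambda>x1 x2. sw s (\<lambda>y' y3. sw s (\<lambda>y1 y2. F x1 x2 x3 y1 y2 y3) y') y) x') x"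
    by (rule sw_coassoc[OF s, symmetric])
  also have "\<dots> = ?r"
    by (subst sw_swap[OF s]) (rule refl)
  finally show ?thesis .
qed

text \<open>In the convolution algebra of bilinear maps on pairs, \<open>S (x \<odot> y)\<close> is
  a left inverse and \<open>S y \<odot> S x\<close> a right inverse of the multiplication, hence the
  two agree.\<close>

lemma S_mul: "S (x \<odot> y) = S y \<odot> S x"
proof -
  note HV = vector_space_H
  let ?sw = "sw sH"
  have right: "?sw (\<lambda>x2 x3. ?sw (\<lambda>y2 y3. (x2 \<odot> y2) \<odot> (S y3 \<odot> S x3)) y') x' = sH (ep x' * ep y') \<one>" for x' y'
  proof -
    have "?sw (\<lambda>y2 y3. (x2 \<odot> y2) \<odot> (S y3 \<odot> S x3)) y' = sH (ep y') (pr (x2 \<odot> S x3))" for x2 x3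
      using sw_antipode_right[OF HV, of "\<lambda>z. x2 \<odot> z \<odot> S x3" y']
      by (simp add: mul_assoc pr_simps hlin_intros)
    then have "?sw (\<lambda>x2 x3. ?sw (\<lambda>y2 y3. (x2 \<odot> y2) \<odot> (S y3 \<odot> S x3)) y') x' =
        sH (ep y') (?sw (\<lambda>x2 x3. pr (x2 \<odot> S x3)) x')"
      by (simp only: sw_scale[OF HV])
    then show ?thesis
      using sw_antipode_right[OF HV, of pr x'] by (simp add: hlin_intros pr_simps mult.commute)
  qed
  have left: "?sw (\<lambda>x1 x2. ?sw (\<lambda>y1 y2. S (x1 \<odot> y1) \<odot> (x2 \<odot> y2)) y') x' = sH (ep x' * ep y') \<one>" for x' y'
  proof -
    have "?sw (\<lambda>u v. pr (S u \<odot> v)) (x' \<odot> y') = ?sw (\<lambda>x1 x2. ?sw (\<lambda>y1 y2. pr (S (x1 \<odot> y1) \<odot> (x2 \<odot> y2))) y') x'"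
      by (rule sw_mul[OF HV]) (simp_all add: pr_simps hlin_intros)
    then show ?thesis
      using sw_antipode_left[OF HV, of pr "x' \<odot> y'"] by (simp add: hlin_intros pr_simps ep_mul)
  qed
  have "S (x \<odot> y) = ?sw (\<lambda>x1 x'. ?sw (\<lambda>y1 y'. sH (ep x' * ep y') (S (x1 \<odot> y1))) y) x"
  proof -
    have "?sw (\<lambda>y1 y'. sH (ep x' * ep y') (S (x1 \<odot> y1))) y = sH (ep x') (S (x1 \<odot> y))" for x1 x'
      using sw_counit_right[OF HV, of "\<lambda>z. S (x1 \<odot> z)" y]
      by (simp only: H.scale_scale[symmetric] sw_scale[OF HV, symmetric] hlin_intros)
    then show ?thesis
      using sw_counit_right[OF HV, of "\<lambda>z. S (z \<odot> y)" x] by (simp add: hlin_intros)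
  qed
  also have "\<dots> = ?sw (\<lambda>x1 x'. ?sw (\<lambda>y1 y'. ?sw (\<lambda>x2 x3. ?sw (\<lambda>y2 y3.
      S (x1 \<odot> y1) \<odot> ((x2 \<odot> y2) \<odot> (S y3 \<odot> S x3))) y') x') y) x"
    by (simp only: sw_mul_right[symmetric] right) (simp add: mul_scale_right pr_simps)
  also have "\<dots> = ?sw (\<lambda>x' x3. ?sw (\<lambda>y' y3. ?sw (\<lambda>x1 x2. ?sw (\<lambda>y1 y2.
      S (x1 \<odot> y1) \<odot> ((x2 \<odot> y2) \<odot> (S y3 \<odot> S x3))) y') x') y) x"
    by (rule sw_coassoc_pair[OF HV])
  also have "\<dots> = ?sw (\<lambda>x' x3. ?sw (\<lambda>y' y3. sH (ep x' * ep y') (S y3 \<odot> S x3)) y) x"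
  proof -
    have "?sw (\<lambda>x1 x2. ?sw (\<lambda>y1 y2. S (x1 \<odot> y1) \<odot> ((x2 \<odot> y2) \<odot> (S y3 \<odot> S x3))) y') x' =
        ?sw (\<lambda>x1 x2. ?sw (\<lambda>y1 y2. S (x1 \<odot> y1) \<odot> (x2 \<odot> y2)) y') x' \<odot> (S y3 \<odot> S x3)" for x' y' x3 y3
      by (simp only: sw_mul_left mul_assoc)
    then show ?thesis by (simp only: left mul_scale_left pr_simps)
  qed
  also have "\<dots> = S y \<odot> S x"
  proof -
    have "?sw (\<lambda>y' y3. sH (ep x' * ep y') (S y3 \<odot> S x3)) y = sH (ep x') (S y \<odot> S x3)" for x' x3
      using sw_counit_left[OF HV, of "\<lambda>z. S z \<odot> S x3" y]
      by (simp only: H.scale_scale[symmetric] sw_scale[OF HV, symmetric] hlin_intros)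
    then show ?thesis
      using sw_counit_left[OF HV, of "\<lambda>z. S y \<odot> S z" x] by (simp add: hlin_intros)
  qed
  finally show ?thesis .
qed

text \<open>Dual to \<open>S_mul\<close>: the coproduct of \<open>S a\<close>, and the flipped
  coproduct of \<open>a\<close> with \<open>S\<close> on both legs, are a left and a right
  convolution inverse of the coproduct as a map from \<open>H\<close> to its tensor square. The
  bilinear form \<open>\<phi>\<close> tests the equality.\<close>

lemma sw_S:
  assumes s: "vector_space s" and \<phi>: "\<And>y. hlin s (\<lambda>x. \<phi> x y)" "\<And>x. hlin s (\<phi> x)"
  shows "sw s \<phi> (S a) = sw s (\<lambda>x y. \<phi> (S y) (S x)) a"
proof -
  interpret N: vector_space s by (rule s)
  let ?sw = "sw s"
  note l1 = hlin_comp[OF s \<phi>(1)] and l2 = hlin_comp[OF s \<phi>(2)]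
  note pr1 = hlin_pr_eq[OF \<phi>(1)] and pr2 = hlin_pr_eq[OF \<phi>(2)]
  \<comment> \<open>\<open>\<phi>\<close> on a product of three tensors: \<open>u, v\<close> will be
    the legs of \<open>S a1\<close>, \<open>p, q\<close> the next two legs of \<open>a\<close>, and
    \<open>S w\<close>, \<open>S z\<close> come from the last two legs in flipped order.\<close>
  define G where "G u v p q z w = \<phi> (u \<odot> p \<odot> S w) (v \<odot> q \<odot> S z)" for u v p q z w
  have G1: "?sw (\<lambda>a2 a''. ?sw (\<lambda>a3 ah. ?sw (\<lambda>a4 a5. G u v a2 a3 a4 a5) ah) a'') a' =
      s (ep a') (\<phi> u v)" for u v a'
  proof -
    have "?sw (\<lambda>a3 a4. G u v a2 a3 a4 a5) t = s (ep t) (\<phi> (u \<odot> a2 \<odot> S a5) v)" for a2 a5 t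
      using sw_antipode_right[OF s, of "\<lambda>z. \<phi> (u \<odot> a2 \<odot> S a5) (v \<odot> z)" t]
      by (simp add: G_def mul_assoc l2 hlin_intros pr_simps pr2)
    then have "?sw (\<lambda>a3 ah. ?sw (\<lambda>a4 a5. G u v a2 a3 a4 a5) ah) a'' = \<phi> (u \<odot> a2 \<odot> S a'') v" for a2 a''
      unfolding sw_coassoc[OF s, symmetric]
      using sw_counit_left[OF s, of "\<lambda>z. \<phi> (u \<odot> a2 \<odot> S z) v" a''] by (simp add: l1 hlin_intros)
    then show ?thesis
      using sw_antipode_right[OF s, of "\<lambda>z. \<phi> (u \<odot> z) v" a']
      by (simp add: mul_assoc l1 hlin_intros pr_simps pr1)
  qed
  have "?sw \<phi> (S a) = ?sw (\<lambda>a1 a'. s (ep a') (?sw \<phi> (S a1))) a"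
    by (rule sw_counit_right[OF s, symmetric]) (rule hlin_comp[OF s hlin_sw[OF s] hlin_S])
  also have "\<dots> = ?sw (\<lambda>a1 a'. ?sw (\<lambda>u v. ?sw (\<lambda>a2 a''. ?sw (\<lambda>a3 ah. ?sw (\<lambda>a4 a5.
      G u v a2 a3 a4 a5) ah) a'') a') (S a1)) a"
    by (simp only: G1 sw_scale[OF s])
  also have "\<dots> = ?sw (\<lambda>a1 a'. ?sw (\<lambda>a2 a''. ?sw (\<lambda>a3 ah. ?sw (\<lambda>u v. ?sw (\<lambda>a4 a5.
      G u v a2 a3 a4 a5) ah) (S a1)) a'') a') a"
    by (simp only: sw_swap[OF s, where a = "S a1" for a1])
  also have "\<dots> = ?sw (\<lambda>r ah. ?sw (\<lambda>a1 t. ?sw (\<lambda>a2 a3. ?sw (\<lambda>u v. ?sw (\<lambda>a4 a5.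
      G u v a2 a3 a4 a5) ah) (S a1)) t) r) a"
    by (simp only: sw_coassoc[OF s, symmetric])
  also have "\<dots> = ?sw (\<lambda>r ah. s (ep r) (?sw (\<lambda>a4 a5. \<phi> (S a5) (S a4)) ah)) a"
  proof (rule sw_cong)
    fix r ah
    \<comment> \<open>Absorbs the last convolution factor into a bilinear form.
      \<open>sw_mul\<close> then reads the first two factors as the coproduct of
      \<open>S a1 \<odot> t\<close>, which the antipode axiom evaluates.\<close>
    define K where "K x y = ?sw (\<lambda>a4 a5. \<phi> (x \<odot> S a5) (y \<odot> S a4)) ah" for x y
    have K: "hlin s (\<lambda>x. K x y)" "hlin s (K x)" for x y
      unfolding K_def by (intro hlin_swI[OF s] l1 l2 hlin_intros)+
    have "?sw (\<lambda>a1 t. ?sw (\<lambda>a2 a3. ?sw (\<lambda>u v. ?sw (\<lambda>a4 a5. G u v a2 a3 a4 a5) ah) (S a1)) t) r =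
        ?sw (\<lambda>a1 t. ?sw K (S a1 \<odot> t)) r"
      unfolding sw_mul[OF s K] unfolding K_def G_def by (rule sw_cong) (rule sw_swap[OF s])
    also have "\<dots> = s (ep r) (?sw K \<one>)"
      by (rule sw_antipode_left[OF s]) (rule hlin_sw[OF s])
    also have "?sw K \<one> = K \<one> \<one>" by (rule sw_one[OF s K])
    also have "K \<one> \<one> = ?sw (\<lambda>a4 a5. \<phi> (S a5) (S a4)) ah"
      by (simp add: K_def pr_simps)
    finally show "?sw (\<lambda>a1 t. ?sw (\<lambda>a2 a3. ?sw (\<lambda>u v. ?sw (\<lambda>a4 a5. G u v a2 a3 a4 a5) ah) (S a1)) t) r =
        s (ep r) (?sw (\<lambda>a4 a5. \<phi> (S a5) (S a4)) ah)" .
  qed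
  also have "\<dots> = ?sw (\<lambda>x y. \<phi> (S y) (S x)) a"
    by (rule sw_counit_left[OF s]) (rule hlin_sw[OF s])
  finally show ?thesis .
qed

lemma S_one: "S \<one> = \<one>"
proof -
  have "sw sH (\<lambda>x y. pr (S x \<odot> y)) \<one> = pr (S \<one> \<odot> \<one>)"
    by (rule sw_one[OF vector_space_H]) (simp_all add: pr_simps hlin_intros)
  then show ?thesis
    using sw_antipode_left[OF vector_space_H hlin_pr, of \<one>] by (simp add: pr_simps ep_one)
qed

lemma ep_S: "ep (S a) = ep a"
proof -
  note T = vector_space_times
  have "sw (*) (\<lambda>x y. ep (S x \<odot> y)) a = ep a"
    using sw_antipode_left[OF T hlin_ep, of a] by (simp add: ep_one)
  moreover have "sw (*) (\<lambda>x y. ep y * ep (S x)) a = ep (S a)"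
    by (rule sw_counit_right[OF T]) (rule hlin_comp[OF T hlin_ep hlin_S])
  ultimately show ?thesis by (simp add: ep_mul mult.commute)
qed

text \<open>
  The antipode is injective: by Fitting's lemma some even power \<open>g\<close> of \<open>S\<close> restricts to a bijection of its
  image, so there is a multiplicative map \<open>\<sigma>\<close> onto that image with \<open>g \<circ> \<sigma> = g\<close>. If
  \<open>S\<^sup>m\<^sup>+\<^sup>1 = S\<^sup>m\<^sup>+\<^sup>1 \<circ> \<sigma>\<close>, then \<open>S\<^sup>m\<close> and \<open>S\<^sup>m \<circ> \<sigma>\<close> have the same convolution inverse
  \<open>S\<^sup>m\<^sup>+\<^sup>1\<close>, hence agree; descending to \<open>m = 0\<close> shows that \<open>\<sigma>\<close> is the identity.
\<close>

lemma convolution_inverse_unique: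
  fixes star :: "'h \<Rightarrow> 'h \<Rightarrow> 'h"
  assumes star_assoc: "\<And>x y z. star (star x y) z = star x (star y z)"
    and star_left: "\<And>y. hlin sH (\<lambda>x. star x y)" and star_right: "\<And>x. hlin sH (star x)"
    and star_one: "\<And>x. star \<one> x = pr x" "\<And>x. star x \<one> = pr x"
    and P: "hlin sH P" "\<And>x. pr (P x) = P x" and P': "hlin sH P'" "\<And>x. pr (P' x) = P' x"
    and PN: "\<And>x. sw sH (\<lambda>a b. star (P a) (N b)) x = sH (ep x) \<one>"
    and NP': "\<And>x. sw sH (\<lambda>a b. star (N a) (P' b)) x = sH (ep x) \<one>"
  shows "P x = P' x"
proof -
  note HV = vector_space_H
  have R: "star y (sw sH \<phi> a) = sw sH (\<lambda>u v. star y (\<phi> u v)) a" for y \<phi> a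
    by (rule sw_map[OF HV hlin_add[OF HV star_right] hlin_scale[OF HV star_right] hlin_zero[OF HV star_right]])
  have L: "star (sw sH \<phi> a) y = sw sH (\<lambda>u v. star (\<phi> u v) y) a" for y \<phi> a
    by (rule sw_map[OF HV hlin_add[OF HV star_left] hlin_scale[OF HV star_left] hlin_zero[OF HV star_left]])
  have "P x = sw sH (\<lambda>a t. sH (ep t) (P a)) x"
    by (rule sw_counit_right[OF HV P(1), symmetric])
  also have "\<dots> = sw sH (\<lambda>a t. star (P a) (sw sH (\<lambda>b c. star (N b) (P' c)) t)) x"
    by (simp only: NP' hlin_scale[OF HV star_right] star_one P)
  also have "\<dots> = sw sH (\<lambda>t c. star (sw sH (\<lambda>a b. star (P a) (N b)) t) (P' c)) x"
    by (simp only: R L star_assoc sw_coassoc[OF HV, symmetric])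
  also have "\<dots> = sw sH (\<lambda>t c. sH (ep t) (P' c)) x"
    by (simp only: PN hlin_scale[OF HV star_left] star_one P')
  also have "\<dots> = P' x"
    by (rule sw_counit_left[OF HV P'(1)])
  finally show ?thesis .
qed

lemma Spow_add: "(S ^^ n) (x + y) = (S ^^ n) x + (S ^^ n) y"
  and Spow_scale: "(S ^^ n) (sH k x) = sH k ((S ^^ n) x)"
  by (induction n) (simp_all add: hlin_add[OF vector_space_H hlin_S] hlin_scale[OF vector_space_H hlin_S])

lemma Spow_one: "(S ^^ n) \<one> = \<one>"
  by (induction n) (simp_all add: S_one)

lemma Spow_mul: "(S ^^ n) (x \<odot> y) = (if even n then (S ^^ n) x \<odot> (S ^^ n) y else (S ^^ n) y \<odot> (S ^^ n) x)"
  by (induction n) (simp_all add: S_mul)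

lemma pr_Spow: "pr x = x \<Longrightarrow> pr ((S ^^ n) x) = (S ^^ n) x"
  by (induction n) (simp_all add: pr_S)

lemma hlin_Spow_comp: "hlin sH f \<Longrightarrow> hlin sH (\<lambda>x. (S ^^ n) (f x))"
  by (induction n) (simp_all add: hlin_S_comp)

lemma antipode_bijective_of_fitting:
  assumes k: "even k" "k \<ge> 1"
    and inj: "\<And>x. (S ^^ k) ((S ^^ k) x) = 0 \<Longrightarrow> (S ^^ k) x = 0"
    and surj: "\<And>x. \<exists>y. (S ^^ k) x = (S ^^ k) ((S ^^ k) y)"
  shows "S x = 0 \<Longrightarrow> pr x = 0" and "pr x \<in> range S"
proof -
  define g where "g = S ^^ k"
  define \<sigma> where "\<sigma> x = g (SOME y. g x = g (g y))" for x
  have g_add: "g (x + y) = g x + g y" and g_scale: "g (sH c x) = sH c (g x)"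
    and g_mul: "g (x \<odot> y) = g x \<odot> g y" and g_one: "g \<one> = \<one>" and g_S: "g (S x) = S (g x)" for x y c
    using k by (simp_all add: g_def Spow_add Spow_scale Spow_mul Spow_one funpow_swap1)
  have g_diff: "g (x - y) = g x - g y" for x y
    using g_add[of "x - y" y] by (simp add: algebra_simps)
  have g_pr: "pr (g x) = g x" for x
    using k unfolding g_def by (cases k) (simp_all add: pr_S)
  have g_of_pr: "g (pr x) = g x" for x
    using k unfolding g_def by (cases k) (simp_all add: S_of_pr funpow_swap1)
  have \<sigma>: "g (\<sigma> x) = g x" "\<sigma> x \<in> range g" for x
    using someI_ex[OF surj[of x, folded g_def]] by (simp_all add: \<sigma>_def)
  \<comment> \<open>The uniqueness behind all algebraic properties of \<open>\<sigma>\<close>: an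
    element of the image of \<open>g\<close> is determined by its value under \<open>g\<close>, so
    each law for \<open>\<sigma>\<close> is checked after applying \<open>g\<close>.\<close>
  have \<sigma>_eq: "\<sigma> x = y" if y: "y \<in> range g" "g y = g x" for x y
  proof -
    obtain u where "\<sigma> x = g u" using \<sigma>(2)[of x] by blast
    moreover obtain v where "y = g v" using y(1) by blast
    moreover have "g (\<sigma> x - y) = 0" using y by (simp add: g_diff \<sigma>)
    ultimately have "g (g (u - v)) = 0" by (simp add: g_diff)
    then have "g (u - v) = 0" using inj[folded g_def] by blast
    then show ?thesis using \<open>\<sigma> x = g u\<close> \<open>y = g v\<close> by (simp add: g_diff)
  qed
  have \<sigma>_add: "\<sigma> (x + y) = \<sigma> x + \<sigma> y" for x y
  proof (rule \<sigma>_eq)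
    show "\<sigma> x + \<sigma> y \<in> range g" using \<sigma>(2)[of x] \<sigma>(2)[of y] by (auto simp: g_add[symmetric])
  qed (simp add: g_add \<sigma>)
  have \<sigma>_scale: "\<sigma> (sH c x) = sH c (\<sigma> x)" for c x
  proof (rule \<sigma>_eq)
    show "sH c (\<sigma> x) \<in> range g" using \<sigma>(2)[of x] by (auto simp: g_scale[symmetric])
  qed (simp add: g_scale \<sigma>)
  have \<sigma>_mul: "\<sigma> (x \<odot> y) = \<sigma> x \<odot> \<sigma> y" for x y
  proof (rule \<sigma>_eq)
    show "\<sigma> x \<odot> \<sigma> y \<in> range g" using \<sigma>(2)[of x] \<sigma>(2)[of y] by (auto simp: g_mul[symmetric])
  qed (simp add: g_mul \<sigma>)
  have \<sigma>_one: "\<sigma> \<one> = \<one>"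
  proof (rule \<sigma>_eq)
    show "\<one> \<in> range g" by (metis g_one rangeI)
  qed simp
  have \<sigma>_S: "\<sigma> (S x) = S (\<sigma> x)" for x
  proof (rule \<sigma>_eq)
    show "S (\<sigma> x) \<in> range g" using \<sigma>(2)[of x] by (auto simp: g_S[symmetric])
  qed (simp add: g_S \<sigma>)
  have \<sigma>_pr: "pr (\<sigma> x) = \<sigma> x" for x using \<sigma>(2)[of x] g_pr by auto
  have \<sigma>_of_pr: "\<sigma> (pr x) = \<sigma> x" for x
    by (rule \<sigma>_eq) (simp_all add: \<sigma> g_of_pr)
  have "\<sigma> 0 = 0" using \<sigma>_scale[of 0 0] by simp
  from hlin_post[OF vector_space_H hlin_pr \<sigma>_add \<sigma>_scale this]
  have \<sigma>_lin: "hlin sH \<sigma>" by (simp only: \<sigma>_of_pr)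
  have descend: "(S ^^ m) (pr x) = (S ^^ m) (\<sigma> x)"
    if IH: "\<And>x. (S ^^ Suc m) (pr x) = (S ^^ Suc m) (\<sigma> x)" for m x
  proof -
    let ?P = "\<lambda>x. (S ^^ m) (pr x)" and ?P' = "\<lambda>x. (S ^^ m) (\<sigma> x)" and ?N = "\<lambda>x. (S ^^ Suc m) x"
    have NP: "?N x = ?P (S x)" and NP': "?N x = ?P' (S x)" for x
      using IH[of x] by (simp_all add: pr_S \<sigma>_S funpow_swap1 S_of_pr)
    have P: "hlin sH ?P" "hlin sH ?P'" "pr (?P x) = ?P x" "pr (?P' x) = ?P' x" for x
      by (simp_all add: hlin_Spow_comp hlin_pr \<sigma>_lin pr_Spow pr_pr \<sigma>_pr)
    have eps: "sw sH (\<lambda>a b. f (a \<odot> S b)) x = sH (ep x) \<one>" "sw sH (\<lambda>a b. f (S a \<odot> b)) x = sH (ep x) \<one>"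
      if "f = ?P \<or> f = ?P'" for f x
      using that P sw_antipode_right[OF vector_space_H, of f x] sw_antipode_left[OF vector_space_H, of f x]
      by (auto simp: pr_one Spow_one \<sigma>_one)
    show ?thesis
    proof (cases "even m")
      case True
      show ?thesis
      proof (rule convolution_inverse_unique[where star = "(\<odot>)" and P = ?P and N = ?N and P' = ?P'])
        show "sw sH (\<lambda>a b. ?P a \<odot> ?N b) x = sH (ep x) \<one>" for x
          using eps(1)[of ?P x] True unfolding NP by (simp add: pr_mul Spow_mul pr_S pr_basis cong: sw_cong)
        show "sw sH (\<lambda>a b. ?N a \<odot> ?P' b) x = sH (ep x) \<one>" for x
          using eps(2)[of ?P' x] True unfolding NP' by (simp add: \<sigma>_mul Spow_mul)
      qed (use P in \<open>simp_all add: pr_simps mul_assoc hlin_intros\<close>)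
    next
      \<comment> \<open>For odd \<open>m\<close> the map \<open>S ^^ m\<close> reverses products, so
        the same argument runs in the opposite algebra. This is why the product \<open>star\<close>
        is a parameter of \<open>convolution_inverse_unique\<close>.\<close>
      case False
      show ?thesis
      proof (rule sym, rule convolution_inverse_unique[where star = "\<lambda>x y. y \<odot> x" and P = ?P' and N = ?N and P' = ?P])
        show "sw sH (\<lambda>a b. ?N b \<odot> ?P' a) x = sH (ep x) \<one>" for x
          using eps(1)[of ?P' x] False unfolding NP' by (simp add: \<sigma>_mul Spow_mul)
        show "sw sH (\<lambda>a b. ?P b \<odot> ?N a) x = sH (ep x) \<one>" for x
          using eps(2)[of ?P x] False unfolding NP by (simp add: pr_mul Spow_mul pr_S pr_basis cong: sw_cong)
      qed (use P in \<open>simp_all add: pr_simps mul_assoc hlin_intros\<close>)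
    qed
  qed
  have "\<forall>x. (S ^^ m) (pr x) = (S ^^ m) (\<sigma> x)" if "m \<le> k" for m
    using that
  proof (induction m rule: inc_induct)
    case base
    show ?case using \<sigma>(1) g_of_pr by (simp add: g_def)
  next
    case (step m)
    then show ?case using descend by blast
  qed
  from this[of 0] have pr_eq: "pr x = \<sigma> x" by simp
  have "range g \<subseteq> range S"
    using k unfolding g_def by (cases k) auto
  then show "pr x \<in> range S" using \<sigma>(2)[of x] pr_eq by auto
  assume "S x = 0"
  have "\<sigma> x = 0"
  proof (rule \<sigma>_eq)
    have g0: "g 0 = 0" using g_scale[of 0 0] by simp
    then show "0 \<in> range g" by (metis rangeI)
    obtain j where j: "k = Suc j" using k by (cases k) auto
    have "g x = (S ^^ j) (S x)" by (simp add: g_def j funpow_swap1)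
    also have "\<dots> = 0" using \<open>S x = 0\<close> Spow_scale[of j 0 0] by simp
    finally show "g 0 = g x" using g0 by simp
  qed
  then show "pr x = 0" using pr_eq by simp
qed

lemma antipode_bijective: "S x = 0 \<Longrightarrow> pr x = 0" "pr x \<in> range S"
proof -
  have lin: "Vector_Spaces.linear sH sH S"
    by unfold_locales (simp_all add: hlin_add[OF vector_space_H hlin_S] hlin_scale[OF vector_space_H hlin_S])
  have "S y \<in> H.span B" for y
    using pr_S[of y] unfolding pr_def by (metis (no_types, lifting) H.span_base H.span_scale H.span_sum)
  then have rng: "range S \<subseteq> H.span B" by auto
  obtain k where "even k" "k \<ge> 1"
    and "\<And>x. (S ^^ k) ((S ^^ k) x) = 0 \<Longrightarrow> (S ^^ k) x = 0"
    and "\<And>x. \<exists>y. (S ^^ k) x = (S ^^ k) ((S ^^ k) y)"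
    using H.fitting_even[OF lin finite_B rng] by blast
  from antipode_bijective_of_fitting[OF this] show "S x = 0 \<Longrightarrow> pr x = 0" "pr x \<in> range S"
    by blast+
qed

end

section \<open>Half-edge operators\<close>

text \<open>
  \<open>L h a\<close> and \<open>t k b\<close> stand for \<open>L\<^sub>h(a)\<close> and \<open>T\<^sub>k(b\<^sup>*)\<close>, extended to the whole type;
  \<open>NC\<close> is the carrier. The relations \<open>t_L_same\<close> and \<open>t_L_opposite\<close> are
  \<open>T\<^sub>h(\<alpha>) L\<^sub>h(a) = L\<^sub>h(a\<^sub>1) T\<^sub>h(\<alpha>(- S(a\<^sub>2)))\<close> and
  \<open>T\<^bsub>\<iota>h\<^esub>(\<alpha>) L\<^sub>h(a) = L\<^sub>h(a\<^sub>2) T\<^bsub>\<iota>h\<^esub>(\<alpha>(a\<^sub>1 -))\<close>.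
\<close>

locale half_edge_ops = fd_hopf sH B e mul one dl ep S + N: vector_space s
  for sH :: "'k::field \<Rightarrow> 'h::ab_group_add \<Rightarrow> 'h" and B :: "'h set" and e :: "'h \<Rightarrow> 'h \<Rightarrow> 'k"
    and mul :: "'h \<Rightarrow> 'h \<Rightarrow> 'h" (infixl "\<odot>" 70) and one :: 'h ("\<one>")
    and dl :: "'h \<Rightarrow> 'h \<Rightarrow> 'h \<Rightarrow> 'k" and ep :: "'h \<Rightarrow> 'k" and S :: "'h \<Rightarrow> 'h"
    and s :: "'k \<Rightarrow> 'n::ab_group_add \<Rightarrow> 'n" +
  fixes NC :: "'n set" and E :: "'d set" and inv_edge :: "'d \<Rightarrow> 'd" ("\<iota>")
    and L :: "'d \<Rightarrow> 'h \<Rightarrow> 'n \<Rightarrow> 'n" and t :: "'d \<Rightarrow> 'h \<Rightarrow> 'n \<Rightarrow> 'n"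
  assumes finite_E: "finite E"
    and iota_E: "h \<in> E \<Longrightarrow> \<iota> h \<in> E" and iota_neq: "h \<in> E \<Longrightarrow> \<iota> h \<noteq> h"
    and iota_iota: "h \<in> E \<Longrightarrow> \<iota> (\<iota> h) = h"
    and NC_subspace: "module.subspace s NC"
    and L_add: "L h a (m + n) = L h a m + L h a n" and L_scale: "L h a (s k m) = s k (L h a m)"
    and L_lin_raw: "L h a m = (\<Sum>b\<in>B. s (e b a) (L h b m))"
    and L_closed: "L h a m \<in> NC"
    and t_add: "t h b (m + n) = t h b m + t h b n" and t_scale: "t h b (s k m) = s k (t h b m)"
    and t_closed: "t h b m \<in> NC"
    and L_commute: "h \<noteq> h' \<Longrightarrow> L h a (L h' b m) = L h' b (L h a m)"
    and t_commute: "h \<noteq> h' \<Longrightarrow> t h b (t h' c m) = t h' c (t h b m)"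
    and L_mul: "L h (a \<odot> b) m = L h a (L h b m)"
    and L_one: "\<lbrakk>h \<in> E; m \<in> NC\<rbrakk> \<Longrightarrow> L h \<one> m = m"
    and t_mul: "\<lbrakk>b \<in> B; c \<in> B\<rbrakk> \<Longrightarrow> t h c (t h b m) = (\<Sum>d\<in>B. s (dl b c d) (t h d m))"
    and t_counit: "\<lbrakk>h \<in> E; m \<in> NC\<rbrakk> \<Longrightarrow> (\<Sum>b\<in>B. s (ep b) (t h b m)) = m"
    and t_L_other: "\<lbrakk>h' \<noteq> h; h' \<noteq> \<iota> h\<rbrakk> \<Longrightarrow> t h' b (L h a m) = L h a (t h' b m)"
    and t_L_same: "b \<in> B \<Longrightarrow> t h b (L h a m) =
        (\<Sum>c\<in>B. \<Sum>x\<in>B. \<Sum>y\<in>B. s (dl x y a * e b (c \<odot> S y)) (L h x (t h c m)))"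
    and t_L_opposite: "b \<in> B \<Longrightarrow> t (\<iota> h) b (L h a m) =
        (\<Sum>c\<in>B. \<Sum>x\<in>B. \<Sum>y\<in>B. s (dl x y a * e b (x \<odot> c)) (L h y (t (\<iota> h) c m)))"
begin

lemma linear_op_zero_sum:
  assumes "\<And>m n. f (m + n) = f m + f n" "\<And>k m. f (s k m) = s k (f m :: 'n)"
  shows "f 0 = 0" "f (sum g I) = (\<Sum>i\<in>I. f (g i))"
proof -
  show 0: "f 0 = 0" using assms(2)[of 0 0] by simp
  show "f (sum g I) = (\<Sum>i\<in>I. f (g i))"
    by (induction I rule: infinite_finite_induct) (simp_all add: 0 assms)
qed

lemmas L_zero = linear_op_zero_sum(1)[of "L h a" for h a, OF L_add L_scale]
  and L_sum = linear_op_zero_sum(2)[of "L h a" for h a, OF L_add L_scale]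
  and t_sum = linear_op_zero_sum(2)[of "t h b" for h b, OF t_add t_scale]

section \<open>Operators of a vertex and of a face along a list of half-edges\<close>

abbreviation Sw :: "('h \<Rightarrow> 'h \<Rightarrow> 'n) \<Rightarrow> 'h \<Rightarrow> 'n" where "Sw \<equiv> sw s"

lemma hlin_L: "hlin s (\<lambda>a. L h a m)"
  unfolding hlin_def using L_lin_raw by blast

lemma NC_scale: "m \<in> NC \<Longrightarrow> s k m \<in> NC" and NC_sum: "(\<And>i. i \<in> I \<Longrightarrow> f i \<in> NC) \<Longrightarrow> sum f I \<in> NC"
  using NC_subspace N.subspace_scale N.subspace_sum by blast+

lemma Sw_closed: "(\<And>x y. \<phi> x y \<in> NC) \<Longrightarrow> Sw \<phi> a \<in> NC"
  unfolding sw_def by (intro NC_sum NC_scale)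

text \<open>The coordinate form of \<open>L_list\<close>; the two agree on carriers by
  \<open>L_list_eq\<close>.\<close>

primrec Lseq :: "'d list \<Rightarrow> 'h \<Rightarrow> 'n \<Rightarrow> 'n" where
  "Lseq [] = (\<lambda>a m. s (ep a) m)"
| "Lseq (h # hs) = (\<lambda>a m. Sw (\<lambda>x y. Lseq hs y (L h x m)) a)"

lemma Sw_add: "Sw (\<lambda>x y. \<phi> x y + \<psi> x y) a = Sw \<phi> a + Sw \<psi> a"
  by (simp add: sw_def N.scale_right_distrib sum.distrib)

lemma Lseq_add: "Lseq hs a (m + n) = Lseq hs a m + Lseq hs a n"
  by (induction hs arbitrary: a m n) (simp_all add: N.scale_right_distrib L_add Sw_add)

lemma Lseq_scale: "Lseq hs a (s k m) = s k (Lseq hs a m)"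
  by (induction hs arbitrary: a m) (simp_all add: mult.commute L_scale sw_scale[OF N.vector_space_axioms])

lemmas Lseq_zero = linear_op_zero_sum(1)[of "Lseq hs a" for hs a, OF Lseq_add Lseq_scale]

lemma hlin_Lseq: "hlin s (\<lambda>a. Lseq hs a m)"
  by (cases hs) (simp_all add: hlin_sw[OF N.vector_space_axioms] hlin_scalarI[OF N.vector_space_axioms hlin_ep])

lemma Lseq_closed: "m \<in> NC \<Longrightarrow> Lseq hs a m \<in> NC"
  by (induction hs arbitrary: a m) (simp_all add: NC_scale L_closed Sw_closed)

lemma Lseq_commute:
  assumes f: "\<And>m n. f (m + n) = f m + f n" "\<And>k m. f (s k m) = s k (f m)"
    and "\<And>h x m. h \<in> set hs \<Longrightarrow> f (L h x m) = L h x (f m)"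
  shows "f (Lseq hs a m) = Lseq hs a (f m)"
  using assms(3)
proof (induction hs arbitrary: a m)
  case (Cons h hs)
  have "f (Lseq (h # hs) a m) = Sw (\<lambda>x y. f (Lseq hs y (L h x m))) a"
    unfolding Lseq.simps
    by (rule sw_map[OF N.vector_space_axioms f linear_op_zero_sum(1)[of f, OF f]])
  then show ?case using Cons by simp
qed (simp add: f)

lemma Lseq_Sw: "Lseq hs a (Sw \<phi> b) = Sw (\<lambda>x y. Lseq hs a (\<phi> x y)) b"
  by (rule sw_map[OF N.vector_space_axioms Lseq_add Lseq_scale Lseq_zero])

lemma L_Sw: "L h a (Sw \<phi> b) = Sw (\<lambda>x y. L h a (\<phi> x y)) b"
  by (rule sw_map[OF N.vector_space_axioms L_add L_scale L_zero])

lemma Lseq_commute_Lseq: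
  assumes "set hs \<inter> set hs' = {}"
  shows "Lseq hs a (Lseq hs' b m) = Lseq hs' b (Lseq hs a m)"
proof (rule Lseq_commute[OF Lseq_add Lseq_scale])
  fix h x m assume "h \<in> set hs'"
  then show "Lseq hs a (L h x m) = L h x (Lseq hs a m)"
    using assms by (intro Lseq_commute[symmetric] L_add L_scale L_commute) auto
qed

text \<open>Comultiplicativity interleaves the operators of \<open>a\<close> and \<open>b\<close>
  half-edge by half-edge. As the half-edges in \<open>hs\<close> are distinct, \<open>L h p\<close>
  commutes with the operators of the tail, and the two composites can be separated.\<close>

lemma Lseq_mul: "distinct hs \<Longrightarrow> Lseq hs (a \<odot> b) m = Lseq hs a (Lseq hs b m)"
proof (induction hs arbitrary: a b m)
  case Nil
  then show ?case by (simp add: ep_mul)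
next
  case (Cons h hs)
  have com: "L h p (Lseq hs u n) = Lseq hs u (L h p n)" for p u n
    by (rule Lseq_commute[OF L_add L_scale]) (use Cons.prems in \<open>auto intro: L_commute\<close>)
  have "Lseq (h # hs) (a \<odot> b) m =
      Sw (\<lambda>p q. Sw (\<lambda>r u. Lseq hs (q \<odot> u) (L h (p \<odot> r) m)) b) a"
    unfolding Lseq.simps
  proof (rule sw_mul[OF N.vector_space_axioms])
    fix y show "hlin s (\<lambda>x. Lseq hs y (L h x m))"
      by (rule hlin_post[OF N.vector_space_axioms hlin_L Lseq_add Lseq_scale Lseq_zero])
  qed (rule hlin_Lseq)
  also have "\<dots> = Sw (\<lambda>p q. Sw (\<lambda>r u. Lseq hs q (L h p (Lseq hs u (L h r m)))) b) a"
    using Cons by (simp add: L_mul com)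
  also have "\<dots> = Lseq (h # hs) a (Lseq (h # hs) b m)"
    by (simp add: L_Sw Lseq_Sw)
  finally show ?case .
qed

lemma Lseq_one: "set hs \<subseteq> E \<Longrightarrow> m \<in> NC \<Longrightarrow> Lseq hs \<one> m = m"
proof (induction hs arbitrary: m)
  case (Cons h hs)
  have "Lseq (h # hs) \<one> m = Lseq hs \<one> (L h \<one> m)"
    unfolding Lseq.simps
  proof (rule sw_one[OF N.vector_space_axioms])
    fix y show "hlin s (\<lambda>x. Lseq hs y (L h x m))"
      by (rule hlin_post[OF N.vector_space_axioms hlin_L Lseq_add Lseq_scale Lseq_zero])
  qed (rule hlin_Lseq)
  then show ?case using Cons by (simp add: L_one)
qed (simp add: ep_one)

text \<open>The coordinate form of \<open>T_list\<close>. In dual bases the coproduct of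
  \<open>\<alpha>\<close> is the sum over \<open>b\<close> of the function
  \<open>\<alpha> (y \<odot> b)\<close> of \<open>y\<close>, tensored with the coordinate functional
  of \<open>b\<close>; the latter acts at the head of the list.\<close>

primrec Tseq :: "'d list \<Rightarrow> ('h \<Rightarrow> 'k) \<Rightarrow> 'n \<Rightarrow> 'n" where
  "Tseq [] = (\<lambda>\<alpha> m. s (\<alpha> \<one>) m)"
| "Tseq (k # ks) = (\<lambda>\<alpha> m. \<Sum>b\<in>B. Tseq ks (\<lambda>y. \<alpha> (y \<odot> b)) (t k b m))"

lemma Tseq_add: "Tseq ks \<alpha> (m + n) = Tseq ks \<alpha> m + Tseq ks \<alpha> n"
  by (induction ks arbitrary: \<alpha> m n) (simp_all add: N.scale_right_distrib t_add sum.distrib)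

lemma Tseq_scale: "Tseq ks \<alpha> (s k m) = s k (Tseq ks \<alpha> m)"
  by (induction ks arbitrary: \<alpha> m) (simp_all add: mult.commute t_scale N.scale_sum_right)

lemmas Tseq_sum = linear_op_zero_sum(2)[of "Tseq ks a" for ks a, OF Tseq_add Tseq_scale]

lemma Tseq_closed: "m \<in> NC \<Longrightarrow> Tseq ks \<alpha> m \<in> NC"
  by (induction ks arbitrary: \<alpha> m) (simp_all add: NC_scale t_closed NC_sum)

lemma Tseq_lin: "Tseq ks (\<lambda>y. \<Sum>i\<in>I. c i * \<alpha> i y) m = (\<Sum>i\<in>I. s (c i) (Tseq ks (\<alpha> i) m))"
proof (induction ks arbitrary: \<alpha> m)
  case Nil
  then show ?case by (simp add: N.scale_sum_left)
next
  case (Cons k ks)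
  then show ?case by (simp add: N.scale_sum_right) (rule sum.swap)
qed

lemma Tseq_expand: "hlin (*) \<alpha> \<Longrightarrow> (\<Sum>b\<in>B. s (\<alpha> b) (Tseq ks (e b) m)) = Tseq ks \<alpha> m"
proof -
  assume \<alpha>: "hlin (*) \<alpha>"
  have "(\<lambda>y. \<Sum>b\<in>B. \<alpha> b * e b y) = \<alpha>"
    using hlin_expand[OF vector_space_times \<alpha>] by (simp add: mult.commute)
  then show ?thesis using Tseq_lin[where I = B and c = \<alpha> and \<alpha> = e] by simp
qed

lemma Tseq_commute:
  assumes f: "\<And>m n. f (m + n) = f m + f n" "\<And>k m. f (s k m) = s k (f m)"
    and "\<And>k b m. k \<in> set ks \<Longrightarrow> f (t k b m) = t k b (f m)"
  shows "f (Tseq ks \<alpha> m) = Tseq ks \<alpha> (f m)"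
  using assms(3)
proof (induction ks arbitrary: \<alpha> m)
  case (Cons k ks)
  then show ?case by (simp add: linear_op_zero_sum(2)[of f, OF f])
qed (simp add: f)

lemma Tseq_commute_Tseq:
  assumes "set ks \<inter> set ks' = {}"
  shows "Tseq ks \<alpha> (Tseq ks' \<beta> m) = Tseq ks' \<beta> (Tseq ks \<alpha> m)"
proof (rule Tseq_commute[OF Tseq_add Tseq_scale])
  fix k b m assume "k \<in> set ks'"
  then show "Tseq ks \<alpha> (t k b m) = t k b (Tseq ks \<alpha> m)"
    using assms by (intro Tseq_commute[symmetric] t_add t_scale t_commute) auto
qed

lemma Tseq_ep: "set ks \<subseteq> E \<Longrightarrow> m \<in> NC \<Longrightarrow> Tseq ks ep m = m"
proof (induction ks arbitrary: m)
  case (Cons k ks)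
  have "Tseq ks (\<lambda>y. ep (y \<odot> b)) n = s (ep b) (Tseq ks ep n)" for b n
    using Tseq_lin[where I = "{()}" and c = "\<lambda>_. ep b" and \<alpha> = "\<lambda>_. ep"] by (simp add: ep_mul mult.commute)
  then have "Tseq (k # ks) ep m = Tseq ks ep (\<Sum>b\<in>B. s (ep b) (t k b m))"
    by (simp add: Tseq_sum Tseq_scale)
  then show ?case using Cons by (simp add: t_counit)
qed (simp add: ep_one)

text \<open>The product of the dual Hopf algebra.\<close>

definition conv :: "('h \<Rightarrow> 'k) \<Rightarrow> ('h \<Rightarrow> 'k) \<Rightarrow> 'h \<Rightarrow> 'k" where
  "conv \<alpha> \<beta> = sw (*) (\<lambda>u v. \<alpha> u * \<beta> v)"

lemma hlin_mult_const: "hlin (*) \<alpha> \<Longrightarrow> hlin (*) (\<lambda>x. \<alpha> x * c)"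
  by (rule hlin_scalarI[OF vector_space_times])

lemma hlin_const_mult: "hlin (*) \<alpha> \<Longrightarrow> hlin (*) (\<lambda>x. c * \<alpha> x)"
  by (rule hlin_scaleI[OF vector_space_times])

text \<open>Dual to \<open>Lseq_mul\<close>: a single half-edge contributes \<open>t_mul\<close>,
  the coassociativity of its coaction, and \<open>conv \<alpha> \<beta>\<close> splits at
  \<open>y \<odot> d\<close> by comultiplicativity. The form that acts first is the left factor of
  \<open>conv\<close>, as for every left coaction.\<close>

lemma Tseq_conv:
  assumes "distinct ks" "hlin (*) \<alpha>" "hlin (*) \<beta>"
  shows "Tseq ks \<beta> (Tseq ks \<alpha> m) = Tseq ks (conv \<alpha> \<beta>) m"
  using assms
proof (induction ks arbitrary: \<alpha> \<beta> m)
  case Nil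
  have "conv \<alpha> \<beta> \<one> = \<alpha> \<one> * \<beta> \<one>"
    unfolding conv_def using Nil
    by (intro sw_one[OF vector_space_times]) (simp_all add: hlin_mult_const hlin_const_mult)
  then show ?case by (simp add: mult.commute)
next
  case (Cons k ks)
  have com: "t k c (Tseq ks \<gamma> n) = Tseq ks \<gamma> (t k c n)" for c \<gamma> n
    by (rule Tseq_commute[OF t_add t_scale]) (use Cons.prems in \<open>auto intro: t_commute\<close>)
  have comp: "hlin (*) (\<lambda>y. \<gamma> (y \<odot> b))" if "hlin (*) \<gamma>" for \<gamma> b
    by (rule hlin_comp[OF vector_space_times that hlin_mul_left])
  have conv: "conv \<alpha> \<beta> (y \<odot> d) =
      (\<Sum>(b, c)\<in>B \<times> B. dl b c d * conv (\<lambda>y. \<alpha> (y \<odot> b)) (\<lambda>y. \<beta> (y \<odot> c)) y)" for y d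
  proof -
    have "conv \<alpha> \<beta> (y \<odot> d) = sw (*) (\<lambda>p q. sw (*) (\<lambda>r u. \<alpha> (p \<odot> r) * \<beta> (q \<odot> u)) d) y"
      unfolding conv_def using Cons.prems
      by (intro sw_mul[OF vector_space_times]) (simp_all add: hlin_mult_const hlin_const_mult)
    also have "\<dots> = sw (*) (\<lambda>r u. sw (*) (\<lambda>p q. \<alpha> (p \<odot> r) * \<beta> (q \<odot> u)) y) d"
      by (rule sw_swap[OF vector_space_times])
    finally show ?thesis
      unfolding sw_def[of "(*)" _ d] by (simp add: conv_def sum.cartesian_product)
  qed
  have "Tseq (k # ks) \<beta> (Tseq (k # ks) \<alpha> m) =
      (\<Sum>c\<in>B. \<Sum>b\<in>B. Tseq ks (\<lambda>y. \<beta> (y \<odot> c)) (Tseq ks (\<lambda>y. \<alpha> (y \<odot> b)) (t k c (t k b m))))"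
    by (simp add: t_sum Tseq_sum com)
  also have "\<dots> = (\<Sum>c\<in>B. \<Sum>b\<in>B. \<Sum>d\<in>B. s (dl b c d)
      (Tseq ks (conv (\<lambda>y. \<alpha> (y \<odot> b)) (\<lambda>y. \<beta> (y \<odot> c))) (t k d m)))"
    using Cons by (simp add: comp t_mul Tseq_sum Tseq_scale)
  also have "\<dots> = (\<Sum>d\<in>B. \<Sum>(b, c)\<in>B \<times> B. s (dl b c d)
      (Tseq ks (conv (\<lambda>y. \<alpha> (y \<odot> b)) (\<lambda>y. \<beta> (y \<odot> c))) (t k d m)))"
    unfolding sum.cartesian_product
    by (rule sum.reindex_bij_witness[of _ "\<lambda>(d, b, c). (c, b, d)" "\<lambda>(c, b, d). (d, b, c)"]) auto
  also have "\<dots> = Tseq (k # ks) (conv \<alpha> \<beta>) m"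
    unfolding Tseq.simps conv case_prod_unfold by (simp only: Tseq_lin)
  finally show ?case .
qed

text \<open>
  \<open>CS ks \<Phi>\<close> is the joint coaction of the half-edges in \<open>ks\<close>, contracted with a form \<open>\<Phi>\<close> that is
  multilinear in their \<open>H\<close>-components. Moving \<open>L\<^sub>h(a)\<close> past it changes only the components at
  \<open>h\<close> and \<open>\<iota> h\<close>.
\<close>

primrec CS :: "'d list \<Rightarrow> (('d \<Rightarrow> 'h) \<Rightarrow> 'k) \<Rightarrow> 'n \<Rightarrow> 'n" where
  "CS [] = (\<lambda>\<Phi> m. s (\<Phi> (\<lambda>_. \<one>)) m)"
| "CS (k # ks) = (\<lambda>\<Phi> m. \<Sum>b\<in>B. CS ks (\<lambda>\<beta>. \<Phi> (\<beta>(k := b))) (t k b m))"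

definition multi :: "'d set \<Rightarrow> (('d \<Rightarrow> 'h) \<Rightarrow> 'k) \<Rightarrow> bool" where
  "multi K \<Phi> \<longleftrightarrow> (\<forall>k\<in>K. \<forall>\<beta>. hlin (*) (\<lambda>z. \<Phi> (\<beta>(k := z))))"

section \<open>Moving a half-edge operator past the joint coaction\<close>

lemma CS_add: "CS ks \<Phi> (m + n) = CS ks \<Phi> m + CS ks \<Phi> n"
  by (induction ks arbitrary: \<Phi> m n) (simp_all add: N.scale_right_distrib t_add sum.distrib)

lemma CS_scale: "CS ks \<Phi> (s k m) = s k (CS ks \<Phi> m)"
  by (induction ks arbitrary: \<Phi> m) (simp_all add: mult.commute t_scale N.scale_sum_right)

lemmas CS_zero = linear_op_zero_sum(1)[of "CS ks \<Phi>" for ks \<Phi>, OF CS_add CS_scale]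
  and CS_sum = linear_op_zero_sum(2)[of "CS ks \<Phi>" for ks \<Phi>, OF CS_add CS_scale]

lemma CS_lin: "CS ks (\<lambda>\<beta>. \<Sum>i\<in>I. c i * \<Phi> i \<beta>) m = (\<Sum>i\<in>I. s (c i) (CS ks (\<Phi> i) m))"
proof (induction ks arbitrary: \<Phi> m)
  case Nil
  then show ?case by (simp add: N.scale_sum_left)
next
  case (Cons k ks)
  then show ?case by (simp add: N.scale_sum_right) (rule sum.swap)
qed

lemma CS_commute:
  assumes f: "\<And>m n. f (m + n) = f m + f n" "\<And>k m. f (s k m) = s k (f m)"
    and "\<And>k b m. k \<in> set ks \<Longrightarrow> f (t k b m) = t k b (f m)"
  shows "f (CS ks \<Phi> m) = CS ks \<Phi> (f m)"
  using assms(3)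
proof (induction ks arbitrary: \<Phi> m)
  case (Cons k ks)
  then show ?case by (simp add: linear_op_zero_sum(2)[of f, OF f])
qed (simp add: f)

text \<open>The operators \<open>t\<close> at distinct half-edges commute, and \<open>\<Phi>\<close>
  addresses its components by name rather than by position, so an entry may be brought to the
  front.\<close>

lemma CS_move: "k \<notin> set us \<Longrightarrow> CS (us @ k # vs) \<Phi> m = CS (k # us @ vs) \<Phi> m"
proof (induction us arbitrary: \<Phi> m)
  case (Cons u us)
  have "CS ((u # us) @ k # vs) \<Phi> m =
      (\<Sum>b\<in>B. \<Sum>c\<in>B. CS (us @ vs) (\<lambda>\<beta>. \<Phi> (\<beta>(k := c, u := b))) (t k c (t u b m)))"
    using Cons by simp
  also have "\<dots> = (\<Sum>c\<in>B. \<Sum>b\<in>B. CS (us @ vs) (\<lambda>\<beta>. \<Phi> (\<beta>(u := b, k := c))) (t u b (t k c m)))"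
  proof -
    have "\<beta>(k := c, u := b) = \<beta>(u := b, k := c)" for \<beta> :: "'d \<Rightarrow> 'h" and b c
      using Cons.prems by (intro fun_upd_twist) auto
    then show ?thesis using Cons.prems by (subst sum.swap) (simp add: t_commute[of k u])
  qed
  finally show ?case by simp
qed simp

lemma CS_front:
  assumes "distinct ks" "h \<in> set ks" "k \<in> set ks" "h \<noteq> k"
  obtains rs where "h \<notin> set rs" "k \<notin> set rs" "\<And>\<Phi> m. CS ks \<Phi> m = CS (k # h # rs) \<Phi> m"
proof -
  obtain us vs where ks: "ks = us @ h # vs" using assms(2) by (auto dest: split_list)
  then have "k \<in> set (us @ vs)" "distinct (us @ vs)" "h \<notin> set (us @ vs)" using assms by auto
  moreover from this obtain us' vs' where uv: "us @ vs = us' @ k # vs'"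
    using split_list[of k "us @ vs"] by blast
  ultimately have d: "k \<notin> set us'" "k \<notin> set vs'" "h \<notin> set us'" "h \<notin> set vs'"
    by (auto simp: uv)
  have "CS ks \<Phi> m = CS (k # h # us' @ vs') \<Phi> m" for \<Phi> m
  proof -
    have "CS ks \<Phi> m = CS (h # us @ vs) \<Phi> m"
      unfolding ks by (rule CS_move) (use assms ks in auto)
    also have "\<dots> = CS ((h # us') @ k # vs') \<Phi> m" by (simp add: uv)
    also have "\<dots> = CS (k # (h # us') @ vs') \<Phi> m"
      by (rule CS_move) (use d assms in auto)
    finally show ?thesis by simp
  qed
  with d show ?thesis by (intro that[of "us' @ vs'"]) auto
qed

text \<open>Removes the dual-basis coefficients that \<open>t_L_same\<close> and
  \<open>t_L_opposite\<close> produce: summing over \<open>b\<close> puts the product itself into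
  the slot of \<open>\<Phi>\<close>.\<close>

lemma CS_expand:
  assumes "\<And>\<beta>. hlin (*) (\<lambda>z. \<Phi> \<beta> z)"
  shows "(\<Sum>b\<in>B. s (e b z) (CS ks (\<lambda>\<beta>. \<Phi> \<beta> b) m)) = CS ks (\<lambda>\<beta>. \<Phi> \<beta> z) m"
proof -
  have "(\<lambda>\<beta>. \<Phi> \<beta> z) = (\<lambda>\<beta>. \<Sum>b\<in>B. e b z * \<Phi> \<beta> b)"
    using hlin_expand[OF vector_space_times assms] by simp
  then show ?thesis by (simp only: CS_lin)
qed

lemma CS_L_same:
  assumes \<Phi>: "\<And>\<beta>. hlin (*) (\<lambda>z. \<Phi> (\<beta>(h := z)))" and h: "h \<notin> set rs" "\<iota> h \<notin> set rs"
  shows "CS (h # rs) \<Phi> (L h a m) =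
    Sw (\<lambda>x y. L h x (CS (h # rs) (\<lambda>\<beta>. \<Phi> (\<beta>(h := \<beta> h \<odot> S y))) m)) a"
proof -
  have com: "CS rs \<Psi> (L h x n) = L h x (CS rs \<Psi> n)" for \<Psi> x n
    by (rule CS_commute[OF L_add L_scale, symmetric], rule t_L_other[symmetric]) (use h in auto)
  have "CS (h # rs) \<Phi> (L h a m) = (\<Sum>b\<in>B. \<Sum>c\<in>B. \<Sum>x\<in>B. \<Sum>y\<in>B. s (dl x y a)
      (s (e b (c \<odot> S y)) (CS rs (\<lambda>\<beta>. \<Phi> (\<beta>(h := b))) (L h x (t h c m)))))"
    by (simp add: t_L_same CS_sum CS_scale)
  also have "\<dots> = (\<Sum>x\<in>B. \<Sum>y\<in>B. \<Sum>c\<in>B. \<Sum>b\<in>B. s (dl x y a)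
      (s (e b (c \<odot> S y)) (CS rs (\<lambda>\<beta>. \<Phi> (\<beta>(h := b))) (L h x (t h c m)))))"
    unfolding sum.cartesian_product
    by (rule sum.reindex_bij_witness[of _ "\<lambda>(x, y, c, b). (b, c, x, y)" "\<lambda>(b, c, x, y). (x, y, c, b)"]) auto
  also have "\<dots> = (\<Sum>x\<in>B. \<Sum>y\<in>B. \<Sum>c\<in>B. s (dl x y a)
      (CS rs (\<lambda>\<beta>. \<Phi> (\<beta>(h := c \<odot> S y))) (L h x (t h c m))))"
    by (simp only: N.scale_sum_right[symmetric] CS_expand[of "\<lambda>\<beta> z. \<Phi> (\<beta>(h := z))", OF \<Phi>])
  also have "\<dots> = Sw (\<lambda>x y. L h x (CS (h # rs) (\<lambda>\<beta>. \<Phi> (\<beta>(h := \<beta> h \<odot> S y))) m)) a"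
    by (simp add: sw_def N.scale_sum_right L_sum com)
  finally show ?thesis .
qed

lemma CS_L_opposite:
  assumes \<Phi>: "\<And>\<beta>. hlin (*) (\<lambda>z. \<Phi> (\<beta>(\<iota> h := z)))"
  shows "CS (\<iota> h # rs) \<Phi> (L h a m) =
    Sw (\<lambda>x y. \<Sum>c\<in>B. CS rs (\<lambda>\<beta>. \<Phi> (\<beta>(\<iota> h := x \<odot> c))) (L h y (t (\<iota> h) c m))) a"
proof -
  have "CS (\<iota> h # rs) \<Phi> (L h a m) = (\<Sum>b\<in>B. \<Sum>c\<in>B. \<Sum>x\<in>B. \<Sum>y\<in>B. s (dl x y a)
      (s (e b (x \<odot> c)) (CS rs (\<lambda>\<beta>. \<Phi> (\<beta>(\<iota> h := b))) (L h y (t (\<iota> h) c m)))))"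
    by (simp add: t_L_opposite CS_sum CS_scale)
  also have "\<dots> = (\<Sum>x\<in>B. \<Sum>y\<in>B. \<Sum>c\<in>B. \<Sum>b\<in>B. s (dl x y a)
      (s (e b (x \<odot> c)) (CS rs (\<lambda>\<beta>. \<Phi> (\<beta>(\<iota> h := b))) (L h y (t (\<iota> h) c m)))))"
    unfolding sum.cartesian_product
    by (rule sum.reindex_bij_witness[of _ "\<lambda>(x, y, c, b). (b, c, x, y)" "\<lambda>(b, c, x, y). (x, y, c, b)"]) auto
  also have "\<dots> = (\<Sum>x\<in>B. \<Sum>y\<in>B. \<Sum>c\<in>B. s (dl x y a)
      (CS rs (\<lambda>\<beta>. \<Phi> (\<beta>(\<iota> h := x \<odot> c))) (L h y (t (\<iota> h) c m))))"
    by (simp only: N.scale_sum_right[symmetric] CS_expand[of "\<lambda>\<beta> z. \<Phi> (\<beta>(\<iota> h := z))", OF \<Phi>])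
  also have "\<dots> = Sw (\<lambda>x y. \<Sum>c\<in>B. CS rs (\<lambda>\<beta>. \<Phi> (\<beta>(\<iota> h := x \<odot> c))) (L h y (t (\<iota> h) c m))) a"
    by (simp add: sw_def N.scale_sum_right)
  finally show ?thesis .
qed

text \<open>With \<open>\<iota> h\<close> and \<open>h\<close> brought to the front,
  \<open>CS_L_opposite\<close> splits off the first leg of \<open>a\<close> at
  \<open>\<iota> h\<close>, and \<open>CS_L_same\<close> then splits off the last leg at
  \<open>h\<close>; the middle leg stays in \<open>L\<close>.\<close>

lemma CS_L:
  assumes ks: "distinct ks" "h \<in> set ks" "\<iota> h \<in> set ks" and h: "h \<in> E" and \<Phi>: "multi (set ks) \<Phi>"
  shows "CS ks \<Phi> (L h a m) =
    Sw (\<lambda>x y. Sw (\<lambda>u v. L h u (CS ks (\<lambda>\<beta>. \<Phi> (\<beta>(\<iota> h := x \<odot> \<beta> (\<iota> h), h := \<beta> h \<odot> S v))) m)) y) a"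
proof -
  obtain rs where rs: "h \<notin> set rs" "\<iota> h \<notin> set rs" "\<And>\<Phi> m. CS ks \<Phi> m = CS (\<iota> h # h # rs) \<Phi> m"
    using CS_front[OF ks(1,2,3)] iota_neq[OF h] by metis
  have lin: "hlin (*) (\<lambda>z. \<Phi> (\<beta>(h := z)))" "hlin (*) (\<lambda>z. \<Phi> (\<beta>(\<iota> h := z)))" for \<beta>
    using \<Phi> ks by (simp_all add: multi_def)
  have "CS ks \<Phi> (L h a m) =
      Sw (\<lambda>x y. \<Sum>c\<in>B. CS (h # rs) (\<lambda>\<beta>. \<Phi> (\<beta>(\<iota> h := x \<odot> c))) (L h y (t (\<iota> h) c m))) a"
    unfolding rs(3) by (rule CS_L_opposite) (rule lin)
  also have "\<dots> = Sw (\<lambda>x y. \<Sum>c\<in>B. Sw (\<lambda>u v. L h u (CS (h # rs)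
      (\<lambda>\<beta>. \<Phi> (\<beta>(h := \<beta> h \<odot> S v, \<iota> h := x \<odot> c))) (t (\<iota> h) c m))) y) a"
  proof -
    have "hlin (*) (\<lambda>z. \<Phi> (\<beta>(h := z, \<iota> h := w)))" for \<beta> w
      using lin(1)[of "\<beta>(\<iota> h := w)"] iota_neq[OF h] by (simp add: fun_upd_twist)
    then show ?thesis by (simp add: CS_L_same rs del: CS.simps)
  qed
  also have "\<dots> = Sw (\<lambda>x y. Sw (\<lambda>u v. L h u (\<Sum>c\<in>B. CS (h # rs)
      (\<lambda>\<beta>. \<Phi> (\<beta>(h := \<beta> h \<odot> S v, \<iota> h := x \<odot> c))) (t (\<iota> h) c m))) y) a"
    by (simp only: sw_sum[OF N.vector_space_axioms, symmetric] L_sum)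
  also have "\<dots> = Sw (\<lambda>x y. Sw (\<lambda>u v. L h u (CS ks
      (\<lambda>\<beta>. \<Phi> (\<beta>(\<iota> h := x \<odot> \<beta> (\<iota> h), h := \<beta> h \<odot> S v))) m)) y) a"
  proof -
    have "(\<lambda>\<beta>. \<Phi> (\<beta>(h := \<beta> h \<odot> S v, \<iota> h := x \<odot> c))) =
        (\<lambda>\<beta>. \<Phi> ((\<beta>(\<iota> h := c))(\<iota> h := x \<odot> (\<beta>(\<iota> h := c)) (\<iota> h), h := (\<beta>(\<iota> h := c)) h \<odot> S v)))" for x c v
      using iota_neq[OF h] by (auto simp: fun_upd_twist)
    then show ?thesis unfolding rs(3) CS.simps(2)[of "\<iota> h" "h # rs"] by presburger
  qed
  finally show ?thesis .
qed

text \<open>The updates are nested, the second one reading the result of the first, so that the case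
  \<open>h' = \<iota> h\<close> is covered: both factors then enter the same component, one from
  each side.\<close>

definition insert_ends :: "'d \<Rightarrow> 'h \<Rightarrow> 'd \<Rightarrow> 'h \<Rightarrow> ('d \<Rightarrow> 'h) \<Rightarrow> 'd \<Rightarrow> 'h" where
  "insert_ends h x h' y \<beta> = (let \<gamma> = \<beta>(\<iota> h := x \<odot> \<beta> (\<iota> h)) in \<gamma>(h' := \<gamma> h' \<odot> y))"

lemma insert_ends_apply: "insert_ends h x h' y \<beta> k =
  (if k = h' then (if k = \<iota> h then (x \<odot> \<beta> k) \<odot> y else \<beta> k \<odot> y) else if k = \<iota> h then x \<odot> \<beta> k else \<beta> k)"
  by (simp add: insert_ends_def Let_def)

lemma multi_insert_ends: "multi K \<Phi> \<Longrightarrow> multi K (\<lambda>\<beta>. \<Phi> (insert_ends h x h' y \<beta>))"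
  unfolding multi_def
proof (intro ballI allI)
  fix k \<beta> assume \<Phi>: "\<forall>k\<in>K. \<forall>\<beta>. hlin (*) (\<lambda>z. \<Phi> (\<beta>(k := z)))" and k: "k \<in> K"
  define w where "w z = insert_ends h x h' y (\<lambda>_. z) k" for z
  have eq: "insert_ends h x h' y (\<beta>(k := z)) = (insert_ends h x h' y \<beta>)(k := w z)" for z
    by (auto simp: fun_eq_iff insert_ends_apply w_def)
  have lin: "hlin (*) (\<lambda>z. \<Phi> ((insert_ends h x h' y \<beta>)(k := z)))"
    using \<Phi> k by blast
  \<comment> \<open>A component that is not touched is transformed by the identity, which need not
    be \<open>hlin\<close>; hence the alternative.\<close>
  have "w = (\<lambda>z. z) \<or> hlin sH w"
    unfolding w_def insert_ends_apply
    by (cases "k = h'"; cases "k = \<iota> h") (simp_all add: hlin_intros)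
  then show "hlin (*) (\<lambda>z. \<Phi> (insert_ends h x h' y (\<beta>(k := z))))"
    unfolding eq using lin hlin_comp[OF vector_space_times lin, of w] by auto
qed

text \<open>The corner between \<open>h\<close> and \<open>h'\<close> is passed through by \<open>\<Phi>\<close>, so that insertions there multiply.\<close>

definition corner :: "(('d \<Rightarrow> 'h) \<Rightarrow> 'k) \<Rightarrow> 'd \<Rightarrow> 'd \<Rightarrow> bool" where
  "corner \<Phi> h h' \<longleftrightarrow> \<iota> h' \<noteq> h \<and>
     (\<forall>\<beta> x y. \<Phi> (\<beta>(\<iota> h' := x \<odot> \<beta> (\<iota> h'), h := \<beta> h \<odot> y)) = \<Phi> (\<beta>(\<iota> h' := (y \<odot> x) \<odot> \<beta> (\<iota> h'))))"

lemma Lseq_single: "Lseq [h] a m = L h a m"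
  using sw_counit_right[OF N.vector_space_axioms hlin_L] by simp

text \<open>By induction on \<open>hs\<close>, the tail inserts a leg \<open>x\<close> at
  \<open>\<iota> h'\<close> and the head inserts \<open>S w\<close> at \<open>h\<close>. The
  property \<open>corner\<close> turns both into the single factor \<open>S w \<odot> x\<close>, and
  since \<open>w\<close> and \<open>x\<close> are neighbouring legs of \<open>a\<close>, it
  collapses to the counit. The insertions at the two outer ends have no partner and are carried
  along.\<close>

lemma CS_Lseq:
  assumes "distinct ks" and "multi (set ks) \<Phi>"
    and "hs \<noteq> []" "distinct hs" "set hs \<subseteq> E" "set hs \<union> \<iota> ` set hs \<subseteq> set ks"
    and "successively (corner \<Phi>) hs"
  shows "CS ks \<Phi> (Lseq hs a m) =
    Sw (\<lambda>x y. Sw (\<lambda>u v. Lseq hs u (CS ks (\<lambda>\<beta>. \<Phi> (insert_ends (hd hs) x (last hs) (S v) \<beta>)) m)) y) a"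
  using assms(3-)
proof (induction hs arbitrary: a m rule: list_nonempty_induct)
  case (single h)
  then have "\<iota> h \<noteq> h" using iota_neq by auto
  then show ?case
    using CS_L[OF assms(1) _ _ _ assms(2), of h a m] single
    by (simp only: Lseq_single) (simp add: insert_ends_def Let_def)
next
  case (cons h hs)
  obtain h' hs' where hs: "hs = h' # hs'" using cons.hyps by (cases hs) auto
  let ?l = "last hs"
  have corner: "corner \<Phi> h h'" and neq: "h \<noteq> h'" "?l \<noteq> h" "h \<in> E" "h' \<in> E"
    using cons.prems hs by auto
  have i_neq: "\<iota> h \<noteq> \<iota> h'" "\<iota> h \<noteq> h" using neq iota_iota iota_neq by metis+
  \<comment> \<open>\<open>\<Phi>\<close> with the outer insertions of the longer list and a
    variable factor \<open>z\<close> at the corner between \<open>h\<close> and \<open>h'\<close>.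
    It will be used with \<open>z = S w \<odot> x\<close>, and \<open>z = \<one>\<close> is what
    remains in the end.\<close>
  define \<Psi> where "\<Psi> p v z \<beta> = \<Phi> ((insert_ends h p ?l (S v) \<beta>)
      (\<iota> h' := z \<odot> insert_ends h p ?l (S v) \<beta> (\<iota> h')))" for p v z \<beta>
  have h'_mem: "\<iota> h' \<in> set ks" using cons.prems hs by auto
  have \<Psi>_lin: "hlin (*) (\<lambda>z. \<Psi> p v z \<beta>)" for p v \<beta>
  proof -
    have "hlin (*) (\<lambda>z. \<Phi> ((insert_ends h p ?l (S v) \<beta>)(\<iota> h' := z)))"
      using assms(2) h'_mem unfolding multi_def by blast
    from hlin_comp[OF vector_space_times this hlin_mul_left] show ?thesis by (simp only: \<Psi>_def)
  qed
  have \<Psi>_one: "\<Psi> p v \<one> \<beta> = \<Phi> (insert_ends h p ?l (S v) \<beta>)" for p v \<beta>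
  proof -
    have "hlin (*) (\<lambda>z. \<Phi> ((insert_ends h p ?l (S v) \<beta>)(\<iota> h' := z)))"
      using assms(2) h'_mem unfolding multi_def by blast
    from hlin_pr_eq[OF this] show ?thesis by (simp add: \<Psi>_def one_mul)
  qed
  define F where "F p r u v z = Lseq hs u (L h r (CS ks (\<Psi> p v z) m))" for p r u v z
  have F_lin: "hlin s (F p r u v)" for p r u v
  proof -
    have "hlin s (\<lambda>z. CS ks (\<Psi> p v z) m)"
      unfolding hlin_def using CS_expand[of "\<lambda>\<beta> z. \<Psi> p v z \<beta>", OF \<Psi>_lin] by simp
    then have "hlin s (\<lambda>z. L h r (CS ks (\<Psi> p v z) m))"
      by (rule hlin_post[OF N.vector_space_axioms _ L_add L_scale L_zero])
    then show ?thesis unfolding F_def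
      by (rule hlin_post[OF N.vector_space_axioms _ Lseq_add Lseq_scale Lseq_zero])
  qed
  have step: "CS ks (\<lambda>\<beta>. \<Phi> (insert_ends h' x ?l (S v) \<beta>)) (L h a1 m) =
      Sw (\<lambda>p q. Sw (\<lambda>r w. L h r (CS ks (\<Psi> p v (S w \<odot> x)) m)) q) a1" for x v a1
  proof -
    have "CS ks (\<lambda>\<beta>. \<Phi> (insert_ends h' x ?l (S v) \<beta>)) (L h a1 m) =
      Sw (\<lambda>p q. Sw (\<lambda>r w. L h r (CS ks (\<lambda>\<beta>. \<Phi> (insert_ends h' x ?l (S v)
        (\<beta>(\<iota> h := p \<odot> \<beta> (\<iota> h), h := \<beta> h \<odot> S w)))) m)) q) a1"
      by (rule CS_L[OF assms(1)]) (use cons.prems neq assms(2) in \<open>auto intro: multi_insert_ends\<close>)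
    moreover have "\<Phi> (insert_ends h' x ?l (S v) (\<beta>(\<iota> h := p \<odot> \<beta> (\<iota> h), h := \<beta> h \<odot> S w))) = \<Psi> p v (S w \<odot> x) \<beta>"
      for \<beta> p w
    proof -
      let ?\<gamma> = "insert_ends h p ?l (S v) \<beta>"
      \<comment> \<open>\<open>\<iota> h\<close> or \<open>\<iota> h'\<close> may coincide with
        \<open>?l\<close>. Then a left and a right insertion meet in one component, and
        associativity makes their order irrelevant.\<close>
      have "insert_ends h' x ?l (S v) (\<beta>(\<iota> h := p \<odot> \<beta> (\<iota> h), h := \<beta> h \<odot> S w)) =
          ?\<gamma>(\<iota> h' := x \<odot> ?\<gamma> (\<iota> h'), h := ?\<gamma> h \<odot> S w)"
        using neq i_neq corner by (auto simp: fun_eq_iff insert_ends_apply mul_assoc corner_def)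
      then show ?thesis
        using corner unfolding corner_def \<Psi>_def by simp
    qed
    ultimately show ?thesis by simp
  qed
  note C = sw_coassoc[OF N.vector_space_axioms]
  note W = sw_swap[OF N.vector_space_axioms]
  have "CS ks \<Phi> (Lseq (h # hs) a m) = Sw (\<lambda>a1 a'. CS ks \<Phi> (Lseq hs a' (L h a1 m))) a"
    unfolding Lseq.simps by (rule sw_map[OF N.vector_space_axioms CS_add CS_scale CS_zero])
  also have "\<dots> = Sw (\<lambda>a1 a'. Sw (\<lambda>x y. Sw (\<lambda>u v. Lseq hs u
      (CS ks (\<lambda>\<beta>. \<Phi> (insert_ends h' x ?l (S v) \<beta>)) (L h a1 m))) y) a') a"
    using cons hs by simp
  also have "\<dots> = Sw (\<lambda>a1 a'. Sw (\<lambda>x y. Sw (\<lambda>u v. Sw (\<lambda>p q. Sw (\<lambda>r w.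
      F p r u v (S w \<odot> x)) q) a1) y) a') a"
    by (simp only: step Lseq_Sw F_def)
  \<comment> \<open>The legs of \<open>a\<close> in order are \<open>p, r, w, x, u, v\<close>, but
    here \<open>x, u, v\<close> are split off before \<open>p, r, w\<close>. Interchanging the
    independent sums restores the order; coassociativity can then make \<open>w\<close> and
    \<open>x\<close> the legs of one element \<open>t\<close>.\<close>
  also have "\<dots> = Sw (\<lambda>a1 a'. Sw (\<lambda>p q. Sw (\<lambda>r w. Sw (\<lambda>x y. Sw (\<lambda>u v.
      F p r u v (S w \<odot> x)) y) a') q) a1) a"
  proof (rule sw_cong)
    fix a1 a'
    have "Sw (\<lambda>x y. Sw (\<lambda>u v. Sw (\<lambda>p q. Sw (\<lambda>r w. F p r u v (S w \<odot> x)) q) a1) y) a' =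
        Sw (\<lambda>x y. Sw (\<lambda>p q. Sw (\<lambda>r w. Sw (\<lambda>u v. F p r u v (S w \<odot> x)) y) q) a1) a'"
      by (rule sw_cong) (rule trans[OF W sw_cong[OF W]])
    also have "\<dots> = Sw (\<lambda>p q. Sw (\<lambda>x y. Sw (\<lambda>r w. Sw (\<lambda>u v. F p r u v (S w \<odot> x)) y) q) a') a1"
      by (rule W)
    also have "\<dots> = Sw (\<lambda>p q. Sw (\<lambda>r w. Sw (\<lambda>x y. Sw (\<lambda>u v. F p r u v (S w \<odot> x)) y) a') q) a1"
      by (rule sw_cong) (rule W)
    finally show "Sw (\<lambda>x y. Sw (\<lambda>u v. Sw (\<lambda>p q. Sw (\<lambda>r w. F p r u v (S w \<odot> x)) q) a1) y) a' =
        Sw (\<lambda>p q. Sw (\<lambda>r w. Sw (\<lambda>x y. Sw (\<lambda>u v. F p r u v (S w \<odot> x)) y) a') q) a1" .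
  qed
  also have "\<dots> = Sw (\<lambda>p a2. Sw (\<lambda>q a'. Sw (\<lambda>r w. Sw (\<lambda>x y. Sw (\<lambda>u v.
      F p r u v (S w \<odot> x)) y) a') q) a2) a"
    by (rule C)
  also have "\<dots> = Sw (\<lambda>p a2. Sw (\<lambda>r a3. Sw (\<lambda>w a'. Sw (\<lambda>x y. Sw (\<lambda>u v.
      F p r u v (S w \<odot> x)) y) a') a3) a2) a"
    by (rule sw_cong) (rule C)
  also have "\<dots> = Sw (\<lambda>p a2. Sw (\<lambda>r a3. Sw (\<lambda>t y. Sw (\<lambda>w x. Sw (\<lambda>u v.
      F p r u v (S w \<odot> x)) y) t) a3) a2) a"
    by (rule sw_cong, rule sw_cong, rule C[symmetric])
  also have "\<dots> = Sw (\<lambda>p a2. Sw (\<lambda>r a3. Sw (\<lambda>t y. s (ep t) (Sw (\<lambda>u v. F p r u v \<one>) y)) a3) a2) a"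
  proof (intro sw_cong)
    fix p a2 r a3 t y
    have "Sw (\<lambda>w x. Sw (\<lambda>u v. F p r u v (S w \<odot> x)) y) t = Sw (\<lambda>u v. Sw (\<lambda>w x. F p r u v (S w \<odot> x)) t) y"
      by (rule W)
    also have "\<dots> = Sw (\<lambda>u v. s (ep t) (F p r u v \<one>)) y"
      by (intro sw_cong sw_antipode_left[OF N.vector_space_axioms F_lin])
    also have "\<dots> = s (ep t) (Sw (\<lambda>u v. F p r u v \<one>) y)"
      by (rule sw_scale[OF N.vector_space_axioms, symmetric])
    finally show "Sw (\<lambda>w x. Sw (\<lambda>u v. F p r u v (S w \<odot> x)) y) t = s (ep t) (Sw (\<lambda>u v. F p r u v \<one>) y)" .
  qed
  also have "\<dots> = Sw (\<lambda>p a2. Sw (\<lambda>r a3. Sw (\<lambda>u v. F p r u v \<one>) a3) a2) a"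
    by (intro sw_cong sw_counit_left[OF N.vector_space_axioms] hlin_sw[OF N.vector_space_axioms])
  \<comment> \<open>Recombines \<open>r\<close> and \<open>u\<close> into the leg \<open>u'\<close>,
    the argument of \<open>Lseq (h # hs)\<close>.\<close>
  also have "\<dots> = Sw (\<lambda>p a2. Sw (\<lambda>u' v. Sw (\<lambda>r u. F p r u v \<one>) u') a2) a"
    by (rule sw_cong, rule C[symmetric])
  also have "\<dots> = Sw (\<lambda>x y. Sw (\<lambda>u v. Lseq (h # hs) u
      (CS ks (\<lambda>\<beta>. \<Phi> (insert_ends h x ?l (S v) \<beta>)) m)) y) a"
  proof -
    have "\<Psi> p v \<one> = (\<lambda>\<beta>. \<Phi> (insert_ends h p ?l (S v) \<beta>))" for p v
      by (rule ext) (rule \<Psi>_one)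
    then show ?thesis by (simp only: F_def Lseq.simps)
  qed
  finally show ?case using cons.hyps by (simp only: list.sel last.simps if_False)
qed

end

section \<open>Face words, and face operators against vertex operators\<close>

context half_edge_ops
begin

text \<open>The head of the list is the rightmost factor, because the operator at the head receives
  the last tensor factor of the coproduct in the dual.\<close>

primrec word :: "'d list \<Rightarrow> ('d \<Rightarrow> 'h) \<Rightarrow> 'h" where
  "word [] = (\<lambda>\<beta>. \<one>)"
| "word (k # ks) = (\<lambda>\<beta>. word ks \<beta> \<odot> \<beta> k)"

lemma pr_word: "pr (word ks \<beta>) = word ks \<beta>"
  by (cases ks) (simp_all add: pr_simps)

lemma word_upd: "k \<notin> set ks \<Longrightarrow> word ks (\<beta>(k := z)) = word ks \<beta>"
  by (induction ks) auto

lemma word_append: "word (us @ vs) \<beta> = word vs \<beta> \<odot> word us \<beta>"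
  by (induction us) (simp_all add: pr_simps pr_word mul_assoc)

lemma hlin_word: "distinct ks \<Longrightarrow> k \<in> set ks \<Longrightarrow> hlin sH (\<lambda>z. word ks (\<beta>(k := z)))"
proof (induction ks)
  case (Cons l ks)
  then show ?case by (cases "k = l") (simp_all add: word_upd hlin_intros del: fun_upd_apply add: fun_upd_same fun_upd_other)
qed simp

lemma word_hd: "distinct ks \<Longrightarrow> ks \<noteq> [] \<Longrightarrow> word ks (\<beta>(hd ks := \<beta> (hd ks) \<odot> y)) = word ks \<beta> \<odot> y"
  by (cases ks) (auto simp: word_upd mul_assoc)

lemma word_last: "distinct ks \<Longrightarrow> ks \<noteq> [] \<Longrightarrow> word ks (\<beta>(last ks := x \<odot> \<beta> (last ks))) = x \<odot> word ks \<beta>"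
proof (induction ks)
  case (Cons k ks)
  then show ?case
    by (cases "ks = []") (auto simp: pr_simps mul_assoc)
qed simp

text \<open>The form that turns the joint coaction of all half-edges into the coaction of the face
  \<open>F\<close>. The half-edges in \<open>R\<close> lie off the face and are removed by the
  counit; they take part because \<open>CS_Lseq\<close> works with lists that contain both
  half-edges of every edge at the vertex.\<close>

definition face_form :: "'d list \<Rightarrow> 'd set \<Rightarrow> ('h \<Rightarrow> 'k) \<Rightarrow> ('d \<Rightarrow> 'h) \<Rightarrow> 'k" where
  "face_form F R \<alpha> \<beta> = \<alpha> (word F \<beta>) * (\<Prod>r\<in>R. ep (\<beta> r))"

lemma prod_ep_upd:
  assumes "finite R" "k \<in> R"
  shows "(\<Prod>r\<in>R. ep ((\<beta>(k := z)) r)) = ep z * (\<Prod>r\<in>R - {k}. ep (\<beta> r))"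
proof -
  have "(\<Prod>r\<in>R. ep ((\<beta>(k := z)) r)) = ep ((\<beta>(k := z)) k) * (\<Prod>r\<in>R - {k}. ep ((\<beta>(k := z)) r))"
    by (rule prod.remove[OF assms])
  moreover have "(\<Prod>r\<in>R - {k}. ep ((\<beta>(k := z)) r)) = (\<Prod>r\<in>R - {k}. ep (\<beta> r))"
    by (rule prod.cong) auto
  ultimately show ?thesis by simp
qed

lemma prod_ep_upd_other: "k \<notin> R \<Longrightarrow> (\<Prod>r\<in>R. ep ((\<beta>(k := z)) r)) = (\<Prod>r\<in>R. ep (\<beta> r))"
  by (rule prod.cong) auto

lemma prod_ep_upd_mult:
  "finite R \<Longrightarrow> q \<in> R \<Longrightarrow> ep z = c * ep (\<beta> q) \<Longrightarrow>
   (\<Prod>r\<in>R. ep ((\<beta>(q := z)) r)) = c * (\<Prod>r\<in>R. ep (\<beta> r))"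
  by (simp add: prod_ep_upd prod.remove[of R q] del: fun_upd_apply)

lemma CS_rest: "distinct rs \<Longrightarrow> set rs \<subseteq> E \<Longrightarrow> m \<in> NC \<Longrightarrow> CS rs (\<lambda>\<beta>. c * (\<Prod>r\<in>set rs. ep (\<beta> r))) m = s c m"
proof (induction rs arbitrary: c m)
  case (Cons r rs)
  have "c * (\<Prod>q\<in>set (r # rs). ep ((\<beta>(r := b)) q)) = (c * ep b) * (\<Prod>q\<in>set rs. ep (\<beta> q))" for \<beta> b
    using Cons.prems by (simp add: prod_ep_upd_other del: fun_upd_apply) simp
  then have "CS (r # rs) (\<lambda>\<beta>. c * (\<Prod>q\<in>set (r # rs). ep (\<beta> q))) m =
      (\<Sum>b\<in>B. CS rs (\<lambda>\<beta>. (c * ep b) * (\<Prod>q\<in>set rs. ep (\<beta> q))) (t r b m))"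
    by (simp only: CS.simps)
  also have "\<dots> = (\<Sum>b\<in>B. s (c * ep b) (t r b m))"
    using Cons by (simp add: t_closed)
  also have "\<dots> = s c (\<Sum>b\<in>B. s (ep b) (t r b m))" by (simp add: N.scale_sum_right)
  finally show ?case using Cons.prems by (simp add: t_counit)
qed simp

lemma CS_face_form:
  "distinct (F @ rs) \<Longrightarrow> set rs \<subseteq> E \<Longrightarrow> m \<in> NC \<Longrightarrow> CS (F @ rs) (face_form F (set rs) \<alpha>) m = Tseq F \<alpha> m"
proof (induction F arbitrary: \<alpha> m)
  case Nil
  then show ?case using CS_rest[of rs m "\<alpha> \<one>"] by (simp add: face_form_def[abs_def])
next
  case (Cons k F)
  have "(\<lambda>\<beta>. face_form (k # F) (set rs) \<alpha> (\<beta>(k := b))) = face_form F (set rs) (\<lambda>y. \<alpha> (y \<odot> b))" for b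
    using Cons.prems prod_ep_upd_other[of k "set rs" _ b] by (auto simp: face_form_def fun_eq_iff word_upd)
  then show ?case using Cons by (simp add: t_closed)
qed

lemma multi_face_form:
  assumes "distinct F" "finite R" "set F \<inter> R = {}" and \<alpha>: "hlin (*) \<alpha>"
  shows "multi (set F \<union> R) (face_form F R \<alpha>)"
  unfolding multi_def
proof (intro ballI allI)
  fix k \<beta> assume "k \<in> set F \<union> R"
  then consider "k \<in> set F" "k \<notin> R" | "k \<in> R" "k \<notin> set F" using assms(3) by auto
  then show "hlin (*) (\<lambda>z. face_form F R \<alpha> (\<beta>(k := z)))"
  proof cases
    case 1
    have "hlin (*) (\<lambda>z. \<alpha> (word F (\<beta>(k := z))))"
      by (rule hlin_comp[OF vector_space_times \<alpha> hlin_word[OF assms(1) 1(1)]])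
    then show ?thesis
      unfolding face_form_def prod_ep_upd_other[OF 1(2)] by (rule hlin_mult_const)
  next
    case 2
    show ?thesis
      unfolding face_form_def prod_ep_upd[OF assms(2) 2(1)] word_upd[OF 2(2)]
      by (intro hlin_const_mult hlin_mult_const hlin_ep)
  qed
qed

text \<open>If \<open>\<iota> h'\<close> directly precedes \<open>h\<close> in \<open>F\<close>, the
  word contains \<open>\<beta> h\<close> immediately to the left of
  \<open>\<beta> (\<iota> h')\<close>, so the factors \<open>y\<close> and \<open>x\<close> stand
  side by side and merge by associativity. If both half-edges lie off the face, multiplicativity of
  \<open>ep\<close> has the same effect.\<close>

lemma corner_face_form:
  assumes "distinct F" "finite R" "set F \<inter> R = {}" "\<iota> h' \<noteq> h"
    and "(\<exists>us vs. F = us @ \<iota> h' # h # vs) \<or> h \<in> R \<and> \<iota> h' \<in> R"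
  shows "corner (face_form F R \<alpha>) h h'"
  unfolding corner_def
proof (intro conjI allI)
  fix \<beta> x y
  show "face_form F R \<alpha> (\<beta>(\<iota> h' := x \<odot> \<beta> (\<iota> h'), h := \<beta> h \<odot> y)) =
      face_form F R \<alpha> (\<beta>(\<iota> h' := (y \<odot> x) \<odot> \<beta> (\<iota> h')))"
    using assms(5)
  proof (elim disjE exE conjE)
    fix us vs assume F: "F = us @ \<iota> h' # h # vs"
    then have "h \<notin> R" "\<iota> h' \<notin> R" "h \<notin> set us" "h \<notin> set vs" "\<iota> h' \<notin> set us" "\<iota> h' \<notin> set vs"
      using assms(1,3) by auto
    then show ?thesis
      using assms(4) by (simp add: face_form_def prod_ep_upd_other word_append F word_upd mul_assoc
          del: fun_upd_apply add: fun_upd_same fun_upd_other)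
  next
    assume R: "h \<in> R" "\<iota> h' \<in> R"
    then have F: "h \<notin> set F" "\<iota> h' \<notin> set F" using assms(3) by auto
    have "(\<Prod>r\<in>R. ep ((\<beta>(\<iota> h' := x \<odot> \<beta> (\<iota> h'), h := \<beta> h \<odot> y)) r)) = ep y * (ep x * (\<Prod>r\<in>R. ep (\<beta> r)))"
      by (subst prod_ep_upd_mult[OF assms(2) R(1), of _ "ep y"], use assms(4) in \<open>simp add: ep_mul\<close>,
          subst prod_ep_upd_mult[OF assms(2) R(2), of _ "ep x"]) (simp_all add: ep_mul)
    moreover have "(\<Prod>r\<in>R. ep ((\<beta>(\<iota> h' := y \<odot> x \<odot> \<beta> (\<iota> h'))) r)) = (ep y * ep x) * (\<Prod>r\<in>R. ep (\<beta> r))"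
      by (rule prod_ep_upd_mult[OF assms(2) R(2)]) (simp add: ep_mul)
    ultimately show ?thesis by (simp only: face_form_def word_upd F mult.assoc not_False_eq_True)
  qed
qed (rule assms(4))

text \<open>\<open>hd F\<close> is the rightmost and \<open>last F\<close> the leftmost letter of
  the word, so insertions at these two places multiply the word as a whole.\<close>

lemma face_form_insert_same:
  assumes "distinct F" "F \<noteq> []" "set F \<inter> R = {}" "hd F = h'" "last F = \<iota> h"
  shows "face_form F R \<alpha> (insert_ends h x h' y \<beta>) = face_form F R (\<lambda>z. \<alpha> (x \<odot> z \<odot> y)) \<beta>"
proof -
  have R: "h' \<notin> R" "\<iota> h \<notin> R" using assms hd_in_set[of F] last_in_set[of F] by auto
  have "insert_ends h x h' y \<beta> = (\<beta>(last F := x \<odot> \<beta> (last F)))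
      (hd F := (\<beta>(last F := x \<odot> \<beta> (last F))) (hd F) \<odot> y)"
    by (simp add: insert_ends_def Let_def assms del: fun_upd_apply)
  then have "word F (insert_ends h x h' y \<beta>) = x \<odot> word F \<beta> \<odot> y"
    by (simp only: word_hd[OF assms(1,2)] word_last[OF assms(1,2)])
  moreover have "(\<Prod>r\<in>R. ep (insert_ends h x h' y \<beta> r)) = (\<Prod>r\<in>R. ep (\<beta> r))"
    using R by (intro prod.cong refl) (auto simp: insert_ends_apply)
  ultimately show ?thesis by (simp add: face_form_def)
qed

lemma face_form_insert_other:
  assumes R: "finite R" "h' \<in> R" "\<iota> h \<in> R" and "set F \<inter> R = {}"
  shows "face_form F R \<alpha> (insert_ends h x h' y \<beta>) = ep x * ep y * face_form F R \<alpha> \<beta>"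
proof -
  have F: "h' \<notin> set F" "\<iota> h \<notin> set F" using assms by auto
  have "(\<Prod>r\<in>R. ep (insert_ends h x h' y \<beta> r)) = ep y * (ep x * (\<Prod>r\<in>R. ep (\<beta> r)))"
    unfolding insert_ends_def Let_def
    by (subst prod_ep_upd_mult[OF R(1,2), of _ "ep y"], simp add: ep_mul mult.commute,
        subst prod_ep_upd_mult[OF R(1,3), of _ "ep x"])
      (simp_all add: ep_mul)
  moreover have "word F (insert_ends h x h' y \<beta>) = word F \<beta>"
    unfolding insert_ends_def Let_def using F by (simp add: word_upd)
  ultimately show ?thesis by (simp add: face_form_def)
qed

text \<open>The combinatorial condition that implies
  \<open>corner (face_form F R \<alpha>) h h'\<close> when \<open>R\<close> consists of the
  half-edges off \<open>F\<close>.\<close>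

definition consecutive :: "'d list \<Rightarrow> 'd \<Rightarrow> 'd \<Rightarrow> bool" where
  "consecutive F h h' \<longleftrightarrow> \<iota> h' \<noteq> h \<and> ((\<exists>us vs. F = us @ \<iota> h' # h # vs) \<or> h \<notin> set F \<and> \<iota> h' \<notin> set F)"

context
  fixes F hs :: "'d list" and \<alpha> :: "'h \<Rightarrow> 'k" and m :: 'n
  assumes F: "distinct F" "set F \<subseteq> E" and hs: "hs \<noteq> []" "distinct hs" "set hs \<subseteq> E"
    and consec: "successively (consecutive F) hs"
    and \<alpha>: "hlin (*) \<alpha>" and m: "m \<in> NC"
begin

text \<open>The face is completed by \<open>rs\<close> to a list of all half-edges, so that
  \<open>CS_Lseq\<close> applies with \<open>face_form\<close> as the form.\<close>

lemma Tseq_Lseq_aux: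
  assumes "distinct rs" "set rs = E - set F"
  shows "Tseq F \<alpha> (Lseq hs a m) = Sw (\<lambda>x y. Sw (\<lambda>u v. Lseq hs u
    (CS (F @ rs) (\<lambda>\<beta>. face_form F (set rs) \<alpha> (insert_ends (hd hs) x (last hs) (S v) \<beta>)) m)) y) a"
proof -
  have d: "distinct (F @ rs)" using F assms by auto
  have set: "set (F @ rs) = E" using F assms by auto
  have "Tseq F \<alpha> (Lseq hs a m) = CS (F @ rs) (face_form F (set rs) \<alpha>) (Lseq hs a m)"
    by (rule CS_face_form[symmetric, OF d]) (use assms m Lseq_closed in auto)
  also have "\<dots> = Sw (\<lambda>x y. Sw (\<lambda>u v. Lseq hs u
    (CS (F @ rs) (\<lambda>\<beta>. face_form F (set rs) \<alpha> (insert_ends (hd hs) x (last hs) (S v) \<beta>)) m)) y) a"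
  proof (rule CS_Lseq[OF d _ hs])
    have "multi (set F \<union> set rs) (face_form F (set rs) \<alpha>)"
      by (rule multi_face_form[OF F(1) _ _ \<alpha>]) (use assms finite_E in auto)
    then show "multi (set (F @ rs)) (face_form F (set rs) \<alpha>)" by simp
    show "set hs \<union> \<iota> ` set hs \<subseteq> set (F @ rs)"
      unfolding set using hs iota_E by auto
    show "successively (corner (face_form F (set rs) \<alpha>)) hs"
    proof (rule successively_mono[OF consec])
      fix h h' assume h: "h \<in> set hs" "h' \<in> set hs" "consecutive F h h'"
      then have "h \<in> E" "\<iota> h' \<in> E" using hs iota_E by auto
      then show "corner (face_form F (set rs) \<alpha>) h h'"
        using h(3) assms(2) by (intro corner_face_form[OF F(1)]) (auto simp: consecutive_def finite_E)
    qed
  qed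
  finally show ?thesis .
qed

lemma rest_list: obtains rs where "distinct rs" "set rs = E - set F"
  using finite_distinct_list[of "E - set F"] finite_E by auto

lemma Tseq_Lseq_same:
  assumes "F \<noteq> []" "hd F = last hs" "last F = \<iota> (hd hs)"
  shows "Tseq F \<alpha> (Lseq hs a m) =
    Sw (\<lambda>x y. Sw (\<lambda>u v. Lseq hs u (Tseq F (\<lambda>z. \<alpha> (x \<odot> z \<odot> S v)) m)) y) a"
proof -
  obtain rs where rs: "distinct rs" "set rs = E - set F" by (rule rest_list)
  have "CS (F @ rs) (\<lambda>\<beta>. face_form F (set rs) \<alpha> (insert_ends (hd hs) x (last hs) y \<beta>)) m =
      Tseq F (\<lambda>z. \<alpha> (x \<odot> z \<odot> y)) m" for x y
  proof -
    have "(\<lambda>\<beta>. face_form F (set rs) \<alpha> (insert_ends (hd hs) x (last hs) y \<beta>)) =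
        face_form F (set rs) (\<lambda>z. \<alpha> (x \<odot> z \<odot> y))"
      using face_form_insert_same[OF F(1) assms(1) _ assms(2,3), of "set rs"] rs by auto
    then show ?thesis using CS_face_form[of F rs m] F rs m by auto
  qed
  then show ?thesis using Tseq_Lseq_aux[OF rs] by simp
qed

text \<open>Both outer insertions fall on half-edges off the face, where the form applies
  \<open>ep\<close>; the outer legs of \<open>a\<close> are then absorbed by the counit
  axioms.\<close>

lemma Tseq_Lseq_other:
  assumes "last hs \<notin> set F" "\<iota> (hd hs) \<notin> set F"
  shows "Tseq F \<alpha> (Lseq hs a m) = Lseq hs a (Tseq F \<alpha> m)"
proof -
  obtain rs where rs: "distinct rs" "set rs = E - set F" by (rule rest_list)
  have mem: "last hs \<in> set rs" "\<iota> (hd hs) \<in> set rs"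
    using assms rs hs(3) iota_E[of "hd hs"] last_in_set[OF hs(1)] hd_in_set[OF hs(1)] by auto
  have CS: "CS (F @ rs) (\<lambda>\<beta>. face_form F (set rs) \<alpha> (insert_ends (hd hs) x (last hs) y \<beta>)) m =
      s (ep x * ep y) (Tseq F \<alpha> m)" for x y
  proof -
    \<comment> \<open>Written as a sum over one index, so that \<open>CS_lin\<close> can pull out
      the scalar.\<close>
    have eq: "face_form F (set rs) \<alpha> (insert_ends (hd hs) x (last hs) y \<beta>) =
        (\<Sum>i\<in>{()}. (ep x * ep y) * face_form F (set rs) \<alpha> \<beta>)" for \<beta>
      using face_form_insert_other[OF _ mem, of F \<alpha> x y \<beta>] rs finite_E by auto
    show ?thesis
      unfolding eq CS_lin using CS_face_form[of F rs m] F rs m by auto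
  qed
  have "Tseq F \<alpha> (Lseq hs a m) =
      Sw (\<lambda>x y. Sw (\<lambda>u v. s (ep x * ep v) (Lseq hs u (Tseq F \<alpha> m))) y) a"
    unfolding Tseq_Lseq_aux[OF rs] CS by (simp only: Lseq_scale ep_S)
  also have "\<dots> = Sw (\<lambda>x y. s (ep x) (Lseq hs y (Tseq F \<alpha> m))) a"
  proof (rule sw_cong)
    fix x y
    have "Sw (\<lambda>u v. s (ep v) (Lseq hs u (Tseq F \<alpha> m))) y = Lseq hs y (Tseq F \<alpha> m)"
      by (rule sw_counit_right[OF N.vector_space_axioms hlin_Lseq])
    then show "Sw (\<lambda>u v. s (ep x * ep v) (Lseq hs u (Tseq F \<alpha> m))) y = s (ep x) (Lseq hs y (Tseq F \<alpha> m))"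
      by (simp only: N.scale_scale[symmetric] sw_scale[OF N.vector_space_axioms, symmetric])
  qed
  also have "\<dots> = Lseq hs a (Tseq F \<alpha> m)"
    by (rule sw_counit_left[OF N.vector_space_axioms hlin_Lseq])
  finally show ?thesis .
qed

end

end

section \<open>Composites of commuting families of operators\<close>

primrec comps :: "'c list \<Rightarrow> ('c \<Rightarrow> 'n \<Rightarrow> 'n) \<Rightarrow> 'n \<Rightarrow> 'n" where
  "comps [] = (\<lambda>F m. m)"
| "comps (c # cs) = (\<lambda>F m. comps cs F (F c m))"

lemma comps_cong: "(\<And>c m. c \<in> set cs \<Longrightarrow> F c m = G c m) \<Longrightarrow> comps cs F m = comps cs G m"
  by (induction cs arbitrary: m) auto

lemma comps_cong_on:
  assumes "\<And>c m. c \<in> set cs \<Longrightarrow> m \<in> X \<Longrightarrow> F c m = G c m" "\<And>c m. c \<in> set cs \<Longrightarrow> m \<in> X \<Longrightarrow> F c m \<in> X" "m \<in> X"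
  shows "comps cs F m = comps cs G m"
  using assms by (induction cs arbitrary: m) auto

lemma comps_closed:
  "(\<And>c m. c \<in> set cs \<Longrightarrow> m \<in> X \<Longrightarrow> F c m \<in> X) \<Longrightarrow> m \<in> X \<Longrightarrow> comps cs F m \<in> X"
  by (induction cs arbitrary: m) auto

lemma comps_commute:
  assumes "\<And>c m. c \<in> set cs \<Longrightarrow> m \<in> X \<Longrightarrow> f (F c m) = F c (f m)" "\<And>c m. c \<in> set cs \<Longrightarrow> m \<in> X \<Longrightarrow> F c m \<in> X" "m \<in> X"
  shows "f (comps cs F m) = comps cs F (f m)"
  using assms by (induction cs arbitrary: m) auto

text \<open>\<open>F c\<close> and \<open>G c\<close> at the same index need not commute, so
  \<open>G c\<close> is kept directly after \<open>F c\<close>, and only operators at different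
  indices are moved past each other.\<close>

lemma comps_comp:
  assumes "distinct cs"
    and "\<And>c d m. c \<in> set cs \<Longrightarrow> d \<in> set cs \<Longrightarrow> c \<noteq> d \<Longrightarrow> m \<in> X \<Longrightarrow> G c (F d m) = F d (G c m)"
    and "\<And>c m. c \<in> set cs \<Longrightarrow> m \<in> X \<Longrightarrow> F c m \<in> X" "\<And>c m. c \<in> set cs \<Longrightarrow> m \<in> X \<Longrightarrow> G c m \<in> X"
    and "m \<in> X"
  shows "comps cs G (comps cs F m) = comps cs (\<lambda>c m. G c (F c m)) m"
  using assms
proof (induction cs arbitrary: m)
  case (Cons c cs)
  have com: "G c (comps cs F (F c m)) = comps cs F (G c (F c m))"
    by (rule comps_commute[of cs X]) (use Cons.prems in auto)
  have "comps cs G (comps cs F (G c (F c m))) = comps cs (\<lambda>c m. G c (F c m)) (G c (F c m))"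
    by (rule Cons.IH) (use Cons.prems in auto)
  then show ?case by (simp add: com)
qed simp

context vector_space
begin

lemma comps_add:
  "(\<And>c m n. c \<in> set cs \<Longrightarrow> F c (m + n) = F c m + F c n) \<Longrightarrow> comps cs F (m + n :: 'b) = comps cs F m + comps cs F n"
  by (induction cs arbitrary: m n) auto

lemma comps_scale:
  "(\<And>c k m. c \<in> set cs \<Longrightarrow> F c (scale k m) = scale k (F c m)) \<Longrightarrow> comps cs F (scale k m) = scale k (comps cs F m)"
  by (induction cs arbitrary: m) auto

text \<open>The counterpart of \<open>multilin_sum_expand\<close> for composites: each factor is a
  linear combination of operators, and every choice function contributes one composite.\<close>

lemma comps_expand:
  assumes "distinct cs" "finite J"
    and lin: "\<And>c j m n. c \<in> set cs \<Longrightarrow> U c j (m + n) = U c j m + U c j n"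
      "\<And>c j k m. c \<in> set cs \<Longrightarrow> U c j (scale k m) = scale k (U c j m)"
  shows "comps cs (\<lambda>c n. \<Sum>j\<in>J. scale (w c j) (U c j n)) m =
    (\<Sum>g\<in>set cs \<rightarrow>\<^sub>E J. scale (\<Prod>c\<in>set cs. w c (g c)) (comps cs (\<lambda>c. U c (g c)) m))"
  using assms(1) lin
proof (induction cs arbitrary: m)
  case Nil
  then show ?case by simp
next
  case (Cons c cs)
  have c: "c \<notin> set cs" using Cons.prems by simp
  have sum: "comps cs (\<lambda>c. U c (g c)) (\<Sum>j\<in>J. scale (w' j) (x j)) =
      (\<Sum>j\<in>J. scale (w' j) (comps cs (\<lambda>c. U c (g c)) (x j)))" for g w' x
  proof -
    note a = comps_add[of cs "\<lambda>c. U c (g c)"] and b = comps_scale[of cs "\<lambda>c. U c (g c)"]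
    have 0: "comps cs (\<lambda>c. U c (g c)) 0 = 0" using b[of 0 0] Cons.prems(3) by simp
    show ?thesis
      by (induction J rule: infinite_finite_induct) (use 0 a b Cons.prems in simp_all)
  qed
  have p: "(\<Prod>d\<in>set (c # cs). w d ((g(c := j)) d)) = w c j * (\<Prod>d\<in>set cs. w d (g d))" for g j
  proof -
    have "(\<Prod>d\<in>set cs. w d ((g(c := j)) d)) = (\<Prod>d\<in>set cs. w d (g d))"
      using c by (intro prod.cong) auto
    then show ?thesis using c by simp
  qed
  have cc: "comps (c # cs) (\<lambda>d. U d ((g(c := j)) d)) m = comps cs (\<lambda>d. U d (g d)) (U c j m)" for g j
    using c by (auto intro!: comps_cong)
  have "comps (c # cs) (\<lambda>c n. \<Sum>j\<in>J. scale (w c j) (U c j n)) m =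
      (\<Sum>g\<in>set cs \<rightarrow>\<^sub>E J. scale (\<Prod>c\<in>set cs. w c (g c))
        (\<Sum>j\<in>J. scale (w c j) (comps cs (\<lambda>c. U c (g c)) (U c j m))))"
    using Cons by (simp add: sum)
  also have "\<dots> = (\<Sum>j\<in>J. \<Sum>g\<in>set cs \<rightarrow>\<^sub>E J. scale (w c j * (\<Prod>c\<in>set cs. w c (g c)))
        (comps cs (\<lambda>c. U c (g c)) (U c j m)))"
    by (subst sum.swap) (simp add: scale_sum_right mult.commute)
  also have "\<dots> = (\<Sum>g\<in>set (c # cs) \<rightarrow>\<^sub>E J. scale (\<Prod>c\<in>set (c # cs). w c (g c)) (comps (c # cs) (\<lambda>c. U c (g c)) m))"
    unfolding list.set(2)[of c cs] sum_PiE_insert[OF c]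
    by (simp only: p[unfolded list.set(2)[of c cs]] cc)
  finally show ?case .
qed

end

section \<open>Coordinates on a finite-dimensional Hopf algebra\<close>

text \<open>A basis of the carrier with coordinate functionals, and a linear coproduct. The locale
  serves \<open>H\<close> itself and also the tensor power of \<open>H\<close> with its product
  basis, where the coefficients of the coproduct and of comodules are read off in the same
  way.\<close>

locale based_space =
  fixes H :: "('k::field, 'h::ab_group_add) hopf" and B :: "'h set" and e :: "'h \<Rightarrow> 'h \<Rightarrow> 'k"
  assumes car_vspace: "is_vspace H" and coprod_lin: "linmap H (H \<otimes>\<^sub>s H) (comult H)"
    and fin_B: "finite B" and B_car: "b \<in> B \<Longrightarrow> b \<in> vcar H"
    and e_add: "e b (x + y) = e b x + e b y"
    and e_scale: "e b (vscale H k x) = k * e b x"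
    and e_basis: "b \<in> B \<Longrightarrow> c \<in> B \<Longrightarrow> e b c = (if b = c then 1 else 0)"
    and basis_expand: "x \<in> vcar H \<Longrightarrow> (\<Sum>b\<in>B. vscale H (e b x) b) = x"
begin

sublocale HV: vector_space "vscale H" by (rule vs_vector_space[OF car_vspace])

definition pj :: "'h \<Rightarrow> 'h" where "pj x = (\<Sum>b\<in>B. vscale H (e b x) b)"
text \<open>A tensor is a functional on bilinear forms, so its coefficient at a pair of basis
  vectors is its value at the product of the two coordinate functionals; see
  \<open>tensor_expand\<close>.\<close>

definition gdl :: "'h \<Rightarrow> 'h \<Rightarrow> 'h \<Rightarrow> 'k" where "gdl b c a = comult H (pj a) (\<lambda>x y. e b x * e c y)"
lemma pj_closed: "pj x \<in> vcar H"
  unfolding pj_def by (intro vs_sum[OF car_vspace] vs_scale[OF car_vspace] B_car)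

lemma pj_id: "x \<in> vcar H \<Longrightarrow> pj x = x"
  by (simp add: pj_def basis_expand)

lemma linmap_pj: "is_vspace W \<Longrightarrow> linmap H W f \<Longrightarrow> f (pj x) = (\<Sum>b\<in>B. vscale W (e b x) (f b))"
  unfolding pj_def by (rule linmap_sum_scale[OF car_vspace]) (auto simp: B_car)

lemma linmap_expand: "is_vspace W \<Longrightarrow> linmap H W f \<Longrightarrow> x \<in> vcar H \<Longrightarrow> f x = (\<Sum>b\<in>B. vscale W (e b x) (f b))"
  using linmap_pj[of W f x] by (simp add: pj_id)

lemma linmap_e: "linmap H scalars (e b)"
  by (simp add: linmap_def e_add e_scale)

lemma bilin_e_e: "bilin H H scalars (\<lambda>x y. e b x * e c y)"
  by (simp add: bilin_def linmap_def e_add e_scale algebra_simps)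

lemma tensor_e_e: "tensor H H x y (\<lambda>x y. e b x * e c y) = e b x * e c y"
  by (simp add: tensor_def bilin_e_e)

lemma sum_e_basis_left: "b \<in> B \<Longrightarrow> (\<Sum>c\<in>B. e b c * f c) = (f b :: 'k)"
proof -
  assume b: "b \<in> B"
  then have "(\<Sum>c\<in>B. e b c * f c) = (\<Sum>c\<in>B. if b = c then f c else 0)"
    by (intro sum.cong refl) (simp add: e_basis)
  then show ?thesis using b fin_B by simp
qed

lemma sum_e_e: "b \<in> B \<Longrightarrow> c \<in> B \<Longrightarrow> (\<Sum>p\<in>B. \<Sum>q\<in>B. G p q * (e b p * e c q)) = (G b c :: 'k)"
proof -
  assume "b \<in> B" "c \<in> B"
  have "(\<Sum>p\<in>B. \<Sum>q\<in>B. G p q * (e b p * e c q)) = (\<Sum>p\<in>B. e b p * (\<Sum>q\<in>B. e c q * G p q))"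
    by (simp add: sum_distrib_left ac_simps)
  then show ?thesis using \<open>b \<in> B\<close> \<open>c \<in> B\<close> by (simp add: sum_e_basis_left)
qed

lemma tensor_expand:
  assumes "t \<in> vcar (H \<otimes>\<^sub>s H)"
  shows "t = (\<Sum>b\<in>B. \<Sum>c\<in>B. fscale (t (\<lambda>x y. e b x * e c y)) (tensor H H b c))"
proof (rule linmap_tprod_eqI[OF is_vspace_tprod linmap_id _ _ assms])
  interpret F: vector_space "fscale :: 'k \<Rightarrow> (('h \<Rightarrow> 'h \<Rightarrow> 'k) \<Rightarrow> 'k) \<Rightarrow> _"
    by (rule vector_space_fscale)
  show "linmap (H \<otimes>\<^sub>s H) (H \<otimes>\<^sub>s H) (\<lambda>t. \<Sum>b\<in>B. \<Sum>c\<in>B. fscale (t (\<lambda>x y. e b x * e c y)) (tensor H H b c))"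
    by (intro linmap_sum_fun is_vspace_tprod)
      (rule linmap_scalar_fun[OF is_vspace_tprod linmap_fscale_eval(1), unfolded vscale_tprod],
        rule tensor_closed, simp_all add: B_car)
  fix x y assume xy: "x \<in> vcar H" "y \<in> vcar H"
  have "tensor H H x y = (\<Sum>b\<in>B. fscale (e b x) (tensor H H b y))"
    using linmap_expand[OF is_vspace_tprod bilin_left[OF bilin_tensor xy(2)] xy(1)] by simp
  also have "\<dots> = (\<Sum>b\<in>B. fscale (e b x) (\<Sum>c\<in>B. fscale (e c y) (tensor H H b c)))"
    using linmap_expand[OF is_vspace_tprod bilin_right[OF bilin_tensor B_car] xy(2)] by simp
  also have "\<dots> = (\<Sum>b\<in>B. \<Sum>c\<in>B. fscale (e b x * e c y) (tensor H H b c))"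
    by (simp add: F.scale_sum_right)
  finally show "tensor H H x y =
      (\<Sum>b\<in>B. \<Sum>c\<in>B. fscale (tensor H H x y (\<lambda>x y. e b x * e c y)) (tensor H H b c))"
    unfolding tensor_e_e .
qed

lemma tlift_expand:
  assumes X: "is_vspace X" and \<phi>: "bilin H H X \<phi>" and t: "t \<in> vcar (H \<otimes>\<^sub>s H)"
  shows "tlift H H X \<phi> t = (\<Sum>b\<in>B. \<Sum>c\<in>B. vscale X (t (\<lambda>x y. e b x * e c y)) (\<phi> b c))"
proof -
  note lin = tensor_universal(1)[OF X \<phi>] and T = is_vspace_tprod
  have ten: "tensor H H b c \<in> vcar (H \<otimes>\<^sub>s H)" if "b \<in> B" "c \<in> B" for b c
    using that by (simp add: tensor_closed B_car)
  have "tlift H H X \<phi> t =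
      tlift H H X \<phi> (\<Sum>b\<in>B. \<Sum>c\<in>B. vscale (H \<otimes>\<^sub>s H) (t (\<lambda>x y. e b x * e c y)) (tensor H H b c))"
    using tensor_expand[OF t] by simp
  also have "\<dots> = (\<Sum>b\<in>B. tlift H H X \<phi> (\<Sum>c\<in>B. vscale (H \<otimes>\<^sub>s H) (t (\<lambda>x y. e b x * e c y)) (tensor H H b c)))"
    by (rule linmap_sum[OF T X lin]) (intro vs_sum[OF T] vs_scale[OF T] ten)
  also have "\<dots> = (\<Sum>b\<in>B. \<Sum>c\<in>B. vscale X (t (\<lambda>x y. e b x * e c y)) (tlift H H X \<phi> (tensor H H b c)))"
    by (intro sum.cong refl linmap_sum_scale[OF T X lin] ten)
  also have "\<dots> = (\<Sum>b\<in>B. \<Sum>c\<in>B. vscale X (t (\<lambda>x y. e b x * e c y)) (\<phi> b c))"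
    by (intro sum.cong refl) (simp add: tensor_universal(2)[OF X \<phi>] B_car)
  finally show ?thesis .
qed

lemma sw2_expand:
  assumes "is_vspace X" "bilin H H X \<phi>" "a \<in> vcar H"
  shows "sw2 H X \<phi> a = (\<Sum>b\<in>B. \<Sum>c\<in>B. vscale X (gdl b c a) (\<phi> b c))"
  using tlift_expand[OF assms(1,2) linmap_closed[OF coprod_lin assms(3)]] assms(3)
  by (simp add: sw2_def gdl_def pj_id)

lemma linmap_sw2: "is_vspace X \<Longrightarrow> bilin H H X \<phi> \<Longrightarrow> linmap H X (sw2 H X \<phi>)"
  unfolding sw2_def[abs_def] by (rule linmap_tlift_arg[OF _ _ coprod_lin])

lemma map_sw2:
  assumes X: "is_vspace X" and Y: "is_vspace Y" and g: "linmap X Y g" and \<phi>: "bilin H H X \<phi>" and a: "a \<in> vcar H"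
  shows "g (sw2 H X \<phi> a) = (\<Sum>b\<in>B. \<Sum>c\<in>B. vscale Y (gdl b c a) (g (\<phi> b c)))"
proof -
  have \<phi>c: "\<phi> b c \<in> vcar X" if "b \<in> B" "c \<in> B" for b c
    using bilin_closed[OF \<phi>] that B_car by blast
  have "g (sw2 H X \<phi> a) = (\<Sum>b\<in>B. g (\<Sum>c\<in>B. vscale X (gdl b c a) (\<phi> b c)))"
    unfolding sw2_expand[OF X \<phi> a]
    by (rule linmap_sum[OF X Y g]) (intro vs_sum[OF X] vs_scale[OF X] \<phi>c)
  also have "\<dots> = (\<Sum>b\<in>B. \<Sum>c\<in>B. vscale Y (gdl b c a) (g (\<phi> b c)))"
    by (intro sum.cong refl linmap_sum_scale[OF X Y g] \<phi>c)
  finally show ?thesis .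
qed

lemma e_pj: "e b (pj x) = (\<Sum>c\<in>B. e c x * e b c)"
  using linmap_pj[OF is_vspace_scalars linmap_e] by simp

lemma e_pj_basis: "b \<in> B \<Longrightarrow> e b (pj x) = e b x"
  unfolding e_pj using sum_e_basis_left[of b "\<lambda>c. e c x"] by (simp add: mult.commute)

text \<open>Contraction of the \<open>H\<close>-factor with a coordinate functional, that is, the
  \<open>W\<close>-valued coefficient of \<open>b\<close>. No basis of \<open>W\<close> is involved,
  so \<open>W\<close> may have any dimension.\<close>

definition lcf :: "('k, 'w::ab_group_add, 'z) vspace_scheme \<Rightarrow> 'h \<Rightarrow> (('h \<Rightarrow> 'w \<Rightarrow> 'k) \<Rightarrow> 'k) \<Rightarrow> 'w" where
  "lcf W b = tlift H W W (\<lambda>x n. vscale W (e b x) n)"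

definition rcf :: "('k, 'w::ab_group_add, 'z) vspace_scheme \<Rightarrow> 'h \<Rightarrow> (('w \<Rightarrow> 'h \<Rightarrow> 'k) \<Rightarrow> 'k) \<Rightarrow> 'w" where
  "rcf W b = tlift W H W (\<lambda>n x. vscale W (e b x) n)"

section \<open>Coefficients of tensors with one factor in the Hopf algebra\<close>

context
  fixes W :: "('k, 'w::ab_group_add, 'z) vspace_scheme"
  assumes W: "is_vspace W"
begin

interpretation WV: vector_space "vscale W" by (rule vs_vector_space[OF W])

lemma linmap_lcf: "linmap (H \<otimes>\<^sub>s W) W (lcf W b)"
  unfolding lcf_def by (rule tensor_universal(1)[OF W bilin_scalar_fun(1)[OF W linmap_e]])

lemma linmap_rcf: "linmap (W \<otimes>\<^sub>s H) W (rcf W b)"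
  unfolding rcf_def by (rule tensor_universal(1)[OF W bilin_scalar_fun(2)[OF W linmap_e]])

lemma lcf_tensor: "x \<in> vcar H \<Longrightarrow> n \<in> vcar W \<Longrightarrow> lcf W b (tensor H W x n) = vscale W (e b x) n"
  unfolding lcf_def by (rule tensor_universal(2)[OF W bilin_scalar_fun(1)[OF W linmap_e]])

lemma rcf_tensor: "x \<in> vcar H \<Longrightarrow> n \<in> vcar W \<Longrightarrow> rcf W b (tensor W H n x) = vscale W (e b x) n"
  unfolding rcf_def by (rule tensor_universal(2)[OF W bilin_scalar_fun(2)[OF W linmap_e]])

lemma left_expand:
  assumes "t \<in> vcar (H \<otimes>\<^sub>s W)"
  shows "t = (\<Sum>b\<in>B. tensor H W b (lcf W b t))"
proof (rule linmap_tprod_eqI[OF is_vspace_tprod linmap_id _ _ assms])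
  show "linmap (H \<otimes>\<^sub>s W) (H \<otimes>\<^sub>s W) (\<lambda>t. \<Sum>b\<in>B. tensor H W b (lcf W b t))"
    by (intro linmap_sum_fun is_vspace_tprod linmap_comp[OF linmap_lcf bilin_right[OF bilin_tensor]] B_car)
  fix x n assume xn: "x \<in> vcar H" "n \<in> vcar W"
  have "tensor H W x n = (\<Sum>b\<in>B. vscale (H \<otimes>\<^sub>s W) (e b x) (tensor H W b n))"
    by (rule linmap_expand[OF is_vspace_tprod bilin_left[OF bilin_tensor xn(2)] xn(1)])
  also have "\<dots> = (\<Sum>b\<in>B. tensor H W b (vscale W (e b x) n))"
    by (intro sum.cong refl linmap_scale[OF bilin_right[OF bilin_tensor] xn(2), symmetric] B_car)
  finally show "tensor H W x n = (\<Sum>b\<in>B. tensor H W b (lcf W b (tensor H W x n)))"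
    unfolding lcf_tensor[OF xn] .
qed

lemma right_expand:
  assumes "t \<in> vcar (W \<otimes>\<^sub>s H)"
  shows "t = (\<Sum>b\<in>B. tensor W H (rcf W b t) b)"
proof (rule linmap_tprod_eqI[OF is_vspace_tprod linmap_id _ _ assms])
  show "linmap (W \<otimes>\<^sub>s H) (W \<otimes>\<^sub>s H) (\<lambda>t. \<Sum>b\<in>B. tensor W H (rcf W b t) b)"
    by (intro linmap_sum_fun is_vspace_tprod linmap_comp[OF linmap_rcf bilin_left[OF bilin_tensor]] B_car)
  fix n x assume xn: "n \<in> vcar W" "x \<in> vcar H"
  have "tensor W H n x = (\<Sum>b\<in>B. vscale (W \<otimes>\<^sub>s H) (e b x) (tensor W H n b))"
    by (rule linmap_expand[OF is_vspace_tprod bilin_right[OF bilin_tensor xn(1)] xn(2)])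
  also have "\<dots> = (\<Sum>b\<in>B. tensor W H (vscale W (e b x) n) b)"
    by (intro sum.cong refl linmap_scale[OF bilin_left[OF bilin_tensor] xn(1), symmetric] B_car)
  finally show "tensor W H n x = (\<Sum>b\<in>B. tensor W H (rcf W b (tensor W H n x)) b)"
    unfolding rcf_tensor[OF xn(2,1)] .
qed

lemma lcf_closed: "t \<in> vcar (H \<otimes>\<^sub>s W) \<Longrightarrow> lcf W b t \<in> vcar W"
  by (rule linmap_closed[OF linmap_lcf])

lemma rcf_closed: "t \<in> vcar (W \<otimes>\<^sub>s H) \<Longrightarrow> rcf W b t \<in> vcar W"
  by (rule linmap_closed[OF linmap_rcf])

lemma tlift_left_expand:
  assumes X: "is_vspace X" and \<phi>: "bilin H W X \<phi>" and t: "t \<in> vcar (H \<otimes>\<^sub>s W)"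
  shows "tlift H W X \<phi> t = (\<Sum>b\<in>B. \<phi> b (lcf W b t))"
proof -
  have "tlift H W X \<phi> t = tlift H W X \<phi> (\<Sum>b\<in>B. tensor H W b (lcf W b t))"
    by (rule arg_cong[OF left_expand[OF t]])
  also have "\<dots> = (\<Sum>b\<in>B. \<phi> b (lcf W b t))"
    by (rule tlift_tensor_sum[OF X \<phi>]) (simp_all add: B_car lcf_closed[OF t])
  finally show ?thesis .
qed

lemma tlift_right_expand:
  assumes X: "is_vspace X" and \<phi>: "bilin W H X \<phi>" and t: "t \<in> vcar (W \<otimes>\<^sub>s H)"
  shows "tlift W H X \<phi> t = (\<Sum>b\<in>B. \<phi> (rcf W b t) b)"
proof -
  have "tlift W H X \<phi> t = tlift W H X \<phi> (\<Sum>b\<in>B. tensor W H (rcf W b t) b)"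
    by (rule arg_cong[OF right_expand[OF t]])
  also have "\<dots> = (\<Sum>b\<in>B. \<phi> (rcf W b t) b)"
    by (rule tlift_tensor_sum[OF X \<phi>]) (simp_all add: B_car rcf_closed[OF t])
  finally show ?thesis .
qed

lemma sum_e_vec: "b \<in> B \<Longrightarrow> (\<Sum>c\<in>B. vscale W (e b c) (f c)) = f b"
proof -
  assume b: "b \<in> B"
  then have "(\<Sum>c\<in>B. vscale W (e b c) (f c)) = (\<Sum>c\<in>B. if b = c then f c else 0)"
    by (intro sum.cong refl) (simp add: e_basis)
  then show ?thesis using b fin_B by simp
qed

lemma sw2_bilin:
  assumes X: "is_vspace X" and 1: "\<And>n. n \<in> vcar W \<Longrightarrow> bilin H H X (\<lambda>a b. \<phi> a b n)"
    and 2: "\<And>a b. a \<in> vcar H \<Longrightarrow> b \<in> vcar H \<Longrightarrow> linmap W X (\<phi> a b)"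
  shows "bilin H W X (\<lambda>x n. sw2 H X (\<lambda>a b. \<phi> a b n) x)"
proof (rule bilinI)
  fix x assume x: "x \<in> vcar H"
  show "linmap W X (\<lambda>n. sw2 H X (\<lambda>a b. \<phi> a b n) x)"
  proof (rule linmap_cong[OF _ W])
    show "linmap W X (\<lambda>n. \<Sum>b\<in>B. \<Sum>c\<in>B. vscale X (gdl b c x) (\<phi> b c n))"
      by (intro linmap_sum_fun X linmap_scale_fun 2 B_car)
  qed (rule sw2_expand[OF X 1 x, symmetric])
qed (intro linmap_sw2 X 1)

text \<open>Coassociativity contracted by \<open>\<theta>\<close>, with the coordinate functional of
  \<open>b\<close> on the first factor and that of \<open>c\<close> on the second. The auxiliary
  facts establish bilinearity, on which the defining property of \<open>tlift\<close> rests.\<close>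

lemma left_comodule_mul:
  assumes co: "left_comodule H W co" and n: "n \<in> vcar W" and bc: "b \<in> B" "c \<in> B"
  shows "lcf W c (co (lcf W b (co n))) = (\<Sum>d\<in>B. vscale W (gdl b c d) (lcf W d (co n)))"
proof -
  let ?X = "H \<otimes>\<^sub>s H \<otimes>\<^sub>s W"
  have X: "is_vspace ?X" by (rule is_vspace_tprod)
  have co_lin: "linmap W (H \<otimes>\<^sub>s W) co" using co by (simp add: left_comodule_def)
  then have co_n: "co n \<in> vcar (H \<otimes>\<^sub>s W)" if "n \<in> vcar W" for n using that by (rule linmap_closed)
  let ?t = "\<lambda>b. lcf W b (co n)"
  have t: "?t b \<in> vcar W" for b by (rule lcf_closed[OF co_n[OF n]])
  define \<theta> where "\<theta> x u = vscale W (e b x) (lcf W c u)" for x u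
  have \<theta>: "bilin H (H \<otimes>\<^sub>s W) W \<theta>"
    unfolding \<theta>_def by (intro bilinI linmap_scale_fun[OF W] linmap_lcf linmap_scalar_fun[OF W] linmap_e lcf_closed)
  let ?g = "tlift H (H \<otimes>\<^sub>s W) W \<theta>"
  have g: "linmap ?X W ?g" by (rule tensor_universal(1)[OF W \<theta>])
  note gt = tensor_universal(2)[OF W \<theta>]
  note tl = bilin_left[OF bilin_tensor] and tr = bilin_right[OF bilin_tensor]
  have 1: "bilin H H ?X (\<lambda>a b. tensor H (H \<otimes>\<^sub>s W) a (tensor H W b n'))" if "n' \<in> vcar W" for n'
    by (intro bilinI linmap_comp[OF tl tr] tl tensor_closed that)
  have 2: "bilin H W ?X (\<lambda>x n'. sw2 H ?X (\<lambda>a b. tensor H (H \<otimes>\<^sub>s W) a (tensor H W b n')) x)"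
    by (intro sw2_bilin X 1 linmap_comp[OF tr tr])
  have 3: "bilin H W ?X (\<lambda>x n'. tensor H (H \<otimes>\<^sub>s W) x (co n'))"
    by (intro bilinI linmap_comp[OF co_lin tr] tl co_n)
  have "?g (tlift H W ?X (\<lambda>x n'. sw2 H ?X (\<lambda>a b. tensor H (H \<otimes>\<^sub>s W) a (tensor H W b n')) x) (co n)) =
      (\<Sum>d\<in>B. ?g (sw2 H ?X (\<lambda>a b. tensor H (H \<otimes>\<^sub>s W) a (tensor H W b (?t d))) d))"
    unfolding tlift_left_expand[OF X 2 co_n[OF n]]
    by (rule linmap_sum[OF X W g]) (rule linmap_closed[OF linmap_sw2[OF X 1[OF t]] B_car])
  also have "\<dots> = (\<Sum>d\<in>B. \<Sum>p\<in>B. \<Sum>q\<in>B. vscale W (gdl p q d) (vscale W (e b p) (vscale W (e c q) (?t d))))"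
    by (intro sum.cong refl)
      (simp add: map_sw2[OF X W g 1[OF t] B_car] gt \<theta>_def tensor_closed t B_car lcf_tensor del: WV.scale_scale)
  also have "\<dots> = (\<Sum>d\<in>B. vscale W (gdl b c d) (?t d))"
    by (simp add: WV.scale_sum_left[symmetric] sum_e_e bc)
  finally have "?g (tlift H W ?X (\<lambda>x n'. sw2 H ?X (\<lambda>a b. tensor H (H \<otimes>\<^sub>s W) a (tensor H W b n')) x) (co n)) =
      (\<Sum>d\<in>B. vscale W (gdl b c d) (?t d))" .
  moreover have "?g (tlift H W ?X (\<lambda>x n'. tensor H (H \<otimes>\<^sub>s W) x (co n')) (co n)) =
      (\<Sum>d\<in>B. ?g (tensor H (H \<otimes>\<^sub>s W) d (co (?t d))))"
    unfolding tlift_left_expand[OF X 3 co_n[OF n]]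
    by (rule linmap_sum[OF X W g]) (intro tensor_closed B_car co_n t)
  moreover have "\<dots> = (\<Sum>d\<in>B. vscale W (e b d) (lcf W c (co (?t d))))"
    by (intro sum.cong refl) (simp add: gt B_car co_n t \<theta>_def)
  ultimately show ?thesis
    using co n bc by (simp add: left_comodule_def sum_e_vec)
qed

end

end

locale based_hopf = hopf_algebra H + based_space H B e
  for H :: "('k::field, 'h::ab_group_add) hopf" and B :: "'h set" and e :: "'h \<Rightarrow> 'h \<Rightarrow> 'k"
begin

definition gmul :: "'h \<Rightarrow> 'h \<Rightarrow> 'h" where "gmul x y = hmult H (pj x) (pj y)"
definition gep :: "'h \<Rightarrow> 'k" where "gep a = counit H (pj a)"
definition gS :: "'h \<Rightarrow> 'h" where "gS a = antipode H (pj a)"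

text \<open>The functional induced by \<open>\<beta>\<close>, the product of the coordinate
  functionals of \<open>b\<close>, \<open>c\<close> and \<open>d\<close>, reads off one coefficient
  of a triple tensor; it is applied to both sides of the coassociativity axiom.\<close>

lemma gdl_coassoc:
  assumes bcd: "b \<in> B" "c \<in> B" "d \<in> B"
  shows "(\<Sum>f\<in>B. gdl f d a * gdl b c f) = (\<Sum>f\<in>B. gdl b f a * gdl c d f)"
proof -
  let ?X = "H \<otimes>\<^sub>s H \<otimes>\<^sub>s H"
  have T: "is_vspace ?X" "is_vspace (H \<otimes>\<^sub>s H)" by (rule is_vspace_tprod)+
  define \<beta> where "\<beta> x t = e b x * (t :: ('h \<Rightarrow> 'h \<Rightarrow> 'k) \<Rightarrow> 'k) (\<lambda>y z. e c y * e d z)" for x t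
  have \<beta>: "bilin H (H \<otimes>\<^sub>s H) scalars \<beta>"
    by (simp add: bilin_def linmap_def \<beta>_def e_add e_scale algebra_simps fscale_def)
  let ?g = "tlift H (H \<otimes>\<^sub>s H) scalars \<beta>"
  have g: "linmap ?X scalars ?g" by (rule tensor_universal(1)[OF is_vspace_scalars \<beta>])
  have gt: "?g (tensor H (H \<otimes>\<^sub>s H) x (tensor H H y z)) = e b x * (e c y * e d z)"
    if "x \<in> vcar H" "y \<in> vcar H" "z \<in> vcar H" for x y z
    using tensor_universal(2)[OF is_vspace_scalars \<beta> that(1) tensor_closed[OF that(2,3)]]
    by (simp add: \<beta>_def tensor_e_e)
  note tl = bilin_left[OF bilin_tensor] and tr = bilin_right[OF bilin_tensor]
  have L1: "bilin H H ?X (\<lambda>c' d'. tensor H (H \<otimes>\<^sub>s H) c' (tensor H H d' y))" if "y \<in> vcar H" for y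
    by (intro bilinI linmap_comp[OF tl tr] tl that tensor_closed)
  have R1: "bilin H H ?X (\<lambda>c' d'. tensor H (H \<otimes>\<^sub>s H) y (tensor H H c' d'))" if "y \<in> vcar H" for y
    by (intro bilinI linmap_comp[OF tr tr] linmap_comp[OF tl tr] that)
  have lin_y: "linmap H ?X (\<lambda>y. sw2 H ?X (\<lambda>c' d'. tensor H (H \<otimes>\<^sub>s H) c' (tensor H H d' y)) x)" if "x \<in> vcar H" for x
  proof (rule linmap_cong[OF _ vspace])
    show "linmap H ?X (\<lambda>y. \<Sum>p\<in>B. \<Sum>q\<in>B. vscale ?X (gdl p q x) (tensor H (H \<otimes>\<^sub>s H) p (tensor H H q y)))"
      by (intro linmap_sum_fun T linmap_scale_fun linmap_comp[OF tr tr] B_car)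
  qed (rule sw2_expand[OF T(1) L1 that, symmetric])
  have lin_y': "linmap H ?X (\<lambda>y. sw2 H ?X (\<lambda>c' d'. tensor H (H \<otimes>\<^sub>s H) y (tensor H H c' d')) x)" if "x \<in> vcar H" for x
  proof (rule linmap_cong[OF _ vspace])
    show "linmap H ?X (\<lambda>y. \<Sum>p\<in>B. \<Sum>q\<in>B. vscale ?X (gdl p q x) (tensor H (H \<otimes>\<^sub>s H) y (tensor H H p q)))"
      by (intro linmap_sum_fun T linmap_scale_fun tl tensor_closed B_car)
  qed (rule sw2_expand[OF T(1) R1 that, symmetric])
  have L2: "bilin H H ?X (\<lambda>a b. sw2 H ?X (\<lambda>c' d'. tensor H (H \<otimes>\<^sub>s H) c' (tensor H H d' b)) a)"
    by (intro bilinI lin_y linmap_sw2 T L1)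
  have R2: "bilin H H ?X (\<lambda>a b. sw2 H ?X (\<lambda>c' d'. tensor H (H \<otimes>\<^sub>s H) a (tensor H H c' d')) b)"
    by (intro bilinI lin_y' linmap_sw2 T R1)
  have "?g (sw2 H ?X (\<lambda>a b. sw2 H ?X (\<lambda>c' d'. tensor H (H \<otimes>\<^sub>s H) c' (tensor H H d' b)) a) (pj a)) =
      (\<Sum>f\<in>B. \<Sum>d'\<in>B. gdl f d' (pj a) * (\<Sum>p\<in>B. \<Sum>q\<in>B. gdl p q f * (e b p * (e c q * e d d'))))"
    by (simp add: map_sw2[OF T(1) is_vspace_scalars g L2 pj_closed] map_sw2[OF T(1) is_vspace_scalars g L1] gt B_car)
  also have "\<dots> = (\<Sum>f\<in>B. \<Sum>d'\<in>B. e d d' * (gdl f d' (pj a) * (\<Sum>p\<in>B. \<Sum>q\<in>B. gdl p q f * (e b p * e c q))))"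
    by (simp add: sum_distrib_left ac_simps)
  also have "\<dots> = (\<Sum>f\<in>B. gdl f d (pj a) * gdl b c f)"
    using bcd by (simp add: sum_e_e sum_e_basis_left)
  finally have 1: "?g (sw2 H ?X (\<lambda>a b. sw2 H ?X (\<lambda>c' d'. tensor H (H \<otimes>\<^sub>s H) c' (tensor H H d' b)) a) (pj a)) =
      (\<Sum>f\<in>B. gdl f d (pj a) * gdl b c f)" .
  have "?g (sw2 H ?X (\<lambda>a b. sw2 H ?X (\<lambda>c' d'. tensor H (H \<otimes>\<^sub>s H) a (tensor H H c' d')) b) (pj a)) =
      (\<Sum>p\<in>B. \<Sum>f\<in>B. gdl p f (pj a) * (\<Sum>q\<in>B. \<Sum>r\<in>B. gdl q r f * (e b p * (e c q * e d r))))"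
    by (simp add: map_sw2[OF T(1) is_vspace_scalars g R2 pj_closed] map_sw2[OF T(1) is_vspace_scalars g R1] gt B_car)
  also have "\<dots> = (\<Sum>p\<in>B. e b p * (\<Sum>f\<in>B. gdl p f (pj a) * (\<Sum>q\<in>B. \<Sum>r\<in>B. gdl q r f * (e c q * e d r))))"
    by (simp add: sum_distrib_left ac_simps)
  also have "\<dots> = (\<Sum>f\<in>B. gdl b f (pj a) * gdl c d f)"
    using bcd by (simp add: sum_e_e sum_e_basis_left)
  finally show ?thesis
    using 1 coassoc[OF pj_closed[of a]] by (simp add: gdl_def pj_id pj_closed)
qed

lemma gmul_closed: "gmul x y \<in> vcar H"
  unfolding gmul_def by (rule bilin_closed[OF mult_bilin pj_closed pj_closed])

lemma gS_closed: "gS x \<in> vcar H"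
  unfolding gS_def by (rule linmap_closed[OF antipode_lin pj_closed])

lemma map_e_sw2:
  assumes "bilin H H H \<phi>" "a \<in> vcar H"
  shows "e k (sw2 H H \<phi> a) = (\<Sum>b\<in>B. \<Sum>c\<in>B. gdl b c a * e k (\<phi> b c))"
  using map_sw2[OF vspace is_vspace_scalars linmap_e assms] by simp

lemma fd_hopf_axioms_hold: "fd_hopf (vscale H) B e gmul (hone H) gdl gep gS"
proof
  note cl = pj_closed gmul_closed gS_closed one_closed
  note hm_l = bilin_left[OF mult_bilin] and hm_r = bilin_right[OF mult_bilin]
  fix x y z a b c d p q k
  show "finite B" by (rule fin_B)
  show "e b (x + y) = e b x + e b y" "e b (vscale H k x) = k * e b x" by (simp_all add: e_add e_scale)
  show "b \<in> B \<Longrightarrow> c \<in> B \<Longrightarrow> e b c = (if b = c then 1 else 0)" by (rule e_basis)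
  show "gmul x y = (\<Sum>b\<in>B. vscale H (e b x) (gmul b y))"
    unfolding gmul_def using linmap_pj[OF vspace hm_l[OF pj_closed]] by (simp add: pj_id B_car)
  show "gmul x y = (\<Sum>b\<in>B. vscale H (e b y) (gmul x b))"
    unfolding gmul_def using linmap_pj[OF vspace hm_r[OF pj_closed]] by (simp add: pj_id B_car)
  show "gdl p q x = (\<Sum>b\<in>B. e b x * gdl p q b)"
    unfolding gdl_def using linmap_pj[OF is_vspace_scalars linmap_comp[OF comult_lin linmap_fscale_eval(1)]]
    by (simp add: pj_id B_car)
  show "gep x = (\<Sum>b\<in>B. e b x * gep b)"
    unfolding gep_def using linmap_pj[OF is_vspace_scalars counit_lin] by (simp add: pj_id B_car)
  show "gS x = (\<Sum>b\<in>B. vscale H (e b x) (gS b))"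
    unfolding gS_def using linmap_pj[OF vspace antipode_lin] by (simp add: pj_id B_car)
  show "(\<Sum>b\<in>B. vscale H (e b (gmul x y)) b) = gmul x y" "(\<Sum>b\<in>B. vscale H (e b (gS x)) b) = gS x"
    "(\<Sum>b\<in>B. vscale H (e b (hone H)) b) = hone H"
    by (simp_all add: basis_expand cl)
  show "gmul (gmul x y) z = gmul x (gmul y z)"
    by (simp add: gmul_def pj_id bilin_closed[OF mult_bilin] pj_closed mult_assoc)
  show "gmul (hone H) x = (\<Sum>b\<in>B. vscale H (e b x) b)"
    using one_left[OF pj_closed[of x]] by (simp add: gmul_def pj_id cl) (simp add: pj_def)
  show "gmul x (hone H) = (\<Sum>b\<in>B. vscale H (e b x) b)"
    using one_right[OF pj_closed[of x]] by (simp add: gmul_def pj_id cl) (simp add: pj_def)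
  show "\<lbrakk>b \<in> B; c \<in> B; d \<in> B\<rbrakk> \<Longrightarrow> (\<Sum>f\<in>B. gdl f d a * gdl b c f) = (\<Sum>f\<in>B. gdl b f a * gdl c d f)"
    by (rule gdl_coassoc)
  have gdl_pj: "gdl b c (pj a) = gdl b c a" for b c a by (simp add: gdl_def pj_id pj_closed)
  have gep_B: "gep b = counit H b" if "b \<in> B" for b by (simp add: gep_def pj_id B_car that)
  have gS_B: "gS b = antipode H b" if "b \<in> B" for b by (simp add: gS_def pj_id B_car that)
  have gmul_car: "gmul x y = hmult H x y" if "x \<in> vcar H" "y \<in> vcar H" for x y
    by (simp add: gmul_def pj_id that)
  have cu: "bilin H H H (\<lambda>a b. vscale H (counit H a) b)" "bilin H H H (\<lambda>a b. vscale H (counit H b) a)"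
    by (rule bilin_scalar_fun[OF vspace counit_lin])+
  show "(\<Sum>b\<in>B. gdl b c a * gep b) = e c a" if c: "c \<in> B"
  proof -
    have "e c a = (\<Sum>b\<in>B. \<Sum>d\<in>B. gdl b d a * (counit H b * e c d))"
      using map_e_sw2[OF cu(1) pj_closed[of a], of c] counit_left[OF pj_closed[of a]]
      by (simp add: gdl_pj e_scale e_pj_basis[OF c])
    also have "\<dots> = (\<Sum>b\<in>B. \<Sum>d\<in>B. e c d * (gdl b d a * counit H b))" by (simp add: ac_simps)
    finally show ?thesis by (simp add: sum_e_basis_left[OF c] gep_B)
  qed
  show "(\<Sum>c\<in>B. gdl b c a * gep c) = e b a" if b: "b \<in> B"
  proof -
    have "e b a = (\<Sum>d\<in>B. \<Sum>c\<in>B. gdl d c a * (counit H c * e b d))"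
      using map_e_sw2[OF cu(2) pj_closed[of a], of b] counit_right[OF pj_closed[of a]]
      by (simp add: gdl_pj e_scale e_pj_basis[OF b])
    also have "\<dots> = (\<Sum>c\<in>B. \<Sum>d\<in>B. e b d * (gdl d c a * counit H c))"
      by (subst sum.swap) (simp add: ac_simps)
    finally show ?thesis by (simp add: sum_e_basis_left[OF b] gep_B)
  qed
  show "gdl b c (gmul x y) =
        (\<Sum>p\<in>B. \<Sum>q\<in>B. gdl p q x * (\<Sum>r\<in>B. \<Sum>u\<in>B. gdl r u y * (e b (gmul p r) * e c (gmul q u))))"
    if bc: "b \<in> B" "c \<in> B"
  proof -
    let ?X = "H \<otimes>\<^sub>s H"
    have X: "is_vspace ?X" by (rule is_vspace_tprod)
    note tl = bilin_left[OF bilin_tensor] and tr = bilin_right[OF bilin_tensor]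
    have 1: "bilin H H ?X (\<lambda>c d. tensor H H (hmult H a c) (hmult H b d))" if "a \<in> vcar H" "b \<in> vcar H" for a b
      by (intro bilinI linmap_comp[OF hm_r tr] linmap_comp[OF hm_r tl] bilin_closed[OF mult_bilin] that)
    have 2: "bilin H H ?X (\<lambda>a b. sw2 H ?X (\<lambda>c d. tensor H H (hmult H a c) (hmult H b d)) (pj y))"
    proof (rule bilinI)
      fix a assume a: "a \<in> vcar H"
      show "linmap H ?X (\<lambda>b. sw2 H ?X (\<lambda>c d. tensor H H (hmult H a c) (hmult H b d)) (pj y))"
      proof (rule linmap_cong[OF _ vspace])
        show "linmap H ?X (\<lambda>b. \<Sum>p\<in>B. \<Sum>q\<in>B. vscale ?X (gdl p q (pj y)) (tensor H H (hmult H a p) (hmult H b q)))"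
          by (intro linmap_sum_fun X linmap_scale_fun linmap_comp[OF hm_l tr] bilin_closed[OF mult_bilin] B_car a)
      qed (rule sw2_expand[OF X 1[OF a] pj_closed, symmetric])
    next
      fix b assume b: "b \<in> vcar H"
      show "linmap H ?X (\<lambda>a. sw2 H ?X (\<lambda>c d. tensor H H (hmult H a c) (hmult H b d)) (pj y))"
      proof (rule linmap_cong[OF _ vspace])
        show "linmap H ?X (\<lambda>a. \<Sum>p\<in>B. \<Sum>q\<in>B. vscale ?X (gdl p q (pj y)) (tensor H H (hmult H a p) (hmult H b q)))"
          by (intro linmap_sum_fun X linmap_scale_fun linmap_comp[OF hm_l tl] bilin_closed[OF mult_bilin] B_car b)
      qed (rule sw2_expand[OF X 1[OF _ b] pj_closed, symmetric])
    qed
    note ev = linmap_fscale_eval(1)[of H H "\<lambda>x y. e b x * e c y"]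
    have "gdl b c (gmul x y) = comult H (hmult H (pj x) (pj y)) (\<lambda>x y. e b x * e c y)"
      by (simp add: gdl_def gmul_def pj_id bilin_closed[OF mult_bilin] pj_closed)
    also have "\<dots> = (\<Sum>p\<in>B. \<Sum>q\<in>B. gdl p q x * (\<Sum>r\<in>B. \<Sum>u\<in>B. gdl r u y *
        tensor H H (hmult H p r) (hmult H q u) (\<lambda>x y. e b x * e c y)))"
      unfolding comult_mult[OF pj_closed pj_closed]
        map_sw2[OF X is_vspace_scalars ev 2 pj_closed]
      by (simp add: map_sw2[OF X is_vspace_scalars ev 1 pj_closed] B_car gdl_pj)
    also have "\<dots> = (\<Sum>p\<in>B. \<Sum>q\<in>B. gdl p q x * (\<Sum>r\<in>B. \<Sum>u\<in>B. gdl r u y * (e b (gmul p r) * e c (gmul q u))))"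
      by (simp add: tensor_e_e gmul_car B_car)
    finally show ?thesis .
  qed
  show "gdl b c (hone H) = e b (hone H) * e c (hone H)"
    by (simp add: gdl_def pj_id one_closed comult_one tensor_e_e)
  show "gep (gmul x y) = gep x * gep y"
    by (simp add: gep_def gmul_def pj_id bilin_closed[OF mult_bilin] pj_closed counit_mult)
  show "gep (hone H) = 1" by (simp add: gep_def pj_id one_closed counit_one)
  have Sl: "bilin H H H (\<lambda>a b. hmult H (antipode H a) b)"
    by (intro bilinI hm_r linmap_comp[OF antipode_lin hm_l] linmap_closed[OF antipode_lin])
  have Sr: "bilin H H H (\<lambda>a b. hmult H a (antipode H b))"
    by (intro bilinI hm_l linmap_comp[OF antipode_lin hm_r] linmap_closed[OF antipode_lin])
  have S_car: "antipode H x \<in> vcar H" if "x \<in> vcar H" for x using linmap_closed[OF antipode_lin that] .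
  show "(\<Sum>p\<in>B. \<Sum>q\<in>B. gdl p q a * e c (gmul (gS p) q)) = gep a * e c (hone H)"
    using map_e_sw2[OF Sl pj_closed[of a], of c] antipode_left[OF pj_closed[of a]]
    by (simp add: gdl_pj gS_B gmul_car B_car S_car e_scale gep_def)
  show "(\<Sum>p\<in>B. \<Sum>q\<in>B. gdl p q a * e c (gmul p (gS q))) = gep a * e c (hone H)"
    using map_e_sw2[OF Sr pj_closed[of a], of c] antipode_right[OF pj_closed[of a]]
    by (simp add: gdl_pj gS_B gmul_car B_car S_car e_scale gep_def)
qed

sublocale fd_hopf "vscale H" B e gmul "hone H" gdl gep gS
  by (rule fd_hopf_axioms_hold)

lemma sw2_eq_sw: "is_vspace X \<Longrightarrow> bilin H H X \<phi> \<Longrightarrow> a \<in> vcar H \<Longrightarrow> sw2 H X \<phi> a = sw (vscale X) \<phi> a"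
  by (simp add: sw2_expand sw_def)

lemma pr_eq_pj: "pr = pj"
  by (simp add: pr_def[abs_def] pj_def[abs_def])

lemma gmul_car: "x \<in> vcar H \<Longrightarrow> y \<in> vcar H \<Longrightarrow> gmul x y = hmult H x y"
  and gep_car: "x \<in> vcar H \<Longrightarrow> gep x = counit H x"
  and gS_car: "x \<in> vcar H \<Longrightarrow> gS x = antipode H x"
  by (simp_all add: gmul_def gep_def gS_def pj_id)

lemma antipode_bij: "bij_betw (antipode H) (vcar H) (vcar H)"
  unfolding bij_betw_def
proof
  have diff: "gS (x - y) = gS x - gS y" for x y
    using hlin_add[OF vector_space_H hlin_S, of "x - y" y] by (simp add: algebra_simps)
  show "inj_on (antipode H) (vcar H)"
  proof (rule inj_onI)
    fix x y assume xy: "x \<in> vcar H" "y \<in> vcar H" "antipode H x = antipode H y"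
    have "x + vscale H (- 1) y \<in> vcar H" by (intro vs_add[OF vspace] vs_scale[OF vspace] xy)
    then have d: "x - y \<in> vcar H" by simp
    have "gS (x - y) = 0" using xy diff by (simp add: gS_car)
    then have "pj (x - y) = 0" using antipode_bijective(1) by (simp add: pr_eq_pj)
    then show "x = y" using pj_id[OF d] by simp
  qed
  show "antipode H ` vcar H = vcar H"
  proof
    show "antipode H ` vcar H \<subseteq> vcar H" using linmap_closed[OF antipode_lin] by auto
    show "vcar H \<subseteq> antipode H ` vcar H"
    proof
      fix x assume "x \<in> vcar H"
      then have "x \<in> range gS" using antipode_bijective(2)[of x] by (simp add: pr_eq_pj pj_id)
      then show "x \<in> antipode H ` vcar H" unfolding gS_def using pj_closed by auto
    qed
  qed
qed

end

text \<open>The coordinate functionals of a basis of the carrier are extended linearly to the whole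
  type, where the coordinate locales evaluate them; the extension is otherwise arbitrary, and
  \<open>pj\<close> is the resulting projection onto the carrier.\<close>

lemma based_hopf_exists:
  fixes H :: "('k::field, 'h::ab_group_add) hopf"
  assumes "hopf_algebra H" and "fin_dim H"
  shows "\<exists>B e. based_hopf H B e"
proof -
  interpret hopf_algebra H by (rule assms(1))
  interpret HV: vector_space "vscale H" by (rule vs_vector_space[OF vspace])
  interpret K: vector_space "(*) :: 'k \<Rightarrow> 'k \<Rightarrow> 'k"
    by unfold_locales (auto simp: algebra_simps)
  interpret HK: vector_space_pair "vscale H" "(*) :: 'k \<Rightarrow> 'k \<Rightarrow> 'k" ..
  obtain B0 where B0: "finite B0" "vcar H \<subseteq> HV.span B0"
    using assms(2) unfolding fin_dim_def by blast
  obtain B where B: "B \<subseteq> vcar H" "HV.independent B" "vcar H \<subseteq> HV.span B"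
    by (rule HV.maximal_independent_subset)
  have fin: "finite B" using HV.independent_span_bound[OF B0(1) B(2)] B(1) B0(2) by blast
  define P where "P b f \<longleftrightarrow> Vector_Spaces.linear (vscale H) (*) f \<and> (\<forall>c\<in>B. f c = (if b = c then 1 else 0))"
    for b and f :: "'h \<Rightarrow> 'k"
  define e where "e b = (SOME f. P b f)" for b
  have e: "P b (e b)" for b
  proof -
    have "\<exists>f. P b f"
      using HK.linear_independent_extend[OF B(2), of "\<lambda>c. if b = c then 1 else 0"] unfolding P_def by blast
    then show ?thesis unfolding e_def by (rule someI_ex)
  qed
  have lin: "Vector_Spaces.linear (vscale H) (*) (e b)" for b using e[of b] by (simp add: P_def)
  have scale: "e b (vscale H k x) = k * e b x" for b k x
    using module_hom.scale[OF lin[of b, unfolded linear_iff_module_hom]] .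
  have add: "e b (x + y) = e b x + e b y" for b x y
    using module_hom.add[OF lin[of b, unfolded linear_iff_module_hom]] .
  have zero: "e b 0 = 0" for b using scale[of b 0 0] by simp
  have basis: "e b c = (if b = c then 1 else 0)" if "c \<in> B" for b c using e[of b] that by (simp add: P_def)
  have "(\<Sum>b\<in>B. vscale H (e b x) b) = x" if "x \<in> HV.span B" for x
    using that
  proof (induction rule: HV.span_induct_alt)
    case base
    then show ?case by (simp add: zero)
  next
    case (step c x y)
    have "(\<Sum>b\<in>B. vscale H (e b x) b) = (\<Sum>b\<in>B. if b = x then b else 0)"
      using step by (intro sum.cong refl) (simp add: basis)
    then have "(\<Sum>b\<in>B. vscale H (e b x) b) = x" using step fin by simp
    then show ?case
      using step by (simp add: add scale HV.scale_left_distrib sum.distrib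
          HV.scale_scale[symmetric] HV.scale_sum_right[symmetric] del: HV.scale_scale)
  qed
  then have "based_hopf H B e"
    using B fin by unfold_locales (auto simp: add scale basis vspace comult_lin)
  then show ?thesis by blast
qed

section \<open>Involutive Hopf bimodules in coordinates\<close>

context based_hopf
begin

lemma gdl_linmap: "linmap H scalars (gdl b c)"
  using hlin_add[OF vector_space_times hlin_dl] hlin_scale[OF vector_space_times hlin_dl]
  by (simp add: linmap_def)

context
  fixes W :: "('k, 'w::ab_group_add, 'z) vspace_scheme"
  assumes W: "is_vspace W"
begin

interpretation WV: vector_space "vscale W" by (rule vs_vector_space[OF W])

lemma linmap_sw:
  assumes Y: "is_vspace Y" and g: "linmap W Y g" and \<phi>: "\<And>a b. a \<in> B \<Longrightarrow> b \<in> B \<Longrightarrow> \<phi> a b \<in> vcar W"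
  shows "g (sw (vscale W) \<phi> h) = sw (vscale Y) (\<lambda>a b. g (\<phi> a b)) h"
proof -
  have "g (sw (vscale W) \<phi> h) = (\<Sum>b\<in>B. g (\<Sum>c\<in>B. vscale W (gdl b c h) (\<phi> b c)))"
    unfolding sw_def by (rule linmap_sum[OF W Y g]) (intro vs_sum[OF W] vs_scale[OF W] \<phi>)
  also have "\<dots> = sw (vscale Y) (\<lambda>a b. g (\<phi> a b)) h"
    unfolding sw_def by (intro sum.cong refl linmap_sum_scale[OF W Y g] \<phi>)
  finally show ?thesis .
qed

lemma sw_closed: "(\<And>a b. a \<in> B \<Longrightarrow> b \<in> B \<Longrightarrow> \<phi> a b \<in> vcar W) \<Longrightarrow> sw (vscale W) \<phi> h \<in> vcar W"
  unfolding sw_def by (intro vs_sum[OF W] vs_scale[OF W])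

lemma linmap_sw_fun:
  "(\<And>a b. a \<in> B \<Longrightarrow> b \<in> B \<Longrightarrow> linmap V W (\<lambda>z. \<phi> a b z)) \<Longrightarrow> linmap V W (\<lambda>z. sw (vscale W) (\<lambda>a b. \<phi> a b z) h)"
  unfolding sw_def by (intro linmap_sum_fun W linmap_scale_fun)

lemma linmap_sw_arg: "(\<And>a b. a \<in> B \<Longrightarrow> b \<in> B \<Longrightarrow> \<phi> a b \<in> vcar W) \<Longrightarrow> linmap H W (sw (vscale W) \<phi>)"
  unfolding sw_def
  by (intro linmap_sum_fun W linmap_scalar_fun gdl_linmap)

lemma hlin_of_linmap: "linmap H W f \<Longrightarrow> hlin (vscale W) (\<lambda>a. f (pj a))"
  unfolding hlin_def using linmap_pj[OF W] by (simp add: pj_id B_car)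

lemma sw_counit_right_car:
  assumes "linmap H W f" "a \<in> vcar H"
  shows "sw (vscale W) (\<lambda>x y. vscale W (gep y) (f x)) a = f a"
proof -
  have "sw (vscale W) (\<lambda>x y. vscale W (gep y) (f (pj x))) a = f (pj a)"
    by (rule sw_counit_right[OF WV.vector_space_axioms hlin_of_linmap[OF assms(1)]])
  moreover have "sw (vscale W) (\<lambda>x y. vscale W (gep y) (f (pj x))) a = sw (vscale W) (\<lambda>x y. vscale W (gep y) (f x)) a"
    by (rule sw_cong) (simp add: pj_id B_car)
  ultimately show ?thesis by (simp add: pj_id assms(2))
qed

lemma sw_counit_left_car:
  assumes "linmap H W f" "a \<in> vcar H"
  shows "sw (vscale W) (\<lambda>x y. vscale W (gep x) (f y)) a = f a"
proof -
  have "sw (vscale W) (\<lambda>x y. vscale W (gep x) (f (pj y))) a = f (pj a)"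
    by (rule sw_counit_left[OF WV.vector_space_axioms hlin_of_linmap[OF assms(1)]])
  moreover have "sw (vscale W) (\<lambda>x y. vscale W (gep x) (f (pj y))) a = sw (vscale W) (\<lambda>x y. vscale W (gep x) (f y)) a"
    by (rule sw_cong) (simp add: pj_id B_car)
  ultimately show ?thesis by (simp add: pj_id assms(2))
qed

lemma sw_one_car:
  assumes "bilin H H W \<phi>"
  shows "sw (vscale W) \<phi> (hone H) = \<phi> (hone H) (hone H)"
proof -
  have "sw (vscale W) \<phi> (hone H) = sw2 H W \<phi> (hone H)"
    by (rule sw2_eq_sw[OF W assms one_closed, symmetric])
  also have "\<dots> = \<phi> (hone H) (hone H)"
    unfolding sw2_def comult_one by (rule tensor_universal(2)[OF W assms one_closed one_closed])
  finally show ?thesis .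
qed

lemma left_comodule_counit:
  assumes "left_comodule H W co" "n \<in> vcar W"
  shows "(\<Sum>b\<in>B. vscale W (gep b) (lcf W b (co n))) = n"
  using assms tlift_left_expand[OF W W bilin_scalar_fun(1)[OF W counit_lin], of "co n"]
  unfolding left_comodule_def by (auto simp: linmap_closed gep_car B_car cong: sum.cong)

lemma right_comodule_counit:
  assumes "right_comodule H W co" "n \<in> vcar W"
  shows "(\<Sum>b\<in>B. vscale W (gep b) (rcf W b (co n))) = n"
  using assms tlift_right_expand[OF W W bilin_scalar_fun(2)[OF W counit_lin], of "co n"]
  unfolding right_comodule_def by (auto simp: linmap_closed gep_car B_car cong: sum.cong)

lemma right_comodule_mul:
  assumes co: "right_comodule H W co" and n: "n \<in> vcar W" and bc: "b \<in> B" "c \<in> B"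
  shows "rcf W b (co (rcf W c (co n))) = (\<Sum>d\<in>B. vscale W (gdl b c d) (rcf W d (co n)))"
proof -
  let ?X = "W \<otimes>\<^sub>s H \<otimes>\<^sub>s H"
  have X: "is_vspace ?X" by (rule is_vspace_tprod)
  have co_lin: "linmap W (W \<otimes>\<^sub>s H) co" using co by (simp add: right_comodule_def)
  then have co_n: "co n \<in> vcar (W \<otimes>\<^sub>s H)" if "n \<in> vcar W" for n using that by (rule linmap_closed)
  let ?t = "\<lambda>b. rcf W b (co n)"
  have t: "?t b \<in> vcar W" for b by (rule rcf_closed[OF W co_n[OF n]])
  define \<theta> where "\<theta> w u = vscale W (u (\<lambda>x y. e b x * e c y)) w" for w and u :: "('h \<Rightarrow> 'h \<Rightarrow> 'k) \<Rightarrow> 'k"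
  have \<theta>: "bilin W (H \<otimes>\<^sub>s H) W \<theta>"
    unfolding \<theta>_def
    by (intro bilinI linmap_scale_fun[OF W] linmap_id linmap_scalar_fun[OF W] linmap_fscale_eval)
  let ?g = "tlift W (H \<otimes>\<^sub>s H) W \<theta>"
  have g: "linmap ?X W ?g" by (rule tensor_universal(1)[OF W \<theta>])
  note gt = tensor_universal(2)[OF W \<theta>]
  note tl = bilin_left[OF bilin_tensor] and tr = bilin_right[OF bilin_tensor]
  have 1: "bilin W H ?X (\<lambda>n'' y. tensor W (H \<otimes>\<^sub>s H) n'' (tensor H H y x))" if "x \<in> vcar H" for x
    by (intro bilinI linmap_comp[OF tl tr] tl tensor_closed that)
  have 2: "bilin W H ?X (\<lambda>n' x. tlift W H ?X (\<lambda>n'' y. tensor W (H \<otimes>\<^sub>s H) n'' (tensor H H y x)) (co n'))"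
  proof (rule bilinI)
    fix n' assume n': "n' \<in> vcar W"
    show "linmap H ?X (\<lambda>x. tlift W H ?X (\<lambda>n'' y. tensor W (H \<otimes>\<^sub>s H) n'' (tensor H H y x)) (co n'))"
    proof (rule linmap_cong[OF _ vspace])
      show "linmap H ?X (\<lambda>x. \<Sum>b\<in>B. tensor W (H \<otimes>\<^sub>s H) (rcf W b (co n')) (tensor H H b x))"
        by (intro linmap_sum_fun X linmap_comp[OF tr tr] rcf_closed[OF W] co_n n' B_car)
    qed (rule tlift_right_expand[OF W X 1 co_n[OF n'], symmetric])
  qed (intro linmap_tlift_arg X 1 co_lin)
  have 3: "bilin W H ?X (\<lambda>n' x. tensor W (H \<otimes>\<^sub>s H) n' (comult H x))"
    by (intro bilinI linmap_comp[OF comult_lin tr] tl linmap_closed[OF comult_lin])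
  have "?g (tlift W H ?X (\<lambda>n' x. tlift W H ?X (\<lambda>n'' y. tensor W (H \<otimes>\<^sub>s H) n'' (tensor H H y x)) (co n')) (co n)) =
      (\<Sum>d\<in>B. ?g (tlift W H ?X (\<lambda>n'' y. tensor W (H \<otimes>\<^sub>s H) n'' (tensor H H y d)) (co (?t d))))"
    unfolding tlift_right_expand[OF W X 2 co_n[OF n]]
    by (rule linmap_sum[OF X W g]) (rule linmap_closed[OF tensor_universal(1)[OF X 1[OF B_car]] co_n[OF t]])
  also have "\<dots> = (\<Sum>d\<in>B. \<Sum>p\<in>B. ?g (tensor W (H \<otimes>\<^sub>s H) (rcf W p (co (?t d))) (tensor H H p d)))"
  proof (rule sum.cong[OF refl])
    fix d assume d: "d \<in> B"
    show "?g (tlift W H ?X (\<lambda>n'' y. tensor W (H \<otimes>\<^sub>s H) n'' (tensor H H y d)) (co (?t d))) =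
        (\<Sum>p\<in>B. ?g (tensor W (H \<otimes>\<^sub>s H) (rcf W p (co (?t d))) (tensor H H p d)))"
      unfolding tlift_right_expand[OF W X 1[OF B_car[OF d]] co_n[OF t]]
      by (rule linmap_sum[OF X W g]) (intro tensor_closed rcf_closed[OF W] co_n t B_car d)
  qed
  also have "\<dots> = (\<Sum>d\<in>B. \<Sum>p\<in>B. vscale W (e b p * e c d) (rcf W p (co (?t d))))"
    by (intro sum.cong refl) (simp add: gt tensor_closed rcf_closed[OF W] co_n t B_car \<theta>_def tensor_e_e)
  also have "\<dots> = (\<Sum>d\<in>B. vscale W (e c d) (\<Sum>p\<in>B. vscale W (e b p) (rcf W p (co (?t d)))))"
    by (simp add: WV.scale_sum_right mult.commute)
  also have "\<dots> = rcf W b (co (?t c))"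
    by (simp add: sum_e_vec[OF W] bc)
  finally have lhs: "?g (tlift W H ?X (\<lambda>n' x. tlift W H ?X (\<lambda>n'' y. tensor W (H \<otimes>\<^sub>s H) n'' (tensor H H y x)) (co n')) (co n)) =
      rcf W b (co (?t c))" .
  have "?g (tlift W H ?X (\<lambda>n' x. tensor W (H \<otimes>\<^sub>s H) n' (comult H x)) (co n)) =
      (\<Sum>d\<in>B. ?g (tensor W (H \<otimes>\<^sub>s H) (?t d) (comult H d)))"
    unfolding tlift_right_expand[OF W X 3 co_n[OF n]]
    by (rule linmap_sum[OF X W g]) (intro tensor_closed B_car t linmap_closed[OF comult_lin])
  also have "\<dots> = (\<Sum>d\<in>B. vscale W (gdl b c d) (?t d))"
    by (intro sum.cong refl) (simp add: gt B_car t linmap_closed[OF comult_lin] \<theta>_def gdl_def pj_id)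
  finally show ?thesis
    using lhs co n by (simp add: right_comodule_def)
qed

end

end

locale based_bimodule = based_hopf H B e + M: involutive_hopf_bimodule H M
  for H :: "('k::field, 'h::ab_group_add) hopf" and B :: "'h set" and e :: "'h \<Rightarrow> 'h \<Rightarrow> 'k"
    and M :: "('k, 'h, 'm::ab_group_add) hbimod"
begin

sublocale MV: vector_space "vscale M" by (rule vs_vector_space[OF M.vspace])

abbreviation (input) "sM \<equiv> vscale M"

text \<open>\<open>lam b\<close> and \<open>mu b\<close> are the operators by which the coordinate
  functional of \<open>b\<close> acts on \<open>M\<close> through the left and the right
  coaction.\<close>

definition lam :: "'h \<Rightarrow> 'm \<Rightarrow> 'm" where "lam b m = lcf M b (lco M m)"
definition mu :: "'h \<Rightarrow> 'm \<Rightarrow> 'm" where "mu b m = rcf M b (rco M m)"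

definition Sii :: "'h \<Rightarrow> 'h" where "Sii g = antipode_inv H (antipode_inv H g)"

lemma lco_lin: "linmap M (H \<otimes>\<^sub>s M) (lco M)" and rco_lin: "linmap M (M \<otimes>\<^sub>s H) (rco M)"
  using M.left_comodule M.right_comodule by (simp_all add: left_comodule_def right_comodule_def)

lemma lam_lin: "linmap M M (lam b)" and mu_lin: "linmap M M (mu b)"
  unfolding lam_def[abs_def] mu_def[abs_def]
  by (rule linmap_comp[OF lco_lin linmap_lcf[OF M.vspace]] linmap_comp[OF rco_lin linmap_rcf[OF M.vspace]])+

lemmas lam_closed = linmap_closed[OF lam_lin] and mu_closed = linmap_closed[OF mu_lin]

lemma lact_bilin: "bilin H M M (lact M)" and ract_bilin: "bilin M H M (ract M)"
  using M.left_module M.right_module by (simp_all add: left_module_def right_module_def)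

lemma antipode_inv_lin: "linmap H H (antipode_inv H)"
proof -
  have inj: "inj_on (antipode H) (vcar H)" and img: "antipode H ` vcar H = vcar H"
    using antipode_bij by (simp_all add: bij_betw_def)
  have f: "antipode_inv H x \<in> vcar H" "antipode H (antipode_inv H x) = x" if "x \<in> vcar H" for x
    using that inv_into_into[of x "antipode H" "vcar H"] f_inv_into_f[of x "antipode H" "vcar H"]
    by (simp_all add: antipode_inv_def img)
  have eq: "antipode_inv H x = y" if "y \<in> vcar H" "antipode H y = x" for x y
    using inv_into_f_f[OF inj that(1)] that(2) by (simp add: antipode_inv_def)
  show ?thesis
    unfolding linmap_def
  proof (intro conjI ballI allI)
    fix x y assume xy: "x \<in> vcar H" "y \<in> vcar H"
    show "antipode_inv H (x + y) = antipode_inv H x + antipode_inv H y"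
      by (rule eq) (simp_all add: f xy vs_add[OF vspace] linmap_add[OF antipode_lin])
  next
    fix c x assume x: "x \<in> vcar H"
    show "antipode_inv H (vscale H c x) = vscale H c (antipode_inv H x)"
      by (rule eq) (simp_all add: f x vs_scale[OF vspace] linmap_scale[OF antipode_lin])
  qed (rule f)
qed

lemma antipode_antipode_inv: "x \<in> vcar H \<Longrightarrow> antipode H (antipode_inv H x) = x"
  unfolding antipode_inv_def using antipode_bij by (simp add: bij_betw_def f_inv_into_f)

lemma antipode_inv_antipode: "x \<in> vcar H \<Longrightarrow> antipode_inv H (antipode H x) = x"
  unfolding antipode_inv_def using antipode_bij by (simp add: bij_betw_def inv_into_f_f)

lemma Sii_lin: "linmap H H Sii"
  unfolding Sii_def[abs_def] by (rule linmap_comp[OF antipode_inv_lin antipode_inv_lin])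

lemma gep_Sii: "g \<in> vcar H \<Longrightarrow> gep (Sii g) = gep g"
proof -
  have *: "gep (antipode_inv H g) = gep g" if "g \<in> vcar H" for g
    using ep_S[of "antipode_inv H g"] that
    by (simp add: gS_car linmap_closed[OF antipode_inv_lin] antipode_antipode_inv)
  show "g \<in> vcar H \<Longrightarrow> gep (Sii g) = gep g"
    by (simp add: Sii_def * linmap_closed[OF antipode_inv_lin])
qed

lemma hmult_lin_left: "linmap V H f \<Longrightarrow> z \<in> vcar H \<Longrightarrow> linmap V H (\<lambda>x. hmult H (f x) z)"
  and hmult_lin_right: "linmap V H f \<Longrightarrow> z \<in> vcar H \<Longrightarrow> linmap V H (\<lambda>x. hmult H z (f x))"
  and lact_lin_left: "linmap V H f \<Longrightarrow> n \<in> vcar M \<Longrightarrow> linmap V M (\<lambda>x. lact M (f x) n)"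
  and lact_lin_right: "linmap V M g \<Longrightarrow> z \<in> vcar H \<Longrightarrow> linmap V M (\<lambda>x. lact M z (g x))"
  and ract_lin_left: "linmap V M g \<Longrightarrow> z \<in> vcar H \<Longrightarrow> linmap V M (\<lambda>x. ract M (g x) z)"
  and ract_lin_right: "linmap V H f \<Longrightarrow> n \<in> vcar M \<Longrightarrow> linmap V M (\<lambda>x. ract M n (f x))"
  and Sii_lin_comp: "linmap V H f \<Longrightarrow> linmap V H (\<lambda>x. Sii (f x))"
  and antipode_lin_comp: "linmap V H f \<Longrightarrow> linmap V H (\<lambda>x. antipode H (f x))"
  by (rule linmap_comp, assumption, (rule bilin_left[OF mult_bilin] bilin_right[OF mult_bilin] bilin_left[OF lact_bilin]
      bilin_right[OF lact_bilin] bilin_left[OF ract_bilin] bilin_right[OF ract_bilin] Sii_lin antipode_lin), assumption?)+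

lemma tensor_lin_left: "linmap V U f \<Longrightarrow> y \<in> vcar W \<Longrightarrow> linmap V (U \<otimes>\<^sub>s W) (\<lambda>x. tensor U W (f x) y)"
  and tensor_lin_right: "linmap V W g \<Longrightarrow> z \<in> vcar U \<Longrightarrow> linmap V (U \<otimes>\<^sub>s W) (\<lambda>x. tensor U W z (g x))"
  by (rule linmap_comp, assumption, (rule bilin_left[OF bilin_tensor] bilin_right[OF bilin_tensor]), assumption)+

lemmas lin_intros = hmult_lin_left hmult_lin_right lact_lin_left lact_lin_right ract_lin_left
  ract_lin_right Sii_lin_comp antipode_lin_comp tensor_lin_left tensor_lin_right linmap_id

lemmas closed_simps = B_car one_closed bilin_closed[OF mult_bilin] bilin_closed[OF lact_bilin] bilin_closed[OF ract_bilin]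
  linmap_closed[OF Sii_lin] linmap_closed[OF antipode_lin] lam_closed mu_closed tensor_closed

lemma sw3_eq_sw:
  assumes X: "is_vspace X" and h: "h \<in> vcar H"
    and 1: "\<And>b c. b \<in> vcar H \<Longrightarrow> c \<in> vcar H \<Longrightarrow> linmap H X (\<lambda>a. \<phi> a b c)"
    and 2: "\<And>a c. a \<in> vcar H \<Longrightarrow> c \<in> vcar H \<Longrightarrow> linmap H X (\<lambda>b. \<phi> a b c)"
    and 3: "\<And>a b. a \<in> vcar H \<Longrightarrow> b \<in> vcar H \<Longrightarrow> linmap H X (\<lambda>c. \<phi> a b c)"
  shows "sw3 H X \<phi> h = sw (vscale X) (\<lambda>a b. sw (vscale X) (\<phi> a) b) h"
proof -
  have bi: "bilin H H X (\<phi> a)" if "a \<in> vcar H" for a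
    using that by (intro bilinI 2 3)
  have eq: "sw2 H X (\<phi> a) b = sw (vscale X) (\<phi> a) b" if "a \<in> vcar H" "b \<in> vcar H" for a b
    by (rule sw2_eq_sw[OF X bi[OF that(1)] that(2)])
  have "bilin H H X (\<lambda>a b. sw2 H X (\<phi> a) b)"
  proof (rule bilinI)
    fix b assume b: "b \<in> vcar H"
    show "linmap H X (\<lambda>a. sw2 H X (\<phi> a) b)"
    proof (rule linmap_cong[OF _ vspace])
      show "linmap H X (\<lambda>a. sw (vscale X) (\<phi> a) b)"
        by (rule linmap_sw_fun[OF X]) (simp add: 1 B_car)
    qed (simp add: eq b)
  qed (intro linmap_sw2 X bi)
  then have "sw3 H X \<phi> h = sw (vscale X) (\<lambda>a b. sw2 H X (\<phi> a) b) h"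
    unfolding sw3_def by (rule sw2_eq_sw[OF X _ h])
  also have "\<dots> = sw (vscale X) (\<lambda>a b. sw (vscale X) (\<phi> a) b) h"
    by (rule sw_cong) (simp add: eq B_car)
  finally show ?thesis .
qed

lemma bico_expand:
  assumes X: "is_vspace X" and m: "m \<in> vcar M"
    and 1: "\<And>n y. n \<in> vcar M \<Longrightarrow> y \<in> vcar H \<Longrightarrow> linmap H X (\<lambda>x. \<phi> x n y)"
    and 2: "\<And>x y. x \<in> vcar H \<Longrightarrow> y \<in> vcar H \<Longrightarrow> linmap M X (\<lambda>n. \<phi> x n y)"
    and 3: "\<And>x n. x \<in> vcar H \<Longrightarrow> n \<in> vcar M \<Longrightarrow> linmap H X (\<lambda>y. \<phi> x n y)"
  shows "bico_sw H M X \<phi> m = (\<Sum>b\<in>B. \<Sum>c\<in>B. \<phi> b (mu c (lam b m)) c)"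
proof -
  have bi: "bilin M H X (\<lambda>n y. \<phi> x n y)" if "x \<in> vcar H" for x
    using that by (intro bilinI 2 3)
  have r: "rco M n \<in> vcar (M \<otimes>\<^sub>s H)" if "n \<in> vcar M" for n
    by (rule linmap_closed[OF rco_lin that])
  have eq: "tlift M H X (\<lambda>n' y. \<phi> x n' y) (rco M n) = (\<Sum>c\<in>B. \<phi> x (mu c n) c)" if "x \<in> vcar H" "n \<in> vcar M" for x n
    using tlift_right_expand[OF M.vspace X bi[OF that(1)] r[OF that(2)]] by (simp add: mu_def)
  have "bilin H M X (\<lambda>x n. tlift M H X (\<lambda>n' y. \<phi> x n' y) (rco M n))"
  proof (rule bilinI)
    fix n assume n: "n \<in> vcar M"
    show "linmap H X (\<lambda>x. tlift M H X (\<lambda>n' y. \<phi> x n' y) (rco M n))"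
    proof (rule linmap_cong[OF _ vspace])
      show "linmap H X (\<lambda>x. \<Sum>c\<in>B. \<phi> x (mu c n) c)"
        by (intro linmap_sum_fun X 1 mu_closed n B_car)
    qed (simp add: eq n)
  qed (intro linmap_tlift_arg X bi rco_lin)
  then have "bico_sw H M X \<phi> m = (\<Sum>b\<in>B. tlift M H X (\<lambda>n' y. \<phi> b n' y) (rco M (lam b m)))"
    unfolding bico_sw_def lam_def by (rule tlift_left_expand[OF M.vspace X _ linmap_closed[OF lco_lin m]])
  also have "\<dots> = (\<Sum>b\<in>B. \<Sum>c\<in>B. \<phi> b (mu c (lam b m)) c)"
    by (intro sum.cong refl eq B_car lam_closed m)
  finally show ?thesis .
qed

text \<open>The \<open>M\<close>-valued coefficient of an element of the threefold tensor product at
  \<open>b\<close> and \<open>c\<close> in the two outer factors.\<close>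

definition triple :: "'h \<Rightarrow> 'h \<Rightarrow> (('h \<Rightarrow> (('m \<Rightarrow> 'h \<Rightarrow> 'k) \<Rightarrow> 'k) \<Rightarrow> 'k) \<Rightarrow> 'k) \<Rightarrow> 'm" where
  "triple b c = tlift H (M \<otimes>\<^sub>s H) M (\<lambda>x u. vscale M (e b x) (rcf M c u))"

lemma triple_bilin: "bilin H (M \<otimes>\<^sub>s H) M (\<lambda>x u. vscale M (e b x) (rcf M c u))"
  by (intro bilinI linmap_scale_fun linmap_scalar_fun M.vspace linmap_rcf linmap_e rcf_closed)

lemma triple_lin: "linmap (H \<otimes>\<^sub>s M \<otimes>\<^sub>s H) M (triple b c)"
  unfolding triple_def by (rule tensor_universal(1)[OF M.vspace triple_bilin])

lemma triple_tensor: "x \<in> vcar H \<Longrightarrow> n \<in> vcar M \<Longrightarrow> y \<in> vcar H \<Longrightarrow>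
    triple b c (tensor H (M \<otimes>\<^sub>s H) x (tensor M H n y)) = vscale M (e b x * e c y) n"
  unfolding triple_def
  by (subst tensor_universal(2)[OF M.vspace triple_bilin]) (simp_all add: tensor_closed rcf_tensor[OF M.vspace])

lemma triple_bico:
  assumes m: "m \<in> vcar M" and bc: "b \<in> B" "c \<in> B"
  shows "triple b c (bico_sw H M (H \<otimes>\<^sub>s M \<otimes>\<^sub>s H) (\<lambda>x n y. tensor H (M \<otimes>\<^sub>s H) x (tensor M H n y)) m) =
    mu c (lam b m)"
proof -
  let ?X = "H \<otimes>\<^sub>s M \<otimes>\<^sub>s H"
  have "bico_sw H M ?X (\<lambda>x n y. tensor H (M \<otimes>\<^sub>s H) x (tensor M H n y)) m =
      (\<Sum>b\<in>B. \<Sum>c\<in>B. tensor H (M \<otimes>\<^sub>s H) b (tensor M H (mu c (lam b m)) c))"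
    by (rule bico_expand[OF is_vspace_tprod m]) (simp_all add: lin_intros closed_simps)
  moreover have "triple b c (\<Sum>b\<in>B. \<Sum>c\<in>B. tensor H (M \<otimes>\<^sub>s H) b (tensor M H (mu c (lam b m)) c)) =
      (\<Sum>p\<in>B. \<Sum>q\<in>B. triple b c (tensor H (M \<otimes>\<^sub>s H) p (tensor M H (mu q (lam p m)) q)))"
    by (subst linmap_sum[OF is_vspace_tprod M.vspace triple_lin])
      (auto intro!: vs_sum[OF is_vspace_tprod] sum.cong linmap_sum[OF is_vspace_tprod M.vspace triple_lin]
        simp: closed_simps m)
  moreover have "\<dots> = (\<Sum>p\<in>B. vscale M (e b p) (\<Sum>q\<in>B. vscale M (e c q) (mu q (lam p m))))"
    by (simp add: triple_tensor closed_simps m MV.scale_sum_right)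
  ultimately show ?thesis by (simp add: sum_e_vec[OF M.vspace] bc)
qed

lemma mu_lam: "m \<in> vcar M \<Longrightarrow> b \<in> B \<Longrightarrow> c \<in> B \<Longrightarrow> lam b (mu c m) = mu c (lam b m)"
proof -
  assume m: "m \<in> vcar M" and bc: "b \<in> B" "c \<in> B"
  let ?X = "H \<otimes>\<^sub>s M \<otimes>\<^sub>s H"
  have X: "is_vspace ?X" by (rule is_vspace_tprod)
  have l: "lco M n \<in> vcar (H \<otimes>\<^sub>s M)" if "n \<in> vcar M" for n
    by (rule linmap_closed[OF lco_lin that])
  have 1: "bilin H M ?X (\<lambda>x n'. tensor H (M \<otimes>\<^sub>s H) x (tensor M H n' y))" if "y \<in> vcar H" for y
    by (rule bilinI) (simp_all add: lin_intros closed_simps that)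
  have eq: "tlift H M ?X (\<lambda>x n'. tensor H (M \<otimes>\<^sub>s H) x (tensor M H n' y)) (lco M n) =
      (\<Sum>b\<in>B. tensor H (M \<otimes>\<^sub>s H) b (tensor M H (lam b n) y))" if "y \<in> vcar H" "n \<in> vcar M" for y n
    using tlift_left_expand[OF M.vspace X 1[OF that(1)] l[OF that(2)]] by (simp add: lam_def)
  have 2: "bilin M H ?X (\<lambda>n y. tlift H M ?X (\<lambda>x n'. tensor H (M \<otimes>\<^sub>s H) x (tensor M H n' y)) (lco M n))"
  proof (rule bilinI)
    fix n assume n: "n \<in> vcar M"
    show "linmap H ?X (\<lambda>y. tlift H M ?X (\<lambda>x n'. tensor H (M \<otimes>\<^sub>s H) x (tensor M H n' y)) (lco M n))"
    proof (rule linmap_cong[OF _ vspace])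
      show "linmap H ?X (\<lambda>y. \<Sum>b\<in>B. tensor H (M \<otimes>\<^sub>s H) b (tensor M H (lam b n) y))"
        by (intro linmap_sum_fun X lin_intros closed_simps n)
    qed (simp add: eq n)
  qed (intro linmap_tlift_arg X 1 lco_lin)
  have "tlift M H ?X (\<lambda>n y. tlift H M ?X (\<lambda>x n'. tensor H (M \<otimes>\<^sub>s H) x (tensor M H n' y)) (lco M n)) (rco M m) =
      (\<Sum>q\<in>B. \<Sum>p\<in>B. tensor H (M \<otimes>\<^sub>s H) p (tensor M H (lam p (mu q m)) q))"
    unfolding tlift_right_expand[OF M.vspace X 2 linmap_closed[OF rco_lin m]]
    by (intro sum.cong refl) (simp add: eq B_car mu_closed m flip: mu_def)
  moreover have "triple b c (\<Sum>q\<in>B. \<Sum>p\<in>B. tensor H (M \<otimes>\<^sub>s H) p (tensor M H (lam p (mu q m)) q)) =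
      (\<Sum>q\<in>B. \<Sum>p\<in>B. triple b c (tensor H (M \<otimes>\<^sub>s H) p (tensor M H (lam p (mu q m)) q)))"
    by (subst linmap_sum[OF is_vspace_tprod M.vspace triple_lin])
      (auto intro!: vs_sum[OF is_vspace_tprod] sum.cong linmap_sum[OF is_vspace_tprod M.vspace triple_lin]
        simp: closed_simps m)
  moreover have "\<dots> = (\<Sum>q\<in>B. vscale M (e c q) (\<Sum>p\<in>B. vscale M (e b p) (lam p (mu q m))))"
    by (simp add: triple_tensor closed_simps m MV.scale_sum_right mult.commute)
  ultimately have "triple b c (tlift M H ?X (\<lambda>n y. tlift H M ?X
      (\<lambda>x n'. tensor H (M \<otimes>\<^sub>s H) x (tensor M H n' y)) (lco M n)) (rco M m)) = lam b (mu c m)"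
    by (simp add: sum_e_vec[OF M.vspace] bc)
  then show ?thesis
    unfolding M.bicomodule[OF m] triple_bico[OF m bc] by simp
qed

lemma lam_counit: "m \<in> vcar M \<Longrightarrow> (\<Sum>b\<in>B. vscale M (gep b) (lam b m)) = m"
  unfolding lam_def by (rule left_comodule_counit[OF M.vspace M.left_comodule])

lemma mu_counit: "m \<in> vcar M \<Longrightarrow> (\<Sum>b\<in>B. vscale M (gep b) (mu b m)) = m"
  unfolding mu_def by (rule right_comodule_counit[OF M.vspace M.right_comodule])

lemma lam_lam: "m \<in> vcar M \<Longrightarrow> b \<in> B \<Longrightarrow> c \<in> B \<Longrightarrow>
    lam c (lam b m) = (\<Sum>d\<in>B. vscale M (gdl b c d) (lam d m))"
  unfolding lam_def by (rule left_comodule_mul[OF M.vspace M.left_comodule])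

lemma mu_mu: "m \<in> vcar M \<Longrightarrow> b \<in> B \<Longrightarrow> c \<in> B \<Longrightarrow>
    mu b (mu c m) = (\<Sum>d\<in>B. vscale M (gdl b c d) (mu d m))"
  unfolding mu_def by (rule right_comodule_mul[OF M.vspace M.right_comodule])

text \<open>The Hopf bimodule law contracted with \<open>triple b c\<close>. The nested Sweedler
  sums are lifts defined by choice, so linearity in each leg has to be established before they can
  be expanded; \<open>linmap_cong\<close> transfers it from the explicit sums over
  \<open>B\<close>.\<close>

lemma mu_lam_act:
  assumes h: "h \<in> vcar H" and m: "m \<in> vcar M" and g: "g \<in> vcar H" and bc: "b \<in> B" "c \<in> B"
  shows "mu c (lam b (ract M (lact M h m) g)) =
    sw sM (\<lambda>h1 h'. sw sM (\<lambda>h2 h3. sw sM (\<lambda>g1 g'. sw sM (\<lambda>g2 g3. \<Sum>x\<in>B. \<Sum>y\<in>B.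
      vscale M (e b (hmult H (hmult H h1 x) g1) * e c (hmult H (hmult H h3 y) (Sii g3)))
        (ract M (lact M h2 (mu y (lam x m))) g2)) g') g) h') h"
proof -
  let ?X = "H \<otimes>\<^sub>s M \<otimes>\<^sub>s H"
  let ?s = "vscale ?X"
  have X: "is_vspace ?X" by (rule is_vspace_tprod)
  define \<phi> where "\<phi> h1 h2 h3 g1 g2 g3 x n y = tensor H (M \<otimes>\<^sub>s H) (hmult H (hmult H h1 x) g1)
      (tensor M H (ract M (lact M h2 n) g2) (hmult H (hmult H h3 y) (Sii g3)))" for h1 h2 h3 g1 g2 g3 x n y
  define \<psi> where "\<psi> h1 h2 h3 g1 g2 g3 = (\<Sum>x\<in>B. \<Sum>y\<in>B. \<phi> h1 h2 h3 g1 g2 g3 x (mu y (lam x m)) y)"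
    for h1 h2 h3 g1 g2 g3
  note LI = lin_intros closed_simps
  have bico: "bico_sw H M ?X (\<phi> h1 h2 h3 g1 g2 g3) m = \<psi> h1 h2 h3 g1 g2 g3"
    if "h1 \<in> vcar H" "h2 \<in> vcar H" "h3 \<in> vcar H" "g1 \<in> vcar H" "g2 \<in> vcar H" "g3 \<in> vcar H"
    for h1 h2 h3 g1 g2 g3
    unfolding \<psi>_def
  proof (rule bico_expand[OF X m])
    fix x n y
    show "n \<in> vcar M \<Longrightarrow> y \<in> vcar H \<Longrightarrow> linmap H ?X (\<lambda>x. \<phi> h1 h2 h3 g1 g2 g3 x n y)"
      and "x \<in> vcar H \<Longrightarrow> y \<in> vcar H \<Longrightarrow> linmap M ?X (\<lambda>n. \<phi> h1 h2 h3 g1 g2 g3 x n y)"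
      and "x \<in> vcar H \<Longrightarrow> n \<in> vcar M \<Longrightarrow> linmap H ?X (\<lambda>y. \<phi> h1 h2 h3 g1 g2 g3 x n y)"
      unfolding \<phi>_def by (simp_all add: lin_intros closed_simps that)
  qed
  have \<psi>_closed: "\<psi> h1 h2 h3 g1 g2 g3 \<in> vcar ?X"
    if "h1 \<in> vcar H" "h2 \<in> vcar H" "h3 \<in> vcar H" "g1 \<in> vcar H" "g2 \<in> vcar H" "g3 \<in> vcar H"
    for h1 h2 h3 g1 g2 g3
    unfolding \<psi>_def \<phi>_def by (intro vs_sum[OF X] closed_simps that m)
  have inner: "sw3 H ?X (\<lambda>g1 g2 g3. bico_sw H M ?X (\<phi> h1 h2 h3 g1 g2 g3) m) g =
      sw ?s (\<lambda>g1 g'. sw ?s (\<psi> h1 h2 h3 g1) g') g"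
    if hs: "h1 \<in> vcar H" "h2 \<in> vcar H" "h3 \<in> vcar H" for h1 h2 h3
  proof -
    have "sw3 H ?X (\<lambda>g1 g2 g3. bico_sw H M ?X (\<phi> h1 h2 h3 g1 g2 g3) m) g =
        sw ?s (\<lambda>g1 g'. sw ?s (\<lambda>g2 g3. bico_sw H M ?X (\<phi> h1 h2 h3 g1 g2 g3) m) g') g"
    proof (rule sw3_eq_sw[OF X g])
      fix b c assume bc: "b \<in> vcar H" "c \<in> vcar H"
      show "linmap H ?X (\<lambda>a. bico_sw H M ?X (\<phi> h1 h2 h3 a b c) m)"
      proof (rule linmap_cong[OF _ vspace])
        show "linmap H ?X (\<lambda>a. \<psi> h1 h2 h3 a b c)"
          unfolding \<psi>_def \<phi>_def by (intro linmap_sum_fun X LI hs bc m)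
      qed (rule bico[OF hs _ bc, symmetric])
      show "linmap H ?X (\<lambda>a. bico_sw H M ?X (\<phi> h1 h2 h3 b a c) m)"
      proof (rule linmap_cong[OF _ vspace])
        show "linmap H ?X (\<lambda>a. \<psi> h1 h2 h3 b a c)"
          unfolding \<psi>_def \<phi>_def by (intro linmap_sum_fun X LI hs bc m)
      qed (rule bico[OF hs bc(1) _ bc(2), symmetric])
      show "linmap H ?X (\<lambda>a. bico_sw H M ?X (\<phi> h1 h2 h3 b c a) m)"
      proof (rule linmap_cong[OF _ vspace])
        show "linmap H ?X (\<lambda>a. \<psi> h1 h2 h3 b c a)"
          unfolding \<psi>_def \<phi>_def by (intro linmap_sum_fun X LI hs bc m)
      qed (rule bico[OF hs bc, symmetric])
    qed
    also have "\<dots> = sw ?s (\<lambda>g1 g'. sw ?s (\<psi> h1 h2 h3 g1) g') g"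
      by (intro sw_cong bico hs B_car)
    finally show ?thesis .
  qed
  let ?F = "\<lambda>h1 h2 h3. sw3 H ?X (\<lambda>g1 g2 g3. bico_sw H M ?X (\<phi> h1 h2 h3 g1 g2 g3) m) g"
  let ?G = "\<lambda>h1 h2 h3. sw ?s (\<lambda>g1 g'. sw ?s (\<psi> h1 h2 h3 g1) g') g"
  have outer: "sw3 H ?X ?F h = sw ?s (\<lambda>h1 h'. sw ?s (?G h1) h') h"
  proof -
    have "sw3 H ?X ?F h = sw ?s (\<lambda>h1 h'. sw ?s (?F h1) h') h"
    proof (rule sw3_eq_sw[OF X h])
      fix b c assume bc: "b \<in> vcar H" "c \<in> vcar H"
      show "linmap H ?X (\<lambda>a. ?F a b c)"
      proof (rule linmap_cong[OF _ vspace])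
        show "linmap H ?X (\<lambda>a. ?G a b c)"
          unfolding \<psi>_def \<phi>_def by (intro linmap_sw_fun X linmap_sum_fun LI bc m)
      qed (rule inner[OF _ bc, symmetric])
      show "linmap H ?X (\<lambda>a. ?F b a c)"
      proof (rule linmap_cong[OF _ vspace])
        show "linmap H ?X (\<lambda>a. ?G b a c)"
          unfolding \<psi>_def \<phi>_def by (intro linmap_sw_fun X linmap_sum_fun LI bc m)
      qed (rule inner[OF bc(1) _ bc(2), symmetric])
      show "linmap H ?X (\<lambda>a. ?F b c a)"
      proof (rule linmap_cong[OF _ vspace])
        show "linmap H ?X (\<lambda>a. ?G b c a)"
          unfolding \<psi>_def \<phi>_def by (intro linmap_sw_fun X linmap_sum_fun LI bc m)
      qed (rule inner[OF bc, symmetric])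
    qed
    also have "\<dots> = sw ?s (\<lambda>h1 h'. sw ?s (?G h1) h') h"
      by (rule sw_cong, rule sw_cong, rule inner) (simp_all add: B_car)
    finally show ?thesis .
  qed
  have "mu c (lam b (ract M (lact M h m) g)) = triple b c (sw ?s (\<lambda>h1 h'. sw ?s (?G h1) h') h)"
    using triple_bico[of "ract M (lact M h m) g", OF _ bc] M.hopf_bimodule[OF h m g] outer h m g
    by (simp add: closed_simps \<phi>_def[abs_def] flip: Sii_def)
  also have "\<dots> = sw sM (\<lambda>h1 h'. sw sM (\<lambda>h2 h3. sw sM (\<lambda>g1 g'. sw sM (\<lambda>g2 g3.
      triple b c (\<psi> h1 h2 h3 g1 g2 g3)) g') g) h') h"
  proof -
    note T = linmap_sw[OF X M.vspace triple_lin] and C = sw_closed[OF X]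
    have "triple b c (sw ?s (\<lambda>h1 h'. sw ?s (?G h1) h') h) =
        sw sM (\<lambda>h1 h'. triple b c (sw ?s (?G h1) h')) h"
      by (rule T) (intro C \<psi>_closed B_car)
    also have "\<dots> = sw sM (\<lambda>h1 h'. sw sM (\<lambda>h2 h3. triple b c (?G h1 h2 h3)) h') h"
      by (rule sw_cong, rule T) (intro C \<psi>_closed B_car)
    also have "\<dots> = sw sM (\<lambda>h1 h'. sw sM (\<lambda>h2 h3. sw sM (\<lambda>g1 g'. triple b c (sw ?s (\<psi> h1 h2 h3 g1) g')) g) h') h"
      by (rule sw_cong, rule sw_cong, rule T) (intro C \<psi>_closed B_car)
    also have "\<dots> = sw sM (\<lambda>h1 h'. sw sM (\<lambda>h2 h3. sw sM (\<lambda>g1 g'. sw sM (\<lambda>g2 g3.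
        triple b c (\<psi> h1 h2 h3 g1 g2 g3)) g') g) h') h"
      by (rule sw_cong, rule sw_cong, rule sw_cong, rule T) (intro \<psi>_closed B_car)
    finally show ?thesis .
  qed
  also have "\<dots> = sw sM (\<lambda>h1 h'. sw sM (\<lambda>h2 h3. sw sM (\<lambda>g1 g'. sw sM (\<lambda>g2 g3. \<Sum>x\<in>B. \<Sum>y\<in>B.
      vscale M (e b (hmult H (hmult H h1 x) g1) * e c (hmult H (hmult H h3 y) (Sii g3)))
        (ract M (lact M h2 (mu y (lam x m))) g2)) g') g) h') h"
  proof (intro sw_cong)
    fix h1 h' h2 h3 g1 g' g2 g3
    assume mem: "h1 \<in> B" "h' \<in> B" "h2 \<in> B" "h3 \<in> B" "g1 \<in> B" "g' \<in> B" "g2 \<in> B" "g3 \<in> B"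
    have \<phi>c: "\<phi> h1 h2 h3 g1 g2 g3 x (mu y (lam x m)) y \<in> vcar ?X" if "x \<in> B" "y \<in> B" for x y
      unfolding \<phi>_def by (intro closed_simps mem that m)
    have "triple b c (\<psi> h1 h2 h3 g1 g2 g3) =
        (\<Sum>x\<in>B. triple b c (\<Sum>y\<in>B. \<phi> h1 h2 h3 g1 g2 g3 x (mu y (lam x m)) y))"
      unfolding \<psi>_def by (rule linmap_sum[OF X M.vspace triple_lin]) (intro vs_sum[OF X] \<phi>c)
    also have "\<dots> = (\<Sum>x\<in>B. \<Sum>y\<in>B. triple b c (\<phi> h1 h2 h3 g1 g2 g3 x (mu y (lam x m)) y))"
      by (intro sum.cong refl linmap_sum[OF X M.vspace triple_lin] \<phi>c)
    also have "\<dots> = (\<Sum>x\<in>B. \<Sum>y\<in>B.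
      vscale M (e b (hmult H (hmult H h1 x) g1) * e c (hmult H (hmult H h3 y) (Sii g3)))
        (ract M (lact M h2 (mu y (lam x m))) g2))"
      unfolding \<phi>_def by (intro sum.cong refl triple_tensor closed_simps mem m)
    finally show "triple b c (\<psi> h1 h2 h3 g1 g2 g3) = (\<Sum>x\<in>B. \<Sum>y\<in>B.
      vscale M (e b (hmult H (hmult H h1 x) g1) * e c (hmult H (hmult H h3 y) (Sii g3)))
        (ract M (lact M h2 (mu y (lam x m))) g2))" .
  qed
  finally show ?thesis .
qed

end

section \<open>Each action against each coaction, and the operators on one edge\<close>

context based_bimodule
begin

lemma sum_scale_sw: "(\<Sum>c\<in>B. sM (w c) (sw sM (\<phi> c) a)) = sw sM (\<lambda>x y. \<Sum>c\<in>B. sM (w c) (\<phi> c x y)) a"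
  by (simp only: sw_scale[OF MV.vector_space_axioms] sw_sum[OF MV.vector_space_axioms])

lemma sum_e_gep: "z \<in> vcar H \<Longrightarrow> (\<Sum>c\<in>B. e c z * gep c) = gep z"
  using hlin_expand[OF vector_space_times hlin_ep] .

lemma linmap_sum_scale_M:
  assumes "linmap M M f" "\<And>i. i \<in> I \<Longrightarrow> g i \<in> vcar M"
  shows "f (\<Sum>i\<in>I. sM (c i) (g i)) = (\<Sum>i\<in>I. sM (c i) (f (g i)))"
  by (rule linmap_sum_scale[OF M.vspace M.vspace assms])

lemma gep_mult: "x \<in> vcar H \<Longrightarrow> y \<in> vcar H \<Longrightarrow> gep (hmult H x y) = gep x * gep y"
  by (simp add: gep_car bilin_closed[OF mult_bilin] counit_mult)

text \<open>Applying the counit to the right coaction in \<open>mu_lam_act\<close> leaves the left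
  coaction alone: \<open>gep\<close> is multiplicative and invariant under \<open>Sii\<close>, so
  the legs \<open>h3\<close> and \<open>g3\<close> disappear together with the right
  component.\<close>

lemma lam_act:
  assumes h: "h \<in> vcar H" and m: "m \<in> vcar M" and g: "g \<in> vcar H" and b: "b \<in> B"
  shows "lam b (ract M (lact M h m) g) = sw sM (\<lambda>h1 h2. sw sM (\<lambda>g1 g2. \<Sum>x\<in>B.
    sM (e b (hmult H (hmult H h1 x) g1)) (ract M (lact M h2 (lam x m)) g2)) g) h"
proof -
  define E where "E h1 g1 x = e b (hmult H (hmult H h1 x) g1)" for h1 g1 x
  define v where "v h2 g2 n = ract M (lact M h2 n) g2" for h2 g2 n
  have v_lin: "linmap M M (v h2 g2)" if "h2 \<in> vcar H" "g2 \<in> vcar H" for h2 g2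
    unfolding v_def by (simp add: lin_intros that)
  define F where "F h1 h2 g1 g2 = (\<Sum>x\<in>B. sM (E h1 g1 x) (v h2 g2 (lam x m)))" for h1 h2 g1 g2
  have F_lin: "linmap H M (\<lambda>h2. F h1 h2 g1 g2)" if "g2 \<in> vcar H" for h1 g1 g2
    unfolding F_def v_def
    by (intro linmap_sum_fun linmap_scale_fun M.vspace lin_intros lam_closed m that)
  have F_lin2: "linmap H M (\<lambda>g2. F h1 h2 g1 g2)" if "h2 \<in> vcar H" for h1 h2 g1
    unfolding F_def v_def
    by (intro linmap_sum_fun linmap_scale_fun M.vspace lin_intros closed_simps m that)
  have inner: "(\<Sum>c\<in>B. sM (gep c) (\<Sum>x\<in>B. \<Sum>y\<in>B. sM (E h1 g1 x * e c (hmult H (hmult H h3 y) (Sii g3)))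
      (v h2 g2 (mu y (lam x m))))) = sM (gep h3 * gep g3) (F h1 h2 g1 g2)"
    if mem: "h1 \<in> B" "h2 \<in> B" "h3 \<in> B" "g1 \<in> B" "g2 \<in> B" "g3 \<in> B" for h1 h2 h3 g1 g2 g3
  proof -
    have "(\<Sum>c\<in>B. sM (gep c) (\<Sum>x\<in>B. \<Sum>y\<in>B. sM (E h1 g1 x * e c (hmult H (hmult H h3 y) (Sii g3)))
      (v h2 g2 (mu y (lam x m))))) =
      (\<Sum>x\<in>B. \<Sum>y\<in>B. \<Sum>c\<in>B. sM (E h1 g1 x * (e c (hmult H (hmult H h3 y) (Sii g3)) * gep c)) (v h2 g2 (mu y (lam x m))))"
      unfolding MV.scale_sum_right sum.cartesian_product
      by (rule sum.reindex_bij_witness[of _ "\<lambda>(x, y, c). (c, x, y)" "\<lambda>(c, x, y). (x, y, c)"]) (auto simp: ac_simps)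
    also have "\<dots> = (\<Sum>x\<in>B. \<Sum>y\<in>B. sM (E h1 g1 x * (gep h3 * gep y * gep g3)) (v h2 g2 (mu y (lam x m))))"
      by (simp only: MV.scale_sum_left[symmetric] sum_distrib_left[symmetric])
        (simp add: sum_e_gep closed_simps mem gep_mult gep_Sii)
    also have "\<dots> = (\<Sum>x\<in>B. sM (E h1 g1 x * gep h3 * gep g3) (\<Sum>y\<in>B. sM (gep y) (v h2 g2 (mu y (lam x m)))))"
      by (simp add: MV.scale_sum_right ac_simps)
    also have "\<dots> = (\<Sum>x\<in>B. sM (E h1 g1 x * gep h3 * gep g3) (v h2 g2 (lam x m)))"
      by (intro sum.cong refl arg_cong[of _ _ "sM _"])
        (simp add: linmap_sum_scale_M[OF v_lin[OF B_car B_car], symmetric] mem mu_closed lam_closed m mu_counit)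
    also have "\<dots> = sM (gep h3 * gep g3) (F h1 h2 g1 g2)"
      by (simp add: F_def MV.scale_sum_right ac_simps)
    finally show ?thesis .
  qed
  let ?n = "ract M (lact M h m) g"
  have n: "?n \<in> vcar M" by (simp add: closed_simps h m g)
  have "lam b ?n = (\<Sum>c\<in>B. sM (gep c) (mu c (lam b ?n)))"
    by (rule mu_counit[OF lam_closed[OF n], symmetric])
  also have "\<dots> = (\<Sum>c\<in>B. sM (gep c) (sw sM (\<lambda>h1 h'. sw sM (\<lambda>h2 h3. sw sM (\<lambda>g1 g'. sw sM (\<lambda>g2 g3. \<Sum>x\<in>B. \<Sum>y\<in>B.
      sM (E h1 g1 x * e c (hmult H (hmult H h3 y) (Sii g3))) (v h2 g2 (mu y (lam x m)))) g') g) h') h))"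
    unfolding E_def v_def by (intro sum.cong refl) (simp only: mu_lam_act[OF h m g b])
  also have "\<dots> = sw sM (\<lambda>h1 h'. sw sM (\<lambda>h2 h3. sw sM (\<lambda>g1 g'. sw sM (\<lambda>g2 g3. \<Sum>c\<in>B. sM (gep c) (\<Sum>x\<in>B. \<Sum>y\<in>B.
      sM (E h1 g1 x * e c (hmult H (hmult H h3 y) (Sii g3))) (v h2 g2 (mu y (lam x m))))) g') g) h') h"
    by (simp only: sum_scale_sw)
  also have "\<dots> = sw sM (\<lambda>h1 h'. sw sM (\<lambda>h2 h3. sw sM (\<lambda>g1 g'. sw sM (\<lambda>g2 g3.
      sM (gep h3) (sM (gep g3) (F h1 h2 g1 g2))) g') g) h') h"
    by (rule sw_cong, rule sw_cong, rule sw_cong, rule sw_cong) (simp only: inner MV.scale_scale)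
  also have "\<dots> = sw sM (\<lambda>h1 h'. sw sM (\<lambda>h2 h3. sM (gep h3) (sw sM (\<lambda>g1 g'. F h1 h2 g1 g') g)) h') h"
    by (rule sw_cong, rule sw_cong)
      (simp only: sw_scale[OF MV.vector_space_axioms, symmetric], rule arg_cong[of _ _ "sM _"],
        rule sw_cong, rule sw_counit_right_car[OF M.vspace F_lin2], simp_all add: B_car)
  also have "\<dots> = sw sM (\<lambda>h1 h'. sw sM (\<lambda>g1 g'. F h1 h' g1 g') g) h"
    by (rule sw_cong, rule sw_counit_right_car[OF M.vspace])
      (auto intro!: linmap_sw_fun M.vspace F_lin simp: B_car)
  finally show ?thesis by (simp only: F_def[abs_def] E_def v_def)
qed

lemma mu_act:
  assumes h: "h \<in> vcar H" and m: "m \<in> vcar M" and g: "g \<in> vcar H" and c: "c \<in> B"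
  shows "mu c (ract M (lact M h m) g) = sw sM (\<lambda>h1 h2. sw sM (\<lambda>g1 g2. \<Sum>y\<in>B.
    sM (e c (hmult H (hmult H h2 y) (Sii g2))) (ract M (lact M h1 (mu y m)) g1)) g) h"
proof -
  define E where "E h3 g3 y = e c (hmult H (hmult H h3 y) (Sii g3))" for h3 g3 y
  define v where "v h2 g2 n = ract M (lact M h2 n) g2" for h2 g2 n
  have v_lin: "linmap M M (\<lambda>n. v h2 g2 (mu y n))" if "h2 \<in> vcar H" "g2 \<in> vcar H" for h2 g2 y
    unfolding v_def by (rule linmap_comp[OF mu_lin]) (simp add: lin_intros that)
  define F where "F h2 h3 g2 g3 = (\<Sum>y\<in>B. sM (E h3 g3 y) (v h2 g2 (mu y m)))" for h2 h3 g2 g3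
  have F_closed: "F h2 h3 g2 g3 \<in> vcar M" if "h2 \<in> vcar H" "g2 \<in> vcar H" for h2 h3 g2 g3
    unfolding F_def v_def by (intro vs_sum[OF M.vspace] vs_scale[OF M.vspace] closed_simps that m)
  have inner: "(\<Sum>b\<in>B. sM (gep b) (\<Sum>x\<in>B. \<Sum>y\<in>B. sM (e b (hmult H (hmult H h1 x) g1) * E h3 g3 y)
      (v h2 g2 (mu y (lam x m))))) = sM (gep h1 * gep g1) (F h2 h3 g2 g3)"
    if mem: "h1 \<in> B" "h2 \<in> B" "h3 \<in> B" "g1 \<in> B" "g2 \<in> B" "g3 \<in> B" for h1 h2 h3 g1 g2 g3
  proof -
    have "(\<Sum>b\<in>B. sM (gep b) (\<Sum>x\<in>B. \<Sum>y\<in>B. sM (e b (hmult H (hmult H h1 x) g1) * E h3 g3 y)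
      (v h2 g2 (mu y (lam x m))))) =
      (\<Sum>y\<in>B. \<Sum>x\<in>B. \<Sum>b\<in>B. sM (E h3 g3 y * (e b (hmult H (hmult H h1 x) g1) * gep b)) (v h2 g2 (mu y (lam x m))))"
      unfolding MV.scale_sum_right sum.cartesian_product
      by (rule sum.reindex_bij_witness[of _ "\<lambda>(y, x, b). (b, x, y)" "\<lambda>(b, x, y). (y, x, b)"]) (auto simp: ac_simps)
    also have "\<dots> = (\<Sum>y\<in>B. \<Sum>x\<in>B. sM (E h3 g3 y * (gep h1 * gep x * gep g1)) (v h2 g2 (mu y (lam x m))))"
      by (simp only: MV.scale_sum_left[symmetric] sum_distrib_left[symmetric])
        (simp add: sum_e_gep closed_simps mem gep_mult)
    also have "\<dots> = (\<Sum>y\<in>B. sM (E h3 g3 y * gep h1 * gep g1) (\<Sum>x\<in>B. sM (gep x) (v h2 g2 (mu y (lam x m)))))"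
      by (simp add: MV.scale_sum_right ac_simps)
    also have "\<dots> = (\<Sum>y\<in>B. sM (E h3 g3 y * gep h1 * gep g1) (v h2 g2 (mu y m)))"
      by (intro sum.cong refl arg_cong[of _ _ "sM _"])
        (simp add: linmap_sum_scale_M[OF v_lin[OF B_car B_car], symmetric] mem lam_closed m lam_counit)
    also have "\<dots> = sM (gep h1 * gep g1) (F h2 h3 g2 g3)"
      by (simp add: F_def MV.scale_sum_right ac_simps)
    finally show ?thesis .
  qed
  let ?n = "ract M (lact M h m) g"
  have n: "?n \<in> vcar M" by (simp add: closed_simps h m g)
  have "mu c ?n = (\<Sum>b\<in>B. sM (gep b) (lam b (mu c ?n)))"
    by (rule lam_counit[OF mu_closed[OF n], symmetric])
  also have "\<dots> = (\<Sum>b\<in>B. sM (gep b) (sw sM (\<lambda>h1 h'. sw sM (\<lambda>h2 h3. sw sM (\<lambda>g1 g'. sw sM (\<lambda>g2 g3. \<Sum>x\<in>B. \<Sum>y\<in>B.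
      sM (e b (hmult H (hmult H h1 x) g1) * E h3 g3 y) (v h2 g2 (mu y (lam x m)))) g') g) h') h))"
    unfolding E_def v_def by (intro sum.cong refl) (simp only: mu_lam[OF n _ c] mu_lam_act[OF h m g _ c])
  also have "\<dots> = sw sM (\<lambda>h1 h'. sw sM (\<lambda>h2 h3. sw sM (\<lambda>g1 g'. sw sM (\<lambda>g2 g3. \<Sum>b\<in>B. sM (gep b) (\<Sum>x\<in>B. \<Sum>y\<in>B.
      sM (e b (hmult H (hmult H h1 x) g1) * E h3 g3 y) (v h2 g2 (mu y (lam x m))))) g') g) h') h"
    by (simp only: sum_scale_sw)
  also have "\<dots> = sw sM (\<lambda>h1 h'. sw sM (\<lambda>h2 h3. sw sM (\<lambda>g1 g'. sw sM (\<lambda>g2 g3.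
      sM (gep h1) (sM (gep g1) (F h2 h3 g2 g3))) g') g) h') h"
    by (rule sw_cong, rule sw_cong, rule sw_cong, rule sw_cong) (simp only: inner MV.scale_scale)
  also have "\<dots> = sw sM (\<lambda>h1 h'. sM (gep h1) (sw sM (\<lambda>h2 h3. sw sM (\<lambda>g1 g'. sM (gep g1) (sw sM (F h2 h3) g')) g) h')) h"
    by (simp only: sw_scale[OF MV.vector_space_axioms])
  also have "\<dots> = sw sM (\<lambda>h1 h'. sM (gep h1) (sw sM (\<lambda>h2 h3. sw sM (F h2 h3) g) h')) h"
    by (rule sw_cong, rule arg_cong[of _ _ "sM _"], rule sw_cong,
        rule sw_counit_left_car[OF M.vspace linmap_sw_arg[OF M.vspace F_closed] g]) (simp_all add: B_car)
  also have "\<dots> = sw sM (\<lambda>h2 h3. sw sM (F h2 h3) g) h"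
    by (rule sw_counit_left_car[OF M.vspace linmap_sw_arg[OF M.vspace sw_closed[OF M.vspace F_closed]] h])
      (simp_all add: B_car)
  finally show ?thesis by (simp only: F_def[abs_def] E_def v_def)
qed

lemma lact_one: "m \<in> vcar M \<Longrightarrow> lact M (hone H) m = m"
  and ract_one: "m \<in> vcar M \<Longrightarrow> ract M m (hone H) = m"
  and lact_mult: "m \<in> vcar M \<Longrightarrow> x \<in> vcar H \<Longrightarrow> y \<in> vcar H \<Longrightarrow> lact M (hmult H x y) m = lact M x (lact M y m)"
  and ract_mult: "m \<in> vcar M \<Longrightarrow> x \<in> vcar H \<Longrightarrow> y \<in> vcar H \<Longrightarrow> ract M m (hmult H x y) = ract M (ract M m x) y"
  using M.left_module M.right_module by (simp_all add: left_module_def right_module_def)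

lemma Sii_one: "Sii (hone H) = hone H"
proof -
  have "antipode_inv H (hone H) = hone H"
    using antipode_inv_antipode[OF one_closed] S_one by (simp add: gS_car one_closed)
  then show ?thesis by (simp add: Sii_def)
qed

text \<open>\<open>lam_act\<close> with the unit acting from the right. The three laws that follow
  arise in the same way, by putting the unit on one side in \<open>lam_act\<close> or
  \<open>mu_act\<close>.\<close>

lemma lam_lact:
  assumes h: "h \<in> vcar H" and m: "m \<in> vcar M" and b: "b \<in> B"
  shows "lam b (lact M h m) = sw sM (\<lambda>x y. \<Sum>c\<in>B. sM (e b (hmult H x c)) (lact M y (lam c m))) h"
proof -
  have "sw sM (\<lambda>g1 g2. \<Sum>x\<in>B. sM (e b (hmult H (hmult H h1 x) g1)) (ract M (lact M h2 (lam x m)) g2)) (hone H) =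
      (\<Sum>c\<in>B. sM (e b (hmult H h1 c)) (lact M h2 (lam c m)))" if "h1 \<in> B" "h2 \<in> B" for h1 h2
  proof -
    have "bilin H H M (\<lambda>g1 g2. \<Sum>x\<in>B. sM (e b (hmult H (hmult H h1 x) g1)) (ract M (lact M h2 (lam x m)) g2))"
      by (intro bilinI linmap_sum_fun M.vspace linmap_scale_fun linmap_scalar_fun
          linmap_comp[OF _ linmap_e] lin_intros) (simp_all add: closed_simps m that)
    from sw_one_car[OF M.vspace this] show ?thesis
      by (simp add: one_right ract_one closed_simps m that)
  qed
  then show ?thesis
    using lam_act[OF h m one_closed b] by (simp add: ract_one closed_simps h m cong: sw_cong)
qed

lemma mu_lact:
  assumes h: "h \<in> vcar H" and m: "m \<in> vcar M" and b: "b \<in> B"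
  shows "mu b (lact M h m) = sw sM (\<lambda>x y. \<Sum>c\<in>B. sM (e b (hmult H y c)) (lact M x (mu c m))) h"
proof -
  have "sw sM (\<lambda>g1 g2. \<Sum>y\<in>B. sM (e b (hmult H (hmult H h2 y) (Sii g2))) (ract M (lact M h1 (mu y m)) g1)) (hone H) =
      (\<Sum>c\<in>B. sM (e b (hmult H h2 c)) (lact M h1 (mu c m)))" if "h1 \<in> B" "h2 \<in> B" for h1 h2
  proof -
    have "bilin H H M (\<lambda>g1 g2. \<Sum>y\<in>B. sM (e b (hmult H (hmult H h2 y) (Sii g2))) (ract M (lact M h1 (mu y m)) g1))"
      by (intro bilinI linmap_sum_fun M.vspace linmap_scale_fun linmap_scalar_fun
          linmap_comp[OF _ linmap_e] lin_intros) (simp_all add: closed_simps m that)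
    from sw_one_car[OF M.vspace this] show ?thesis
      by (simp add: one_right ract_one closed_simps m that Sii_one)
  qed
  then show ?thesis
    using mu_act[OF h m one_closed b] by (simp add: ract_one closed_simps h m cong: sw_cong)
qed

lemma lam_ract:
  assumes g: "g \<in> vcar H" and m: "m \<in> vcar M" and b: "b \<in> B"
  shows "lam b (ract M m g) = sw sM (\<lambda>x y. \<Sum>c\<in>B. sM (e b (hmult H c x)) (ract M (lam c m) y)) g"
proof -
  have "bilin H H M (\<lambda>h1 h2. sw sM (\<lambda>g1 g2. \<Sum>x\<in>B. sM (e b (hmult H (hmult H h1 x) g1)) (ract M (lact M h2 (lam x m)) g2)) g)"
    by (intro bilinI linmap_sw_fun linmap_sum_fun M.vspace linmap_scale_fun linmap_scalar_fun
          linmap_comp[OF _ linmap_e] lin_intros) (simp_all add: closed_simps m)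
  from sw_one_car[OF M.vspace this]
  show ?thesis
    using lam_act[OF one_closed m g b]
    by (simp add: lact_one one_left closed_simps m g cong: sw_cong)
qed

lemma mu_ract:
  assumes g: "g \<in> vcar H" and m: "m \<in> vcar M" and b: "b \<in> B"
  shows "mu b (ract M m g) = sw sM (\<lambda>x y. \<Sum>c\<in>B. sM (e b (hmult H c (Sii y))) (ract M (mu c m) x)) g"
proof -
  have "bilin H H M (\<lambda>h1 h2. sw sM (\<lambda>g1 g2. \<Sum>y\<in>B. sM (e b (hmult H (hmult H h2 y) (Sii g2))) (ract M (lact M h1 (mu y m)) g1)) g)"
    by (intro bilinI linmap_sw_fun linmap_sum_fun M.vspace linmap_scale_fun linmap_scalar_fun
          linmap_comp[OF _ linmap_e] lin_intros) (simp_all add: closed_simps m)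
  from sw_one_car[OF M.vspace this]
  show ?thesis
    using mu_act[OF one_closed m g b]
    by (simp add: lact_one one_left closed_simps m g cong: sw_cong)
qed

text \<open>\<open>lop \<sigma> a\<close> and \<open>tau \<sigma> b\<close> are \<open>L\<^sub>h(a)\<close> and \<open>T\<^sub>h(b\<^sup>*)\<close> on one edge; \<open>\<sigma>\<close> says whether \<open>h\<close> is a source.\<close>

definition lop :: "bool \<Rightarrow> 'h \<Rightarrow> 'm \<Rightarrow> 'm" where
  "lop \<sigma> a m = (if \<sigma> then ract M m (gS a) else lact M (pj a) m)"

definition tau :: "bool \<Rightarrow> 'h \<Rightarrow> 'm \<Rightarrow> 'm" where
  "tau \<sigma> b m = (if \<sigma> then lam b m else (\<Sum>c\<in>B. sM (e b (gS c)) (mu c m)))"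

lemma lop_lin: "linmap M M (lop \<sigma> a)"
  by (cases \<sigma>) (simp_all add: lop_def[abs_def] lin_intros gS_closed pj_closed)

lemma tau_lin: "linmap M M (tau \<sigma> b)"
  by (cases \<sigma>) (auto simp: tau_def[abs_def] lam_lin intro!: linmap_sum_fun M.vspace linmap_scale_fun mu_lin)

lemmas tau_closed = linmap_closed[OF tau_lin]

lemma lop_lin_arg: "m \<in> vcar M \<Longrightarrow> linmap H M (\<lambda>a. lop \<sigma> a m)"
proof (cases \<sigma>)
  case True
  assume m: "m \<in> vcar M"
  have "linmap H M (\<lambda>a. ract M m (antipode H a))" by (intro lin_intros m)
  then show ?thesis
    by (rule linmap_cong[OF _ vspace]) (simp add: lop_def True gS_car)
next
  case False
  assume m: "m \<in> vcar M"
  have "linmap H M (\<lambda>a. lact M a m)" by (intro lin_intros m)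
  then show ?thesis
    by (rule linmap_cong[OF _ vspace]) (simp add: lop_def False pj_id)
qed

lemma lop_pj: "lop \<sigma> (pj a) m = lop \<sigma> a m"
  by (simp add: lop_def gS_def pj_id pj_closed)

lemma lop_expand: "m \<in> vcar M \<Longrightarrow> lop \<sigma> a m = (\<Sum>b\<in>B. sM (e b a) (lop \<sigma> b m))"
  using linmap_pj[OF M.vspace lop_lin_arg, of m \<sigma> a] by (simp add: lop_pj)

lemma lop_mul: "m \<in> vcar M \<Longrightarrow> lop \<sigma> (gmul a b) m = lop \<sigma> a (lop \<sigma> b m)"
proof (cases \<sigma>)
  case True
  assume "m \<in> vcar M"
  then show ?thesis by (simp add: lop_def True S_mul gmul_car gS_closed ract_mult)
next
  case False
  assume "m \<in> vcar M"
  then show ?thesis by (simp add: lop_def False gmul_def pj_id closed_simps pj_closed lact_mult)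
qed

lemma lop_one: "m \<in> vcar M \<Longrightarrow> lop \<sigma> (hone H) m = m"
  by (simp add: lop_def S_one pj_id one_closed ract_one lact_one)

lemma lop_commute: "m \<in> vcar M \<Longrightarrow> lop (\<not> \<sigma>) a (lop \<sigma> b m) = lop \<sigma> b (lop (\<not> \<sigma>) a m)"
  by (cases \<sigma>) (simp_all add: lop_def M.bimodule gS_closed pj_closed)

lemma tau_commute: "m \<in> vcar M \<Longrightarrow> b \<in> B \<Longrightarrow> c \<in> B \<Longrightarrow> tau (\<not> \<sigma>) b (tau \<sigma> c m) = tau \<sigma> c (tau (\<not> \<sigma>) b m)"
  by (cases \<sigma>) (auto simp: tau_def linmap_sum_scale_M[OF lam_lin] mu_closed mu_lam cong: sum.cong)

lemma sum_tau_False: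
  assumes m: "m \<in> vcar M" and \<alpha>: "hlin (*) \<alpha>"
  shows "(\<Sum>b\<in>B. sM (\<alpha> b) (tau False b m)) = (\<Sum>c\<in>B. sM (\<alpha> (gS c)) (mu c m))"
proof -
  have "(\<Sum>b\<in>B. sM (\<alpha> b) (tau False b m)) = (\<Sum>c\<in>B. sM (\<Sum>b\<in>B. e b (gS c) * \<alpha> b) (mu c m))"
    by (simp add: tau_def MV.scale_sum_right MV.scale_sum_left mult.commute) (rule sum.swap)
  then show ?thesis using hlin_expand[OF vector_space_times \<alpha>] by simp
qed

text \<open>For a target two reversals cancel: the operators \<open>mu\<close> compose in the
  opposite order to the operators \<open>lam\<close>, and the antipode in \<open>tau\<close>
  reverses the coproduct.\<close>

lemma tau_tau: "m \<in> vcar M \<Longrightarrow> b \<in> B \<Longrightarrow> c \<in> B \<Longrightarrow>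
    tau \<sigma> c (tau \<sigma> b m) = (\<Sum>d\<in>B. sM (gdl b c d) (tau \<sigma> d m))"
proof (cases \<sigma>)
  case True
  assume "m \<in> vcar M" "b \<in> B" "c \<in> B"
  then show ?thesis by (simp add: tau_def True lam_lam)
next
  case False
  assume m: "m \<in> vcar M" and bc: "b \<in> B" "c \<in> B"
  have "gdl b c (gS d) = sw (*) (\<lambda>x y. e b (gS y) * e c (gS x)) d" for d
  proof -
    have "sw (*) (\<lambda>x y. e b x * e c y) (gS d) = gdl b c (gS d)"
      unfolding sw_def by (rule sum_e_e[OF bc])
    moreover have "sw (*) (\<lambda>x y. e b x * e c y) (gS d) = sw (*) (\<lambda>x y. e b (gS y) * e c (gS x)) d"
      by (rule sw_S[OF vector_space_times])
        (use bc in \<open>auto intro!: hlin_scalarI[OF vector_space_times, of "e b"] hlin_scaleI[OF vector_space_times] hlin_e\<close>)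
    ultimately show ?thesis by simp
  qed
  then have "(\<Sum>d\<in>B. sM (gdl b c d) (tau \<sigma> d m)) =
      (\<Sum>d\<in>B. sM (\<Sum>x\<in>B. \<Sum>y\<in>B. gdl x y d * (e b (gS y) * e c (gS x))) (mu d m))"
    using sum_tau_False[OF m hlin_dl[of b c]] by (simp add: False sw_def)
  also have "\<dots> = (\<Sum>x\<in>B. \<Sum>y\<in>B. \<Sum>d\<in>B. sM (gdl x y d * (e b (gS y) * e c (gS x))) (mu d m))"
    unfolding MV.scale_sum_left by (rule sum_rot3[symmetric])
  also have "\<dots> = (\<Sum>x\<in>B. \<Sum>y\<in>B. sM (e c (gS x)) (sM (e b (gS y)) (mu x (mu y m))))"
    by (intro sum.cong refl) (simp add: mu_mu m MV.scale_sum_right ac_simps)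
  also have "\<dots> = tau \<sigma> c (tau \<sigma> b m)"
    by (simp add: tau_def False linmap_sum_scale_M[OF mu_lin] mu_closed m MV.scale_sum_right)
  finally show ?thesis by simp
qed

lemma tau_counit: "m \<in> vcar M \<Longrightarrow> (\<Sum>b\<in>B. sM (gep b) (tau \<sigma> b m)) = m"
proof (cases \<sigma>)
  case True
  assume "m \<in> vcar M"
  then show ?thesis by (simp add: tau_def True lam_counit)
next
  case False
  assume "m \<in> vcar M"
  then show ?thesis using sum_tau_False[OF _ hlin_ep] by (simp add: False ep_S mu_counit)
qed

lemma sw_as_sum: "sw sM (\<lambda>x y. \<Sum>c\<in>B. sM (f x y c) (g x y c)) a =
    (\<Sum>c\<in>B. \<Sum>x\<in>B. \<Sum>y\<in>B. sM (gdl x y a * f x y c) (g x y c))"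
  unfolding sw_def MV.scale_sum_right MV.scale_scale by (rule sum_rot3)

lemma hlin_e_mul: "b \<in> B \<Longrightarrow> hlin (*) (\<lambda>z. e b (gmul x z))" "b \<in> B \<Longrightarrow> hlin (*) (\<lambda>z. e b (gmul z x))"
  by (rule hlin_comp[OF vector_space_times hlin_e hlin_mul_right] hlin_comp[OF vector_space_times hlin_e hlin_mul_left], assumption)+

lemma tau_False_sum:
  assumes "\<And>c. c \<in> B \<Longrightarrow> mu c n = sw sM (\<lambda>x y. \<Sum>d\<in>B. sM (e c (z x y d)) (g x y d)) a" and b: "b \<in> B"
  shows "tau False b n = sw sM (\<lambda>x y. \<Sum>d\<in>B. sM (e b (gS (z x y d))) (g x y d)) a"
proof -
  have "tau False b n = (\<Sum>c\<in>B. sM (e b (gS c)) (sw sM (\<lambda>x y. \<Sum>d\<in>B. sM (e c (z x y d)) (g x y d)) a))"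
    using assms(1) by (simp add: tau_def)
  also have "\<dots> = sw sM (\<lambda>x y. \<Sum>d\<in>B. sM (\<Sum>c\<in>B. e c (z x y d) * e b (gS c)) (g x y d)) a"
    unfolding sum_scale_sw by (simp add: MV.scale_sum_right MV.scale_sum_left mult.commute) (subst sum.swap, rule refl)
  also have "\<dots> = sw sM (\<lambda>x y. \<Sum>d\<in>B. sM (e b (gS (z x y d))) (g x y d)) a"
    using hlin_expand[OF vector_space_times hlin_comp[OF vector_space_times hlin_e[OF b] hlin_S]] by simp
  finally show ?thesis .
qed

lemma sum_lop_tau_False:
  assumes m: "m \<in> vcar M" and \<alpha>: "hlin (*) \<alpha>"
  shows "(\<Sum>c\<in>B. sM (\<alpha> c) (lop \<sigma> x (tau False c m))) = (\<Sum>d\<in>B. sM (\<alpha> (gS d)) (lop \<sigma> x (mu d m)))"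
  using arg_cong[OF sum_tau_False[OF m \<alpha>], of "lop \<sigma> x"]
  by (simp add: linmap_sum_scale_M[OF lop_lin] tau_closed mu_closed m)

text \<open>The factor \<open>S\<close> on the last leg has two origins. For a source the action is
  by \<open>S a\<close>, whose legs are the antipodes of those of \<open>a\<close> in reversed
  order; for a target \<open>S\<close> is applied to the product of leg and coaction component and
  reverses it.\<close>

lemma tau_lop_same:
  assumes m: "m \<in> vcar M" and b: "b \<in> B"
  shows "tau \<sigma> b (lop \<sigma> a m) =
    sw sM (\<lambda>x y. \<Sum>c\<in>B. sM (e b (gmul c (gS y))) (lop \<sigma> x (tau \<sigma> c m))) a"
proof (cases \<sigma>)
  case True
  let ?\<phi> = "\<lambda>x y. \<Sum>c\<in>B. sM (e b (gmul c x)) (ract M (lam c m) (pj y))"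
  have "tau \<sigma> b (lop \<sigma> a m) = sw sM (\<lambda>x y. \<Sum>c\<in>B. sM (e b (hmult H c x)) (ract M (lam c m) y)) (gS a)"
    by (simp add: tau_def lop_def True lam_ract gS_closed m b)
  also have "\<dots> = sw sM ?\<phi> (gS a)"
    by (rule sw_cong) (simp add: gmul_car pj_id B_car)
  also have "\<dots> = sw sM (\<lambda>x y. ?\<phi> (gS y) (gS x)) a"
  proof (rule sw_S[OF MV.vector_space_axioms])
    show "hlin sM (\<lambda>x. ?\<phi> x y)" for y
      by (intro hlin_sumI[OF MV.vector_space_axioms] hlin_scalarI[OF MV.vector_space_axioms] hlin_e_mul b)
    show "hlin sM (?\<phi> x)" for x
      by (rule hlin_of_linmap[OF M.vspace]) (intro linmap_sum_fun M.vspace linmap_scale_fun lin_intros lam_closed m)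
  qed
  finally show ?thesis by (simp add: tau_def lop_def True pj_id gS_closed)
next
  case False
  have "tau \<sigma> b (lop \<sigma> a m) = sw sM (\<lambda>x y. \<Sum>d\<in>B. sM (e b (gS (hmult H y d))) (lact M x (mu d m))) (pj a)"
    by (simp only: False lop_def if_False) (rule tau_False_sum[OF mu_lact[OF pj_closed m] b])
  also have "\<dots> = sw sM (\<lambda>x y. \<Sum>d\<in>B. sM (e b (gmul (gS d) (gS y))) (lop \<sigma> x (mu d m))) a"
    unfolding sw_pr[OF MV.vector_space_axioms, unfolded pr_eq_pj]
    by (rule sw_cong) (simp add: False lop_def pj_id B_car S_mul flip: gmul_car)
  also have "\<dots> = sw sM (\<lambda>x y. \<Sum>c\<in>B. sM (e b (gmul c (gS y))) (lop \<sigma> x (tau \<sigma> c m))) a"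
    using sum_lop_tau_False[OF m hlin_e_mul(2)[OF b]] by (simp add: False)
  finally show ?thesis .
qed

text \<open>For a source the action is by \<open>S a\<close>, and \<open>mu_ract\<close> puts
  \<open>Sii\<close> on the leg that the opposite half-edge, a target, reads through
  \<open>S\<close>; since \<open>gS (Sii (gS x)) = x\<close>, the bare leg remains, and the reversal
  of the product moves it to the left. For a target \<open>lam_lact\<close> already has the required
  form.\<close>

lemma tau_lop_opposite:
  assumes m: "m \<in> vcar M" and b: "b \<in> B"
  shows "tau (\<not> \<sigma>) b (lop \<sigma> a m) =
    sw sM (\<lambda>x y. \<Sum>c\<in>B. sM (e b (gmul x c)) (lop \<sigma> y (tau (\<not> \<sigma>) c m))) a"
proof (cases \<sigma>)
  case True
  let ?\<phi> = "\<lambda>x y. \<Sum>d\<in>B. sM (e b (gmul (gS (Sii (pj y))) (gS d))) (ract M (mu d m) (pj x))"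
  have SS: "gS (gmul d (Sii y)) = gmul (gS (Sii y)) (gS d)" for d y by (rule S_mul)
  have "tau (\<not> \<sigma>) b (lop \<sigma> a m) =
      sw sM (\<lambda>x y. \<Sum>d\<in>B. sM (e b (gS (hmult H d (Sii y)))) (ract M (mu d m) x)) (gS a)"
    by (simp only: True lop_def if_True not_True_eq_False) (rule tau_False_sum[OF mu_ract[OF gS_closed m] b])
  also have "\<dots> = sw sM ?\<phi> (gS a)"
    by (rule sw_cong) (simp add: pj_id B_car closed_simps SS flip: gmul_car)
  also have "\<dots> = sw sM (\<lambda>x y. ?\<phi> (gS y) (gS x)) a"
  proof (rule sw_S[OF MV.vector_space_axioms])
    show "hlin sM (\<lambda>x. ?\<phi> x y)" for y
      by (rule hlin_of_linmap[OF M.vspace]) (intro linmap_sum_fun M.vspace linmap_scale_fun lin_intros mu_closed m)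
    have "linmap H H (\<lambda>y. hmult H (antipode H (Sii y)) (gS d))" for d
      by (intro lin_intros gS_closed)
    then have "linmap H scalars (\<lambda>y. e b (hmult H (antipode H (Sii y)) (gS d)))" for d
      by (rule linmap_comp[OF _ linmap_e])
    then have "hlin sM (\<lambda>y. \<Sum>d\<in>B. sM (e b (hmult H (antipode H (Sii (pj y))) (gS d))) (ract M (mu d m) (pj x)))" for x
      by (intro hlin_of_linmap[OF M.vspace] linmap_sum_fun M.vspace linmap_scalar_fun closed_simps pj_closed m)
    then show "hlin sM (?\<phi> x)" for x
      by (simp add: gmul_car gS_car closed_simps pj_closed gS_closed)
  qed
  also have "\<dots> = sw sM (\<lambda>x y. \<Sum>d\<in>B. sM (e b (gmul x (gS d))) (lop \<sigma> y (mu d m))) a"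
  proof (rule sw_cong)
    fix x y assume "x \<in> B" "y \<in> B"
    then have "gS (Sii (pj (gS x))) = x"
      by (simp add: pj_id gS_car closed_simps Sii_def linmap_closed[OF antipode_inv_lin]
          antipode_antipode_inv antipode_inv_antipode)
    then show "?\<phi> (gS y) (gS x) = (\<Sum>d\<in>B. sM (e b (gmul x (gS d))) (lop \<sigma> y (mu d m)))"
      by (simp add: lop_def True pj_id gS_closed)
  qed
  also have "\<dots> = sw sM (\<lambda>x y. \<Sum>c\<in>B. sM (e b (gmul x c)) (lop \<sigma> y (tau (\<not> \<sigma>) c m))) a"
    using sum_lop_tau_False[OF m hlin_e_mul(1)[OF b]] by (simp add: True)
  finally show ?thesis .
next
  case False
  have "tau (\<not> \<sigma>) b (lop \<sigma> a m) = sw sM (\<lambda>x y. \<Sum>c\<in>B. sM (e b (hmult H x c)) (lact M y (lam c m))) (pj a)"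
    by (simp add: tau_def lop_def False lam_lact pj_closed m b)
  also have "\<dots> = sw sM (\<lambda>x y. \<Sum>c\<in>B. sM (e b (gmul x c)) (lop \<sigma> y (tau (\<not> \<sigma>) c m))) a"
    unfolding sw_pr[OF MV.vector_space_axioms, unfolded pr_eq_pj]
    by (rule sw_cong) (simp add: False lop_def tau_def pj_id B_car gmul_car)
  finally show ?thesis .
qed

end

section \<open>Vertex and face cycles\<close>

context
  fixes p :: "'d \<Rightarrow> 'd" and h :: 'd
  assumes p: "permutation p"
begin

lemma cycle_length: "card (orbit p h) = funpow_dist1 p h h"
  and cycle_return: "(p ^^ card (orbit p h)) h = h"
  and cycle_inj: "inj_on (\<lambda>r. (p ^^ r) h) {0..<card (orbit p h)}"
  and cycle_image: "orbit p h = (\<lambda>r. (p ^^ r) h) ` {0..<card (orbit p h)}"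
proof -
  have self: "h \<in> orbit p h" by (rule permutation_self_in_orbit[OF p])
  have inj: "inj_on (\<lambda>r. (p ^^ r) h) {0..<funpow_dist1 p h h}" by (rule inj_on_funpow_dist1[OF self])
  have img: "orbit p h = (\<lambda>r. (p ^^ r) h) ` {0..<funpow_dist1 p h h}" by (rule orbit_conv_funpow_dist1[OF self])
  show len: "card (orbit p h) = funpow_dist1 p h h"
    using card_image[OF inj] unfolding img[symmetric] by simp
  show "(p ^^ card (orbit p h)) h = h" unfolding len by (rule funpow_dist1_prop[OF self])
  show "inj_on (\<lambda>r. (p ^^ r) h) {0..<card (orbit p h)}" unfolding len by (rule inj)
  show "orbit p h = (\<lambda>r. (p ^^ r) h) ` {0..<card (orbit p h)}" unfolding len by (rule img)
qed

lemma cycle_from_set: "set (cycle_from p h) = orbit p h"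
  using cycle_image by (simp add: cycle_from_def)

lemma cycle_from_distinct: "distinct (cycle_from p h)"
  using cycle_inj by (simp add: cycle_from_def distinct_map)

lemma cycle_from_length: "length (cycle_from p h) = card (orbit p h)"
  by (simp add: cycle_from_def)

lemma cycle_from_pos: "0 < card (orbit p h)"
  using cycle_length by simp

lemma cycle_from_not_Nil: "cycle_from p h \<noteq> []"
  using cycle_from_pos by (simp add: cycle_from_def)

lemma cycle_from_nth: "r < card (orbit p h) \<Longrightarrow> cycle_from p h ! r = (p ^^ r) h"
  by (simp add: cycle_from_def)

lemma cycle_from_hd: "hd (cycle_from p h) = h"
  using cycle_from_pos by (simp add: hd_conv_nth cycle_from_not_Nil cycle_from_nth)

lemma cycle_from_last: "p (last (cycle_from p h)) = h"
proof -
  obtain n where n: "card (orbit p h) = Suc n" using cycle_from_pos gr0_conv_Suc by auto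
  have "p (last (cycle_from p h)) = (p ^^ Suc n) h"
    by (simp add: last_conv_nth cycle_from_not_Nil cycle_from_length cycle_from_nth n)
  then show ?thesis using cycle_return n by simp
qed

lemma cycle_from_next:
  assumes "k \<in> orbit p h" "p k \<noteq> h"
  shows "\<exists>us vs. cycle_from p h = us @ k # p k # vs"
proof -
  obtain r where r: "r < card (orbit p h)" "k = (p ^^ r) h"
  proof -
    have "k \<in> (\<lambda>r. (p ^^ r) h) ` {0..<card (orbit p h)}"
      using assms(1) by (subst (asm) cycle_image)
    then show ?thesis using that by auto
  qed
  have "Suc r \<noteq> card (orbit p h)"
  proof
    assume "Suc r = card (orbit p h)"
    then have "(p ^^ Suc r) h = h" using cycle_return by simp
    then show False using assms(2) r(2) by simp
  qed
  then have sr: "Suc r < card (orbit p h)" using r(1) by simp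
  then have "cycle_from p h = take r (cycle_from p h) @ cycle_from p h ! r # cycle_from p h ! Suc r # drop (Suc (Suc r)) (cycle_from p h)"
    by (simp add: cycle_from_length Cons_nth_drop_Suc)
  then have "cycle_from p h = take r (cycle_from p h) @ k # p k # drop (Suc (Suc r)) (cycle_from p h)"
    using r sr by (simp add: cycle_from_nth)
  then show ?thesis by blast
qed

lemma cycle_from_successively:
  assumes "\<And>k. k \<in> orbit p h \<Longrightarrow> p k \<noteq> h \<Longrightarrow> P k (p k)"
  shows "successively P (cycle_from p h)"
  unfolding successively_conv_nth
proof (intro allI impI)
  fix i assume i: "Suc i < length (cycle_from p h)"
  then have i': "Suc i < card (orbit p h)" by (simp add: cycle_from_length)
  let ?k = "(p ^^ i) h"
  have "?k \<in> orbit p h" by (subst cycle_image) (use i' in auto)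
  moreover have "p ?k \<noteq> h"
    using inj_onD[OF cycle_inj, of "Suc i" 0] i' by auto
  ultimately have "P ?k (p ?k)" by (rule assms)
  then show "P (cycle_from p h ! i) (cycle_from p h ! Suc i)"
    using i' by (simp add: cycle_from_nth)
qed

end

section \<open>Vertices, faces and cilia of a Kitaev graph\<close>

context kitaev_graph
begin

lemma rho_permutation: "permutation (rho G)"
  using fin rho_permutes permutation_permutes by blast

lemma face_perm_permutes: "face_perm G permutes hedges G"
  unfolding face_perm_def by (intro permutes_compose hinv_permutes permutes_inv rho_permutes)

lemma face_permutation: "permutation (face_perm G)"
  using fin face_perm_permutes permutation_permutes by blast

lemma rho_inv: "rho G (inv (rho G) h) = h" "inv (rho G) (rho G h) = h"
  using permutes_inverses[OF rho_permutes] by simp_all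

lemma hinv_closed: "h \<in> hedges G \<Longrightarrow> hinv G h \<in> hedges G"
  using permutes_in_image[OF hinv_permutes] by simp

lemma hinv_hinv: "hinv G (hinv G h) = h"
  using hinv_invol permutes_not_in[OF hinv_permutes] by (cases "h \<in> hedges G") auto

lemma inv_rho_closed: "h \<in> hedges G \<Longrightarrow> inv (rho G) h \<in> hedges G"
  using permutes_in_image[OF permutes_inv[OF rho_permutes]] by simp

lemma edge_of_eq: "edge_of G h = {h, hinv G h}"
proof -
  have "orbit (hinv G) h = {(hinv G ^^ n) h | n. n < 2}"
    by (rule orbit_altdef_bounded) (simp_all add: numeral_2_eq_2 hinv_hinv)
  also have "\<dots> = {h, hinv G h}"
    by (force simp: less_2_cases_iff)
  finally show ?thesis by (simp add: edge_of_def)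
qed

lemma edge_of_hinv: "edge_of G (hinv G h) = edge_of G h"
  by (auto simp: edge_of_eq hinv_hinv)

lemma edge_of_neq: "k \<noteq> h \<Longrightarrow> k \<noteq> hinv G h \<Longrightarrow> edge_of G k \<noteq> edge_of G h"
  by (auto simp: edge_of_eq)

lemma edge_of_in: "h \<in> hedges G \<Longrightarrow> edge_of G h \<in> edges G"
  by (simp add: edges_def)

lemma is_source_hinv: "h \<in> hedges G \<Longrightarrow> is_source G (hinv G h) \<longleftrightarrow> \<not> is_source G h"
proof -
  assume h: "h \<in> hedges G"
  have tot: "total_on (hedges G) (ord G)" and anti: "antisym (ord G)"
    using ord_linear by (simp_all add: linear_order_on_def partial_order_on_def)
  have "h \<noteq> hinv G h" using hinv_no_fix[OF h] by simp
  then show ?thesis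
    using tot anti h hinv_closed[OF h] unfolding is_source_def lt_def hinv_hinv
    by (auto simp: total_on_def antisym_def)
qed

abbreviation vlist :: "'d \<Rightarrow> 'd list" where "vlist c \<equiv> cycle_from (rho G) c"
abbreviation flist :: "'d \<Rightarrow> 'd list" where "flist c \<equiv> cycle_from (face_perm G) (inv (rho G) c)"

lemma orbit_eq_iff: "permutation p \<Longrightarrow> y \<in> orbit p x \<longleftrightarrow> orbit p x = orbit p y"
  using orbit_cyclic_eq3[OF cyclic_on_orbit'] permutation_self_in_orbit by metis

lemma vertex_cilium_unique:
  assumes "c \<in> cilia G" "c' \<in> cilia G" "c' \<in> orbit (rho G) c"
  shows "c' = c"
proof -
  have "vertex_of G c' = vertex_of G c"
    using assms(3) orbit_eq_iff[OF rho_permutation] by (simp add: vertex_of_def)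
  then show ?thesis using cilia_vertices assms(1,2) by (auto simp: bij_betw_def dest: inj_onD)
qed

lemma face_cilium_unique:
  assumes "c \<in> cilia G" "c' \<in> cilia G" "x \<in> orbit (face_perm G) (inv (rho G) c)"
    "x \<in> orbit (face_perm G) (inv (rho G) c')"
  shows "c = c'"
proof -
  have "face_of G (inv (rho G) c) = face_of G (inv (rho G) c')"
    using assms(3,4) orbit_eq_iff[OF face_permutation] by (simp add: face_of_def)
  then show ?thesis using cilia_faces assms(1,2) by (auto simp: bij_betw_def dest: inj_onD)
qed

lemma vlist_sub: "c \<in> cilia G \<Longrightarrow> set (vlist c) \<subseteq> hedges G"
  unfolding cycle_from_set[OF rho_permutation]
  using permutes_orbit_subset[OF rho_permutes] cilia_sub by auto

lemma flist_sub: "c \<in> cilia G \<Longrightarrow> set (flist c) \<subseteq> hedges G"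
  unfolding cycle_from_set[OF face_permutation]
  using permutes_orbit_subset[OF face_perm_permutes inv_rho_closed] cilia_sub by auto

lemma vlist_disjoint: "c \<in> cilia G \<Longrightarrow> c' \<in> cilia G \<Longrightarrow> c \<noteq> c' \<Longrightarrow> set (vlist c) \<inter> set (vlist c') = {}"
  unfolding cycle_from_set[OF rho_permutation]
  using vertex_cilium_unique orbit_eq_iff[OF rho_permutation] permutation_self_in_orbit[OF rho_permutation]
  by (metis disjoint_iff)

lemma flist_disjoint: "c \<in> cilia G \<Longrightarrow> c' \<in> cilia G \<Longrightarrow> c \<noteq> c' \<Longrightarrow> set (flist c) \<inter> set (flist c') = {}"
  unfolding cycle_from_set[OF face_permutation] using face_cilium_unique by blast

lemma vlist_last: "last (vlist c) = inv (rho G) c"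
  using cycle_from_last[OF rho_permutation, of c] rho_inv by metis

text \<open>Together with \<open>vlist_last\<close> this says that the vertex and the face of
  \<open>c\<close> are cut open at the same corner: the face list begins with the last entry of the
  vertex list and ends with the partner of its first entry. These are the end conditions of
  \<open>Tseq_Lseq_same\<close>.\<close>

lemma flist_last: "last (flist c) = hinv G c"
proof -
  have "inv (rho G) (hinv G (last (flist c))) = inv (rho G) c"
    using cycle_from_last[OF face_permutation, of "inv (rho G) c"] by (simp add: face_perm_def)
  then have "hinv G (last (flist c)) = c" using rho_inv by metis
  then show ?thesis using hinv_hinv by metis
qed

lemma face_perm_hinv: "face_perm G (hinv G h) = inv (rho G) h"
  by (simp add: face_perm_def hinv_hinv)

text \<open>The face permutation sends \<open>hinv G (rho G h)\<close> to \<open>h\<close>, so the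
  two are neighbours in a face list that contains them unless the list is cut there, and a cut would
  make \<open>rho G h\<close> a cilium. If they coincided, \<open>{h}\<close> would be a face, and
  the cilium belonging to this face would again be \<open>rho G h\<close>.\<close>

lemma interior_corner:
  assumes c': "c' \<in> cilia G" and h: "h \<in> hedges G" "rho G h \<notin> cilia G"
  shows "hinv G (rho G h) \<noteq> h"
    and "(\<exists>us vs. flist c' = us @ hinv G (rho G h) # h # vs) \<or> h \<notin> set (flist c') \<and> hinv G (rho G h) \<notin> set (flist c')"
proof -
  let ?k = "hinv G (rho G h)"
  have fk: "face_perm G ?k = h" by (simp add: face_perm_hinv rho_inv)
  show "?k \<noteq> h"
  proof
    assume "?k = h"
    then have "orbit (face_perm G) h = {h}" using fk by (simp add: orbit_eq_singleton_iff)
    moreover obtain c'' where c'': "c'' \<in> cilia G" "face_of G (inv (rho G) c'') = face_of G h"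
    proof -
      have "face_of G h \<in> (\<lambda>c. face_of G (inv (rho G) c)) ` cilia G"
        using cilia_faces h(1) by (simp add: bij_betw_def faces_def)
      then show ?thesis using that by (metis (no_types, lifting) imageE)
    qed
    ultimately have "inv (rho G) c'' = h"
      using permutation_self_in_orbit[OF face_permutation, of "inv (rho G) c''"] by (simp add: face_of_def)
    then have "rho G h = c''" using rho_inv by metis
    then show False using c'' h(2) by simp
  qed
  have iff: "h \<in> orbit (face_perm G) x \<longleftrightarrow> ?k \<in> orbit (face_perm G) x" for x
    using permutation_orbit_step[OF face_permutation, of ?k] orbit_eq_iff[OF face_permutation] fk by metis
  show "(\<exists>us vs. flist c' = us @ ?k # h # vs) \<or> h \<notin> set (flist c') \<and> ?k \<notin> set (flist c')"
  proof (cases "?k \<in> orbit (face_perm G) (inv (rho G) c')")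
    case True
    have "face_perm G ?k \<noteq> inv (rho G) c'"
      using fk h(2) c' rho_inv by metis
    then show ?thesis using cycle_from_next[OF face_permutation True] fk by auto
  next
    case False
    then show ?thesis using iff by (simp add: cycle_from_set[OF face_permutation])
  qed
qed

lemma flist_ends_other:
  assumes "c \<in> cilia G" "c' \<in> cilia G" "c \<noteq> c'"
  shows "inv (rho G) c \<notin> set (flist c')" "hinv G c \<notin> set (flist c')"
proof -
  have "hd (flist c) = inv (rho G) c" "last (flist c) = hinv G c"
    by (simp_all add: cycle_from_hd[OF face_permutation] flist_last)
  then have "inv (rho G) c \<in> set (flist c)" "hinv G c \<in> set (flist c)"
    using hd_in_set[of "flist c"] last_in_set[of "flist c"] cycle_from_not_Nil[OF face_permutation] by metis+
  then show "inv (rho G) c \<notin> set (flist c')" "hinv G c \<notin> set (flist c')"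
    using flist_disjoint[OF assms] by auto
qed

end

section \<open>Half-edge operators on the extended space\<close>

text \<open>Supplies \<open>prN\<close>, by which operators given on the carrier become linear maps
  on the whole type, as \<open>half_edge_ops\<close> demands.\<close>

lemma linear_projection_exists:
  assumes V: "is_vspace V"
  shows "\<exists>P. (\<forall>x y. P (x + y) = P x + P y) \<and> (\<forall>c x. P (vscale V c x) = vscale V c (P x)) \<and>
    (\<forall>x. P x \<in> vcar V) \<and> (\<forall>x\<in>vcar V. P x = x)"
proof -
  interpret V: vector_space "vscale V" by (rule vs_vector_space[OF V])
  interpret VV: vector_space_pair "vscale V" "vscale V" ..
  obtain D where D: "D \<subseteq> vcar V" "V.independent D" "vcar V \<subseteq> V.span D"
    by (rule V.maximal_independent_subset)
  define P where "P = VV.construct D (\<lambda>x. x)"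
  interpret P: Vector_Spaces.linear "vscale V" "vscale V" P
    unfolding P_def by (rule VV.linear_construct[OF D(2)])
  have "P x \<in> vcar V" for x
    using VV.construct_in_span[OF D(2), of "\<lambda>x. x" x] V.span_minimal[OF D(1) vs_subspace[OF V]]
    by (auto simp: P_def)
  moreover have "P x = x" if "x \<in> V.span D" for x
    using that
  proof (induction rule: V.span_induct_alt)
    case (step c x y)
    have "P x = x" unfolding P_def by (rule VV.construct_basis[OF D(2) step(1)])
    then show ?case using step by (simp add: P.add P.scale)
  qed (rule P.zero)
  ultimately show ?thesis using D(3) P.add P.scale by blast
qed

locale based_graph = based_bimodule H B e M + Gr: kitaev_graph G
  for H :: "('k::field, 'h::ab_group_add) hopf" and B :: "'h set" and e :: "'h \<Rightarrow> 'h \<Rightarrow> 'k"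
    and M :: "('k, 'h, 'm::ab_group_add) hbimod" and G :: "'d kitaev"
begin

abbreviation "N \<equiv> ext_space G M"
abbreviation "I \<equiv> edges G"

lemma N_def': "N = tpower I M"
  by (simp add: ext_space_def)

lemma N_vspace: "is_vspace N" unfolding N_def' by (rule is_vspace_tpower)

lemma vscale_N: "vscale N = fscale" by (simp add: ext_space_def)

definition prN where
  "prN = (SOME P. (\<forall>x y. P (x + y) = P x + P y) \<and> (\<forall>c x. P (vscale N c x) = vscale N c (P x)) \<and>
    (\<forall>x. P x \<in> vcar N) \<and> (\<forall>x\<in>vcar N. P x = x))"

lemma prN_props: "(\<forall>x y. prN (x + y) = prN x + prN y) \<and> (\<forall>c x. prN (vscale N c x) = vscale N c (prN x)) \<and>
    (\<forall>x. prN x \<in> vcar N) \<and> (\<forall>x\<in>vcar N. prN x = x)"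
  unfolding prN_def by (rule someI_ex[OF linear_projection_exists[OF N_vspace]])

lemma prN: "prN (x + y) = prN x + prN y" "prN (fscale c x) = fscale c (prN x)"
    "prN x \<in> vcar N" "x \<in> vcar N \<Longrightarrow> prN x = x"
  using prN_props unfolding vscale_N by blast+

lemma upd_eq_map: "x \<in> I \<rightarrow>\<^sub>E vcar M \<Longrightarrow> a \<in> I \<Longrightarrow>
    x(a := f (x a)) = (\<lambda>c\<in>I. (if c = a then f else (\<lambda>m. m)) (x c))"
  by (auto simp: fun_eq_iff PiE_iff extensional_def)

section \<open>Operators on a single tensor factor\<close>

lemma on_edge_multilin:
  assumes "linmap M M f" "a \<in> I"
  shows "multilin I M N (\<lambda>x. ptensor I M (x(a := f (x a))))"
proof (rule multilin_cong[OF M.vspace])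
  show "multilin I M N (\<lambda>x. ptensor I M (\<lambda>c\<in>I. (if c = a then f else (\<lambda>m. m)) (x c)))"
    unfolding N_def' by (rule multilin_map[OF M.vspace multilin_ptensor]) (simp add: assms linmap_id)
qed (simp only: upd_eq_map assms(2))

lemma on_edge_lin: "linmap M M f \<Longrightarrow> a \<in> I \<Longrightarrow> linmap N N (on_edge G M a f)"
  unfolding on_edge_def using ptensor_universal(1)[OF N_vspace on_edge_multilin] by (simp add: N_def')

lemma on_edge_ptensor: "linmap M M f \<Longrightarrow> a \<in> I \<Longrightarrow> x \<in> I \<rightarrow>\<^sub>E vcar M \<Longrightarrow>
    on_edge G M a f (ptensor I M x) = ptensor I M (x(a := f (x a)))"
  unfolding on_edge_def by (rule ptensor_universal(2)[OF N_vspace on_edge_multilin])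

lemma on_edge_cong: "(\<And>m. m \<in> vcar M \<Longrightarrow> f m = g m) \<Longrightarrow> a \<in> I \<Longrightarrow> on_edge G M a f = on_edge G M a g"
  unfolding on_edge_def by (rule plift_cong) (simp add: PiE_iff)

lemma upd_PiE: "x \<in> I \<rightarrow>\<^sub>E vcar M \<Longrightarrow> a \<in> I \<Longrightarrow> v \<in> vcar M \<Longrightarrow> x(a := v) \<in> I \<rightarrow>\<^sub>E vcar M"
  by (auto simp: PiE_iff extensional_def)

lemma N_eqI:
  assumes "linmap N X F" "linmap N X F'" "is_vspace X" "\<And>x. x \<in> I \<rightarrow>\<^sub>E vcar M \<Longrightarrow> F (ptensor I M x) = F' (ptensor I M x)"
    and "n \<in> vcar N"
  shows "F n = F' n"
  by (rule linmap_tpower_eqI[OF assms(3) assms(1,2,4,5)[unfolded N_def']])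

lemma on_edge_comp:
  assumes f: "linmap M M f" and g: "linmap M M g" and a: "a \<in> I" and n: "n \<in> vcar N"
  shows "on_edge G M a f (on_edge G M a g n) = on_edge G M a (\<lambda>m. f (g m)) n"
proof (rule N_eqI[OF _ _ N_vspace _ n])
  show "linmap N N (\<lambda>n. on_edge G M a f (on_edge G M a g n))"
    by (rule linmap_comp[OF on_edge_lin[OF g a] on_edge_lin[OF f a]])
  show "linmap N N (on_edge G M a (\<lambda>m. f (g m)))" by (rule on_edge_lin[OF linmap_comp[OF g f] a])
  fix x assume x: "x \<in> I \<rightarrow>\<^sub>E vcar M"
  then have "g (x a) \<in> vcar M" using a linmap_closed[OF g] by (auto simp: PiE_iff)
  then show "on_edge G M a f (on_edge G M a g (ptensor I M x)) = on_edge G M a (\<lambda>m. f (g m)) (ptensor I M x)"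
    by (simp add: on_edge_ptensor f g a x upd_PiE linmap_comp[OF g f])
qed

lemma on_edge_commute:
  assumes f: "linmap M M f" and g: "linmap M M g" and ab: "a \<in> I" "b \<in> I" "a \<noteq> b" and n: "n \<in> vcar N"
  shows "on_edge G M a f (on_edge G M b g n) = on_edge G M b g (on_edge G M a f n)"
proof (rule N_eqI[OF _ _ N_vspace _ n])
  show "linmap N N (\<lambda>n. on_edge G M a f (on_edge G M b g n))" "linmap N N (\<lambda>n. on_edge G M b g (on_edge G M a f n))"
    by (intro linmap_comp[OF on_edge_lin on_edge_lin] f g ab)+
  fix x assume x: "x \<in> I \<rightarrow>\<^sub>E vcar M"
  then have "g (x b) \<in> vcar M" "f (x a) \<in> vcar M" using ab linmap_closed[OF g] linmap_closed[OF f] by (auto simp: PiE_iff)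
  then show "on_edge G M a f (on_edge G M b g (ptensor I M x)) = on_edge G M b g (on_edge G M a f (ptensor I M x))"
    using ab by (simp add: on_edge_ptensor f g x upd_PiE fun_upd_twist)
qed

lemma on_edge_id:
  assumes a: "a \<in> I" and n: "n \<in> vcar N" and f: "\<And>m. m \<in> vcar M \<Longrightarrow> f m = m"
  shows "on_edge G M a f n = n"
proof -
  have "on_edge G M a f = on_edge G M a (\<lambda>m. m)" by (rule on_edge_cong[OF f a])
  moreover have "on_edge G M a (\<lambda>m. m) n = n"
    by (rule N_eqI[OF on_edge_lin[OF linmap_id a] linmap_id N_vspace _ n])
      (simp add: on_edge_ptensor linmap_id a)
  ultimately show ?thesis by simp
qed

lemma on_edge_sum:
  assumes a: "a \<in> I" and n: "n \<in> vcar N" and f: "\<And>i. i \<in> J \<Longrightarrow> linmap M M (f i)"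
  shows "on_edge G M a (\<lambda>m. \<Sum>i\<in>J. vscale M (c i) (f i m)) n = (\<Sum>i\<in>J. fscale (c i) (on_edge G M a (f i) n))"
proof (rule N_eqI[OF _ _ N_vspace _ n])
  have lin: "linmap M M (\<lambda>m. \<Sum>i\<in>J. vscale M (c i) (f i m))"
    by (intro linmap_sum_fun M.vspace linmap_scale_fun f)
  then show "linmap N N (on_edge G M a (\<lambda>m. \<Sum>i\<in>J. vscale M (c i) (f i m)))" by (rule on_edge_lin[OF _ a])
  show "linmap N N (\<lambda>n. \<Sum>i\<in>J. fscale (c i) (on_edge G M a (f i) n))"
    using linmap_scale_fun[OF N_vspace on_edge_lin[OF f a]] unfolding vscale_N
    by (intro linmap_sum_fun N_vspace)
  fix x assume x: "x \<in> I \<rightarrow>\<^sub>E vcar M"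
  have "x a \<in> vcar M" using x a by (auto simp: PiE_iff)
  then have "ptensor I M (x(a := \<Sum>i\<in>J. vscale M (c i) (f i (x a)))) =
      (\<Sum>i\<in>J. vscale (tpower I M) (c i) (ptensor I M (x(a := f i (x a)))))"
    by (intro linmap_sum_scale[OF M.vspace is_vspace_tpower multilin_upd[OF multilin_ptensor x a]])
      (rule linmap_closed[OF f])
  then show "on_edge G M a (\<lambda>m. \<Sum>i\<in>J. vscale M (c i) (f i m)) (ptensor I M x) =
      (\<Sum>i\<in>J. fscale (c i) (on_edge G M a (f i) (ptensor I M x)))"
    by (simp add: on_edge_ptensor lin a x f)
qed

text \<open>The common form of \<open>Lop\<close> and \<open>Top\<close>. Projecting by
  \<open>prN\<close> and taking the value 0 off the graph makes linearity and the commutation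
  relations hold on the whole types, without membership conditions.\<close>

definition hop :: "'d \<Rightarrow> (bool \<Rightarrow> 'm \<Rightarrow> 'm) \<Rightarrow> ((('d set \<Rightarrow> 'm) \<Rightarrow> 'k) \<Rightarrow> 'k) \<Rightarrow> ((('d set \<Rightarrow> 'm) \<Rightarrow> 'k) \<Rightarrow> 'k)" where
  "hop h f n = (if h \<in> hedges G then on_edge G M (edge_of G h) (f (is_source G h)) (prN n) else 0)"

lemma hop_hinv: "hop (hinv G h) f n = hop h (\<lambda>\<sigma>. f (\<not> \<sigma>)) n"
  using Gr.hinv_closed[of h] Gr.hinv_closed[of "hinv G h"]
  by (auto simp: hop_def Gr.edge_of_hinv Gr.is_source_hinv Gr.hinv_hinv)

lemma tau_expand:
  assumes m: "m \<in> vcar M"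
  shows "tau \<sigma> b m = (\<Sum>d\<in>B. vscale M (e b d) (tau \<sigma> d m))"
proof (cases \<sigma>)
  case True
  let ?t = "lco M m"
  have t: "?t \<in> vcar (H \<otimes>\<^sub>s M)" by (rule linmap_closed[OF lco_lin m])
  have "lcf M b ?t = lcf M b (\<Sum>d\<in>B. tensor H M d (lcf M d ?t))"
    by (rule arg_cong[OF left_expand[OF M.vspace t]])
  also have "\<dots> = (\<Sum>d\<in>B. lcf M b (tensor H M d (lcf M d ?t)))"
    by (rule linmap_sum[OF is_vspace_tprod M.vspace linmap_lcf[OF M.vspace]])
      (simp add: tensor_closed B_car lcf_closed[OF M.vspace t])
  also have "\<dots> = (\<Sum>d\<in>B. vscale M (e b d) (lcf M d ?t))"
    by (intro sum.cong refl lcf_tensor[OF M.vspace] B_car lcf_closed[OF M.vspace t])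
  finally show ?thesis by (simp add: tau_def True lam_def)
next
  case False
  have "(\<Sum>d\<in>B. e b d * e d (gS c)) = e b (gS c)" for c
    using e_pj[of b "gS c"] by (simp add: pj_id gS_closed mult.commute)
  then have "(\<Sum>c\<in>B. vscale M (\<Sum>d\<in>B. e b d * e d (gS c)) (mu c m)) = tau \<sigma> b m"
    by (simp add: tau_def False)
  then show ?thesis
    by (simp add: tau_def False MV.scale_sum_left MV.scale_sum_right) (subst sum.swap, simp)
qed

text \<open>\<open>half_edge_ops\<close> asks for commutation at arbitrary elements of the type,
  whereas \<open>tau_commute\<close> rests on the coefficients at basis vectors;
  \<open>tau_expand\<close> bridges the two.\<close>

lemma tau_commute_all:
  assumes m: "m \<in> vcar M"
  shows "tau (\<not> \<sigma>) b (tau \<sigma> c m) = tau \<sigma> c (tau (\<not> \<sigma>) b m)"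
proof -
  have "tau (\<not> \<sigma>) b (tau \<sigma> c m) = (\<Sum>d\<in>B. vscale M (e b d) (tau (\<not> \<sigma>) d (\<Sum>d'\<in>B. vscale M (e c d') (tau \<sigma> d' m))))"
    by (subst tau_expand[OF tau_closed[OF m]], subst tau_expand[OF m, of \<sigma> c]) (rule refl)
  also have "\<dots> = (\<Sum>d\<in>B. \<Sum>d'\<in>B. vscale M (e b d * e c d') (tau (\<not> \<sigma>) d (tau \<sigma> d' m)))"
    by (simp add: linmap_sum_scale_M[OF tau_lin] tau_closed m MV.scale_sum_right)
  also have "\<dots> = (\<Sum>d'\<in>B. \<Sum>d\<in>B. vscale M (e c d' * e b d) (tau \<sigma> d' (tau (\<not> \<sigma>) d m)))"
    by (subst sum.swap) (simp add: tau_commute m mult.commute)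
  also have "\<dots> = (\<Sum>d'\<in>B. vscale M (e c d') (tau \<sigma> d' (\<Sum>d\<in>B. vscale M (e b d) (tau (\<not> \<sigma>) d m))))"
    by (simp add: linmap_sum_scale_M[OF tau_lin] tau_closed m MV.scale_sum_right)
  also have "\<dots> = tau \<sigma> c (tau (\<not> \<sigma>) b m)"
    by (simp only: tau_expand[OF m, of "\<not> \<sigma>" b, symmetric] tau_expand[OF tau_closed[OF m], symmetric])
  finally show ?thesis .
qed

definition Lop where "Lop h a = hop h (\<lambda>\<sigma>. lop \<sigma> a)"
definition Top where "Top h b = hop h (\<lambda>\<sigma>. tau \<sigma> b)"

lemma hop_lin:
  assumes "\<And>\<sigma>. linmap M M (f \<sigma>)"
  shows "hop h f (m + n) = hop h f m + hop h f n" "hop h f (fscale c n) = fscale c (hop h f n)"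
    and "hop h f n \<in> vcar N"
proof -
  interpret F: vector_space "fscale :: 'k \<Rightarrow> ((('d set \<Rightarrow> 'm) \<Rightarrow> 'k) \<Rightarrow> 'k) \<Rightarrow> _"
    by (rule vector_space_fscale)
  note l = on_edge_lin[OF assms Gr.edge_of_in]
  show "hop h f (m + n) = hop h f m + hop h f n"
    using linmap_add[OF l prN(3) prN(3)] by (simp add: hop_def prN)
  show "hop h f (fscale c n) = fscale c (hop h f n)"
    using linmap_scale[OF l prN(3)] by (simp add: hop_def prN vscale_N)
  show "hop h f n \<in> vcar N"
    using linmap_closed[OF l prN(3)] vs_zero[OF N_vspace] by (simp add: hop_def)
qed

lemma fscale_zero: "fscale c 0 = 0"
  by (simp add: fscale_def fun_eq_iff)

lemma hop_zero: "(\<And>\<sigma>. linmap M M (f \<sigma>)) \<Longrightarrow> hop h f 0 = 0"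
  using hop_lin(2)[of f h 0 0] by (simp add: fscale_def zero_fun_def)

lemma hop_outside: "h \<notin> hedges G \<Longrightarrow> hop h f n = 0"
  by (simp add: hop_def)

text \<open>Half-edges of different edges act on different tensor factors. The assumption
  \<open>opp\<close> settles the remaining case, the two half-edges of one edge.\<close>

lemma hop_commute:
  assumes f: "\<And>\<sigma>. linmap M M (f \<sigma>)" and g: "\<And>\<sigma>. linmap M M (g \<sigma>)" and hk: "h \<noteq> k"
    and opp: "\<And>\<sigma> m. k = hinv G h \<Longrightarrow> m \<in> vcar M \<Longrightarrow> f (\<not> \<sigma>) (g \<sigma> m) = g \<sigma> (f (\<not> \<sigma>) m)"
  shows "hop h f (hop k g n) = hop k g (hop h f n)"
proof (cases "h \<in> hedges G \<and> k \<in> hedges G")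
  case False
  then show ?thesis using hop_zero[of f] hop_zero[of g] f g by (auto simp: hop_outside)
next
  case True
  then have h: "h \<in> hedges G" "k \<in> hedges G" by auto
  note e = h[THEN Gr.edge_of_in]
  have cl: "hop k g n \<in> vcar N" "hop h f n \<in> vcar N" by (rule hop_lin(3)[OF g] hop_lin(3)[OF f])+
  show ?thesis
  proof (cases "k = hinv G h")
    case True
    have src: "is_source G h = (\<not> is_source G k)"
      using Gr.is_source_hinv[OF h(1)] True by auto
    have ed: "edge_of G k = edge_of G h" by (simp add: True Gr.edge_of_hinv)
    have "on_edge G M (edge_of G h) (\<lambda>m. f (is_source G h) (g (is_source G k) m)) =
        on_edge G M (edge_of G h) (\<lambda>m. g (is_source G k) (f (is_source G h) m))"
      by (rule on_edge_cong[OF _ e(1)]) (simp add: src opp[OF True])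
    then show ?thesis
      using h prN(4)[OF cl(1)] prN(4)[OF cl(2)]
      by (simp add: hop_def ed on_edge_comp f g e prN(3))
  next
    case False
    then have "edge_of G h \<noteq> edge_of G k" using Gr.edge_of_neq[of k h] hk by auto
    then show ?thesis
      using h prN(4)[OF cl(1)] prN(4)[OF cl(2)] on_edge_commute[OF f g e _ prN(3)]
      by (simp add: hop_def)
  qed
qed

lemma hop_comp_same:
  assumes f: "\<And>\<sigma>. linmap M M (f \<sigma>)" and g: "\<And>\<sigma>. linmap M M (g \<sigma>)"
  shows "hop h f (hop h g n) = hop h (\<lambda>\<sigma> m. f \<sigma> (g \<sigma> m)) n"
proof (cases "h \<in> hedges G")
  case True
  have cl: "hop h g n \<in> vcar N" by (rule hop_lin(3)[OF g])
  show ?thesis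
    using True prN(4)[OF cl] by (simp add: hop_def on_edge_comp f g Gr.edge_of_in prN(3))
qed (use hop_zero[of f] f in \<open>simp add: hop_outside\<close>)

lemma hop_comp_opposite:
  assumes f: "\<And>\<sigma>. linmap M M (f \<sigma>)" and g: "\<And>\<sigma>. linmap M M (g \<sigma>)"
  shows "hop (hinv G h) f (hop h g n) = hop h (\<lambda>\<sigma> m. f (\<not> \<sigma>) (g \<sigma> m)) n"
proof (cases "h \<in> hedges G")
  case True
  have cl: "hop h g n \<in> vcar N" by (rule hop_lin(3)[OF g])
  show ?thesis
    using True prN(4)[OF cl] Gr.hinv_closed[OF True]
    by (simp add: hop_def on_edge_comp f g Gr.edge_of_in prN(3) Gr.edge_of_hinv Gr.is_source_hinv)
qed (use hop_zero[of f] f in \<open>simp add: hop_outside\<close>)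

lemma hop_sum:
  assumes f: "\<And>i \<sigma>. i \<in> J \<Longrightarrow> linmap M M (f i \<sigma>)"
    and g: "\<And>\<sigma> m. m \<in> vcar M \<Longrightarrow> g \<sigma> m = (\<Sum>i\<in>J. vscale M (c i) (f i \<sigma> m))"
  shows "hop h g n = (\<Sum>i\<in>J. fscale (c i) (hop h (f i) n))"
proof (cases "h \<in> hedges G")
  case True
  have "on_edge G M (edge_of G h) (g (is_source G h)) =
      on_edge G M (edge_of G h) (\<lambda>m. \<Sum>i\<in>J. vscale M (c i) (f i (is_source G h) m))"
    by (rule on_edge_cong[OF g Gr.edge_of_in[OF True]])
  then show ?thesis
    using on_edge_sum[OF Gr.edge_of_in[OF True] prN(3) f] True by (simp add: hop_def)
next
  case False
  then show ?thesis by (simp add: hop_outside fscale_zero)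
qed

lemma half_edge_ops_hold:
  "half_edge_ops (vscale H) B e gmul (hone H) gdl gep gS fscale (vcar N) (hedges G) (hinv G) Lop Top"
proof -
  interpret F: vector_space "fscale :: 'k \<Rightarrow> ((('d set \<Rightarrow> 'm) \<Rightarrow> 'k) \<Rightarrow> 'k) \<Rightarrow> _"
    by (rule vector_space_fscale)
  \<comment> \<open>Transports an identity on \<open>M\<close> whose right-hand side is a Sweedler
    sum over a basis sum to the extended space; the relations for \<open>t_L_same\<close> and
    \<open>t_L_opposite\<close> are both of this shape.\<close>
  have triple: "hop h (\<lambda>\<sigma> m. f \<sigma> m) n = (\<Sum>c\<in>B. \<Sum>x\<in>B. \<Sum>y\<in>B. fscale (gdl x y a * w c x y) (hop h (g c x y) n))"
    if g: "\<And>c x y \<sigma>. linmap M M (g c x y \<sigma>)"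
      and eq: "\<And>\<sigma> m. m \<in> vcar M \<Longrightarrow> f \<sigma> m = sw sM (\<lambda>x y. \<Sum>c\<in>B. vscale M (w c x y) (g c x y \<sigma> m)) a"
    for f and g and h :: 'd and n a w
  proof -
    have "hop h f n = (\<Sum>(c, x, y)\<in>B \<times> B \<times> B. fscale (gdl x y a * w c x y) (hop h (g c x y) n))"
      using hop_sum[of "B \<times> B \<times> B" "\<lambda>(c, x, y). g c x y" f "\<lambda>(c, x, y). gdl x y a * w c x y" h n] g eq
      by (simp add: case_prod_unfold sw_as_sum sum.cartesian_product)
    then show ?thesis by (simp add: sum.cartesian_product)
  qed
  show ?thesis
  proof
    fix h h' :: 'd and a b :: 'h and m n :: "(('d set \<Rightarrow> 'm) \<Rightarrow> 'k) \<Rightarrow> 'k" and k :: 'k and c :: 'h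
    show "finite (hedges G)" by (rule Gr.fin)
    show "h \<in> hedges G \<Longrightarrow> hinv G h \<in> hedges G" by (rule Gr.hinv_closed)
    show "h \<in> hedges G \<Longrightarrow> hinv G h \<noteq> h" by (rule Gr.hinv_no_fix)
    show "h \<in> hedges G \<Longrightarrow> hinv G (hinv G h) = h" by (rule Gr.hinv_invol)
    show "F.subspace (vcar N)" using vs_subspace[OF N_vspace] by (simp add: vscale_N)
    show "Lop h a (m + n) = Lop h a m + Lop h a n" "Lop h a (fscale k m) = fscale k (Lop h a m)"
      "Lop h a m \<in> vcar N" "Top h b (m + n) = Top h b m + Top h b n" "Top h b (fscale k m) = fscale k (Top h b m)"
      "Top h b m \<in> vcar N"
      unfolding Lop_def Top_def by (rule hop_lin, rule lop_lin tau_lin)+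
    show "Lop h a m = (\<Sum>b\<in>B. fscale (e b a) (Lop h b m))"
      unfolding Lop_def by (rule hop_sum) (auto simp: lop_lin intro: lop_expand)
    show "h \<noteq> h' \<Longrightarrow> Lop h a (Lop h' b m) = Lop h' b (Lop h a m)"
      unfolding Lop_def by (rule hop_commute[OF lop_lin lop_lin]) (auto simp: lop_commute)
    show "h \<noteq> h' \<Longrightarrow> Top h b (Top h' c m) = Top h' c (Top h b m)"
      unfolding Top_def by (rule hop_commute[OF tau_lin tau_lin]) (auto simp: tau_commute_all)
    \<comment> \<open>Since \<open>lop_mul\<close> speaks about the carrier of \<open>M\<close>
      only, \<open>hop_sum\<close> with a single index is used as a congruence rule.\<close>
    show "Lop h (gmul a b) m = Lop h a (Lop h b m)"
      unfolding Lop_def hop_comp_same[OF lop_lin lop_lin]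
      using hop_sum[of "{()}" "\<lambda>_ \<sigma> m. lop \<sigma> a (lop \<sigma> b m)" "\<lambda>\<sigma>. lop \<sigma> (gmul a b)" "\<lambda>_. 1" h m]
      by (simp add: lop_mul linmap_comp[OF lop_lin lop_lin])
    show "\<lbrakk>h \<in> hedges G; m \<in> vcar N\<rbrakk> \<Longrightarrow> Lop h (hone H) m = m"
      by (simp add: Lop_def hop_def prN on_edge_id Gr.edge_of_in lop_one)
    show "\<lbrakk>b \<in> B; c \<in> B\<rbrakk> \<Longrightarrow> Top h c (Top h b m) = (\<Sum>d\<in>B. fscale (gdl b c d) (Top h d m))"
      unfolding Top_def hop_comp_same[OF tau_lin tau_lin]
      by (rule hop_sum) (auto simp: tau_lin intro: tau_tau)
    show "(\<Sum>b\<in>B. fscale (gep b) (Top h b m)) = m" if "h \<in> hedges G" "m \<in> vcar N"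
    proof -
      have "(\<Sum>b\<in>B. fscale (gep b) (Top h b m)) = hop h (\<lambda>\<sigma> m. \<Sum>b\<in>B. vscale M (gep b) (tau \<sigma> b m)) m"
        unfolding Top_def by (rule hop_sum[symmetric]) (auto simp: tau_lin)
      then show ?thesis
        using that by (simp add: hop_def prN on_edge_id Gr.edge_of_in tau_counit)
    qed
    show "\<lbrakk>h' \<noteq> h; h' \<noteq> hinv G h\<rbrakk> \<Longrightarrow> Top h' b (Lop h a m) = Lop h a (Top h' b m)"
      unfolding Top_def Lop_def
      by (rule hop_commute[OF tau_lin lop_lin]) (auto simp: Gr.hinv_hinv)
    show "b \<in> B \<Longrightarrow> Top h b (Lop h a m) =
        (\<Sum>c\<in>B. \<Sum>x\<in>B. \<Sum>y\<in>B. fscale (gdl x y a * e b (gmul c (gS y))) (Lop h x (Top h c m)))"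
      unfolding Top_def Lop_def hop_comp_same[OF tau_lin lop_lin] hop_comp_same[OF lop_lin tau_lin]
      by (rule triple) (auto intro: tau_lop_same linmap_comp[OF tau_lin lop_lin])
    show "Top (hinv G h) b (Lop h a m) =
        (\<Sum>c\<in>B. \<Sum>x\<in>B. \<Sum>y\<in>B. fscale (gdl x y a * e b (gmul x c)) (Lop h y (Top (hinv G h) c m)))" if b: "b \<in> B"
    proof -
      have com: "hop h (\<lambda>\<sigma>. lop \<sigma> y) (hop (hinv G h) (\<lambda>\<sigma>. tau \<sigma> c) m) =
          hop h (\<lambda>\<sigma> m. lop \<sigma> y (tau (\<not> \<sigma>) c m)) m" for y c
        using hop_comp_opposite[where f = "\<lambda>\<sigma>. lop \<sigma> y" and g = "\<lambda>\<sigma>. tau \<sigma> c" and h = "hinv G h" and n = m,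
            OF lop_lin tau_lin] by (simp add: Gr.hinv_hinv hop_hinv)
      show ?thesis
        unfolding Top_def Lop_def hop_comp_opposite[OF tau_lin lop_lin] com
        by (rule triple) (auto intro: tau_lop_opposite[OF _ b] linmap_comp[OF tau_lin lop_lin])
    qed
  qed
qed


sublocale O: half_edge_ops "vscale H" B e gmul "hone H" gdl gep gS fscale "vcar N" "hedges G" "hinv G" Lop Top
  by (rule half_edge_ops_hold)

section \<open>The vertex action and the face coaction in coordinates\<close>

abbreviation "D \<equiv> dual H"

definition A where "A c = O.Lseq (Gr.vlist c)"
definition T where "T c = O.Tseq (Gr.flist c)"

lemma vector_space_N: "vector_space (fscale :: 'k \<Rightarrow> ((('d set \<Rightarrow> 'm) \<Rightarrow> 'k) \<Rightarrow> 'k) \<Rightarrow> _)"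
  by (rule vector_space_fscale)

lemma linmap_of_hlin:
  assumes "hlin fscale \<phi>" "\<And>x. \<phi> x \<in> vcar N"
  shows "linmap H N \<phi>"
  using hlin_add[OF vector_space_N assms(1)] hlin_scale[OF vector_space_N assms(1)] assms(2)
  by (simp add: linmap_def vscale_N)

lemma Lseq_linmap: "linmap N N (O.Lseq hs a)"
  using O.Lseq_add O.Lseq_scale O.Lseq_closed by (simp add: linmap_def vscale_N)

lemma L_op_eq:
  assumes "a \<in> vcar H" "h \<in> hedges G" "n \<in> vcar N"
  shows "L_op G H M h a n = Lop h a n"
proof -
  have "on_edge G M (edge_of G h) (\<lambda>m. if is_source G h then ract M m (antipode H a) else lact M a m) =
      on_edge G M (edge_of G h) (lop (is_source G h) a)"
    by (rule on_edge_cong) (simp_all add: lop_def gS_car pj_id assms Gr.edge_of_in)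
  then show ?thesis using assms by (simp add: L_op_def Lop_def hop_def prN)
qed

lemma L_list_eq: "set hs \<subseteq> hedges G \<Longrightarrow> a \<in> vcar H \<Longrightarrow> n \<in> vcar N \<Longrightarrow> L_list G H M hs a n = O.Lseq hs a n"
proof (induction hs arbitrary: a n)
  case Nil
  then show ?case by (simp add: vscale_N gep_car)
next
  case (Cons h hs)
  have bi: "bilin H H N (\<lambda>a1 a2. O.Lseq hs a2 (Lop h a1 n))"
  proof (rule bilinI)
    fix a1 show "linmap H N (\<lambda>a2. O.Lseq hs a2 (Lop h a1 n))"
      by (rule linmap_of_hlin[OF O.hlin_Lseq]) (intro O.Lseq_closed O.L_closed)
  next
    fix a2 show "linmap H N (\<lambda>a1. O.Lseq hs a2 (Lop h a1 n))"
      by (rule linmap_comp[OF linmap_of_hlin[OF O.hlin_L] Lseq_linmap]) (rule O.L_closed)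
  qed
  have "L_list G H M (h # hs) a n = sw2 H N (\<lambda>a1 a2. O.Lseq hs a2 (Lop h a1 n)) a"
    unfolding L_list.simps sw2_def
    by (subst tlift_cong[of H H _ "\<lambda>a1 a2. O.Lseq hs a2 (Lop h a1 n)"])
      (use Cons in \<open>simp_all add: L_op_eq O.L_closed\<close>)
  also have "\<dots> = O.Lseq (h # hs) a n"
    using sw2_eq_sw[OF N_vspace bi Cons.prems(2)] by (simp add: vscale_N)
  finally show ?case .
qed

lemma vertex_action_eq: "c \<in> cilia G \<Longrightarrow> a \<in> vcar H \<Longrightarrow> n \<in> vcar N \<Longrightarrow> vertex_action G H M c a n = A c a n"
  unfolding vertex_action_def A_def by (rule L_list_eq[OF Gr.vlist_sub])

lemma dual_linmap: "\<alpha> \<in> vcar D \<Longrightarrow> linmap H scalars \<alpha>"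
  by (simp add: dual_def)

lemma hlin_dual: "\<alpha> \<in> vcar D \<Longrightarrow> hlin (*) (\<lambda>x. \<alpha> (pj x))"
  using hlin_of_linmap[OF is_vspace_scalars dual_linmap] by simp

text \<open>Elements of the dual vanish off the carrier, whereas the coordinate functionals are
  linear on the whole type.\<close>

definition restr :: "('h \<Rightarrow> 'k) \<Rightarrow> 'h \<Rightarrow> 'k" where "restr f = (\<lambda>x. if x \<in> vcar H then f x else 0)"

lemma restr_dual: "linmap H scalars f \<Longrightarrow> restr f \<in> vcar D"
  by (simp add: dual_def restr_def linmap_def vs_add[OF vspace] vs_scale[OF vspace])

lemma restr_car: "x \<in> vcar H \<Longrightarrow> restr f x = f x"
  by (simp add: restr_def)

lemma vscale_dual [simp]: "vscale D = fscale"
  by (simp add: dual_def)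

lemma is_vspace_dual: "is_vspace D"
proof -
  interpret F: vector_space "fscale :: 'k \<Rightarrow> ('h \<Rightarrow> 'k) \<Rightarrow> _"
    by (rule vector_space_fscale)
  have "F.subspace (vcar D)"
    unfolding F.subspace_def by (auto simp: dual_def linmap_def fscale_def algebra_simps)
  then show ?thesis by (simp add: is_vspace_def F.vector_space_axioms)
qed

lemma dual_expand: "\<alpha> \<in> vcar D \<Longrightarrow> \<alpha> = (\<Sum>b\<in>B. fscale (\<alpha> b) (restr (e b)))"
proof
  fix x assume \<alpha>: "\<alpha> \<in> vcar D"
  have app: "(\<Sum>b\<in>B. fscale (\<alpha> b) (restr (e b))) x = (\<Sum>b\<in>B. \<alpha> b * restr (e b) x)"
    using fin_B by (induction B rule: finite_induct) (simp_all add: fscale_def)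
  show "\<alpha> x = (\<Sum>b\<in>B. fscale (\<alpha> b) (restr (e b))) x"
  proof (cases "x \<in> vcar H")
    case True
    then show ?thesis
      unfolding app using linmap_expand[OF is_vspace_scalars dual_linmap[OF \<alpha>] True]
      by (simp add: restr_car mult.commute)
  next
    case False
    then show ?thesis unfolding app using \<alpha> by (simp add: restr_def dual_def)
  qed
qed

lemma dual_eval_bilin: "bilin D D scalars (\<lambda>\<phi> \<chi>. \<phi> x * \<chi> y)"
  by (simp add: bilin_def linmap_def fscale_def algebra_simps)

text \<open>A tensor of two functionals is determined by its values at pairs of basis vectors; this
  is the uniqueness in the definite description of \<open>dual_comult\<close>.\<close>

lemma dual_tensor_expand:
  assumes "t \<in> vcar (D \<otimes>\<^sub>s D)"
  shows "t = (\<Sum>b\<in>B. \<Sum>c\<in>B. fscale (tlift D D scalars (\<lambda>\<phi> \<chi>. \<phi> b * \<chi> c) t) (tensor D D (restr (e b)) (restr (e c))))"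
proof (rule linmap_tprod_eqI[OF is_vspace_tprod linmap_id _ _ assms])
  note lin = tensor_universal(1)[OF is_vspace_scalars dual_eval_bilin]
  have E: "restr (e b) \<in> vcar D" for b by (rule restr_dual[OF linmap_e])
  show "linmap (D \<otimes>\<^sub>s D) (D \<otimes>\<^sub>s D)
      (\<lambda>t. \<Sum>b\<in>B. \<Sum>c\<in>B. fscale (tlift D D scalars (\<lambda>\<phi> \<chi>. \<phi> b * \<chi> c) t) (tensor D D (restr (e b)) (restr (e c))))"
    by (intro linmap_sum_fun is_vspace_tprod)
      (rule linmap_scalar_fun[OF is_vspace_tprod lin, unfolded vscale_tprod], intro tensor_closed E)
  fix \<phi> \<chi> assume x: "\<phi> \<in> vcar D" "\<chi> \<in> vcar D"
  interpret F: vector_space "fscale :: 'k \<Rightarrow> ((('h \<Rightarrow> 'k) \<Rightarrow> ('h \<Rightarrow> 'k) \<Rightarrow> 'k) \<Rightarrow> 'k) \<Rightarrow> _"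
    by (rule vector_space_fscale)
  have "tensor D D \<phi> \<chi> = tensor D D (\<Sum>b\<in>B. vscale D (\<phi> b) (restr (e b))) \<chi>"
    using dual_expand[OF x(1)] by simp
  also have "\<dots> = (\<Sum>b\<in>B. vscale (D \<otimes>\<^sub>s D) (\<phi> b) (tensor D D (restr (e b)) \<chi>))"
    by (rule linmap_sum_scale[OF is_vspace_dual is_vspace_tprod bilin_left[OF bilin_tensor x(2)]]) (rule E)
  also have "\<dots> = (\<Sum>b\<in>B. fscale (\<phi> b) (tensor D D (restr (e b)) (\<Sum>c\<in>B. vscale D (\<chi> c) (restr (e c)))))"
    using dual_expand[OF x(2)] by simp
  also have "\<dots> = (\<Sum>b\<in>B. fscale (\<phi> b) (\<Sum>c\<in>B. vscale (D \<otimes>\<^sub>s D) (\<chi> c) (tensor D D (restr (e b)) (restr (e c)))))"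
    by (intro sum.cong refl arg_cong[of _ _ "fscale _"]
        linmap_sum_scale[OF is_vspace_dual is_vspace_tprod bilin_right[OF bilin_tensor E]] E)
  also have "\<dots> = (\<Sum>b\<in>B. \<Sum>c\<in>B. fscale (\<phi> b * \<chi> c) (tensor D D (restr (e b)) (restr (e c))))"
    by (simp add: F.scale_sum_right)
  finally show "tensor D D \<phi> \<chi> = (\<Sum>b\<in>B. \<Sum>c\<in>B. fscale (tlift D D scalars (\<lambda>\<phi> \<chi>. \<phi> b * \<chi> c) (tensor D D \<phi> \<chi>))
      (tensor D D (restr (e b)) (restr (e c))))"
    unfolding tensor_universal(2)[OF is_vspace_scalars dual_eval_bilin x] .
qed

lemma restr_mult_dual: "\<alpha> \<in> vcar D \<Longrightarrow> b \<in> vcar H \<Longrightarrow> restr (\<lambda>x. \<alpha> (hmult H x b)) \<in> vcar D"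
  by (rule restr_dual) (rule linmap_comp[OF bilin_left[OF mult_bilin] dual_linmap])

text \<open>Evaluated at \<open>x\<close> and \<open>y\<close>, the right-hand side is the sum of
  the values \<open>\<alpha> (hmult H x b)\<close> weighted by the coordinates of \<open>y\<close>,
  which is \<open>\<alpha>\<close> at the product of \<open>x\<close> and \<open>y\<close>.\<close>

lemma dual_comult_eq:
  assumes \<alpha>: "\<alpha> \<in> vcar D"
  shows "dual_comult H \<alpha> = (\<Sum>b\<in>B. tensor D D (restr (\<lambda>x. \<alpha> (hmult H x b))) (restr (e b)))"
  unfolding dual_comult_def
proof (rule the_equality, intro conjI ballI)
  have E: "restr (e b) \<in> vcar D" for b by (rule restr_dual[OF linmap_e])
  have R: "b \<in> B \<Longrightarrow> restr (\<lambda>x. \<alpha> (hmult H x b)) \<in> vcar D" for b by (rule restr_mult_dual[OF \<alpha> B_car])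
  show "(\<Sum>b\<in>B. tensor D D (restr (\<lambda>x. \<alpha> (hmult H x b))) (restr (e b))) \<in> vcar (D \<otimes>\<^sub>s D)"
    by (intro vs_sum[OF is_vspace_tprod] tensor_closed R E)
  fix x y assume xy: "x \<in> vcar H" "y \<in> vcar H"
  have "tlift D D scalars (\<lambda>\<phi> \<chi>. \<phi> x * \<chi> y) (\<Sum>b\<in>B. tensor D D (restr (\<lambda>x. \<alpha> (hmult H x b))) (restr (e b))) =
      (\<Sum>b\<in>B. restr (\<lambda>x. \<alpha> (hmult H x b)) x * restr (e b) y)"
    by (rule tlift_tensor_sum[OF is_vspace_scalars dual_eval_bilin R E])
  also have "\<dots> = \<alpha> (hmult H x y)"
    using linmap_expand[OF is_vspace_scalars linmap_comp[OF bilin_right[OF mult_bilin xy(1)] dual_linmap[OF \<alpha>]] xy(2)]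
    by (simp add: restr_car xy mult.commute)
  finally show "tlift D D scalars (\<lambda>\<phi> \<chi>. \<phi> x * \<chi> y)
      (\<Sum>b\<in>B. tensor D D (restr (\<lambda>x. \<alpha> (hmult H x b))) (restr (e b))) = \<alpha> (hmult H x y)" .
next
  fix t assume t: "t \<in> vcar (D \<otimes>\<^sub>s D) \<and> (\<forall>x\<in>vcar H. \<forall>y\<in>vcar H.
      tlift D D scalars (\<lambda>\<phi> \<chi>. \<phi> x * \<chi> y) t = \<alpha> (hmult H x y))"
  have E: "restr (e b) \<in> vcar D" for b by (rule restr_dual[OF linmap_e])
  have R: "b \<in> B \<Longrightarrow> restr (\<lambda>x. \<alpha> (hmult H x b)) \<in> vcar D" for b by (rule restr_mult_dual[OF \<alpha> B_car])
  have "t = (\<Sum>b\<in>B. \<Sum>c\<in>B. fscale (tlift D D scalars (\<lambda>\<phi> \<chi>. \<phi> b * \<chi> c) t) (tensor D D (restr (e b)) (restr (e c))))"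
    using t by (intro dual_tensor_expand) auto
  also have "\<dots> = (\<Sum>c\<in>B. \<Sum>b\<in>B. vscale (D \<otimes>\<^sub>s D) (\<alpha> (hmult H b c)) (tensor D D (restr (e b)) (restr (e c))))"
    using t by (subst sum.swap) (simp add: B_car)
  also have "\<dots> = (\<Sum>c\<in>B. tensor D D (\<Sum>b\<in>B. vscale D (\<alpha> (hmult H b c)) (restr (e b))) (restr (e c)))"
    by (intro sum.cong refl linmap_sum_scale[OF is_vspace_dual is_vspace_tprod bilin_left[OF bilin_tensor E], symmetric] E)
  also have "\<dots> = (\<Sum>c\<in>B. tensor D D (restr (\<lambda>x. \<alpha> (hmult H x c))) (restr (e c)))"
  proof (rule sum.cong[OF refl])
    fix c assume c: "c \<in> B"
    have "(\<Sum>b\<in>B. vscale D (\<alpha> (hmult H b c)) (restr (e b))) = restr (\<lambda>x. \<alpha> (hmult H x c))"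
    proof -
      have "(\<Sum>b\<in>B. vscale D (\<alpha> (hmult H b c)) (restr (e b))) =
          (\<Sum>b\<in>B. fscale (restr (\<lambda>x. \<alpha> (hmult H x c)) b) (restr (e b)))"
        by (simp add: restr_car B_car)
      also have "\<dots> = restr (\<lambda>x. \<alpha> (hmult H x c))" by (rule dual_expand[OF R[OF c], symmetric])
      finally show ?thesis .
    qed
    then show "tensor D D (\<Sum>b\<in>B. vscale D (\<alpha> (hmult H b c)) (restr (e b))) (restr (e c)) =
        tensor D D (restr (\<lambda>x. \<alpha> (hmult H x c))) (restr (e c))" by simp
  qed
  finally show "t = (\<Sum>b\<in>B. tensor D D (restr (\<lambda>x. \<alpha> (hmult H x b))) (restr (e b)))" .
qed

lemma T_op_eq:
  assumes \<alpha>: "\<alpha> \<in> vcar D" and k: "k \<in> hedges G" and n: "n \<in> vcar N"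
  shows "T_op G H M k \<alpha> n = (\<Sum>b\<in>B. fscale (\<alpha> b) (Top k b n))"
proof -
  let ?f = "\<lambda>m. if is_source G k then tlift H M M (\<lambda>x n. vscale M (\<alpha> x) n) (lco M m)
      else tlift M H M (\<lambda>n y. vscale M (\<alpha> (antipode H y)) n) (rco M m)"
  have eq: "?f m = (\<Sum>b\<in>B. vscale M (\<alpha> b) (tau (is_source G k) b m))" if m: "m \<in> vcar M" for m
  proof (cases "is_source G k")
    case True
    then show ?thesis
      using tlift_left_expand[OF M.vspace M.vspace bilin_scalar_fun(1)[OF M.vspace dual_linmap[OF \<alpha>]] linmap_closed[OF lco_lin m]]
      by (simp add: tau_def lam_def)
  next
    case False
    have "tlift M H M (\<lambda>n y. vscale M (\<alpha> (antipode H y)) n) (rco M m) = (\<Sum>c\<in>B. vscale M (\<alpha> (antipode H c)) (mu c m))"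
      using tlift_right_expand[OF M.vspace M.vspace bilin_scalar_fun(2)[OF M.vspace linmap_comp[OF antipode_lin dual_linmap[OF \<alpha>]]]
          linmap_closed[OF rco_lin m]] by (simp add: mu_def)
    also have "\<dots> = (\<Sum>b\<in>B. vscale M (\<alpha> b) (tau False b m))"
      using sum_tau_False[OF m hlin_dual[OF \<alpha>]] by (simp add: pj_id B_car gS_car closed_simps)
    finally show ?thesis using False by simp
  qed
  have "T_op G H M k \<alpha> n = on_edge G M (edge_of G k) (\<lambda>m. \<Sum>b\<in>B. vscale M (\<alpha> b) (tau (is_source G k) b m)) n"
    unfolding T_op_def using on_edge_cong[OF eq Gr.edge_of_in[OF k]] by simp
  also have "\<dots> = (\<Sum>b\<in>B. fscale (\<alpha> b) (Top k b n))"
    using on_edge_sum[OF Gr.edge_of_in[OF k] n tau_lin] k n by (simp add: Top_def hop_def prN)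
  finally show ?thesis .
qed

lemma Tseq_linmap: "linmap N N (O.Tseq ks \<alpha>)"
  using O.Tseq_add O.Tseq_scale O.Tseq_closed by (simp add: linmap_def vscale_N)

lemma Tseq_add_arg: "O.Tseq ks (\<lambda>x. \<alpha> x + \<beta> x) n = O.Tseq ks \<alpha> n + O.Tseq ks \<beta> n"
  and Tseq_scale_arg: "O.Tseq ks (\<lambda>x. r * \<alpha> x) n = fscale r (O.Tseq ks \<alpha> n)"
proof -
  have one: "fscale 1 n = n" for n :: "(('d set \<Rightarrow> 'm) \<Rightarrow> 'k) \<Rightarrow> 'k" by (simp add: fscale_def)
  show "O.Tseq ks (\<lambda>x. \<alpha> x + \<beta> x) n = O.Tseq ks \<alpha> n + O.Tseq ks \<beta> n"
    using O.Tseq_lin[where ks = ks and I = "UNIV :: bool set" and c = "\<lambda>_. 1" and \<alpha> = "\<lambda>i. if i then \<alpha> else \<beta>" and m = n]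
    by (simp add: UNIV_bool one add.commute)
  show "O.Tseq ks (\<lambda>x. r * \<alpha> x) n = fscale r (O.Tseq ks \<alpha> n)"
    using O.Tseq_lin[where ks = ks and I = "{()}" and c = "\<lambda>_. r" and \<alpha> = "\<lambda>i. \<alpha>" and m = n] by simp
qed

lemma T_list_eq: "set ks \<subseteq> hedges G \<Longrightarrow> \<alpha> \<in> vcar D \<Longrightarrow> n \<in> vcar N \<Longrightarrow>
    T_list G H M ks \<alpha> n = O.Tseq ks (\<lambda>x. \<alpha> (pj x)) n"
proof (induction ks arbitrary: \<alpha> n)
  case Nil
  then show ?case by (simp add: vscale_N pj_id one_closed)
next
  case (Cons k ks)
  let ?w = "\<lambda>\<chi> :: 'h \<Rightarrow> 'k. \<Sum>b\<in>B. fscale (\<chi> b) (Top k b n)"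
  let ?\<beta> = "\<lambda>\<phi> \<chi>. O.Tseq ks (\<lambda>x. \<phi> (pj x)) (?w \<chi>)"
  have wc: "?w \<chi> \<in> vcar N" for \<chi>
    using vs_scale[OF N_vspace, unfolded vscale_N] by (intro vs_sum[OF N_vspace]) (simp add: O.t_closed)
  have w_lin: "linmap D N ?w"
    using wc by (simp add: linmap_def vscale_N O.N.scale_left_distrib sum.distrib O.N.scale_sum_right fscale_def[of _ "_ :: 'h \<Rightarrow> 'k"])
  have bi: "bilin D D N ?\<beta>"
  proof (rule bilinI)
    fix \<phi> show "linmap D N (?\<beta> \<phi>)" by (rule linmap_comp[OF w_lin Tseq_linmap])
  next
    fix \<chi> show "linmap D N (\<lambda>\<phi>. ?\<beta> \<phi> \<chi>)"
      unfolding linmap_def by (simp add: vscale_N O.Tseq_closed wc Tseq_add_arg fscale_def[of _ "_ :: 'h \<Rightarrow> 'k"] Tseq_scale_arg)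
  qed
  have E: "restr (e b) \<in> vcar D" for b by (rule restr_dual[OF linmap_e])
  have R: "b \<in> B \<Longrightarrow> restr (\<lambda>x. \<alpha> (hmult H x b)) \<in> vcar D" for b by (rule restr_mult_dual[OF Cons.prems(2) B_car])
  have "T_list G H M (k # ks) \<alpha> n = tlift D D N ?\<beta> (dual_comult H \<alpha>)"
    unfolding T_list.simps
    by (subst tlift_cong[of D D _ ?\<beta>]) (use Cons wc in \<open>simp_all add: T_op_eq\<close>)
  also have "\<dots> = (\<Sum>b\<in>B. ?\<beta> (restr (\<lambda>x. \<alpha> (hmult H x b))) (restr (e b)))"
    unfolding dual_comult_eq[OF Cons.prems(2)] by (rule tlift_tensor_sum[OF N_vspace bi R E])
  also have "\<dots> = (\<Sum>b\<in>B. O.Tseq ks (\<lambda>y. \<alpha> (pj (gmul y b))) (Top k b n))"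
  proof (rule sum.cong[OF refl])
    fix b assume b: "b \<in> B"
    have "?w (restr (e b)) = Top k b n"
      using sum_e_vec[OF N_vspace b, unfolded vscale_N] by (simp add: restr_car B_car)
    moreover have "pj (gmul y b) = hmult H (pj y) b" for y
      by (simp add: gmul_def pj_id b closed_simps pj_closed)
    ultimately show "?\<beta> (restr (\<lambda>x. \<alpha> (hmult H x b))) (restr (e b)) = O.Tseq ks (\<lambda>y. \<alpha> (pj (gmul y b))) (Top k b n)"
      by (simp add: restr_car pj_closed)
  qed
  finally show ?case by simp
qed

text \<open>Pairing with the coordinate functionals recovers all coefficients
  \<open>lcf N b t\<close>, so the definite description has exactly one solution.\<close>

lemma face_coaction_eq:
  assumes c: "c \<in> cilia G" and n: "n \<in> vcar N"
  shows "face_coaction G H M c n = (\<Sum>b\<in>B. tensor H N b (T c (e b) n))"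
  unfolding face_coaction_def
proof (rule the_equality, intro conjI ballI)
  have Tc: "T c \<alpha> n \<in> vcar N" for \<alpha> unfolding T_def by (rule O.Tseq_closed[OF n])
  have TL: "T_list G H M (Gr.flist c) \<alpha> n = T c (\<lambda>x. \<alpha> (pj x)) n" if "\<alpha> \<in> vcar D" for \<alpha>
    unfolding T_def by (rule T_list_eq[OF Gr.flist_sub[OF c] that n])
  show "(\<Sum>b\<in>B. tensor H N b (T c (e b) n)) \<in> vcar (H \<otimes>\<^sub>s N)"
    by (intro vs_sum[OF is_vspace_tprod] tensor_closed B_car Tc)
  fix \<alpha> assume \<alpha>: "\<alpha> \<in> vcar D"
  have "tlift H N N (\<lambda>x n. vscale N (\<alpha> x) n) (\<Sum>b\<in>B. tensor H N b (T c (e b) n)) =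
      (\<Sum>b\<in>B. vscale N (\<alpha> b) (T c (e b) n))"
    by (rule tlift_tensor_sum[OF N_vspace bilin_scalar_fun(1)[OF N_vspace dual_linmap[OF \<alpha>]]]) (simp_all add: B_car Tc)
  also have "\<dots> = T c (\<lambda>x. \<alpha> (pj x)) n"
    unfolding T_def using O.Tseq_expand[OF hlin_dual[OF \<alpha>]] by (simp add: vscale_N pj_id B_car)
  finally show "tlift H N N (\<lambda>x n. vscale N (\<alpha> x) n) (\<Sum>b\<in>B. tensor H N b (T c (e b) n)) =
      T_list G H M (Gr.flist c) \<alpha> n"
    by (simp add: TL \<alpha>)
next
  have TL: "T_list G H M (Gr.flist c) \<alpha> n = T c (\<lambda>x. \<alpha> (pj x)) n" if "\<alpha> \<in> vcar D" for \<alpha>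
    unfolding T_def by (rule T_list_eq[OF Gr.flist_sub[OF c] that n])
  fix t assume t: "t \<in> vcar (H \<otimes>\<^sub>s N) \<and> (\<forall>\<alpha>\<in>vcar D.
      tlift H N N (\<lambda>x n. vscale N (\<alpha> x) n) t = T_list G H M (Gr.flist c) \<alpha> n)"
  have "lcf N b t = T c (e b) n" if b: "b \<in> B" for b
  proof -
    have E: "restr (e b) \<in> vcar D" by (rule restr_dual[OF linmap_e])
    have "lcf N b t = tlift H N N (\<lambda>x n. vscale N (restr (e b) x) n) t"
      unfolding lcf_def by (rule fun_cong[OF tlift_cong]) (simp add: restr_car)
    also have "\<dots> = T c (\<lambda>x. restr (e b) (pj x)) n" using t E TL by simp
    also have "(\<lambda>x. restr (e b) (pj x)) = e b"
      by (simp add: restr_car pj_closed e_pj_basis[OF b])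
    finally show ?thesis .
  qed
  then show "t = (\<Sum>b\<in>B. tensor H N b (T c (e b) n))"
    using left_expand[OF N_vspace, of t] t by simp
qed

section \<open>Relations between the operators at the cilia\<close>

lemma A_closed: "n \<in> vcar N \<Longrightarrow> A c a n \<in> vcar N" and T_closed: "n \<in> vcar N \<Longrightarrow> T c \<alpha> n \<in> vcar N"
  by (simp_all add: A_def T_def O.Lseq_closed O.Tseq_closed)

lemma A_mul: "A c (gmul a b) n = A c a (A c b n)"
  unfolding A_def by (rule O.Lseq_mul[OF cycle_from_distinct[OF Gr.rho_permutation]])

lemma A_one: "c \<in> cilia G \<Longrightarrow> n \<in> vcar N \<Longrightarrow> A c (hone H) n = n"
  unfolding A_def by (rule O.Lseq_one[OF Gr.vlist_sub])

lemma A_commute: "c \<in> cilia G \<Longrightarrow> c' \<in> cilia G \<Longrightarrow> c \<noteq> c' \<Longrightarrow> A c a (A c' b n) = A c' b (A c a n)"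
  unfolding A_def by (rule O.Lseq_commute_Lseq[OF Gr.vlist_disjoint])

lemma T_commute: "c \<in> cilia G \<Longrightarrow> c' \<in> cilia G \<Longrightarrow> c \<noteq> c' \<Longrightarrow> T c \<alpha> (T c' \<beta> n) = T c' \<beta> (T c \<alpha> n)"
  unfolding T_def by (rule O.Tseq_commute_Tseq[OF Gr.flist_disjoint])

lemma T_conv: "hlin (*) \<alpha> \<Longrightarrow> hlin (*) \<beta> \<Longrightarrow> T c \<beta> (T c \<alpha> n) = T c (O.conv \<alpha> \<beta>) n"
  unfolding T_def by (rule O.Tseq_conv[OF cycle_from_distinct[OF Gr.face_permutation]])

lemma T_ep: "c \<in> cilia G \<Longrightarrow> n \<in> vcar N \<Longrightarrow> T c gep n = n"
  unfolding T_def by (rule O.Tseq_ep[OF Gr.flist_sub])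

text \<open>A vertex contains only one cilium, so every corner between successive entries of its
  list, which starts at the cilium, is an interior corner.\<close>

lemma vlist_consecutive:
  assumes "c \<in> cilia G" "c' \<in> cilia G"
  shows "successively (O.consecutive (Gr.flist c')) (Gr.vlist c)"
proof (rule cycle_from_successively[OF Gr.rho_permutation])
  fix k assume k: "k \<in> orbit (rho G) c" "rho G k \<noteq> c"
  have "k \<in> hedges G"
    using k(1) Gr.vlist_sub[OF assms(1)] by (auto simp: cycle_from_set[OF Gr.rho_permutation])
  moreover have "rho G k \<notin> cilia G"
    using Gr.vertex_cilium_unique[OF assms(1), of "rho G k"] k orbit.step[OF k(1)] by auto
  ultimately show "O.consecutive (Gr.flist c') k (rho G k)"
    unfolding O.consecutive_def using Gr.interior_corner[OF assms(2)] by blast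
qed

lemma T_A_same:
  assumes "c \<in> cilia G" "n \<in> vcar N" "hlin (*) \<alpha>"
  shows "T c \<alpha> (A c a n) =
    sw fscale (\<lambda>x y. sw fscale (\<lambda>u v. A c u (T c (\<lambda>z. \<alpha> (gmul (gmul x z) (gS v))) n)) y) a"
  unfolding T_def A_def
  by (rule O.Tseq_Lseq_same)
    (simp_all add: assms cycle_from_distinct Gr.face_permutation Gr.rho_permutation Gr.flist_sub Gr.vlist_sub
      cycle_from_not_Nil vlist_consecutive cycle_from_hd Gr.vlist_last Gr.flist_last)

lemma T_A_other:
  assumes "c \<in> cilia G" "c' \<in> cilia G" "c \<noteq> c'" "n \<in> vcar N" "hlin (*) \<alpha>"
  shows "T c' \<alpha> (A c a n) = A c a (T c' \<alpha> n)"
  unfolding T_def A_def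
  by (rule O.Tseq_Lseq_other)
    (simp_all add: assms cycle_from_distinct Gr.face_permutation Gr.rho_permutation Gr.flist_sub Gr.vlist_sub
      cycle_from_not_Nil vlist_consecutive cycle_from_hd Gr.vlist_last Gr.flist_ends_other)

end

section \<open>Tensor powers of a Hopf algebra in coordinates\<close>

lemma tlift_tensor_sum2:
  assumes X: "is_vspace X" and \<phi>: "bilin V W X \<phi>"
    and u: "\<And>b. b \<in> J \<Longrightarrow> u b \<in> vcar V" and v: "\<And>c. c \<in> J' \<Longrightarrow> v c \<in> vcar W"
  shows "tlift V W X \<phi> (\<Sum>b\<in>J. \<Sum>c\<in>J'. fscale (g b c) (tensor V W (u b) (v c))) =
    (\<Sum>b\<in>J. \<Sum>c\<in>J'. vscale X (g b c) (\<phi> (u b) (v c)))"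
proof -
  note T = is_vspace_tprod[of V W] and lin = tensor_universal(1)[OF X \<phi>]
  have ten: "tensor V W (u b) (v c) \<in> vcar (V \<otimes>\<^sub>s W)" if "b \<in> J" "c \<in> J'" for b c
    by (rule tensor_closed[OF u[OF that(1)] v[OF that(2)]])
  have "tlift V W X \<phi> (\<Sum>b\<in>J. \<Sum>c\<in>J'. vscale (V \<otimes>\<^sub>s W) (g b c) (tensor V W (u b) (v c))) =
      (\<Sum>b\<in>J. tlift V W X \<phi> (\<Sum>c\<in>J'. vscale (V \<otimes>\<^sub>s W) (g b c) (tensor V W (u b) (v c))))"
    by (rule linmap_sum[OF T X lin]) (intro vs_sum[OF T] vs_scale[OF T] ten)
  also have "\<dots> = (\<Sum>b\<in>J. \<Sum>c\<in>J'. vscale X (g b c) (tlift V W X \<phi> (tensor V W (u b) (v c))))"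
    by (intro sum.cong refl linmap_sum_scale[OF T X lin] ten)
  also have "\<dots> = (\<Sum>b\<in>J. \<Sum>c\<in>J'. vscale X (g b c) (\<phi> (u b) (v c)))"
    by (intro sum.cong refl arg_cong[of _ _ "vscale X _"] tensor_universal(2)[OF X \<phi>] u v)
  finally show ?thesis by simp
qed

locale hopf_power_space = based_hopf H B e
  for H :: "('k::field, 'h::ab_group_add) hopf" and B :: "'h set" and e :: "'h \<Rightarrow> 'h \<Rightarrow> 'k" +
  fixes C :: "'c set"
  assumes finite_C: "finite C"
begin

section \<open>The product basis of the tensor power\<close>

abbreviation "P \<equiv> tpower C H"
abbreviation "K \<equiv> hopf_power C H"
abbreviation "BB \<equiv> C \<rightarrow>\<^sub>E B"
abbreviation "CH \<equiv> C \<rightarrow>\<^sub>E vcar H"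
abbreviation "pten \<equiv> ptensor C H"

definition pform :: "('c \<Rightarrow> 'h \<Rightarrow> 'k) \<Rightarrow> ('c \<Rightarrow> 'h) \<Rightarrow> 'k" where
  "pform f x = (\<Prod>c\<in>C. f c (x c))"

text \<open>The coefficient at the basis vector \<open>pten \<beta>\<close>. An element of the
  tensor power is a functional on multilinear forms, and its value at the product of the coordinate
  functionals is this coefficient.\<close>

definition cf :: "('c \<Rightarrow> 'h) \<Rightarrow> ((('c \<Rightarrow> 'h) \<Rightarrow> 'k) \<Rightarrow> 'k) \<Rightarrow> 'k" where
  "cf \<beta> s = s (pform (\<lambda>c. e (\<beta> c)))"

lemma vcar_K [simp]: "vcar K = vcar P" and vscale_K [simp]: "vscale K = fscale"
  by (simp_all add: hopf_power_def)

lemma linmap_K: "linmap K X = linmap P X" and linmap_to_K: "linmap V K = linmap V P"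
  by (simp_all add: fun_eq_iff linmap_def)

lemma K_vspace: "is_vspace K"
  using is_vspace_tpower[of C H] by (simp add: is_vspace_def)

text \<open>\<open>P\<close> is a plain space, and \<open>K\<close> is a record with the same
  carrier and scalars extended by the Hopf structure. Tensors consult only carrier and scalars, so
  both records yield the same ones.\<close>

lemma tensor_PP: "tensor P P = tensor K K"
  by (simp add: fun_eq_iff tensor_def bilin_def linmap_def)

lemma tprod_PP: "P \<otimes>\<^sub>s P = K \<otimes>\<^sub>s K"
  by (simp add: tprod_def tensor_PP)

lemma BB_sub: "\<beta> \<in> BB \<Longrightarrow> \<beta> \<in> CH"
  by (auto simp: PiE_iff B_car)

lemma BB_B: "\<beta> \<in> BB \<Longrightarrow> c \<in> C \<Longrightarrow> \<beta> c \<in> B"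
  by (auto simp: PiE_iff)

lemma finite_BB: "finite BB"
  by (simp add: finite_PiE finite_C fin_B)

lemma pform_multilin: "(\<And>c. c \<in> C \<Longrightarrow> linmap H scalars (f c)) \<Longrightarrow> multilin C H scalars (pform f)"
  using multilin_prod[OF finite_C is_vspace_scalars, of H f 1] by (simp add: pform_def[abs_def])

lemma pt_pform: "(\<And>c. c \<in> C \<Longrightarrow> linmap H scalars (f c)) \<Longrightarrow> pten x (pform f) = (\<Prod>c\<in>C. f c (x c))"
  by (simp add: ptensor_def pform_multilin) (simp add: pform_def)

lemma cf_pt: "cf \<beta> (pten x) = (\<Prod>c\<in>C. e (\<beta> c) (x c))"
  unfolding cf_def by (rule pt_pform) (rule linmap_e)

lemma cf_linmap: "linmap K scalars (cf \<beta>)"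
  unfolding linmap_K cf_def[abs_def] by (rule linmap_fscale_eval)

lemma cf_delta: "\<beta> \<in> BB \<Longrightarrow> \<gamma> \<in> BB \<Longrightarrow> cf \<beta> (pten \<gamma>) = (if \<beta> = \<gamma> then 1 else 0)"
proof (cases "\<beta> = \<gamma>")
  case True
  assume "\<beta> \<in> BB"
  then show ?thesis unfolding cf_pt using True by (simp add: e_basis BB_B)
next
  case False
  assume b: "\<beta> \<in> BB" "\<gamma> \<in> BB"
  then obtain c where "c \<in> C" "\<beta> c \<noteq> \<gamma> c" using False by (metis PiE_ext)
  then have "(\<Prod>c\<in>C. e (\<beta> c) (\<gamma> c)) = 0"
    using b finite_C by (intro prod_zero) (auto simp: e_basis BB_B)
  then show ?thesis unfolding cf_pt using False by simp
qed

lemma pt_closed: "x \<in> CH \<Longrightarrow> pten x \<in> vcar K"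
  by (simp add: ptensor_closed)

lemma multilin_pt_expand:
  assumes X: "is_vspace X" and \<phi>: "multilin C H X \<phi>" and x: "x \<in> CH"
  shows "\<phi> x = (\<Sum>\<beta>\<in>BB. vscale X (\<Prod>c\<in>C. e (\<beta> c) (x c)) (\<phi> \<beta>))"
proof -
  have "(\<lambda>c\<in>C. \<Sum>b\<in>B. vscale H (e b (x c)) b) = x"
    using x by (auto simp: fun_eq_iff basis_expand PiE_iff extensional_def)
  moreover have "(\<Sum>\<beta>\<in>BB. vscale X (\<Prod>c\<in>C. e (\<beta> c) (x c)) (\<phi> (\<lambda>c\<in>C. \<beta> c))) =
      (\<Sum>\<beta>\<in>BB. vscale X (\<Prod>c\<in>C. e (\<beta> c) (x c)) (\<phi> \<beta>))"
    by (intro sum.cong refl) simp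
  ultimately show ?thesis
    using multilin_sum_expand[OF finite_C vspace X \<phi>, of B "\<lambda>_ b. b" "\<lambda>c b. e b (x c)"] by (simp add: B_car)
qed

lemma pt_expand:
  assumes "s \<in> vcar K"
  shows "(\<Sum>\<beta>\<in>BB. fscale (cf \<beta> s) (pten \<beta>)) = s"
proof (rule linmap_tpower_eqI[OF K_vspace _ _ _ assms[unfolded vcar_K]])
  show "linmap P K (\<lambda>s. \<Sum>\<beta>\<in>BB. fscale (cf \<beta> s) (pten \<beta>))"
    using linmap_scalar_fun[OF K_vspace cf_linmap pt_closed[OF BB_sub]] unfolding linmap_K vscale_K
    by (intro linmap_sum_fun K_vspace)
  show "linmap P K (\<lambda>s. s)" by (simp add: linmap_to_K linmap_id)
  fix x assume "x \<in> CH"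
  then show "(\<Sum>\<beta>\<in>BB. fscale (cf \<beta> (pten x)) (pten \<beta>)) = pten x"
    unfolding cf_pt using multilin_pt_expand[OF is_vspace_tpower multilin_ptensor, of x, symmetric] by simp
qed

lemma linmap_K_expand:
  assumes X: "is_vspace X" and f: "linmap K X f" and s: "s \<in> vcar K"
  shows "f s = (\<Sum>\<beta>\<in>BB. vscale X (cf \<beta> s) (f (pten \<beta>)))"
proof -
  have "f s = f (\<Sum>\<beta>\<in>BB. vscale K (cf \<beta> s) (pten \<beta>))" by (simp add: pt_expand[OF s])
  also have "\<dots> = (\<Sum>\<beta>\<in>BB. vscale X (cf \<beta> s) (f (pten \<beta>)))"
    by (rule linmap_sum_scale[OF K_vspace X f]) (rule pt_closed[OF BB_sub])
  finally show ?thesis .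
qed

lemma linmap_K_eqI:
  assumes X: "is_vspace X" and f: "linmap K X f" and g: "linmap K X g"
    and "\<And>\<beta>. \<beta> \<in> BB \<Longrightarrow> f (pten \<beta>) = g (pten \<beta>)" and s: "s \<in> vcar K"
  shows "f s = g s"
  unfolding linmap_K_expand[OF X f s] linmap_K_expand[OF X g s] using assms(4) by simp

lemma inj_pt: "inj_on pten BB"
proof (rule inj_onI)
  fix \<beta> \<gamma> assume "\<beta> \<in> BB" "\<gamma> \<in> BB" "pten \<beta> = pten \<gamma>"
  then show "\<beta> = \<gamma>" using cf_delta[of \<beta> \<gamma>] cf_delta[of \<beta> \<beta>] by (auto split: if_splits)
qed

section \<open>Multiplication of the tensor power\<close>

lemma hmult_pointwise_multilin: "y \<in> CH \<Longrightarrow> multilin C H K (\<lambda>x. pten (\<lambda>c\<in>C. hmult H (x c) (y c)))"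
  "x \<in> CH \<Longrightarrow> multilin C H K (\<lambda>y. pten (\<lambda>c\<in>C. hmult H (x c) (y c)))"
proof -
  have m: "multilin C H K pten"
    using multilin_ptensor[of C H] by (simp add: multilin_def linmap_to_K)
  show "y \<in> CH \<Longrightarrow> multilin C H K (\<lambda>x. pten (\<lambda>c\<in>C. hmult H (x c) (y c)))"
    by (rule multilin_map[OF vspace m, of "\<lambda>c x. hmult H x (y c)"]) (auto intro: bilin_left[OF mult_bilin])
  show "x \<in> CH \<Longrightarrow> multilin C H K (\<lambda>y. pten (\<lambda>c\<in>C. hmult H (x c) (y c)))"
    by (rule multilin_map[OF vspace m, of "\<lambda>c. hmult H (x c)"]) (auto intro: bilin_right[OF mult_bilin])
qed

lemma K_universal:
  assumes X: "is_vspace X" and \<beta>: "multilin C H X \<beta>"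
  shows "linmap K X (plift C H X \<beta>)" "x \<in> CH \<Longrightarrow> plift C H X \<beta> (pten x) = \<beta> x"
  using ptensor_universal(1,2)[OF X \<beta>] by (simp_all add: linmap_K)

lemma plift_PK: "plift C H P = plift C H K"
  by (simp add: plift_def linmap_def fun_eq_iff)

lemma hmult_K: "hmult K s t = plift C H K (\<lambda>x. plift C H K (\<lambda>y. pten (\<lambda>c\<in>C. hmult H (x c) (y c))) t) s"
  unfolding plift_PK[symmetric] by (simp add: hopf_power_def)

text \<open>The inner \<open>plift\<close> is chosen separately for each \<open>x\<close>. Expanding
  \<open>t\<close> in the product basis replaces it by a formula that is visibly multilinear in
  \<open>x\<close>.\<close>

lemma hmult_K_multilin:
  assumes t: "t \<in> vcar K"
  shows "multilin C H K (\<lambda>x. plift C H K (\<lambda>y. pten (\<lambda>c\<in>C. hmult H (x c) (y c))) t)"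
proof (rule multilin_cong[OF vspace])
  show "multilin C H K (\<lambda>x. \<Sum>\<beta>\<in>BB. vscale K (cf \<beta> t) (pten (\<lambda>c\<in>C. hmult H (x c) (\<beta> c))))"
    by (intro multilin_sum K_vspace multilin_comp[OF hmult_pointwise_multilin(1) linmap_scale_fun[OF K_vspace linmap_id]] BB_sub)
  fix x assume x: "x \<in> CH"
  show "(\<Sum>\<beta>\<in>BB. vscale K (cf \<beta> t) (pten (\<lambda>c\<in>C. hmult H (x c) (\<beta> c)))) =
      plift C H K (\<lambda>y. pten (\<lambda>c\<in>C. hmult H (x c) (y c))) t"
    using linmap_K_expand[OF K_vspace K_universal(1)[OF K_vspace hmult_pointwise_multilin(2)[OF x]] t]
      K_universal(2)[OF K_vspace hmult_pointwise_multilin(2)[OF x] BB_sub]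
    by simp
qed

lemma hmult_pt: "x \<in> CH \<Longrightarrow> y \<in> CH \<Longrightarrow> hmult K (pten x) (pten y) = pten (\<lambda>c\<in>C. hmult H (x c) (y c))"
  unfolding hmult_K
  by (subst K_universal(2)[OF K_vspace hmult_K_multilin[OF pt_closed]])
    (simp_all add: K_universal(2)[OF K_vspace hmult_pointwise_multilin(2)])

lemma hmult_K_bilin: "bilin K K K (hmult K)"
proof (rule bilinI)
  fix t assume t: "t \<in> vcar K"
  show "linmap K K (\<lambda>s. hmult K s t)"
    unfolding hmult_K by (rule K_universal(1)[OF K_vspace hmult_K_multilin[OF t]])
next
  fix s assume s: "s \<in> vcar K"
  show "linmap K K (hmult K s)"
  proof (rule linmap_cong[OF _ K_vspace])
    show "linmap K K (\<lambda>t. \<Sum>\<beta>\<in>BB. vscale K (cf \<beta> s) (plift C H K (\<lambda>y. pten (\<lambda>c\<in>C. hmult H (\<beta> c) (y c))) t))"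
      by (intro linmap_sum_fun K_vspace linmap_scale_fun K_universal(1) hmult_pointwise_multilin(2) BB_sub)
    fix t assume t: "t \<in> vcar K"
    show "(\<Sum>\<beta>\<in>BB. vscale K (cf \<beta> s) (plift C H K (\<lambda>y. pten (\<lambda>c\<in>C. hmult H (\<beta> c) (y c))) t)) = hmult K s t"
      unfolding hmult_K
      using linmap_K_expand[OF K_vspace K_universal(1)[OF K_vspace hmult_K_multilin[OF t]] s]
        K_universal(2)[OF K_vspace hmult_K_multilin[OF t] BB_sub] by simp
  qed
qed

lemma hone_K: "hone K = pten (\<lambda>c\<in>C. hone H)"
  by (simp add: hopf_power_def)

text \<open>\<open>unzip_tensor\<close> is chosen subject to a condition on families of pure tensors
  only. The coordinate formula \<open>F\<close> satisfies this condition, hence the choice does too,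
  and the two agree on all families because both are multilinear and every family expands into
  families of basis tensors.\<close>

lemma unzip_pt:
  assumes t: "t \<in> C \<rightarrow>\<^sub>E vcar (H \<otimes>\<^sub>s H)"
  shows "unzip_tensor C H (ptensor C (H \<otimes>\<^sub>s H) t) =
    (\<Sum>\<beta>\<in>BB. \<Sum>\<gamma>\<in>BB. fscale (\<Prod>c\<in>C. t c (\<lambda>x y. e (\<beta> c) x * e (\<gamma> c) y)) (tensor K K (pten \<beta>) (pten \<gamma>)))"
proof -
  let ?HH = "H \<otimes>\<^sub>s H" and ?KK = "K \<otimes>\<^sub>s K"
  have HH: "is_vspace ?HH" and KK: "is_vspace ?KK" by (rule is_vspace_tprod)+
  define F where "F t = (\<Sum>\<beta>\<in>BB. \<Sum>\<gamma>\<in>BB. vscale ?KK (\<Prod>c\<in>C. t c (\<lambda>x y. e (\<beta> c) x * e (\<gamma> c) y)) (tensor K K (pten \<beta>) (pten \<gamma>)))"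
    for t :: "'c \<Rightarrow> ('h \<Rightarrow> 'h \<Rightarrow> 'k) \<Rightarrow> 'k"
  have F: "multilin C ?HH ?KK F"
    unfolding F_def
    by (intro multilin_sum KK multilin_prod[OF finite_C KK] linmap_fscale_eval tensor_closed pt_closed BB_sub)
  let ?f = "plift C ?HH ?KK F"
  have Fp: "F (\<lambda>c\<in>C. tensor H H (a c) (b c)) = tensor K K (pten a) (pten b)" if ab: "a \<in> CH" "b \<in> CH" for a b
  proof -
    have "tensor K K (pten a) (pten b) = (\<Sum>\<beta>\<in>BB. vscale ?KK (cf \<beta> (pten a)) (tensor K K (pten \<beta>) (pten b)))"
      by (rule linmap_K_expand[OF KK bilin_left[OF bilin_tensor pt_closed[OF ab(2)]] pt_closed[OF ab(1)]])
    also have "\<dots> = (\<Sum>\<beta>\<in>BB. vscale ?KK (cf \<beta> (pten a)) (\<Sum>\<gamma>\<in>BB. vscale ?KK (cf \<gamma> (pten b)) (tensor K K (pten \<beta>) (pten \<gamma>))))"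
      by (intro sum.cong refl arg_cong[of _ _ "vscale ?KK _"]
          linmap_K_expand[OF KK bilin_right[OF bilin_tensor pt_closed[OF BB_sub]] pt_closed[OF ab(2)]])
    also have "\<dots> = (\<Sum>\<beta>\<in>BB. \<Sum>\<gamma>\<in>BB. vscale ?KK (cf \<beta> (pten a) * cf \<gamma> (pten b)) (tensor K K (pten \<beta>) (pten \<gamma>)))"
    proof -
      interpret KKV: vector_space "vscale ?KK" by (rule vs_vector_space[OF KK])
      show ?thesis by (simp add: KKV.scale_sum_right del: vscale_tprod)
    qed
    also have "\<dots> = F (\<lambda>c\<in>C. tensor H H (a c) (b c))"
      by (simp add: F_def cf_pt tensor_e_e prod.distrib)
    finally show ?thesis by simp
  qed
  define Q where "Q f \<longleftrightarrow> linmap (tpower C ?HH) (P \<otimes>\<^sub>s P) f \<and>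
      (\<forall>a\<in>CH. \<forall>b\<in>CH. f (ptensor C ?HH (\<lambda>c\<in>C. tensor H H (a c) (b c))) = tensor P P (pten a) (pten b))" for f
  have "Q ?f"
    unfolding Q_def
  proof (intro conjI ballI)
    show "linmap (tpower C ?HH) (P \<otimes>\<^sub>s P) ?f" unfolding tprod_PP by (rule ptensor_universal(1)[OF KK F])
    fix a b assume ab: "a \<in> CH" "b \<in> CH"
    have "(\<lambda>c\<in>C. tensor H H (a c) (b c)) \<in> C \<rightarrow>\<^sub>E vcar ?HH"
      using ab by (auto intro: tensor_closed)
    then show "?f (ptensor C ?HH (\<lambda>c\<in>C. tensor H H (a c) (b c))) = tensor P P (pten a) (pten b)"
      using ptensor_universal(2)[OF KK F] Fp[OF ab] by (simp add: tensor_PP)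
  qed
  then have "Q (unzip_tensor C H)"
    unfolding unzip_tensor_def Q_def[symmetric] by (rule someI[of Q])
  then have u: "linmap (tpower C ?HH) ?KK (unzip_tensor C H)"
      "\<And>a b. a \<in> CH \<Longrightarrow> b \<in> CH \<Longrightarrow> unzip_tensor C H (ptensor C ?HH (\<lambda>c\<in>C. tensor H H (a c) (b c))) = tensor K K (pten a) (pten b)"
    unfolding Q_def tprod_PP tensor_PP by auto
  have U: "multilin C ?HH ?KK (\<lambda>t. unzip_tensor C H (ptensor C ?HH t))"
    by (rule multilin_comp[OF multilin_ptensor u(1)])
  let ?s = "\<lambda>c (p :: 'h \<times> 'h). t c (\<lambda>x y. e (fst p) x * e (snd p) y)" and ?u = "\<lambda>c (p :: 'h \<times> 'h). tensor H H (fst p) (snd p)"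
  have uc: "?u c p \<in> vcar ?HH" if "c \<in> C" "p \<in> B \<times> B" for c p
    using that(2) by (auto intro!: tensor_closed B_car)
  have teq: "t = (\<lambda>c\<in>C. \<Sum>p\<in>B \<times> B. vscale ?HH (?s c p) (?u c p))"
  proof
    fix c
    show "t c = (\<lambda>c\<in>C. \<Sum>p\<in>B \<times> B. vscale ?HH (?s c p) (?u c p)) c"
    proof (cases "c \<in> C")
      case True
      then have "t c \<in> vcar ?HH" using t by auto
      from tensor_expand[OF this] show ?thesis
        using True by (simp add: sum.cartesian_product case_prod_unfold)
    next
      case False
      then show ?thesis using t by (simp add: PiE_iff extensional_def)
    qed
  qed
  have agree: "unzip_tensor C H (ptensor C ?HH (\<lambda>c\<in>C. ?u c (g c))) = F (\<lambda>c\<in>C. ?u c (g c))"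
    if g: "g \<in> C \<rightarrow>\<^sub>E B \<times> B" for g
  proof -
    define a where "a = (\<lambda>c\<in>C. fst (g c))"
    define b where "b = (\<lambda>c\<in>C. snd (g c))"
    have ab: "a \<in> CH" "b \<in> CH" using g by (auto simp: a_def b_def PiE_iff intro!: B_car)
    have eq: "(\<lambda>c\<in>C. ?u c (g c)) = (\<lambda>c\<in>C. tensor H H (a c) (b c))" by (auto simp: a_def b_def)
    show ?thesis unfolding eq u(2)[OF ab] Fp[OF ab] ..
  qed
  have "unzip_tensor C H (ptensor C ?HH (\<lambda>c\<in>C. \<Sum>p\<in>B \<times> B. vscale ?HH (?s c p) (?u c p))) =
      (\<Sum>g\<in>C \<rightarrow>\<^sub>E B \<times> B. vscale ?KK (\<Prod>c\<in>C. ?s c (g c)) (unzip_tensor C H (ptensor C ?HH (\<lambda>c\<in>C. ?u c (g c)))))"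
    by (rule multilin_sum_expand[OF finite_C HH KK U]) (rule uc)
  also have "\<dots> = (\<Sum>g\<in>C \<rightarrow>\<^sub>E B \<times> B. vscale ?KK (\<Prod>c\<in>C. ?s c (g c)) (F (\<lambda>c\<in>C. ?u c (g c))))"
    by (intro sum.cong refl arg_cong[of _ _ "vscale ?KK _"] agree)
  also have "\<dots> = F (\<lambda>c\<in>C. \<Sum>p\<in>B \<times> B. vscale ?HH (?s c p) (?u c p))"
    by (rule multilin_sum_expand[OF finite_C HH KK F, symmetric]) (rule uc)
  finally have "unzip_tensor C H (ptensor C ?HH t) = F t"
    unfolding teq[symmetric] .
  then show ?thesis by (simp add: F_def)
qed

section \<open>Coproduct, counit, antipode and projections of the tensor power\<close>

lemma comult_formula_multilin: "multilin C H (K \<otimes>\<^sub>s K) (\<lambda>x. \<Sum>\<beta>\<in>BB. \<Sum>\<gamma>\<in>BB.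
    fscale (\<Prod>c\<in>C. gdl (\<beta> c) (\<gamma> c) (x c)) (tensor K K (pten \<beta>) (pten \<gamma>)))"
proof -
  have "multilin C H (K \<otimes>\<^sub>s K) (\<lambda>x. \<Sum>\<beta>\<in>BB. \<Sum>\<gamma>\<in>BB.
    vscale (K \<otimes>\<^sub>s K) (\<Prod>c\<in>C. gdl (\<beta> c) (\<gamma> c) (x c)) (tensor K K (pten \<beta>) (pten \<gamma>)))"
    by (intro multilin_sum is_vspace_tprod multilin_prod[OF finite_C is_vspace_tprod] gdl_linmap tensor_closed pt_closed BB_sub)
  then show ?thesis by simp
qed

lemma comult_K: "comult K = plift C H (K \<otimes>\<^sub>s K) (\<lambda>x. \<Sum>\<beta>\<in>BB. \<Sum>\<gamma>\<in>BB.
    fscale (\<Prod>c\<in>C. gdl (\<beta> c) (\<gamma> c) (x c)) (tensor K K (pten \<beta>) (pten \<gamma>)))"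
proof -
  have "comult K = plift C H (K \<otimes>\<^sub>s K) (\<lambda>x. unzip_tensor C H (ptensor C (H \<otimes>\<^sub>s H) (\<lambda>c\<in>C. comult H (x c))))"
    unfolding tprod_PP[symmetric] by (simp add: hopf_power_def)
  also have "\<dots> = plift C H (K \<otimes>\<^sub>s K) (\<lambda>x. \<Sum>\<beta>\<in>BB. \<Sum>\<gamma>\<in>BB.
    fscale (\<Prod>c\<in>C. gdl (\<beta> c) (\<gamma> c) (x c)) (tensor K K (pten \<beta>) (pten \<gamma>)))"
  proof (rule plift_cong)
    fix x assume x: "x \<in> CH"
    then have "(\<lambda>c\<in>C. comult H (x c)) \<in> C \<rightarrow>\<^sub>E vcar (H \<otimes>\<^sub>s H)"
      using linmap_closed[OF comult_lin] by auto
    from unzip_pt[OF this] show "unzip_tensor C H (ptensor C (H \<otimes>\<^sub>s H) (\<lambda>c\<in>C. comult H (x c))) =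
        (\<Sum>\<beta>\<in>BB. \<Sum>\<gamma>\<in>BB. fscale (\<Prod>c\<in>C. gdl (\<beta> c) (\<gamma> c) (x c)) (tensor K K (pten \<beta>) (pten \<gamma>)))"
      using x by (simp add: gdl_def pj_id PiE_iff cong: prod.cong)
  qed
  finally show ?thesis .
qed

lemma comult_K_lin: "linmap K (K \<otimes>\<^sub>s K) (comult K)"
  unfolding comult_K by (rule K_universal(1)[OF is_vspace_tprod comult_formula_multilin])

lemma comult_pt: "x \<in> CH \<Longrightarrow> comult K (pten x) = (\<Sum>\<beta>\<in>BB. \<Sum>\<gamma>\<in>BB.
    fscale (\<Prod>c\<in>C. gdl (\<beta> c) (\<gamma> c) (x c)) (tensor K K (pten \<beta>) (pten \<gamma>)))"
  unfolding comult_K by (rule K_universal(2)[OF is_vspace_tprod comult_formula_multilin])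

lemma sw2_pt: "is_vspace X \<Longrightarrow> bilin K K X \<phi> \<Longrightarrow> x \<in> CH \<Longrightarrow> sw2 K X \<phi> (pten x) =
    (\<Sum>\<beta>\<in>BB. \<Sum>\<gamma>\<in>BB. vscale X (\<Prod>c\<in>C. gdl (\<beta> c) (\<gamma> c) (x c)) (\<phi> (pten \<beta>) (pten \<gamma>)))"
  unfolding sw2_def comult_pt by (rule tlift_tensor_sum2) (auto simp: ptensor_closed BB_sub)

lemma linmap_sw2_K: "is_vspace X \<Longrightarrow> bilin K K X \<phi> \<Longrightarrow> linmap K X (sw2 K X \<phi>)"
  unfolding sw2_def[abs_def] by (rule linmap_tlift_arg[OF _ _ comult_K_lin])

lemma counit_pform_multilin: "multilin C H scalars (pform (\<lambda>_. counit H))"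
  by (rule pform_multilin) (rule counit_lin)

lemma counit_K: "counit K = plift C H scalars (pform (\<lambda>_. counit H))"
  by (simp add: hopf_power_def pform_def[abs_def])

lemma counit_K_lin: "linmap K scalars (counit K)"
  unfolding counit_K by (rule K_universal(1)[OF is_vspace_scalars counit_pform_multilin])

lemma counit_pt: "x \<in> CH \<Longrightarrow> counit K (pten x) = (\<Prod>c\<in>C. gep (x c))"
  unfolding counit_K
  by (subst K_universal(2)[OF is_vspace_scalars counit_pform_multilin]) (auto simp: pform_def gep_car PiE_iff intro!: prod.cong)

lemma antipode_multilin: "multilin C H K (\<lambda>x. pten (\<lambda>c\<in>C. antipode H (x c)))"
proof (rule multilin_map[OF vspace])
  show "multilin C H K pten"
    using multilin_ptensor[of C H] by (simp add: multilin_def linmap_to_K)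
qed (rule antipode_lin)

lemma antipode_K: "antipode K = plift C H K (\<lambda>x. pten (\<lambda>c\<in>C. antipode H (x c)))"
  unfolding plift_PK[symmetric] by (simp add: hopf_power_def)

lemma antipode_K_lin: "linmap K K (antipode K)"
  unfolding antipode_K by (rule K_universal(1)[OF K_vspace antipode_multilin])

lemma antipode_pt: "x \<in> CH \<Longrightarrow> antipode K (pten x) = pten (\<lambda>c\<in>C. antipode H (x c))"
  unfolding antipode_K by (rule K_universal(2)[OF K_vspace antipode_multilin])

lemma pr_map_multilin:
  assumes c: "c \<in> C"
  shows "multilin C H H (\<lambda>x. vscale H (\<Prod>d\<in>C - {c}. counit H (x d)) (x c))"
proof (rule multilin_cong[OF vspace])
  \<comment> \<open>The component at \<open>c\<close> is expanded in the basis, so that each summand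
    is a product of functionals times a fixed vector, the shape covered by
    \<open>multilin_prod\<close>.\<close>
  show "multilin C H H (\<lambda>x. \<Sum>b\<in>B. vscale H (\<Prod>d\<in>C. (if d = c then e b else counit H) (x d)) b)"
    by (intro multilin_sum vspace multilin_prod[OF finite_C vspace] B_car) (simp add: linmap_e counit_lin)
  fix x assume x: "x \<in> CH"
  then have xc: "x c \<in> vcar H" using c by auto
  have "(\<Prod>d\<in>C. (if d = c then e b else counit H) (x d)) = (\<Prod>d\<in>C - {c}. counit H (x d)) * e b (x c)" for b
    by (subst prod.remove[OF finite_C c]) (simp add: mult.commute)
  then show "(\<Sum>b\<in>B. vscale H (\<Prod>d\<in>C. (if d = c then e b else counit H) (x d)) b) =
      vscale H (\<Prod>d\<in>C - {c}. counit H (x d)) (x c)"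
    using arg_cong[OF basis_expand[OF xc], of "vscale H (\<Prod>d\<in>C - {c}. counit H (x d))"]
    by (simp add: HV.scale_sum_right)
qed

lemma pr_map_lin: "c \<in> C \<Longrightarrow> linmap K H (pr_map C H c)"
  unfolding pr_map_def by (rule K_universal(1)[OF vspace pr_map_multilin])

lemma pr_map_pt: "c \<in> C \<Longrightarrow> x \<in> CH \<Longrightarrow> pr_map C H c (pten x) = vscale H (\<Prod>d\<in>C - {c}. counit H (x d)) (x c)"
  unfolding pr_map_def by (rule K_universal(2)[OF vspace pr_map_multilin])

text \<open>\<open>based_space\<close> indexes the coordinate functionals by the basis vectors
  themselves, so the family has to be recovered from its pure tensor; this is possible by
  \<open>inj_pt\<close>.\<close>

definition eK :: "((('c \<Rightarrow> 'h) \<Rightarrow> 'k) \<Rightarrow> 'k) \<Rightarrow> ((('c \<Rightarrow> 'h) \<Rightarrow> 'k) \<Rightarrow> 'k) \<Rightarrow> 'k" where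
  "eK b = cf (inv_into BB pten b)"

lemma eK_pt: "\<beta> \<in> BB \<Longrightarrow> eK (pten \<beta>) = cf \<beta>"
  by (simp add: eK_def inv_into_f_f[OF inj_pt])

sublocale KB: based_space K "pten ` BB" eK
proof
  show "is_vspace K" by (rule K_vspace)
  show "linmap K (K \<otimes>\<^sub>s K) (comult K)" by (rule comult_K_lin)
  show "finite (pten ` BB)" using finite_BB by simp
  show "b \<in> pten ` BB \<Longrightarrow> b \<in> vcar K" for b using pt_closed BB_sub by blast
  show "eK b (x + y) = eK b x + eK b y" "eK b (vscale K k x) = k * eK b x" for b x y k
    by (simp_all add: eK_def cf_def fscale_def)
  show "b \<in> pten ` BB \<Longrightarrow> c \<in> pten ` BB \<Longrightarrow> eK b c = (if b = c then 1 else 0)" for b c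
    using inj_onD[OF inj_pt] by (auto simp: eK_pt cf_delta)
  show "(\<Sum>b\<in>pten ` BB. vscale K (eK b x) b) = x" if "x \<in> vcar K" for x
    using pt_expand[OF that] by (simp add: sum.reindex[OF inj_pt] eK_pt)
qed

lemma gdlK_pt:
  assumes \<beta>: "\<beta> \<in> BB" and \<gamma>: "\<gamma> \<in> BB" and x: "x \<in> CH"
  shows "KB.gdl (pten \<beta>) (pten \<gamma>) (pten x) = (\<Prod>c\<in>C. gdl (\<beta> c) (\<gamma> c) (x c))"
proof -
  let ?F = "\<lambda>x y. eK (pten \<beta>) x * eK (pten \<gamma>) y"
  have app: "(\<Sum>i\<in>J. f i) F = (\<Sum>i\<in>J. f i F)" if "finite J" for J F and f :: "('c \<Rightarrow> 'h) \<Rightarrow> _ \<Rightarrow> 'k"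
    using that by (induction J rule: finite_induct) auto
  have "KB.gdl (pten \<beta>) (pten \<gamma>) (pten x) = comult K (pten x) ?F"
    by (simp add: KB.gdl_def KB.pj_id ptensor_closed x)
  also have "\<dots> = (\<Sum>\<beta>'\<in>BB. \<Sum>\<gamma>'\<in>BB. (\<Prod>c\<in>C. gdl (\<beta>' c) (\<gamma>' c) (x c)) * (cf \<beta> (pten \<beta>') * cf \<gamma> (pten \<gamma>')))"
    by (simp add: comult_pt[OF x] app finite_BB fscale_def KB.tensor_e_e[where b = "pten \<beta>" and c = "pten \<gamma>", simplified eK_pt[OF \<beta>] eK_pt[OF \<gamma>]] eK_pt \<beta> \<gamma>)
  also have "\<dots> = (\<Sum>\<beta>'\<in>BB. \<Sum>\<gamma>'\<in>BB. if \<beta> = \<beta>' \<and> \<gamma> = \<gamma>' then (\<Prod>c\<in>C. gdl (\<beta>' c) (\<gamma>' c) (x c)) else 0)"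
    using \<beta> \<gamma> by (intro sum.cong refl) (simp add: cf_delta)
  also have "\<dots> = (\<Sum>\<beta>'\<in>BB. if \<beta> = \<beta>' then (\<Prod>c\<in>C. gdl (\<beta>' c) (\<gamma> c) (x c)) else 0)"
  proof (intro sum.cong refl)
    fix \<beta>'
    show "(\<Sum>\<gamma>'\<in>BB. if \<beta> = \<beta>' \<and> \<gamma> = \<gamma>' then (\<Prod>c\<in>C. gdl (\<beta>' c) (\<gamma>' c) (x c)) else 0) =
        (if \<beta> = \<beta>' then (\<Prod>c\<in>C. gdl (\<beta>' c) (\<gamma> c) (x c)) else 0)"
      using \<gamma> finite_BB by (cases "\<beta> = \<beta>'") simp_all
  qed
  also have "\<dots> = (\<Prod>c\<in>C. gdl (\<beta> c) (\<gamma> c) (x c))"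
    using \<beta> finite_BB by simp
  finally show ?thesis .
qed

end

section \<open>The action and the coaction on the extended Hilbert space\<close>

lemma comps_id: "(\<And>c m. c \<in> set cs \<Longrightarrow> m \<in> X \<Longrightarrow> F c m = m) \<Longrightarrow> m \<in> X \<Longrightarrow> comps cs F m = m"
  by (induction cs) simp_all

lemma comps_single:
  "distinct cs \<Longrightarrow> c \<in> set cs \<Longrightarrow> (\<And>d m. d \<in> set cs \<Longrightarrow> d \<noteq> c \<Longrightarrow> m \<in> X \<Longrightarrow> F d m = m) \<Longrightarrow>
    F c m \<in> X \<Longrightarrow> m \<in> X \<Longrightarrow> comps cs F m = F c m"
proof (induction cs)
  case (Cons d cs)
  show ?case
  proof (cases "d = c")
    case True
    then show ?thesis using Cons.prems by (auto intro!: comps_id[of cs X])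
  next
    case False
    then show ?thesis using Cons by auto
  qed
qed simp

lemma sum_PiE_pair:
  assumes "finite C"
  shows "(\<Sum>g\<in>C \<rightarrow>\<^sub>E J \<times> J'. f g) = (\<Sum>\<beta>\<in>C \<rightarrow>\<^sub>E J. \<Sum>\<gamma>\<in>C \<rightarrow>\<^sub>E J'. f (\<lambda>c\<in>C. (\<beta> c, \<gamma> c)))"
proof -
  have "(\<Sum>g\<in>C \<rightarrow>\<^sub>E J \<times> J'. f g) =
      (\<Sum>(\<beta>, \<gamma>)\<in>(C \<rightarrow>\<^sub>E J) \<times> (C \<rightarrow>\<^sub>E J'). f (\<lambda>c\<in>C. (\<beta> c, \<gamma> c)))"
    by (rule sum.reindex_bij_witness[of _ "\<lambda>(\<beta>, \<gamma>). \<lambda>c\<in>C. (\<beta> c, \<gamma> c)" "\<lambda>g. (\<lambda>c\<in>C. fst (g c), \<lambda>c\<in>C. snd (g c))"])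
      (auto simp: PiE_iff extensional_def fun_eq_iff mem_Times_iff intro!: arg_cong[of _ _ f])
  then show ?thesis by (simp add: sum.cartesian_product)
qed

lemma sum_PiE_quadruple:
  assumes "finite C"
  shows "(\<Sum>g\<in>C \<rightarrow>\<^sub>E J1 \<times> J2 \<times> J3 \<times> J4. f g) =
    (\<Sum>p\<in>C \<rightarrow>\<^sub>E J1. \<Sum>q\<in>C \<rightarrow>\<^sub>E J2. \<Sum>u\<in>C \<rightarrow>\<^sub>E J3. \<Sum>v\<in>C \<rightarrow>\<^sub>E J4. f (\<lambda>c\<in>C. (p c, q c, u c, v c)))"
  unfolding sum_PiE_pair[OF assms] by (simp cong: restrict_cong)

context based_graph
begin

lemma finite_cilia: "finite (cilia G)"
  by (rule finite_subset[OF Gr.cilia_sub Gr.fin])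

sublocale Pw: hopf_power_space H B e "cilia G"
  by unfold_locales (rule finite_cilia)

abbreviation "K \<equiv> hopf_power (cilia G) H"
abbreviation "BB \<equiv> cilia G \<rightarrow>\<^sub>E B"
abbreviation "CH \<equiv> cilia G \<rightarrow>\<^sub>E vcar H"
abbreviation "pten \<equiv> ptensor (cilia G) H"

text \<open>An arbitrary enumeration of the cilia. Operators of the same kind at different cilia
  commute, so the composites do not depend on it.\<close>

definition cs where "cs = (SOME l. distinct l \<and> set l = cilia G)"

lemma cs: "distinct cs" "set cs = cilia G"
proof -
  have "\<exists>l. distinct l \<and> set l = cilia G" using finite_distinct_list[OF finite_cilia] by blast
  from someI_ex[OF this] show "distinct cs" "set cs = cilia G" by (simp_all add: cs_def)
qed

definition Act where "Act x = comps cs (\<lambda>c. A c (x c))"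
definition TT where "TT \<alpha> = comps cs (\<lambda>c. T c (\<alpha> c))"

lemma Act_closed: "n \<in> vcar N \<Longrightarrow> Act x n \<in> vcar N"
  unfolding Act_def by (rule comps_closed) (rule A_closed)

lemma TT_closed: "n \<in> vcar N \<Longrightarrow> TT \<alpha> n \<in> vcar N"
  unfolding TT_def by (rule comps_closed) (rule T_closed)

lemma A_add: "A c a (m + n) = A c a m + A c a n" and A_scale: "A c a (fscale k n) = fscale k (A c a n)"
  and T_add: "T c \<alpha> (m + n) = T c \<alpha> m + T c \<alpha> n" and T_scale: "T c \<alpha> (fscale k n) = fscale k (T c \<alpha> n)"
  by (simp_all add: A_def T_def O.Lseq_add O.Lseq_scale O.Tseq_add O.Tseq_scale)

lemma Act_linmap: "linmap N N (Act x)"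
  unfolding linmap_def vscale_N
proof (intro conjI ballI allI)
  show "Act x (m + n) = Act x m + Act x n" "Act x (fscale k n) = fscale k (Act x n)" for m n k
    unfolding Act_def by (rule O.N.comps_add, rule A_add) (rule O.N.comps_scale, rule A_scale)
qed (rule Act_closed)

lemma TT_linmap: "linmap N N (TT \<alpha>)"
  unfolding linmap_def vscale_N
proof (intro conjI ballI allI)
  show "TT \<alpha> (m + n) = TT \<alpha> m + TT \<alpha> n" "TT \<alpha> (fscale k n) = fscale k (TT \<alpha> n)" for m n k
    unfolding TT_def by (rule O.N.comps_add, rule T_add) (rule O.N.comps_scale, rule T_scale)
qed (rule TT_closed)

lemma Act_cong: "(\<And>c. c \<in> cilia G \<Longrightarrow> x c = y c) \<Longrightarrow> Act x n = Act y n"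
  unfolding Act_def by (rule comps_cong) (simp add: cs)

lemma Act_expand: "Act x n = (\<Sum>\<beta>\<in>BB. fscale (\<Prod>c\<in>cilia G. e (\<beta> c) (x c)) (Act \<beta> n))"
proof -
  have eq: "A c a n = (\<Sum>b\<in>B. fscale (e b a) (A c b n))" for c a n
    unfolding A_def by (rule hlin_expand[OF O.N.vector_space_axioms O.hlin_Lseq, symmetric])
  have "Act x n = comps cs (\<lambda>c n. \<Sum>b\<in>B. fscale (e b (x c)) (A c b n)) n"
    unfolding Act_def by (rule comps_cong) (rule eq)
  also have "\<dots> = (\<Sum>\<beta>\<in>BB. fscale (\<Prod>c\<in>cilia G. e (\<beta> c) (x c)) (Act \<beta> n))"
    using O.N.comps_expand[OF cs(1) fin_B, of A "\<lambda>c b. e b (x c)" n] by (simp add: A_add A_scale cs Act_def)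
  finally show ?thesis .
qed

lemma TT_expand:
  assumes "\<And>c. c \<in> cilia G \<Longrightarrow> hlin (*) (\<alpha> c)"
  shows "TT \<alpha> n = (\<Sum>\<beta>\<in>BB. fscale (\<Prod>c\<in>cilia G. \<alpha> c (\<beta> c)) (TT (\<lambda>c. e (\<beta> c)) n))"
proof -
  have eq: "T c (\<alpha> c) n = (\<Sum>b\<in>B. fscale (\<alpha> c b) (T c (e b) n))" if "c \<in> cilia G" for c n
    unfolding T_def by (rule O.Tseq_expand[OF assms[OF that], symmetric])
  have "TT \<alpha> n = comps cs (\<lambda>c n. \<Sum>b\<in>B. fscale (\<alpha> c b) (T c (e b) n)) n"
    unfolding TT_def by (rule comps_cong) (rule eq, simp add: cs)
  also have "\<dots> = (\<Sum>\<beta>\<in>BB. fscale (\<Prod>c\<in>cilia G. \<alpha> c (\<beta> c)) (TT (\<lambda>c. e (\<beta> c)) n))"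
    using O.N.comps_expand[OF cs(1) fin_B, of "\<lambda>c b. T c (e b)" \<alpha> n] by (simp add: T_add T_scale cs TT_def)
  finally show ?thesis .
qed

lemma Act_Act: "n \<in> vcar N \<Longrightarrow> Act x (Act y n) = Act (\<lambda>c. gmul (x c) (y c)) n"
  unfolding Act_def A_mul by (rule comps_comp[where X = "vcar N"]) (auto simp: cs A_closed A_commute)

lemma TT_TT:
  assumes "n \<in> vcar N" and hl: "\<And>c. c \<in> cilia G \<Longrightarrow> hlin (*) (\<alpha> c)" "\<And>c. c \<in> cilia G \<Longrightarrow> hlin (*) (\<beta> c)"
  shows "TT \<beta> (TT \<alpha> n) = TT (\<lambda>c. O.conv (\<alpha> c) (\<beta> c)) n"
proof -
  have "TT \<beta> (TT \<alpha> n) = comps cs (\<lambda>c m. T c (\<beta> c) (T c (\<alpha> c) m)) n"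
    unfolding TT_def by (rule comps_comp[where X = "vcar N"]) (auto simp: cs T_closed T_commute assms(1))
  also have "\<dots> = TT (\<lambda>c. O.conv (\<alpha> c) (\<beta> c)) n"
    unfolding TT_def by (rule comps_cong) (simp add: cs T_conv hl)
  finally show ?thesis .
qed

section \<open>The action: existence and uniqueness\<close>

definition act where "act s n = (\<Sum>\<beta>\<in>BB. fscale (Pw.cf \<beta> s) (Act \<beta> n))"

lemma act_pt: "act (pten x) n = Act x n"
  by (simp add: act_def Pw.cf_pt Act_expand[of x])

lemma act_bilin: "bilin K N N act"
proof (rule bilinI)
  fix s
  have "linmap N N (\<lambda>n. \<Sum>\<beta>\<in>BB. vscale N (Pw.cf \<beta> s) (Act \<beta> n))"
    by (intro linmap_sum_fun N_vspace linmap_scale_fun Act_linmap)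
  then show "linmap N N (act s)" by (simp add: act_def[abs_def] vscale_N)
next
  fix n assume n: "n \<in> vcar N"
  have "linmap K N (\<lambda>s. \<Sum>\<beta>\<in>BB. vscale N (Pw.cf \<beta> s) (Act \<beta> n))"
    by (intro linmap_sum_fun N_vspace linmap_scalar_fun Pw.cf_linmap Act_closed n)
  then show "linmap K N (\<lambda>s. act s n)" by (simp add: act_def vscale_N)
qed

lemma act_one: "n \<in> vcar N \<Longrightarrow> act (hone K) n = n"
  unfolding Pw.hone_K act_pt Act_def by (rule comps_id[where X = "vcar N"]) (simp_all add: cs A_one)

lemma act_mult:
  assumes s: "s \<in> vcar K" and t: "t \<in> vcar K" and n: "n \<in> vcar N"
  shows "act (hmult K s t) n = act s (act t n)"
proof -
  note K = Pw.hmult_K_bilin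
  have pc: "\<beta> \<in> BB \<Longrightarrow> pten \<beta> \<in> vcar K" for \<beta> by (rule Pw.pt_closed[OF Pw.BB_sub])
  have an: "act t n \<in> vcar N" by (rule bilin_closed[OF act_bilin t n])
  show ?thesis
  proof (rule Pw.linmap_K_eqI[OF N_vspace linmap_comp[OF bilin_left[OF K t] bilin_left[OF act_bilin n]]
        bilin_left[OF act_bilin an] _ s])
    fix \<beta> assume \<beta>: "\<beta> \<in> BB"
    show "act (hmult K (pten \<beta>) t) n = act (pten \<beta>) (act t n)"
    proof (rule Pw.linmap_K_eqI[OF N_vspace linmap_comp[OF bilin_right[OF K pc[OF \<beta>]] bilin_left[OF act_bilin n]]
          linmap_comp[OF bilin_left[OF act_bilin n] bilin_right[OF act_bilin pc[OF \<beta>]]] _ t])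
      fix \<gamma> assume \<gamma>: "\<gamma> \<in> BB"
      have "Act (\<lambda>c\<in>cilia G. hmult H (\<beta> c) (\<gamma> c)) n = Act (\<lambda>c. gmul (\<beta> c) (\<gamma> c)) n"
        by (rule Act_cong) (simp add: gmul_def pj_id B_car Pw.BB_B[OF \<beta>] Pw.BB_B[OF \<gamma>])
      then show "act (hmult K (pten \<beta>) (pten \<gamma>)) n = act (pten \<beta>) (act (pten \<gamma>) n)"
        by (simp add: Pw.hmult_pt Pw.BB_sub \<beta> \<gamma> act_pt Act_Act n)
    qed
  qed
qed

lemma act_left_module: "left_module K N act"
  by (simp add: left_module_def act_bilin act_one act_mult)

lemma act_in_map:
  assumes c: "c \<in> cilia G" and n: "n \<in> vcar N"
  shows "act (in_map (cilia G) H c a) n = A c a n"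
  unfolding in_map_def act_pt Act_def
  using comps_single[where X = "vcar N" and F = "\<lambda>d. A d ((\<lambda>d\<in>cilia G. if d = c then a else hone H) d)", OF cs(1)] c n
  by (simp add: cs A_one A_closed)

lemma act_graph: "is_graph_action G H M act"
  by (simp add: is_graph_action_def kitaev_hopf_def act_left_module act_in_map vertex_action_eq)

text \<open>A pure tensor with units outside the list is peeled off one cilium at a time:
  \<open>?z\<close> is the image of \<open>x c\<close> under the inclusion at \<open>c\<close> and
  stands on the right, so it acts first, like the head of the list in \<open>comps\<close>.\<close>

lemma act_unique:
  assumes act': "is_graph_action G H M act'" and s: "s \<in> vcar K" and n: "n \<in> vcar N"
  shows "act' s n = act s n"
proof -
  have bi: "bilin K N N act'" and one: "\<And>n. n \<in> vcar N \<Longrightarrow> act' (hone K) n = n"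
    and mul: "\<And>s t n. s \<in> vcar K \<Longrightarrow> t \<in> vcar K \<Longrightarrow> n \<in> vcar N \<Longrightarrow> act' (hmult K s t) n = act' s (act' t n)"
    and inm: "\<And>c a n. c \<in> cilia G \<Longrightarrow> a \<in> vcar H \<Longrightarrow> n \<in> vcar N \<Longrightarrow> act' (in_map (cilia G) H c a) n = A c a n"
    using act' by (simp_all add: is_graph_action_def left_module_def kitaev_hopf_def vertex_action_eq)
  have *: "act' (pten (\<lambda>d\<in>cilia G. if d \<in> set l then x d else hone H)) n = comps l (\<lambda>c. A c (x c)) n"
    if "distinct l" "set l \<subseteq> cilia G" "n \<in> vcar N" and x: "x \<in> CH" for l x n
    using that(1-3)
  proof (induction l arbitrary: n)
    case Nil
    then show ?case using one by (simp add: Pw.hone_K restrict_def)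
  next
    case (Cons c l)
    let ?y = "\<lambda>d\<in>cilia G. if d \<in> set l then x d else hone H" and ?z = "\<lambda>d\<in>cilia G. if d = c then x c else hone H"
    have c: "c \<in> cilia G" and xc: "x c \<in> vcar H" using Cons.prems x by auto
    have yz: "?y \<in> CH" "?z \<in> CH" using x xc one_closed by auto
    have "(\<lambda>d\<in>cilia G. if d \<in> set (c # l) then x d else hone H) = (\<lambda>d\<in>cilia G. hmult H (?y d) (?z d))"
      using x xc Cons.prems by (auto simp: fun_eq_iff one_left one_right one_closed PiE_iff)
    then have "act' (pten (\<lambda>d\<in>cilia G. if d \<in> set (c # l) then x d else hone H)) n = act' (hmult K (pten ?y) (pten ?z)) n"
      using Pw.hmult_pt[OF yz] by simp
    also have "\<dots> = act' (pten ?y) (act' (in_map (cilia G) H c (x c)) n)"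
      unfolding in_map_def by (rule mul[OF Pw.pt_closed[OF yz(1)] Pw.pt_closed[OF yz(2)] Cons.prems(3)])
    also have "\<dots> = comps (c # l) (\<lambda>c. A c (x c)) n"
      using Cons by (simp add: inm c xc A_closed restrict_def)
    finally show ?case .
  qed
  show ?thesis
  proof (rule Pw.linmap_K_eqI[OF N_vspace bilin_left[OF bi n] bilin_left[OF act_bilin n] _ s])
    fix \<beta> assume \<beta>: "\<beta> \<in> BB"
    have "(\<lambda>d\<in>cilia G. if d \<in> set cs then \<beta> d else hone H) = \<beta>"
      using \<beta> by (auto simp: cs fun_eq_iff PiE_iff extensional_def)
    then show "act' (pten \<beta>) n = act (pten \<beta>) n"
      using *[OF cs(1) _ n Pw.BB_sub[OF \<beta>]] by (simp add: cs act_pt Act_def)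
  qed
qed


section \<open>The coaction: existence and uniqueness\<close>

definition tt where "tt \<beta> = TT (\<lambda>c. e (\<beta> c))"

lemma tt_closed: "n \<in> vcar N \<Longrightarrow> tt \<beta> n \<in> vcar N"
  by (simp add: tt_def TT_closed)

lemma tt_linmap: "linmap N N (tt \<beta>)"
  by (simp add: tt_def TT_linmap)

definition co where "co n = (\<Sum>\<beta>\<in>BB. tensor K N (pten \<beta>) (tt \<beta> n))"

lemma pten_closed: "\<beta> \<in> BB \<Longrightarrow> pten \<beta> \<in> vcar K"
  by (rule Pw.pt_closed[OF Pw.BB_sub])

lemma co_linmap: "linmap N (K \<otimes>\<^sub>s N) co"
  unfolding co_def[abs_def]
  by (intro linmap_sum_fun is_vspace_tprod linmap_comp[OF tt_linmap bilin_right[OF bilin_tensor]] pten_closed)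

lemma tlift_co: "is_vspace X \<Longrightarrow> bilin K N X \<phi> \<Longrightarrow> n \<in> vcar N \<Longrightarrow>
    tlift K N X \<phi> (co n) = (\<Sum>\<beta>\<in>BB. \<phi> (pten \<beta>) (tt \<beta> n))"
  unfolding co_def by (rule tlift_tensor_sum) (assumption | rule pten_closed tt_closed)+

lemma co_counit:
  assumes n: "n \<in> vcar N"
  shows "tlift K N N (\<lambda>x n'. vscale N (counit K x) n') (co n) = n"
proof -
  have "tlift K N N (\<lambda>x n'. vscale N (counit K x) n') (co n) = (\<Sum>\<beta>\<in>BB. vscale N (counit K (pten \<beta>)) (tt \<beta> n))"
    by (rule tlift_co[OF N_vspace bilin_scalar_fun(1)[OF N_vspace Pw.counit_K_lin] n])
  also have "\<dots> = TT (\<lambda>_. gep) n"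
    unfolding TT_expand[OF hlin_ep] by (simp add: Pw.counit_pt Pw.BB_sub vscale_N tt_def)
  also have "\<dots> = n"
    unfolding TT_def by (rule comps_id[where X = "vcar N"]) (simp_all add: cs T_ep n)
  finally show ?thesis .
qed

lemma conv_basis: "b \<in> B \<Longrightarrow> c \<in> B \<Longrightarrow> O.conv (e b) (e c) d = gdl b c d"
  unfolding O.conv_def sw_def by (rule sum_e_e)

lemma hlin_conv: "hlin (*) (O.conv \<alpha> \<beta>)"
  unfolding O.conv_def by (rule hlin_sw[OF vector_space_times])

text \<open>Convolution at each cilium combines into the coproduct coefficients of the tensor power,
  which are products over the cilia; this is the coassociativity of \<open>co\<close> in
  coordinates.\<close>

lemma tt_tt:
  assumes n: "n \<in> vcar N" and bc: "\<beta> \<in> BB" "\<gamma> \<in> BB"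
  shows "tt \<gamma> (tt \<beta> n) = (\<Sum>\<delta>\<in>BB. fscale (\<Prod>c\<in>cilia G. gdl (\<beta> c) (\<gamma> c) (\<delta> c)) (tt \<delta> n))"
proof -
  have "tt \<gamma> (tt \<beta> n) = TT (\<lambda>c. O.conv (e (\<beta> c)) (e (\<gamma> c))) n"
    unfolding tt_def by (rule TT_TT[OF n]) (rule hlin_e, rule Pw.BB_B, rule bc, assumption)+
  also have "\<dots> = (\<Sum>\<delta>\<in>BB. fscale (\<Prod>c\<in>cilia G. O.conv (e (\<beta> c)) (e (\<gamma> c)) (\<delta> c)) (tt \<delta> n))"
    unfolding tt_def by (rule TT_expand[OF hlin_conv])
  also have "\<dots> = (\<Sum>\<delta>\<in>BB. fscale (\<Prod>c\<in>cilia G. gdl (\<beta> c) (\<gamma> c) (\<delta> c)) (tt \<delta> n))"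
    using bc by (intro sum.cong refl arg_cong[of _ _ "\<lambda>r. fscale r _"] prod.cong conv_basis Pw.BB_B)
  finally show ?thesis .
qed

lemma tensor3_bilin: "n \<in> vcar W \<Longrightarrow> bilin V U (V \<otimes>\<^sub>s U \<otimes>\<^sub>s W) (\<lambda>a b. tensor V (U \<otimes>\<^sub>s W) a (tensor U W b n))"
  by (intro bilinI linmap_comp[OF bilin_left[OF bilin_tensor] bilin_right[OF bilin_tensor]]
      bilin_left[OF bilin_tensor] tensor_closed)

lemma co_coassoc:
  assumes n: "n \<in> vcar N"
  shows "tlift K N (K \<otimes>\<^sub>s K \<otimes>\<^sub>s N)
      (\<lambda>x n'. sw2 K (K \<otimes>\<^sub>s K \<otimes>\<^sub>s N) (\<lambda>a b. tensor K (K \<otimes>\<^sub>s N) a (tensor K N b n')) x) (co n) =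
    tlift K N (K \<otimes>\<^sub>s K \<otimes>\<^sub>s N) (\<lambda>x n'. tensor K (K \<otimes>\<^sub>s N) x (co n')) (co n)"
proof -
  let ?X = "K \<otimes>\<^sub>s K \<otimes>\<^sub>s N"
  let ?t = "\<lambda>\<beta> \<gamma> \<delta>. tensor K (K \<otimes>\<^sub>s N) (pten \<beta>) (tensor K N (pten \<gamma>) (tt \<delta> n))"
  have X: "is_vspace ?X" by (rule is_vspace_tprod)
  note tr = bilin_right[OF bilin_tensor]
  have bi: "bilin K N ?X (\<lambda>x n'. sw2 K ?X (\<lambda>a b. tensor K (K \<otimes>\<^sub>s N) a (tensor K N b n')) x)"
    by (intro Pw.KB.sw2_bilin N_vspace X tensor3_bilin linmap_comp[OF tr tr])
  have bi': "bilin K N ?X (\<lambda>x n'. tensor K (K \<otimes>\<^sub>s N) x (co n'))"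
    by (intro bilinI linmap_comp[OF co_linmap tr] bilin_left[OF bilin_tensor] linmap_closed[OF co_linmap])
  have "tlift K N ?X (\<lambda>x n'. sw2 K ?X (\<lambda>a b. tensor K (K \<otimes>\<^sub>s N) a (tensor K N b n')) x) (co n) =
      (\<Sum>\<delta>\<in>BB. sw2 K ?X (\<lambda>a b. tensor K (K \<otimes>\<^sub>s N) a (tensor K N b (tt \<delta> n))) (pten \<delta>))"
    by (rule tlift_co[OF X bi n])
  also have "\<dots> = (\<Sum>\<delta>\<in>BB. \<Sum>\<beta>\<in>BB. \<Sum>\<gamma>\<in>BB. vscale ?X (\<Prod>c\<in>cilia G. gdl (\<beta> c) (\<gamma> c) (\<delta> c)) (?t \<beta> \<gamma> \<delta>))"
    by (intro sum.cong refl Pw.sw2_pt X tensor3_bilin tt_closed n Pw.BB_sub)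
  also have "\<dots> = (\<Sum>\<beta>\<in>BB. \<Sum>\<gamma>\<in>BB. \<Sum>\<delta>\<in>BB. vscale ?X (\<Prod>c\<in>cilia G. gdl (\<beta> c) (\<gamma> c) (\<delta> c)) (?t \<beta> \<gamma> \<delta>))"
    unfolding sum.cartesian_product
    by (rule sum.reindex_bij_witness[of _ "\<lambda>(\<beta>, \<gamma>, \<delta>). (\<delta>, \<beta>, \<gamma>)" "\<lambda>(\<delta>, \<beta>, \<gamma>). (\<beta>, \<gamma>, \<delta>)"]) auto
  also have "\<dots> = (\<Sum>\<beta>\<in>BB. \<Sum>\<gamma>\<in>BB. tensor K (K \<otimes>\<^sub>s N) (pten \<beta>) (tensor K N (pten \<gamma>) (tt \<gamma> (tt \<beta> n))))"
  proof (intro sum.cong refl)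
    fix \<beta> \<gamma> assume bc: "\<beta> \<in> BB" "\<gamma> \<in> BB"
    show "(\<Sum>\<delta>\<in>BB. vscale ?X (\<Prod>c\<in>cilia G. gdl (\<beta> c) (\<gamma> c) (\<delta> c)) (?t \<beta> \<gamma> \<delta>)) =
        tensor K (K \<otimes>\<^sub>s N) (pten \<beta>) (tensor K N (pten \<gamma>) (tt \<gamma> (tt \<beta> n)))"
      unfolding tt_tt[OF n bc]
      by (rule linmap_sum_scale[OF N_vspace X linmap_comp[OF tr tr], unfolded vscale_N, symmetric])
        (rule pten_closed bc tt_closed n)+
  qed
  also have "\<dots> = (\<Sum>\<beta>\<in>BB. tensor K (K \<otimes>\<^sub>s N) (pten \<beta>) (co (tt \<beta> n)))"
    unfolding co_def
    by (intro sum.cong refl linmap_sum[OF is_vspace_tprod X tr, symmetric] tensor_closed pten_closed tt_closed n)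
  also have "\<dots> = tlift K N ?X (\<lambda>x n'. tensor K (K \<otimes>\<^sub>s N) x (co n')) (co n)"
    by (rule tlift_co[OF X bi' n, symmetric])
  finally show ?thesis .
qed

lemma co_left_comodule: "left_comodule K N co"
  by (simp add: left_comodule_def co_linmap co_counit co_coassoc)

text \<open>The factors of the product form obtained by composing \<open>\<alpha>\<close> with the
  projection to the factor \<open>c\<close>: all other factors are counits; see
  \<open>e_pr_map\<close>.\<close>

definition only :: "'d \<Rightarrow> ('h \<Rightarrow> 'k) \<Rightarrow> 'd \<Rightarrow> 'h \<Rightarrow> 'k" where
  "only c \<alpha> = (\<lambda>d. if d = c then \<alpha> else gep)"

lemma hlin_only: "hlin (*) \<alpha> \<Longrightarrow> hlin (*) (only c \<alpha> d)"
  by (simp add: only_def hlin_ep)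

lemma e_pr_map:
  assumes c: "c \<in> cilia G" and \<beta>: "\<beta> \<in> BB"
  shows "e b (pr_map (cilia G) H c (pten \<beta>)) = (\<Prod>d\<in>cilia G. only c (e b) d (\<beta> d))"
proof -
  have "(\<Prod>d\<in>cilia G. only c (e b) d (\<beta> d)) = e b (\<beta> c) * (\<Prod>d\<in>cilia G - {c}. counit H (\<beta> d))"
    unfolding prod.remove[OF finite_cilia c] using Pw.BB_B[OF \<beta>]
    by (simp add: only_def gep_car B_car)
  then show ?thesis by (simp add: Pw.pr_map_pt[OF c Pw.BB_sub[OF \<beta>]] e_scale mult.commute)
qed

lemma pr_tensor_bilin: "c \<in> cilia G \<Longrightarrow> bilin K N (H \<otimes>\<^sub>s N) (\<lambda>x n. tensor H N (pr_map (cilia G) H c x) n)"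
  by (intro bilinI linmap_comp[OF Pw.pr_map_lin bilin_left[OF bilin_tensor]] bilin_right[OF bilin_tensor]
      linmap_closed[OF Pw.pr_map_lin])

lemma co_pr_map:
  assumes c: "c \<in> cilia G" and n: "n \<in> vcar N"
  shows "tlift K N (H \<otimes>\<^sub>s N) (\<lambda>x n. tensor H N (pr_map (cilia G) H c x) n) (co n) =
    face_coaction G H M c n"
proof -
  let ?T = "H \<otimes>\<^sub>s N"
  have T: "is_vspace ?T" by (rule is_vspace_tprod)
  have Te: "T c (e b) n = (\<Sum>\<beta>\<in>BB. fscale (\<Prod>d\<in>cilia G. only c (e b) d (\<beta> d)) (tt \<beta> n))" if b: "b \<in> B" for b
  proof -
    have "T c (e b) n = TT (only c (e b)) n"
      unfolding TT_def using comps_single[where X = "vcar N" and F = "\<lambda>d. T d (only c (e b) d)", OF cs(1)] c n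
      by (simp add: cs T_ep T_closed only_def)
    then show ?thesis unfolding tt_def using TT_expand[OF hlin_only[OF hlin_e[OF b]]] by simp
  qed
  have "tlift K N ?T (\<lambda>x n. tensor H N (pr_map (cilia G) H c x) n) (co n) =
      (\<Sum>\<beta>\<in>BB. tensor H N (pr_map (cilia G) H c (pten \<beta>)) (tt \<beta> n))"
    by (rule tlift_co[OF T pr_tensor_bilin[OF c] n])
  also have "\<dots> = (\<Sum>\<beta>\<in>BB. \<Sum>b\<in>B. vscale ?T (e b (pr_map (cilia G) H c (pten \<beta>))) (tensor H N b (tt \<beta> n)))"
    by (intro sum.cong refl linmap_expand[OF T bilin_left[OF bilin_tensor tt_closed[OF n]]]
        linmap_closed[OF Pw.pr_map_lin[OF c]] pten_closed)
  also have "\<dots> = (\<Sum>b\<in>B. \<Sum>\<beta>\<in>BB. vscale ?T (\<Prod>d\<in>cilia G. only c (e b) d (\<beta> d)) (tensor H N b (tt \<beta> n)))"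
    by (subst sum.swap) (simp add: e_pr_map c)
  also have "\<dots> = (\<Sum>b\<in>B. tensor H N b (T c (e b) n))"
  proof (intro sum.cong refl)
    fix b assume b: "b \<in> B"
    show "(\<Sum>\<beta>\<in>BB. vscale ?T (\<Prod>d\<in>cilia G. only c (e b) d (\<beta> d)) (tensor H N b (tt \<beta> n))) = tensor H N b (T c (e b) n)"
      unfolding Te[OF b]
      by (rule linmap_sum_scale[OF N_vspace T bilin_right[OF bilin_tensor B_car[OF b]], unfolded vscale_N, symmetric])
        (rule tt_closed[OF n])
  qed
  finally show ?thesis by (simp add: face_coaction_eq c n)
qed

lemma co_graph: "is_graph_coaction G H M co"
  by (simp add: is_graph_coaction_def kitaev_hopf_def co_left_comodule co_pr_map)

lemma conv_gep_left: "hlin (*) \<alpha> \<Longrightarrow> O.conv gep \<alpha> = \<alpha>"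
  unfolding O.conv_def[abs_def] by (rule ext) (rule sw_counit_left[OF vector_space_times])

lemma conv_gep_right: "hlin (*) \<alpha> \<Longrightarrow> O.conv \<alpha> gep = \<alpha>"
  unfolding O.conv_def[abs_def] using sw_counit_right[OF vector_space_times, of \<alpha>] by (simp add: mult.commute fun_eq_iff)

text \<open>Coassociativity turns \<open>co'\<close> into a family of operators \<open>Z\<close>
  that is multiplicative for convolution, and the condition on the projections prescribes
  \<open>Z\<close> on the forms \<open>only c (e b)\<close>. Every coordinate functional of the
  product basis is a convolution product of such forms, one for each cilium, so all coefficients of
  \<open>co'\<close> are forced.\<close>

lemma co_unique:
  assumes co': "is_graph_coaction G H M co'" and n: "n \<in> vcar N"
  shows "co' n = co n"
proof -
  have com: "left_comodule K N co'"
    and pr: "\<And>c n. c \<in> cilia G \<Longrightarrow> n \<in> vcar N \<Longrightarrow>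
      tlift K N (H \<otimes>\<^sub>s N) (\<lambda>x n. tensor H N (pr_map (cilia G) H c x) n) (co' n) = face_coaction G H M c n"
    using co' by (simp_all add: is_graph_coaction_def kitaev_hopf_def)
  have lin: "linmap N (K \<otimes>\<^sub>s N) co'" using com by (simp add: left_comodule_def)
  define t where "t \<beta> n = Pw.KB.lcf N (pten \<beta>) (co' n)" for \<beta> n
  have t_lin: "linmap N N (t \<beta>)" for \<beta>
    unfolding t_def[abs_def] by (rule linmap_comp[OF lin Pw.KB.linmap_lcf[OF N_vspace]])
  have t_closed: "n \<in> vcar N \<Longrightarrow> t \<beta> n \<in> vcar N" for \<beta> n by (rule linmap_closed[OF t_lin])
  have t_lift: "tlift K N X \<phi> (co' n) = (\<Sum>\<beta>\<in>BB. \<phi> (pten \<beta>) (t \<beta> n))"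
    if "is_vspace X" "bilin K N X \<phi>" "n \<in> vcar N" for X :: "('k, 'x::ab_group_add) vspace" and \<phi> n
    using Pw.KB.tlift_left_expand[OF N_vspace that(1,2) linmap_closed[OF lin that(3)]]
    by (simp add: sum.reindex[OF Pw.inj_pt] t_def)
  have t_t: "t \<gamma> (t \<beta> n) = (\<Sum>\<delta>\<in>BB. fscale (\<Prod>c\<in>cilia G. gdl (\<beta> c) (\<gamma> c) (\<delta> c)) (t \<delta> n))"
    if n: "n \<in> vcar N" and bc: "\<beta> \<in> BB" "\<gamma> \<in> BB" for n \<beta> \<gamma>
    using Pw.KB.left_comodule_mul[OF N_vspace com n imageI[OF bc(1)] imageI[OF bc(2)]]
    by (simp add: sum.reindex[OF Pw.inj_pt] t_def vscale_N Pw.gdlK_pt bc Pw.BB_sub)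
  \<comment> \<open>\<open>Z \<alpha>\<close> contracts \<open>co'\<close> with the product form
    whose factors are the \<open>\<alpha> c\<close>.\<close>
  define Z where "Z \<alpha> n = (\<Sum>\<beta>\<in>BB. fscale (\<Prod>c\<in>cilia G. \<alpha> c (\<beta> c)) (t \<beta> n))" for \<alpha> n
  have Z_cong: "Z \<alpha> n = Z \<alpha>' n" if "\<And>c. c \<in> cilia G \<Longrightarrow> \<alpha> c = \<alpha>' c" for \<alpha> \<alpha>' n
    using that by (simp add: Z_def cong: prod.cong)
  have Z_Z: "Z \<alpha>' (Z \<alpha> n) = Z (\<lambda>c. O.conv (\<alpha> c) (\<alpha>' c)) n" if n: "n \<in> vcar N" for \<alpha> \<alpha>' n
  proof -
    have "Z \<alpha>' (Z \<alpha> n) = (\<Sum>\<gamma>\<in>BB. fscale (\<Prod>c\<in>cilia G. \<alpha>' c (\<gamma> c))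
        (\<Sum>\<beta>\<in>BB. fscale (\<Prod>c\<in>cilia G. \<alpha> c (\<beta> c)) (t \<gamma> (t \<beta> n))))"
      unfolding Z_def
      by (intro sum.cong refl arg_cong[of _ _ "fscale _"] linmap_sum_scale[OF N_vspace N_vspace t_lin, unfolded vscale_N] t_closed n)
    also have "\<dots> = (\<Sum>\<gamma>\<in>BB. \<Sum>\<beta>\<in>BB. \<Sum>\<delta>\<in>BB. fscale
        (\<Prod>c\<in>cilia G. gdl (\<beta> c) (\<gamma> c) (\<delta> c) * (\<alpha> c (\<beta> c) * \<alpha>' c (\<gamma> c))) (t \<delta> n))"
      by (simp add: t_t n O.N.scale_sum_right prod.distrib ac_simps)
    also have "\<dots> = (\<Sum>\<delta>\<in>BB. \<Sum>\<beta>\<in>BB. \<Sum>\<gamma>\<in>BB. fscale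
        (\<Prod>c\<in>cilia G. gdl (\<beta> c) (\<gamma> c) (\<delta> c) * (\<alpha> c (\<beta> c) * \<alpha>' c (\<gamma> c))) (t \<delta> n))"
      unfolding sum.cartesian_product
      by (rule sum.reindex_bij_witness[of _ "\<lambda>(\<delta>, \<beta>, \<gamma>). (\<gamma>, \<beta>, \<delta>)" "\<lambda>(\<gamma>, \<beta>, \<delta>). (\<delta>, \<beta>, \<gamma>)"]) auto
    also have "\<dots> = Z (\<lambda>c. O.conv (\<alpha> c) (\<alpha>' c)) n"
      unfolding Z_def O.conv_def sw_def
      by (simp add: prod_sum_PiE finite_cilia fin_B O.N.scale_sum_left)
    finally show ?thesis .
  qed
  have Z_only: "Z (only c (e b)) n = T c (e b) n" if c: "c \<in> cilia G" and b: "b \<in> B" and n: "n \<in> vcar N" for c b n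
  proof -
    have "lcf N b (\<Sum>\<beta>\<in>BB. tensor H N (pr_map (cilia G) H c (pten \<beta>)) (t \<beta> n)) =
        (\<Sum>\<beta>\<in>BB. lcf N b (tensor H N (pr_map (cilia G) H c (pten \<beta>)) (t \<beta> n)))"
      by (rule linmap_sum[OF is_vspace_tprod N_vspace linmap_lcf[OF N_vspace]])
        (intro tensor_closed linmap_closed[OF Pw.pr_map_lin[OF c]] pten_closed t_closed n)
    also have "\<dots> = (\<Sum>\<beta>\<in>BB. vscale N (e b (pr_map (cilia G) H c (pten \<beta>))) (t \<beta> n))"
      by (intro sum.cong refl lcf_tensor[OF N_vspace] linmap_closed[OF Pw.pr_map_lin[OF c]] pten_closed t_closed n)
    also have "\<dots> = Z (only c (e b)) n"
      by (simp add: Z_def e_pr_map c vscale_N)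
    finally have 1: "lcf N b (face_coaction G H M c n) = Z (only c (e b)) n"
      using t_lift[OF is_vspace_tprod pr_tensor_bilin[OF c] n] pr[OF c n] by simp
    have "lcf N b (\<Sum>d\<in>B. tensor H N d (T c (e d) n)) = (\<Sum>d\<in>B. lcf N b (tensor H N d (T c (e d) n)))"
      by (rule linmap_sum[OF is_vspace_tprod N_vspace linmap_lcf[OF N_vspace]])
        (intro tensor_closed B_car T_closed n)
    also have "\<dots> = (\<Sum>d\<in>B. vscale N (e b d) (T c (e d) n))"
      by (intro sum.cong refl lcf_tensor[OF N_vspace] B_car T_closed n)
    also have "\<dots> = T c (e b) n" by (rule sum_e_vec[OF N_vspace b])
    finally show ?thesis using 1 face_coaction_eq[OF c n] by simp
  qed
  have Z_gep: "Z (\<lambda>_. gep) n = n" if n: "n \<in> vcar N" for n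
  proof -
    have "n = tlift K N N (\<lambda>x n'. vscale N (counit K x) n') (co' n)"
      using com n by (simp add: left_comodule_def)
    also have "\<dots> = (\<Sum>\<beta>\<in>BB. vscale N (counit K (pten \<beta>)) (t \<beta> n))"
      by (rule t_lift[OF N_vspace bilin_scalar_fun(1)[OF N_vspace Pw.counit_K_lin] n])
    also have "\<dots> = Z (\<lambda>_. gep) n" by (simp add: Pw.counit_pt Pw.BB_sub vscale_N Z_def)
    finally show ?thesis by simp
  qed
  \<comment> \<open>The cilia in \<open>l\<close> carry coordinate functionals and all others the
    counit, the unit for convolution. Adding a cilium to \<open>l\<close> is one convolution with
    \<open>only\<close>.\<close>
  have *: "Z (\<lambda>d. if d \<in> set l then e (\<beta> d) else gep) n = comps l (\<lambda>c. T c (e (\<beta> c))) n"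
    if "distinct l" "set l \<subseteq> cilia G" "n \<in> vcar N" and \<beta>: "\<beta> \<in> BB" for l n \<beta>
    using that(1-3)
  proof (induction l arbitrary: n)
    case Nil
    then show ?case by (simp add: Z_gep)
  next
    case (Cons c l)
    have c: "c \<in> cilia G" and bc: "\<beta> c \<in> B" using Cons.prems Pw.BB_B[OF \<beta>] by auto
    have "comps (c # l) (\<lambda>c. T c (e (\<beta> c))) n =
        Z (\<lambda>d. if d \<in> set l then e (\<beta> d) else gep) (Z (only c (e (\<beta> c))) n)"
      using Cons by (simp add: Z_only c bc T_closed)
    also have "\<dots> = Z (\<lambda>d. if d \<in> set (c # l) then e (\<beta> d) else gep) n"
      unfolding Z_Z[OF Cons.prems(3)]
      by (rule Z_cong) (use Cons.prems in \<open>auto simp: only_def conv_gep_left conv_gep_right hlin_ep hlin_e Pw.BB_B[OF \<beta>]\<close>)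
    finally show ?case by simp
  qed
  \<comment> \<open>With all cilia in the list the product form is the coordinate functional of
    \<open>\<beta>\<close>, which selects a single coefficient.\<close>
  have tt_eq: "t \<beta> n = tt \<beta> n" if \<beta>: "\<beta> \<in> BB" for \<beta>
  proof -
    have "Z (\<lambda>d. if d \<in> set cs then e (\<beta> d) else gep) n = Z (\<lambda>d. e (\<beta> d)) n"
      by (rule Z_cong) (simp add: cs)
    also have "\<dots> = (\<Sum>\<gamma>\<in>BB. if \<beta> = \<gamma> then t \<gamma> n else 0)"
      unfolding Z_def
      by (intro sum.cong refl) (simp add: Pw.cf_delta[OF \<beta>, unfolded Pw.cf_pt] fscale_def zero_fun_def)
    also have "\<dots> = t \<beta> n" using \<beta> Pw.finite_BB by simp
    finally show ?thesis using *[OF cs(1) _ n \<beta>] by (simp add: cs tt_def TT_def)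
  qed
  have "co' n = (\<Sum>\<beta>\<in>BB. tensor K N (pten \<beta>) (t \<beta> n))"
    using Pw.KB.left_expand[OF N_vspace linmap_closed[OF lin n]] by (simp add: sum.reindex[OF Pw.inj_pt] t_def)
  then show ?thesis by (simp add: co_def tt_eq cong: sum.cong)
qed


section \<open>The Yetter-Drinfeld condition\<close>

definition twist where "twist \<beta> p v = (\<lambda>c\<in>cilia G. hmult H (hmult H (p c) (\<beta> c)) (antipode H (v c)))"

lemma twist_CH: "\<beta> \<in> CH \<Longrightarrow> p \<in> CH \<Longrightarrow> v \<in> CH \<Longrightarrow> twist \<beta> p v \<in> CH"
  by (auto simp: twist_def PiE_iff intro!: bilin_closed[OF mult_bilin] linmap_closed[OF antipode_lin])

lemma twist_pten: "\<beta> \<in> CH \<Longrightarrow> p \<in> CH \<Longrightarrow> v \<in> CH \<Longrightarrow>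
    hmult K (hmult K (pten p) (pten \<beta>)) (antipode K (pten v)) = pten (twist \<beta> p v)"
proof -
  assume h: "\<beta> \<in> CH" "p \<in> CH" "v \<in> CH"
  have 1: "(\<lambda>c\<in>cilia G. hmult H (p c) (\<beta> c)) \<in> CH"
    using h by (auto simp: PiE_iff intro!: bilin_closed[OF mult_bilin])
  have 2: "(\<lambda>c\<in>cilia G. antipode H (v c)) \<in> CH"
    using h by (auto simp: PiE_iff intro!: linmap_closed[OF antipode_lin])
  show ?thesis
    unfolding Pw.hmult_pt[OF h(2,1)] Pw.antipode_pt[OF h(3)] Pw.hmult_pt[OF 1 2] twist_def
    by (simp cong: restrict_cong)
qed

text \<open>Operators at different cilia commute, so the two composites interleave cilium by cilium;
  \<open>T_A_same\<close> is applied at each cilium, and after expanding the sums the composites are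
  separated again.\<close>

lemma tt_Act:
  assumes \<delta>: "\<delta> \<in> BB" and x: "x \<in> CH" and n: "n \<in> vcar N"
  shows "tt \<delta> (Act x n) = (\<Sum>p\<in>BB. \<Sum>y\<in>BB. \<Sum>u\<in>BB. \<Sum>v\<in>BB.
    fscale ((\<Prod>c\<in>cilia G. gdl (p c) (y c) (x c)) * (\<Prod>c\<in>cilia G. gdl (u c) (v c) (y c)))
      (Act u (TT (\<lambda>c z. e (\<delta> c) (gmul (gmul (p c) z) (gS (v c)))) n)))"
proof -
  \<comment> \<open>The coefficients of the two nested Sweedler sums at one cilium. The leg
    \<open>y\<close> is intermediate: it is split into \<open>u\<close> and \<open>v\<close> and
    does not occur in the operator \<open>?U\<close>.\<close>
  let ?W = "\<lambda>c (p, y, u, v). gdl p y (x c) * gdl u v y"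
  let ?U = "\<lambda>c (p, y, u, v) m. A c u (T c (\<lambda>z. e (\<delta> c) (gmul (gmul p z) (gS v))) m)"
  have hl: "c \<in> cilia G \<Longrightarrow> hlin (*) (e (\<delta> c))" for c by (rule hlin_e[OF Pw.BB_B[OF \<delta>]])
  have one: "T c (e (\<delta> c)) (A c (x c) m) = (\<Sum>j\<in>B \<times> B \<times> B \<times> B. fscale (?W c j) (?U c j m))"
    if "c \<in> cilia G" "m \<in> vcar N" for c m
    unfolding T_A_same[OF that hl[OF that(1)]] sw_def
    by (simp add: O.N.scale_sum_right sum.cartesian_product case_prod_unfold)
  have lin: "?U c j (m + m') = ?U c j m + ?U c j m'" "?U c j (fscale k m) = fscale k (?U c j m)" for c j m m' k
    by (simp_all add: case_prod_unfold A_add A_scale T_add T_scale)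
  have "tt \<delta> (Act x n) = comps cs (\<lambda>c m. T c (e (\<delta> c)) (A c (x c) m)) n"
    unfolding tt_def TT_def Act_def
    by (rule comps_comp[where X = "vcar N"]) (auto simp: cs A_closed T_closed T_A_other hl n)
  also have "\<dots> = comps cs (\<lambda>c m. \<Sum>j\<in>B \<times> B \<times> B \<times> B. fscale (?W c j) (?U c j m)) n"
  proof (rule comps_cong_on[where X = "vcar N"])
    show "T c (e (\<delta> c)) (A c (x c) m) \<in> vcar N" if "m \<in> vcar N" for c m
      by (intro T_closed A_closed that)
  qed (auto simp only: cs intro: one n)
  also have "\<dots> = (\<Sum>g\<in>cilia G \<rightarrow>\<^sub>E B \<times> B \<times> B \<times> B. fscale (\<Prod>c\<in>cilia G. ?W c (g c)) (comps cs (\<lambda>c. ?U c (g c)) n))"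
    unfolding cs(2)[symmetric] by (rule O.N.comps_expand[OF cs(1) _ lin]) (simp add: fin_B)
  also have "\<dots> = (\<Sum>p\<in>BB. \<Sum>y\<in>BB. \<Sum>u\<in>BB. \<Sum>v\<in>BB.
      fscale ((\<Prod>c\<in>cilia G. gdl (p c) (y c) (x c)) * (\<Prod>c\<in>cilia G. gdl (u c) (v c) (y c)))
        (comps cs (\<lambda>c m. A c (u c) (T c (\<lambda>z. e (\<delta> c) (gmul (gmul (p c) z) (gS (v c)))) m)) n))"
    unfolding sum_PiE_quadruple[OF finite_cilia]
  proof (intro sum.cong refl arg_cong2[of _ _ _ _ fscale])
    fix p y u v
    show "comps cs (\<lambda>c. ?U c ((\<lambda>c\<in>cilia G. (p c, y c, u c, v c)) c)) n =
        comps cs (\<lambda>c m. A c (u c) (T c (\<lambda>z. e (\<delta> c) (gmul (gmul (p c) z) (gS (v c)))) m)) n"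
      by (rule comps_cong) (simp add: cs)
  qed (simp add: prod.distrib cong: prod.cong)
  also have "\<dots> = (\<Sum>p\<in>BB. \<Sum>y\<in>BB. \<Sum>u\<in>BB. \<Sum>v\<in>BB.
      fscale ((\<Prod>c\<in>cilia G. gdl (p c) (y c) (x c)) * (\<Prod>c\<in>cilia G. gdl (u c) (v c) (y c)))
        (Act u (TT (\<lambda>c z. e (\<delta> c) (gmul (gmul (p c) z) (gS (v c)))) n)))"
  proof (intro sum.cong refl arg_cong[of _ _ "fscale _"])
    fix p u v :: "'d \<Rightarrow> 'h"
    have "hlin (*) (\<lambda>z. e (\<delta> c) (gmul (gmul (p c) z) (gS (v c))))" if "c \<in> cilia G" for c
      by (rule hlin_comp[OF vector_space_times hl[OF that]]) (intro hlin_intros)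
    then show "comps cs (\<lambda>c m. A c (u c) (T c (\<lambda>z. e (\<delta> c) (gmul (gmul (p c) z) (gS (v c)))) m)) n =
        Act u (TT (\<lambda>c z. e (\<delta> c) (gmul (gmul (p c) z) (gS (v c)))) n)"
      unfolding Act_def TT_def
      by (intro comps_comp[where X = "vcar N", symmetric]) (auto simp: cs A_closed T_closed T_A_other n)
  qed
  finally show ?thesis .
qed

text \<open>A change of dual bases: multiplying the argument of the functional of
  \<open>\<delta>\<close> by \<open>p\<close> and \<open>S v\<close>, summed against
  \<open>pten \<delta>\<close>, is the same as multiplying the basis tensors themselves. Both sides
  are the double sum over \<open>\<delta>\<close> and \<open>\<beta>\<close> with the coefficients
  of the twisted tensor.\<close>

lemma sum_delta_twist:
  assumes pv: "p \<in> BB" "v \<in> BB" and n: "n \<in> vcar N"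
  shows "(\<Sum>\<delta>\<in>BB. tensor K N (pten \<delta>) (Act u (TT (\<lambda>c z. e (\<delta> c) (gmul (gmul (p c) z) (gS (v c)))) n))) =
    (\<Sum>\<beta>\<in>BB. tensor K N (pten (twist \<beta> p v)) (Act u (tt \<beta> n)))"
proof -
  let ?X = "K \<otimes>\<^sub>s N"
  have X: "is_vspace ?X" by (rule is_vspace_tprod)
  have "(\<Sum>\<delta>\<in>BB. tensor K N (pten \<delta>) (Act u (TT (\<lambda>c z. e (\<delta> c) (gmul (gmul (p c) z) (gS (v c)))) n))) =
      (\<Sum>\<delta>\<in>BB. tensor K N (pten \<delta>) (Act u (\<Sum>\<beta>\<in>BB. fscale (Pw.cf \<delta> (pten (twist \<beta> p v))) (tt \<beta> n))))"
  proof (intro sum.cong refl arg_cong[of _ _ "tensor K N _"] arg_cong[of _ _ "Act u"])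
    fix \<delta> assume \<delta>: "\<delta> \<in> BB"
    have "hlin (*) (\<lambda>z. e (\<delta> c) (gmul (gmul (p c) z) (gS (v c))))" if "c \<in> cilia G" for c
      by (rule hlin_comp[OF vector_space_times hlin_e[OF Pw.BB_B[OF \<delta> that]]]) (intro hlin_intros)
    from TT_expand[OF this]
    have "TT (\<lambda>c z. e (\<delta> c) (gmul (gmul (p c) z) (gS (v c)))) n =
        (\<Sum>\<beta>\<in>BB. fscale (\<Prod>c\<in>cilia G. e (\<delta> c) (gmul (gmul (p c) (\<beta> c)) (gS (v c)))) (tt \<beta> n))"
      by (simp add: tt_def)
    also have "\<dots> = (\<Sum>\<beta>\<in>BB. fscale (Pw.cf \<delta> (pten (twist \<beta> p v))) (tt \<beta> n))"
    proof (intro sum.cong refl arg_cong2[of _ _ _ _ fscale])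
      fix \<beta> assume \<beta>: "\<beta> \<in> BB"
      have "gmul (gmul (p c) (\<beta> c)) (gS (v c)) = twist \<beta> p v c" if "c \<in> cilia G" for c
      proof -
        have "p c \<in> vcar H" "\<beta> c \<in> vcar H" "v c \<in> vcar H"
          using Pw.BB_B[OF pv(1) that] Pw.BB_B[OF pv(2) that] Pw.BB_B[OF \<beta> that] by (auto intro: B_car)
        then show ?thesis using that by (simp add: twist_def gmul_def gS_car pj_id closed_simps)
      qed
      then show "(\<Prod>c\<in>cilia G. e (\<delta> c) (gmul (gmul (p c) (\<beta> c)) (gS (v c)))) = Pw.cf \<delta> (pten (twist \<beta> p v))"
        unfolding Pw.cf_pt by (intro prod.cong refl) simp
    qed
    finally show "TT (\<lambda>c z. e (\<delta> c) (gmul (gmul (p c) z) (gS (v c)))) n =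
        (\<Sum>\<beta>\<in>BB. fscale (Pw.cf \<delta> (pten (twist \<beta> p v))) (tt \<beta> n))" .
  qed
  also have "\<dots> = (\<Sum>\<delta>\<in>BB. \<Sum>\<beta>\<in>BB. vscale ?X (Pw.cf \<delta> (pten (twist \<beta> p v))) (tensor K N (pten \<delta>) (Act u (tt \<beta> n))))"
  proof (intro sum.cong refl)
    fix \<delta> assume \<delta>: "\<delta> \<in> BB"
    show "tensor K N (pten \<delta>) (Act u (\<Sum>\<beta>\<in>BB. fscale (Pw.cf \<delta> (pten (twist \<beta> p v))) (tt \<beta> n))) =
        (\<Sum>\<beta>\<in>BB. vscale ?X (Pw.cf \<delta> (pten (twist \<beta> p v))) (tensor K N (pten \<delta>) (Act u (tt \<beta> n))))"
      by (rule linmap_sum_scale[OF N_vspace X linmap_comp[OF Act_linmap bilin_right[OF bilin_tensor pten_closed[OF \<delta>]]],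
            unfolded vscale_N]) (rule tt_closed[OF n])
  qed
  also have "\<dots> = (\<Sum>\<beta>\<in>BB. \<Sum>\<delta>\<in>BB. vscale ?X (Pw.cf \<delta> (pten (twist \<beta> p v))) (tensor K N (pten \<delta>) (Act u (tt \<beta> n))))"
    by (rule sum.swap)
  also have "\<dots> = (\<Sum>\<beta>\<in>BB. tensor K N (pten (twist \<beta> p v)) (Act u (tt \<beta> n)))"
    by (intro sum.cong refl Pw.linmap_K_expand[OF X bilin_left[OF bilin_tensor], symmetric] Act_closed tt_closed n
        Pw.pt_closed twist_CH Pw.BB_sub pv)
  finally show ?thesis .
qed

text \<open>The right-hand side of the Yetter-Drinfeld condition as a function of the three legs,
  isolated so that its linearity in each leg can be proved before \<open>sw3\<close> is
  expanded.\<close>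

definition yd where
  "yd n a b c = tlift K N (K \<otimes>\<^sub>s N) (\<lambda>x n'. tensor K N (hmult K (hmult K a x) (antipode K c)) (act b n')) (co n)"

lemma yd_expand:
  assumes n: "n \<in> vcar N" and abc: "a \<in> vcar K" "b \<in> vcar K" "c \<in> vcar K"
  shows "yd n a b c = (\<Sum>\<beta>\<in>BB. tensor K N (hmult K (hmult K a (pten \<beta>)) (antipode K c)) (act b (tt \<beta> n)))"
  unfolding yd_def
proof (rule tlift_co[OF is_vspace_tprod _ n])
  note K = Pw.hmult_K_bilin and Sc = linmap_closed[OF Pw.antipode_K_lin abc(3)]
  show "bilin K N (K \<otimes>\<^sub>s N) (\<lambda>x n'. tensor K N (hmult K (hmult K a x) (antipode K c)) (act b n'))"
    by (intro bilinI linmap_comp[OF bilin_right[OF act_bilin] bilin_right[OF bilin_tensor]]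
        linmap_comp[OF linmap_comp[OF bilin_right[OF K] bilin_left[OF K]] bilin_left[OF bilin_tensor]]
        bilin_closed[OF K] bilin_closed[OF act_bilin] Sc abc)
qed

lemma yd_lin:
  assumes n: "n \<in> vcar N"
  shows "b \<in> vcar K \<Longrightarrow> c \<in> vcar K \<Longrightarrow> linmap K (K \<otimes>\<^sub>s N) (\<lambda>a. yd n a b c)"
    and "a \<in> vcar K \<Longrightarrow> c \<in> vcar K \<Longrightarrow> linmap K (K \<otimes>\<^sub>s N) (\<lambda>b. yd n a b c)"
    and "a \<in> vcar K \<Longrightarrow> b \<in> vcar K \<Longrightarrow> linmap K (K \<otimes>\<^sub>s N) (\<lambda>c. yd n a b c)"
proof -
  note K = Pw.hmult_K_bilin and Sc = linmap_closed[OF Pw.antipode_K_lin]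
  note cl = bilin_closed[OF K] bilin_closed[OF act_bilin] Sc pten_closed tt_closed[OF n]
  show "linmap K (K \<otimes>\<^sub>s N) (\<lambda>a. yd n a b c)" if bc: "b \<in> vcar K" "c \<in> vcar K"
  proof (rule linmap_cong[OF _ Pw.K_vspace])
    show "linmap K (K \<otimes>\<^sub>s N) (\<lambda>a. \<Sum>\<beta>\<in>BB. tensor K N (hmult K (hmult K a (pten \<beta>)) (antipode K c)) (act b (tt \<beta> n)))"
      by (intro linmap_sum_fun is_vspace_tprod
          linmap_comp[OF linmap_comp[OF bilin_left[OF K] bilin_left[OF K]] bilin_left[OF bilin_tensor]] cl bc)
  qed (rule yd_expand[OF n _ bc, symmetric])
  show "linmap K (K \<otimes>\<^sub>s N) (\<lambda>b. yd n a b c)" if ac: "a \<in> vcar K" "c \<in> vcar K"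
  proof (rule linmap_cong[OF _ Pw.K_vspace])
    show "linmap K (K \<otimes>\<^sub>s N) (\<lambda>b. \<Sum>\<beta>\<in>BB. tensor K N (hmult K (hmult K a (pten \<beta>)) (antipode K c)) (act b (tt \<beta> n)))"
      by (intro linmap_sum_fun is_vspace_tprod linmap_comp[OF bilin_left[OF act_bilin] bilin_right[OF bilin_tensor]] cl ac)
  qed (rule yd_expand[OF n ac(1) _ ac(2), symmetric])
  show "linmap K (K \<otimes>\<^sub>s N) (\<lambda>c. yd n a b c)" if ab: "a \<in> vcar K" "b \<in> vcar K"
  proof (rule linmap_cong[OF _ Pw.K_vspace])
    show "linmap K (K \<otimes>\<^sub>s N) (\<lambda>c. \<Sum>\<beta>\<in>BB. tensor K N (hmult K (hmult K a (pten \<beta>)) (antipode K c)) (act b (tt \<beta> n)))"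
      by (intro linmap_sum_fun is_vspace_tprod
          linmap_comp[OF linmap_comp[OF Pw.antipode_K_lin bilin_right[OF K]] bilin_left[OF bilin_tensor]] cl ab)
  qed (rule yd_expand[OF n ab, symmetric])
qed

lemma yd_sw2_bilin:
  assumes n: "n \<in> vcar N"
  shows "a \<in> vcar K \<Longrightarrow> bilin K K (K \<otimes>\<^sub>s N) (yd n a)"
    and "bilin K K (K \<otimes>\<^sub>s N) (\<lambda>a b. sw2 K (K \<otimes>\<^sub>s N) (yd n a) b)"
proof -
  show 1: "bilin K K (K \<otimes>\<^sub>s N) (yd n a)" if "a \<in> vcar K" for a
    using that by (intro bilinI yd_lin n)
  \<comment> \<open>\<open>sw2_bilin\<close> puts the leg that is split in first place, so the two
    arguments appear exchanged; \<open>bilin\<close> treats both sides alike.\<close>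
  have "bilin K K (K \<otimes>\<^sub>s N) (\<lambda>b a. sw2 K (K \<otimes>\<^sub>s N) (\<lambda>p q. yd n a p q) b)"
    by (intro Pw.KB.sw2_bilin Pw.K_vspace is_vspace_tprod 1 yd_lin n)
  then show "bilin K K (K \<otimes>\<^sub>s N) (\<lambda>a b. sw2 K (K \<otimes>\<^sub>s N) (yd n a) b)"
    by (simp add: bilin_def)
qed

text \<open>Both sides are linear in \<open>s\<close>, so basis tensors suffice. There
  \<open>tt_Act\<close> supplies the three legs at every cilium simultaneously, and
  \<open>sum_delta_twist\<close> moves the two outer ones from the functionals to the tensor factor
  in the Hopf algebra.\<close>

lemma co_act:
  assumes s: "s \<in> vcar K" and n: "n \<in> vcar N"
  shows "co (act s n) = sw3 K (K \<otimes>\<^sub>s N) (yd n) s"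
proof (rule Pw.linmap_K_eqI[OF is_vspace_tprod linmap_comp[OF bilin_left[OF act_bilin n] co_linmap] _ _ s])
  let ?X = "K \<otimes>\<^sub>s N"
  have X: "is_vspace ?X" by (rule is_vspace_tprod)
  interpret XV: vector_space "vscale ?X" by (rule vs_vector_space[OF X])
  show "linmap K ?X (sw3 K ?X (yd n))"
    unfolding sw3_def[abs_def] by (rule Pw.linmap_sw2_K[OF X yd_sw2_bilin(2)[OF n]])
  fix x assume "x \<in> BB"
  then have x: "x \<in> CH" by (rule Pw.BB_sub)
  let ?k = "\<lambda>p y u v. (\<Prod>c\<in>cilia G. gdl (p c) (y c) (x c)) * (\<Prod>c\<in>cilia G. gdl (u c) (v c) (y c))"
  let ?Z = "\<lambda>\<delta> p u v. Act u (TT (\<lambda>c z. e (\<delta> c) (gmul (gmul (p c) z) (gS (v c)))) n)"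
  let ?J = "BB \<times> BB \<times> BB \<times> BB"
  have "co (act (pten x) n) = (\<Sum>\<delta>\<in>BB. tensor K N (pten \<delta>) (\<Sum>(p, y, u, v)\<in>?J. fscale (?k p y u v) (?Z \<delta> p u v)))"
    unfolding co_def act_pt using tt_Act[OF _ x n] by (simp add: sum.cartesian_product cong: sum.cong)
  also have "\<dots> = (\<Sum>\<delta>\<in>BB. \<Sum>(p, y, u, v)\<in>?J. vscale ?X (?k p y u v) (tensor K N (pten \<delta>) (?Z \<delta> p u v)))"
  proof (intro sum.cong refl)
    fix \<delta> assume \<delta>: "\<delta> \<in> BB"
    show "tensor K N (pten \<delta>) (\<Sum>(p, y, u, v)\<in>?J. fscale (?k p y u v) (?Z \<delta> p u v)) =
        (\<Sum>(p, y, u, v)\<in>?J. vscale ?X (?k p y u v) (tensor K N (pten \<delta>) (?Z \<delta> p u v)))"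
      unfolding case_prod_unfold
      by (rule linmap_sum_scale[OF N_vspace X bilin_right[OF bilin_tensor pten_closed[OF \<delta>]], unfolded vscale_N])
        (intro Act_closed TT_closed n)
  qed
  also have "\<dots> = (\<Sum>(p, y, u, v)\<in>?J. vscale ?X (?k p y u v) (\<Sum>\<delta>\<in>BB. tensor K N (pten \<delta>) (?Z \<delta> p u v)))"
    unfolding XV.scale_sum_right case_prod_unfold by (rule sum.swap)
  also have "\<dots> = (\<Sum>(p, y, u, v)\<in>?J. vscale ?X (?k p y u v) (yd n (pten p) (pten u) (pten v)))"
  proof (intro sum.cong refl, clarify)
    fix p y u v assume b: "p \<in> BB" "y \<in> BB" "u \<in> BB" "v \<in> BB"
    have "yd n (pten p) (pten u) (pten v) = (\<Sum>\<beta>\<in>BB. tensor K N (pten (twist \<beta> p v)) (Act u (tt \<beta> n)))"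
      unfolding yd_expand[OF n b(1,3,4)[THEN pten_closed]] act_pt
      by (intro sum.cong refl arg_cong2[of _ _ _ _ "tensor K N"] twist_pten Pw.BB_sub b)
    then show "vscale ?X (?k p y u v) (\<Sum>\<delta>\<in>BB. tensor K N (pten \<delta>) (?Z \<delta> p u v)) =
        vscale ?X (?k p y u v) (yd n (pten p) (pten u) (pten v))"
      unfolding sum_delta_twist[OF b(1,4) n] by (rule arg_cong[OF sym])
  qed
  also have "\<dots> = (\<Sum>p\<in>BB. \<Sum>y\<in>BB. vscale ?X (\<Prod>c\<in>cilia G. gdl (p c) (y c) (x c))
      (\<Sum>u\<in>BB. \<Sum>v\<in>BB. vscale ?X (\<Prod>c\<in>cilia G. gdl (u c) (v c) (y c)) (yd n (pten p) (pten u) (pten v))))"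
    by (simp only: XV.scale_sum_right XV.scale_scale sum.cartesian_product case_prod_unfold fst_conv snd_conv)
  also have "\<dots> = sw3 K ?X (yd n) (pten x)"
    unfolding sw3_def Pw.sw2_pt[OF X yd_sw2_bilin(2)[OF n] x]
    by (intro sum.cong refl arg_cong[of _ _ "vscale ?X _"] Pw.sw2_pt[OF X yd_sw2_bilin(1)[OF n], symmetric] pten_closed Pw.BB_sub)
  finally show "co (act (pten x) n) = sw3 K ?X (yd n) (pten x)" .
qed

lemma act_co_yetter_drinfeld: "yetter_drinfeld K N act co"
  unfolding yetter_drinfeld_def
  by (intro conjI ballI act_left_module co_left_comodule co_act[unfolded yd_def[abs_def]])

end

theorem theorem5p12:
  fixes H :: "('k::field, 'h::ab_group_add) hopf"
    and M :: "('k, 'h, 'm::ab_group_add) hbimod"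
    and G :: "'d kitaev"
  assumes "hopf_algebra H"
    and "fin_dim H"
    and "involutive_hopf_bimodule H M"
    and "kitaev_graph G"
  shows "\<exists>act co.
           is_graph_action G H M act \<and>
           (\<forall>act'. is_graph_action G H M act' \<longrightarrow>
              (\<forall>x\<in>vcar (kitaev_hopf G H). \<forall>m\<in>vcar (ext_space G M). act' x m = act x m)) \<and>
           is_graph_coaction G H M co \<and>
           (\<forall>co'. is_graph_coaction G H M co' \<longrightarrow>
              (\<forall>m\<in>vcar (ext_space G M). co' m = co m)) \<and>
           yetter_drinfeld (kitaev_hopf G H) (ext_space G M) act co"
proof -
  obtain B e where "based_hopf H B e"
    using based_hopf_exists[OF assms(1,2)] by blast
  then interpret based_graph H B e M G
    using assms by (simp add: based_graph_def based_bimodule_def)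
  show ?thesis
    unfolding kitaev_hopf_def
    using act_graph act_unique co_graph co_unique act_co_yetter_drinfeld by blast
qed

end
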